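(* Assuming the OMv hypothesis, every algorithm that, on an incremental graph with $n$ vertices, reports YES once there exists a triangle in the current graph requires $n^{3-o(1)}$ total update time.
   Context: All graphs are undirected and unweighted. An incremental graph is an $n$-vertex graph, initially given, undergoing a sequence of edge insertions; after each insertion the algorithm must report whether the current graph contains a triangle (a clique of size 3). Total update time is the total running time over all updates. OMv hypothesis: every (possibly randomized) algorithm that preprocesses a matrix $M\in\{0,1\}^{n\times n}$ and then answers $n$ online Boolean matrix-vector queries (given $v\in\{0,1\}^n$, report $\bigvee_{j\in[n]}(M_{ij}\wedge v_j)$ for all $i\in[n]$, before receiving the next query) requires total time $\Omega(n^{3-o(1)})$. *)

theory Defs
  imports "HOL-Probability.Probability" "HOL-Library.Landau_Symbols"
begin

section \<open>Randomised word RAM\<close>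

text \<open>
  The machine is a random access machine with cells X(0), X(1), ... and indirect addressing,
  unit-cost arithmetic on machine words, and fair coin flips; it is programmed with structured
  control flow, which changes running times by at most a constant factor compared with jumps.
  A program is a fixed finite object, independent of the input size.
\<close>

datatype binop = Add | Sub | Mul | Div | Mod | And | Or | Xor | Shl | Shr | Less | Equal

fun apply_op :: "binop \<Rightarrow> nat \<Rightarrow> nat \<Rightarrow> nat" where
  "apply_op Add x y = x + y"
| "apply_op Sub x y = x - y"
| "apply_op Mul x y = x * y"
| "apply_op Div x y = x div y"
| "apply_op Mod x y = x mod y"
| "apply_op And x y = Bit_Operations.and x y"
| "apply_op Or x y = Bit_Operations.or x y"
| "apply_op Xor x y = Bit_Operations.xor x y"
| "apply_op Shl x y = push_bit y x"
| "apply_op Shr x y = drop_bit y x"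
| "apply_op Less x y = of_bool (x < y)"
| "apply_op Equal x y = of_bool (x = y)"

datatype com =
    Skip
  | Const nat nat             \<comment> \<open>X(i) := k\<close>
  | Op binop nat nat nat      \<comment> \<open>X(i) := X(j) op X(k)\<close>
  | Load nat nat              \<comment> \<open>X(i) := X(X(j))\<close>
  | Store nat nat             \<comment> \<open>X(X(i)) := X(j)\<close>
  | Read nat                  \<comment> \<open>X(i) := next input word\<close>
  | Write nat                 \<comment> \<open>append X(i) to the output\<close>
  | Flip nat                  \<comment> \<open>X(i) := fair coin\<close>
  | Seq com com
  | IfNZ nat com com          \<comment> \<open>branch on X(i) \<noteq> 0\<close>
  | WhileNZ nat com           \<comment> \<open>loop while X(i) \<noteq> 0\<close>

record ram =
  mem :: "nat \<Rightarrow> nat"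
  coin_pos :: nat
  inp :: "nat list"
  outp :: "nat list"

text \<open>
  \<open>exec W \<omega> c s t s'\<close>: started in \<open>s\<close>, program \<open>c\<close> halts in \<open>s'\<close> after exactly \<open>t\<close> steps,
  reading its coin flips from the random tape \<open>\<omega>\<close>. Words are the numbers below \<open>W\<close>. A program
  that produces a larger value (or reads past the end of its input) is stuck: it has no execution.
\<close>

inductive exec :: "nat \<Rightarrow> (nat \<Rightarrow> bool) \<Rightarrow> com \<Rightarrow> ram \<Rightarrow> nat \<Rightarrow> ram \<Rightarrow> bool"
  for W :: nat and \<omega> :: "nat \<Rightarrow> bool" where
  Skip: "exec W \<omega> Skip s 1 s"
| Const: "k < W \<Longrightarrow> exec W \<omega> (Const i k) s 1 (s\<lparr>mem := (mem s)(i := k)\<rparr>)"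
| Op: "x = apply_op f (mem s j) (mem s k) \<Longrightarrow> x < W \<Longrightarrow>
    exec W \<omega> (Op f i j k) s 1 (s\<lparr>mem := (mem s)(i := x)\<rparr>)"
| Load: "exec W \<omega> (Load i j) s 1 (s\<lparr>mem := (mem s)(i := mem s (mem s j))\<rparr>)"
| Store: "exec W \<omega> (Store i j) s 1 (s\<lparr>mem := (mem s)(mem s i := mem s j)\<rparr>)"
| Read: "inp s = x # xs \<Longrightarrow> x < W \<Longrightarrow>
    exec W \<omega> (Read i) s 1 (s\<lparr>mem := (mem s)(i := x), inp := xs\<rparr>)"
| Write: "exec W \<omega> (Write i) s 1 (s\<lparr>outp := outp s @ [mem s i]\<rparr>)"
| Flip: "x = of_bool (\<omega> (coin_pos s)) \<Longrightarrow> x < W \<Longrightarrow>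
    exec W \<omega> (Flip i) s 1 (s\<lparr>mem := (mem s)(i := x), coin_pos := Suc (coin_pos s)\<rparr>)"
| Seq: "exec W \<omega> c1 s t1 s1 \<Longrightarrow> exec W \<omega> c2 s1 t2 s2 \<Longrightarrow>
    exec W \<omega> (Seq c1 c2) s (t1 + t2) s2"
| IfTrue: "mem s i \<noteq> 0 \<Longrightarrow> exec W \<omega> c1 s t s1 \<Longrightarrow> exec W \<omega> (IfNZ i c1 c2) s (Suc t) s1"
| IfFalse: "mem s i = 0 \<Longrightarrow> exec W \<omega> c2 s t s1 \<Longrightarrow> exec W \<omega> (IfNZ i c1 c2) s (Suc t) s1"
| WhileTrue: "mem s i \<noteq> 0 \<Longrightarrow> exec W \<omega> c s t1 s1 \<Longrightarrow> exec W \<omega> (WhileNZ i c) s1 t2 s2 \<Longrightarrow>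
    exec W \<omega> (WhileNZ i c) s (Suc (t1 + t2)) s2"
| WhileFalse: "mem s i = 0 \<Longrightarrow> exec W \<omega> (WhileNZ i c) s 1 s"

text \<open>
  The number of machine words for input size \<open>n\<close>: words have \<open>c * log 2 (n + 2)\<close> bits, where the
  constant \<open>c\<close> may depend on the algorithm. (The offset keeps the count above 1 for all \<open>n\<close>.)
\<close>

definition word_bound :: "nat \<Rightarrow> nat \<Rightarrow> nat" where
  "word_bound c n = (n + 2) ^ c"

definition coin_tape :: "(nat \<Rightarrow> bool) measure" where
  "coin_tape = (\<Pi>\<^sub>M i\<in>UNIV. measure_pmf (bernoulli_pmf (1/2)))"


section \<open>Online algorithms\<close>

text \<open>
  An online algorithm consists of a preprocessing program and a program that is run once for
  every request; the memory persists between the runs. As each run sees only its own request and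
  the output is collected after the run, every request is answered before the next one is known.
  In \<open>session W \<omega> c s xss t yss\<close>, the requests \<open>xss\<close> receive the answers \<open>yss\<close> in total
  time \<open>t\<close>.
\<close>

inductive session ::
  "nat \<Rightarrow> (nat \<Rightarrow> bool) \<Rightarrow> com \<Rightarrow> ram \<Rightarrow> nat list list \<Rightarrow> nat \<Rightarrow> nat list list \<Rightarrow> bool"
  for W :: nat and \<omega> :: "nat \<Rightarrow> bool" and c :: com where
  Nil: "session W \<omega> c s [] 0 []"
| Cons: "exec W \<omega> c (s\<lparr>inp := xs, outp := []\<rparr>) t s1 \<Longrightarrow> session W \<omega> c s1 xss t' yss \<Longrightarrow>
    session W \<omega> c s (xs # xss) (t + t') (outp s1 # yss)"

text \<open>
  Here \<open>x\<close> is the input of the preprocessing, \<open>tp\<close> its running time, and \<open>tr\<close> the total time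
  spent on the requests.
\<close>

definition online_run :: "nat \<Rightarrow> (nat \<Rightarrow> bool) \<Rightarrow> com \<Rightarrow> com \<Rightarrow> nat list \<Rightarrow> nat list list \<Rightarrow>
    nat \<Rightarrow> nat \<Rightarrow> nat list list \<Rightarrow> bool" where
  "online_run W \<omega> pre req x xss tp tr yss \<longleftrightarrow>
    (\<exists>s. exec W \<omega> pre \<lparr>mem = (\<lambda>_. 0), coin_pos = 0, inp = x, outp = []\<rparr> tp s \<and>
         session W \<omega> req s xss tr yss)"

text \<open>\<open>T(n) = \<Omega>(n\<^sup>3\<^sup>-\<^sup>o\<^sup>(\<^sup>1\<^sup>))\<close>\<close>

definition almost_cubic :: "(nat \<Rightarrow> real) \<Rightarrow> bool" where
  "almost_cubic T \<longleftrightarrow> (\<exists>\<delta> \<in> o(\<lambda>_. 1). T \<in> \<Omega>(\<lambda>n. real n powr (3 - \<delta> n)))"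


section \<open>Online Boolean matrix-vector multiplication\<close>

definition vec_input :: "nat \<Rightarrow> (nat \<Rightarrow> bool) \<Rightarrow> nat list" where
  "vec_input n v = map (\<lambda>j. of_bool (v j)) [0..<n]"

definition mat_input :: "nat \<Rightarrow> (nat \<Rightarrow> nat \<Rightarrow> bool) \<Rightarrow> nat list" where
  "mat_input n M = n # concat (map (\<lambda>i. vec_input n (M i)) [0..<n])"

definition bool_mat_vec ::
  "nat \<Rightarrow> (nat \<Rightarrow> nat \<Rightarrow> bool) \<Rightarrow> (nat \<Rightarrow> bool) \<Rightarrow> nat \<Rightarrow> bool" where
  "bool_mat_vec n M v i \<longleftrightarrow> (\<exists>j<n. M i j \<and> v j)"

text \<open>
  Randomised algorithms may err with probability at most 1/3 on every input, where an input
  includes all requests; the time bound holds for all outcomes of the coin flips.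
\<close>

definition solves_OMv :: "com \<Rightarrow> com \<Rightarrow> (nat \<Rightarrow> real) \<Rightarrow> bool" where
  "solves_OMv pre qry T \<longleftrightarrow> (\<exists>c. \<forall>n M vs. length vs = n \<longrightarrow>
    (\<forall>\<omega>. \<exists>tp tq yss.
      online_run (word_bound c n) \<omega> pre qry (mat_input n M) (map (vec_input n) vs) tp tq yss \<and>
      real (tp + tq) \<le> T n) \<and>
    measure coin_tape {\<omega>. \<exists>tp tq.
      online_run (word_bound c n) \<omega> pre qry (mat_input n M) (map (vec_input n) vs) tp tq
        (map (\<lambda>v. vec_input n (bool_mat_vec n M v)) vs)} \<ge> 2/3)"

definition OMv_hypothesis :: bool where
  "OMv_hypothesis \<longleftrightarrow> (\<forall>pre qry T. solves_OMv pre qry T \<longrightarrow> almost_cubic T)"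


section \<open>Incremental triangle detection\<close>

text \<open>Graphs are given by their sets of edges \<open>{u, v}\<close> on the vertices \<open>0, \<dots>, n - 1\<close>.\<close>

definition graph_on :: "nat \<Rightarrow> nat set set \<Rightarrow> bool" where
  "graph_on n E \<longleftrightarrow> E \<subseteq> {{u, v} | u v. u < n \<and> v < n \<and> u \<noteq> v}"

definition has_triangle :: "nat set set \<Rightarrow> bool" where
  "has_triangle E \<longleftrightarrow>
    (\<exists>a b c. a \<noteq> b \<and> b \<noteq> c \<and> a \<noteq> c \<and> {a, b} \<in> E \<and> {b, c} \<in> E \<and> {a, c} \<in> E)"

fun insertions :: "nat \<Rightarrow> nat set set \<Rightarrow> (nat \<times> nat) list \<Rightarrow> bool" where
  "insertions n E [] \<longleftrightarrow> True"
| "insertions n E ((u, v) # es) \<longleftrightarrow>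
    u < n \<and> v < n \<and> u \<noteq> v \<and> {u, v} \<notin> E \<and> insertions n (insert {u, v} E) es"

fun triangle_answers :: "nat set set \<Rightarrow> (nat \<times> nat) list \<Rightarrow> nat list list" where
  "triangle_answers E [] = []"
| "triangle_answers E ((u, v) # es) =
    [of_bool (has_triangle (insert {u, v} E))] # triangle_answers (insert {u, v} E) es"

text \<open>
  The time bound \<open>T\<close> is on the total time over all updates. The preprocessing of the initial graph,
  presented by \<open>n\<close> and its adjacency matrix, is charged separately: it may take arbitrary
  polynomial time in addition to \<open>T\<close>. In particular this covers every algorithm for which \<open>T\<close> bounds
  the time for preprocessing and updates together.
\<close>

definition solves_incremental_triangle :: "com \<Rightarrow> com \<Rightarrow> (nat \<Rightarrow> real) \<Rightarrow> bool" where
  "solves_incremental_triangle pre upd T \<longleftrightarrow> (\<exists>c k. \<forall>n E es. graph_on n E \<and> insertions n E es \<longrightarrow>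
    (\<forall>\<omega>. \<exists>tp tu yss.
      online_run (word_bound c n) \<omega> pre upd
        (mat_input n (\<lambda>u v. {u, v} \<in> E)) (map (\<lambda>(u, v). [u, v]) es) tp tu yss \<and>
      real tu \<le> T n \<and> real tp \<le> T n + (real n + 2) ^ k) \<and>
    measure coin_tape {\<omega>. \<exists>tp tu.
      online_run (word_bound c n) \<omega> pre upd
        (mat_input n (\<lambda>u v. {u, v} \<in> E)) (map (\<lambda>(u, v). [u, v]) es) tp tu
        (triangle_answers E es)} \<ge> 2/3)"

end

theory Submission
  imports Defs "HOL-Real_Asymp.Real_Asymp"
begin

text \<open>If \<open>T N < N powr (3 - \<epsilon>)\<close> for infinitely many \<open>N\<close>, a matrix of side \<open>n = (N - 3) ^ d\<close> is cut
  into blocks of side \<open>b = N div 3\<close>. Each block is an incremental graph on its rows, its columns and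
  \<open>b\<close> query vertices, initially empty. For a query vector one query vertex is joined to the
  columns selected by the vector and to the rows of the block whose result is still 0; a triangle
  appears if and only if the block contributes a new row to the result. In that case the block is
  searched by brute force, which is paid by the new row, and the graph is rolled back to the empty
  one; a rollback also happens when the query vertices are used up, so that over \<open>n\<close> queries each of
  the \<open>(n / b)\<^sup>2\<close> blocks is restarted \<open>n / b\<close> times, apart from \<open>n\<close> restarts per query caused by
  new rows. This takes time about \<open>(n / b) ^ 3 * T N + n\<^sup>2 * T N\<close>, which is below \<open>n powr (3 - \<eta>)\<close>
  once \<open>d\<close> is large. The error is reduced by running a logarithmic number of copies with independent
  coins and searching a block by brute force whenever some copy says YES: then a false YES costs time
  but never correctness, and only a triangle that all copies miss is harmful.\<close>

section \<open>A small imperative language on top of the word RAM\<close>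

text \<open>\<open>solves_OMv\<close> must hold for every \<open>n\<close>, every request sequence
  and every outcome of the coins, whereas \<open>T\<close> is under control only at the chosen sizes
  \<open>N\<close> and need not be computable or monotone. Hence the programs never refer to
  \<open>T\<close>: \<open>N\<close> is computed from \<open>n\<close>, and if the prefetched coins
  do not suffice, brute force keeps the answers correct. Two further obstacles shape the
  construction. The memory of a copy has polynomial size of unknown degree, so a rollback must not
  copy it; version numbers undo all writes in constant time, and the polynomial preprocessing is
  paid once per copy instead of once per restart. The error bound of the given algorithm concerns an
  insertion sequence fixed in advance, whereas the edges inserted for a query depend on earlier
  answers, hence on the coins; as each YES is verified, the sequences are determined by the matrix
  and the vectors until all copies miss a triangle. Since both sides are machine programs, the
  reduction is written in a small language with a verified compiler, and its cost is read off a
  clock in the state.\<close>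

datatype expr = EC nat | EV nat | EA nat expr | EB binop expr expr

abbreviation eadd (infixl "[+]" 65) where "a [+] b \<equiv> EB Add a b"
abbreviation esub (infixl "[-]" 65) where "a [-] b \<equiv> EB Sub a b"
abbreviation emul (infixl "[*]" 70) where "a [*] b \<equiv> EB Mul a b"
abbreviation ediv (infixl "[div]" 70) where "a [div] b \<equiv> EB Div a b"
abbreviation emod (infixl "[mod]" 70) where "a [mod] b \<equiv> EB Mod a b"
abbreviation eless (infix "[<]" 50) where "a [<] b \<equiv> EB Less a b"
abbreviation eeq (infix "[=]" 50) where "a [=] b \<equiv> EB Equal a b"

datatype cmd =
    CSkip
  | CAsg nat expr
  | CBop binop nat nat nat
  | CStr nat expr expr
  | CRd nat
  | CWr nat
  | CFl nat
  | CSeq cmd cmd (infixr ";;" 60)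
  | CIf expr cmd cmd
  | CWh expr cmd

text \<open>The field \<open>tm\<close> is a ghost clock; it may run faster than the machine.\<close>

record hst =
  vr :: "nat \<Rightarrow> nat"
  ar :: "nat \<Rightarrow> nat \<Rightarrow> nat"
  hpos :: nat
  hin :: "nat list"
  hout :: "nat list"
  tm :: nat

fun eval :: "expr \<Rightarrow> hst \<Rightarrow> nat" where
  "eval (EC k) \<sigma> = k"
| "eval (EV v) \<sigma> = vr \<sigma> v"
| "eval (EA k e) \<sigma> = ar \<sigma> k (eval e \<sigma>)"
| "eval (EB f a b) \<sigma> = apply_op f (eval a \<sigma>) (eval b \<sigma>)"

lemma eval_irrelevant [simp]:
  "eval e (\<sigma>\<lparr>tm := t\<rparr>) = eval e \<sigma>"
  "eval e (\<sigma>\<lparr>hin := x\<rparr>) = eval e \<sigma>"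
  "eval e (\<sigma>\<lparr>hout := x\<rparr>) = eval e \<sigma>"
  "eval e (\<sigma>\<lparr>hpos := t\<rparr>) = eval e \<sigma>"
  by (induction e) auto

text \<open>Addresses congruent to 0 modulo 16 hold variables, those congruent to 1 temporaries, and
  each of the remaining 14 residue classes holds one array. \<open>And\<close> with equal operands copies a word.\<close>

fun ecomp :: "nat \<Rightarrow> expr \<Rightarrow> com" where
  "ecomp d (EC k) = Const (16 * d + 1) k"
| "ecomp d (EV v) = Op And (16 * d + 1) (16 * v) (16 * v)"
| "ecomp d (EA k e) = Seq (ecomp d e) (Seq (Const (16 * Suc d + 1) 16)
     (Seq (Op Mul (16 * d + 1) (16 * d + 1) (16 * Suc d + 1)) (Seq (Const (16 * Suc d + 1) (k + 2))
     (Seq (Op Add (16 * d + 1) (16 * d + 1) (16 * Suc d + 1)) (Load (16 * d + 1) (16 * d + 1))))))"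
| "ecomp d (EB f a b) = Seq (ecomp d a) (Seq (ecomp (Suc d) b)
     (Op f (16 * d + 1) (16 * d + 1) (16 * Suc d + 1)))"

text \<open>The exact number of machine steps of \<open>ecomp\<close>. It does not depend on the
  state, so the clock is advanced by a closed expression.\<close>

fun etime :: "expr \<Rightarrow> nat" where
  "etime (EC k) = 1"
| "etime (EV v) = 1"
| "etime (EA k e) = etime e + 5"
| "etime (EB f a b) = etime a + etime b + 1"

text \<open>The machine branches on a cell only, so a loop evaluates its guard before the first test
  and again at the end of every round. In \<open>CStr\<close> the address waits in cell 1 while the
  value is computed at depth 1.\<close>

fun ccomp :: "cmd \<Rightarrow> com" where
  "ccomp CSkip = Skip"
| "ccomp (CAsg v e) = Seq (ecomp 0 e) (Op And (16 * v) 1 1)"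
| "ccomp (CBop f x y z) = Op f (16 * x) (16 * y) (16 * z)"
| "ccomp (CStr k a e) = Seq (ecomp 0 a) (Seq (Const 17 16) (Seq (Op Mul 1 1 17)
     (Seq (Const 17 (k + 2)) (Seq (Op Add 1 1 17) (Seq (ecomp 1 e) (Store 1 17))))))"
| "ccomp (CRd v) = Read (16 * v)"
| "ccomp (CWr v) = Write (16 * v)"
| "ccomp (CFl v) = Flip (16 * v)"
| "ccomp (c ;; d) = Seq (ccomp c) (ccomp d)"
| "ccomp (CIf e c d) = Seq (ecomp 0 e) (IfNZ 1 (ccomp c) (ccomp d))"
| "ccomp (CWh e c) = Seq (ecomp 0 e) (WhileNZ 1 (Seq (ccomp c) (ecomp 0 e)))"

section \<open>Polynomial bounds on all values that occur, which determine the word size\<close>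

fun polyop :: "binop \<Rightarrow> bool" where
  "polyop Add = True" | "polyop Sub = True" | "polyop Mul = True" | "polyop Div = True"
| "polyop Mod = True" | "polyop Less = True" | "polyop Equal = True" | "polyop _ = False"

text \<open>\<open>ebd U e\<close> bounds all intermediate values of \<open>e\<close> if the stored values are at most \<open>U\<close>.\<close>

fun ebd :: "nat \<Rightarrow> expr \<Rightarrow> nat" where
  "ebd U (EC k) = k"
| "ebd U (EV v) = U"
| "ebd U (EA k e) = 16 * ebd U e + k + 18 + U"
| "ebd U (EB f a b) = ebd U a + ebd U b + ebd U a * ebd U b + 1"

text \<open>Expressions are restricted to operations for which \<open>ebd\<close> gives a static
  bound; \<open>Shl\<close> in particular has none of polynomial size. The remaining operations
  reach the machine through \<open>CBop\<close>, whose rule bounds the actual result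
  instead.\<close>

fun eshape :: "expr \<Rightarrow> bool" where
  "eshape (EC k) = True"
| "eshape (EV v) = True"
| "eshape (EA k e) \<longleftrightarrow> k < 14 \<and> eshape e"
| "eshape (EB f a b) \<longleftrightarrow> polyop f \<and> eshape a \<and> eshape b"

fun cshape :: "cmd \<Rightarrow> bool" where
  "cshape (CAsg v e) = eshape e"
| "cshape (CStr k a e) \<longleftrightarrow> k < 14 \<and> eshape a \<and> eshape e"
| "cshape (c ;; d) \<longleftrightarrow> cshape c \<and> cshape d"
| "cshape (CIf e c d) \<longleftrightarrow> eshape e \<and> cshape c \<and> cshape d"
| "cshape (CWh e c) \<longleftrightarrow> eshape e \<and> cshape c"
| "cshape _ = True"

fun cbd :: "nat \<Rightarrow> cmd \<Rightarrow> nat" where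
  "cbd U (CAsg v e) = ebd U e"
| "cbd U (CStr k a e) = ebd U (EA k a) + ebd U e"
| "cbd U (c ;; d) = cbd U c + cbd U d"
| "cbd U (CIf e c d) = ebd U e + cbd U c + cbd U d"
| "cbd U (CWh e c) = ebd U e + cbd U c"
| "cbd U _ = 0"

text \<open>The exponent depends on the expression alone. A fixed program therefore fits into words
  below a fixed power of \<open>U\<close>, uniformly in the input size.\<close>

lemma ebd_poly: "\<exists>k. \<forall>U\<ge>2. ebd U e \<le> U ^ k"
proof (induction e)
  case (EC j)
  have "j \<le> U ^ j" if "U \<ge> 2" for U
    using less_exp[of j] power_mono[OF that, of j] by linarith
  then show ?case by (auto intro!: exI[of _ j])
next
  case (EV v)
  show ?case by (auto intro!: exI[of _ 1])
next
  case (EA j e)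
  then obtain k where k: "\<And>U. U \<ge> 2 \<Longrightarrow> ebd U e \<le> U ^ k" by auto
  have "ebd U (EA j e) \<le> U ^ (k + j + 11)" if U: "U \<ge> 2" for U
  proof -
    have u: "(2::nat) ^ i \<le> U ^ i" for i using power_mono[OF U] by simp
    have p: "1 \<le> U ^ i" for i using U by simp
    have "U ^ (k + j + 11) = U ^ k * U ^ j * U ^ 11" by (simp add: power_add)
    have a: "16 * ebd U e \<le> U ^ 4 * U ^ k" using k[OF U] u[of 4] by (intro mult_le_mono) auto
    have b: "j \<le> U ^ j" using less_exp[of j] u[of j] by linarith
    have c: "18 \<le> U ^ 5" using u[of 5] by simp
    let ?X = "U ^ (k + j + 5)"
    have "U ^ 4 * U ^ k \<le> ?X" using U by (simp add: power_add[symmetric] power_increasing)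
    moreover have "U ^ j \<le> ?X" "U ^ 5 \<le> ?X" using U by (auto intro!: power_increasing)
    moreover have "U \<le> ?X" using power_increasing[of 1 "k + j + 5" U] U by simp
    ultimately have "ebd U (EA j e) \<le> 4 * ?X" using a b c by simp
    also have "\<dots> \<le> U ^ 2 * ?X" using u[of 2] by (intro mult_le_mono) auto
    also have "\<dots> = U ^ (k + j + 7)" by (simp add: power_add[symmetric] add_ac)
    also have "\<dots> \<le> U ^ (k + j + 11)" using U by (intro power_increasing) auto
    finally show ?thesis .
  qed
  then show ?case by blast
next
  case (EB f a b)
  then obtain k l where k: "\<And>U. U \<ge> 2 \<Longrightarrow> ebd U a \<le> U ^ k" and l: "\<And>U. U \<ge> 2 \<Longrightarrow> ebd U b \<le> U ^ l"
    by auto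
  have "ebd U (EB f a b) \<le> U ^ (k + l + 2)" if U: "U \<ge> 2" for U
  proof -
    let ?X = "U ^ (k + l)"
    have "ebd U a \<le> ?X" "ebd U b \<le> ?X" "1 \<le> ?X"
      using k[OF U] l[OF U] U by (auto intro: order_trans[OF _ power_increasing])
    moreover have "ebd U a * ebd U b \<le> ?X" using k[OF U] l[OF U] by (auto simp: power_add intro: mult_le_mono)
    ultimately have "ebd U (EB f a b) \<le> 4 * ?X" by simp
    also have "\<dots> \<le> U ^ 2 * ?X" using power_mono[OF U, of 2] by (intro mult_le_mono) auto
    finally show ?thesis by (simp add: power_add power2_eq_square algebra_simps)
  qed
  then show ?case by blast
qed

lemma power_sum_bound:
  assumes "\<And>U. U \<ge> 2 \<Longrightarrow> f U \<le> U ^ k" "\<And>U. U \<ge> (2::nat) \<Longrightarrow> g U \<le> U ^ l"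
  shows "\<exists>j. \<forall>U\<ge>2. f U + g U \<le> U ^ j"
proof -
  have "f U + g U \<le> U ^ Suc (k + l)" if U: "U \<ge> 2" for U
  proof -
    have "f U \<le> U ^ (k + l)" "g U \<le> U ^ (k + l)"
      using assms(1)[OF U] assms(2)[OF U] U by (auto intro: order_trans[OF _ power_increasing])
    then have "f U + g U \<le> 2 * U ^ (k + l)" by simp
    also have "\<dots> \<le> U * U ^ (k + l)" using U by simp
    finally show ?thesis by simp
  qed
  then show ?thesis by blast
qed

lemma cbd_poly: "\<exists>k. \<forall>U\<ge>2. cbd U c \<le> U ^ k"
proof -
  have *: "\<exists>j. \<forall>U\<ge>2. f U + g U \<le> U ^ j" if "\<exists>k. \<forall>U\<ge>2. f U \<le> U ^ k" "\<exists>k. \<forall>U\<ge>(2::nat). g U \<le> U ^ k"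
    for f g using that power_sum_bound[of f _ g] by blast
  have z: "\<exists>k. \<forall>U\<ge>(2::nat). 0 \<le> U ^ k" by simp
  show ?thesis
  proof (induction c)
    case (CStr k a e)
    have "\<exists>j. \<forall>U\<ge>2. ebd U (EA k a) + ebd U e \<le> U ^ j" by (intro * ebd_poly)
    then show ?case by simp
  next
    case (CIf e c d)
    have "\<exists>j. \<forall>U\<ge>2. (ebd U e + cbd U c) + cbd U d \<le> U ^ j" using CIf by (intro * ebd_poly)
    then show ?case by simp
  next
    case (CAsg v e)
    then show ?case using ebd_poly by simp
  next
    case (CWh e c)
    have "\<exists>j. \<forall>U\<ge>2. (ebd U e + cbd U c) \<le> U ^ j" using CWh by (intro * ebd_poly)
    then show ?case by simp
  next
    case (CSeq c d)
    have "\<exists>j. \<forall>U\<ge>2. (cbd U c + cbd U d) \<le> U ^ j" using CSeq by (intro *)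
    then show ?case by simp
  qed (use z in auto)
qed

text \<open>Forgets the temporaries, so that evaluating an expression leaves the abstract state
  unchanged. Array numbers from 14 on have no residue class of addresses and read as zero.\<close>

definition absr :: "ram \<Rightarrow> nat \<Rightarrow> hst" where
  "absr s t = \<lparr>vr = (\<lambda>v. mem s (16 * v)),
     ar = (\<lambda>k x. if k < 14 then mem s (16 * x + k + 2) else 0),
     hpos = coin_pos s, hin = inp s, hout = outp s, tm = t\<rparr>"

lemma absr_temps:
  assumes "\<And>a. a mod 16 \<noteq> 1 \<Longrightarrow> m a = mem s a"
  shows "absr (s\<lparr>mem := m\<rparr>) t = absr s t"
proof -
  have "m (16 * v) = mem s (16 * v)" for v by (rule assms) simp
  moreover have "m (16 * x + k + 2) = mem s (16 * x + k + 2)" if "k < 14" for x k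
  proof (rule assms)
    show "(16 * x + k + 2) mod 16 \<noteq> 1" using that by presburger
  qed
  ultimately show ?thesis by (auto simp: absr_def fun_eq_iff)
qed

definition valok :: "nat \<Rightarrow> hst \<Rightarrow> bool" where
  "valok U \<sigma> \<longleftrightarrow> (\<forall>v. vr \<sigma> v \<le> U) \<and> (\<forall>k x. ar \<sigma> k x \<le> U)"

lemma eval_le_ebd: "eshape e \<Longrightarrow> valok U \<sigma> \<Longrightarrow> eval e \<sigma> \<le> ebd U e"
proof (induction e)
  case (EA k e)
  then show ?case by (auto simp: valok_def intro: le_trans trans_le_add2)
next
  case (EB f a b)
  then have ab: "eval a \<sigma> \<le> ebd U a" "eval b \<sigma> \<le> ebd U b" "polyop f" by auto
  have "eval a \<sigma> * eval b \<sigma> \<le> ebd U a * ebd U b" using ab by (intro mult_le_mono)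
  moreover have "eval a \<sigma> div eval b \<sigma> \<le> eval a \<sigma>" "eval a \<sigma> mod eval b \<sigma> \<le> eval a \<sigma>" by simp_all
  ultimately have *: "apply_op f (eval a \<sigma>) (eval b \<sigma>) \<le> eval a \<sigma> + eval b \<sigma> + eval a \<sigma> * eval b \<sigma> + 1"
    using ab(3) by (cases f) (auto simp: of_bool_def intro: order_trans[of _ "eval a \<sigma>"])
  with ab have "\<dots> \<le> ebd U (EB f a b)" using \<open>eval a \<sigma> * eval b \<sigma> \<le> _\<close> by simp
  with * show ?case by simp
qed (auto simp: valok_def)

section \<open>Correctness of compiled expressions\<close>

context
  fixes W U :: nat and \<omega> :: "nat \<Rightarrow> bool"
begin

text \<open>Evaluation at depth \<open>d\<close> writes only temporaries of depth at least
  \<open>d\<close>. The first operand of a binary operation thus survives the evaluation of the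
  second one at depth \<open>Suc d\<close>, and the latter cell is free as scratch for address
  arithmetic.\<close>

lemma exec_ecomp:
  assumes "eshape e" "ebd U e < W" "valok U (absr s 0)" "U < W"
  shows "\<exists>m. exec W \<omega> (ecomp d e) s (etime e) (s\<lparr>mem := m\<rparr>) \<and> m (16 * d + 1) = eval e (absr s 0) \<and>
     (\<forall>a. (\<forall>j\<ge>d. a \<noteq> 16 * j + 1) \<longrightarrow> m a = mem s a)"
  using assms
proof (induction e arbitrary: d s)
  case (EC k)
  then have "exec W \<omega> (ecomp d (EC k)) s 1 (s\<lparr>mem := (mem s)(16 * d + 1 := k)\<rparr>)"
    by (auto intro!: exec.Const simp del: One_nat_def)
  then show ?case by force
next
  case (EV v)
  have "mem s (16 * v) < W" using EV by (auto simp: valok_def absr_def dest: spec[of _ v])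
  then have "exec W \<omega> (ecomp d (EV v)) s 1 (s\<lparr>mem := (mem s)(16 * d + 1 := mem s (16 * v))\<rparr>)"
    by (auto intro!: exec.Op simp del: One_nat_def)
  then show ?case by (force simp: absr_def)
next
  case (EA k e)
  have lt: "ebd U e < W" "16 * ebd U e + k + 2 < W" "16 < W" "k + 2 < W" using EA.prems by auto
  obtain m where m: "exec W \<omega> (ecomp d e) s (etime e) (s\<lparr>mem := m\<rparr>)" "m (16 * d + 1) = eval e (absr s 0)"
    "\<And>a. (\<And>j. j \<ge> d \<Longrightarrow> a \<noteq> 16 * j + 1) \<Longrightarrow> m a = mem s a"
    using EA.IH[of s d] EA.prems lt by auto
  let ?v = "eval e (absr s 0)"
  have v: "?v \<le> ebd U e" using EA.prems by (intro eval_le_ebd) auto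
  let ?x = "16 * d + 1" and ?y = "16 * Suc d + 1"
  define m1 where "m1 = m(?y := 16)"
  define m2 where "m2 = m1(?x := 16 * ?v)"
  define m3 where "m3 = m2(?y := k + 2)"
  define m4 where "m4 = m3(?x := 16 * ?v + k + 2)"
  define m5 where "m5 = m4(?x := m4 (16 * ?v + k + 2))"
  have e1: "exec W \<omega> (Const ?y 16) (s\<lparr>mem := m\<rparr>) 1 (s\<lparr>mem := m1\<rparr>)"
    using exec.Const[OF lt(3), of \<omega> ?y "s\<lparr>mem := m\<rparr>"] by (simp add: m1_def)
  have e2: "exec W \<omega> (Op Mul ?x ?x ?y) (s\<lparr>mem := m1\<rparr>) 1 (s\<lparr>mem := m2\<rparr>)"
    using exec.Op[of "16 * ?v" Mul "s\<lparr>mem := m1\<rparr>" ?x ?y W \<omega> ?x] m(2) v lt by (simp add: m1_def m2_def)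
  have e3: "exec W \<omega> (Const ?y (k + 2)) (s\<lparr>mem := m2\<rparr>) 1 (s\<lparr>mem := m3\<rparr>)"
    using exec.Const[OF lt(4), of \<omega> ?y "s\<lparr>mem := m2\<rparr>"] by (simp add: m3_def)
  have e4: "exec W \<omega> (Op Add ?x ?x ?y) (s\<lparr>mem := m3\<rparr>) 1 (s\<lparr>mem := m4\<rparr>)"
    using exec.Op[of "16 * ?v + k + 2" Add "s\<lparr>mem := m3\<rparr>" ?x ?y W \<omega> ?x] v lt by (simp add: m2_def m3_def m4_def)
  have e5: "exec W \<omega> (Load ?x ?x) (s\<lparr>mem := m4\<rparr>) 1 (s\<lparr>mem := m5\<rparr>)"
    using exec.Load[of W \<omega> ?x ?x "s\<lparr>mem := m4\<rparr>"] by (simp add: m4_def m5_def)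
  have "exec W \<omega> (ecomp d (EA k e)) s (etime e + (1 + (1 + (1 + (1 + 1))))) (s\<lparr>mem := m5\<rparr>)"
    unfolding ecomp.simps by (intro exec.Seq[OF m(1)] exec.Seq[OF e1] exec.Seq[OF e2] exec.Seq[OF e3] exec.Seq[OF e4] e5)
  moreover have "m5 ?x = eval (EA k e) (absr s 0)"
  proof -
    \<comment> \<open>Arrays own the residues 2 to 15, so the scratch writes cannot have changed the
      cell that is loaded.\<close>
    have "(16 * x + k + 2) mod 16 \<noteq> 1" for x
    proof -
      have "k < 14" using EA.prems(1) by simp
      then show ?thesis by presburger
    qed
    then have *: "(16 * ?v + k + 2) mod 16 \<noteq> 1" .
    have "16 * ?v + k + 2 \<noteq> 16 * j + 1" for j
    proof
      assume "16 * ?v + k + 2 = 16 * j + 1"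
      then have "(16 * ?v + k + 2) mod 16 = (16 * j + 1) mod 16" by (rule arg_cong)
      also have "\<dots> = 1" by presburger
      finally show False using * by blast
    qed
    then have "m4 (16 * ?v + k + 2) = mem s (16 * ?v + k + 2)"
      unfolding m4_def m3_def m2_def m1_def by (simp add: m(3) del: mult_Suc_right add_2_eq_Suc')
    then show ?thesis using EA.prems by (simp add: m5_def) (simp add: absr_def)
  qed
  moreover have "m5 a = mem s a" if "\<forall>j\<ge>d. a \<noteq> 16 * j + 1" for a
  proof -
    have "a \<noteq> ?x" "a \<noteq> ?y" using that[rule_format, of d] that[rule_format, of "Suc d"] by simp_all
    then show ?thesis using that by (simp add: m5_def m4_def m3_def m2_def m1_def m(3))
  qed
  ultimately show ?case by (auto simp: numeral_eq_Suc)
next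
  case (EB f a b)
  have lt: "ebd U a < W" "ebd U b < W" using EB.prems by auto
  obtain m where m: "exec W \<omega> (ecomp d a) s (etime a) (s\<lparr>mem := m\<rparr>)" "m (16 * d + 1) = eval a (absr s 0)"
    "\<And>a. (\<And>j. j \<ge> d \<Longrightarrow> a \<noteq> 16 * j + 1) \<Longrightarrow> m a = mem s a"
    using EB.IH(1)[of s d] EB.prems lt by auto
  have eq: "absr (s\<lparr>mem := m\<rparr>) 0 = absr s 0"
  proof (rule absr_temps)
    fix a :: nat assume "a mod 16 \<noteq> 1"
    then show "m a = mem s a" by (intro m(3)) auto
  qed
  obtain m' where m': "exec W \<omega> (ecomp (Suc d) b) (s\<lparr>mem := m\<rparr>) (etime b) (s\<lparr>mem := m'\<rparr>)"
     "m' (16 * Suc d + 1) = eval b (absr s 0)"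
    "\<And>a. (\<And>j. j \<ge> Suc d \<Longrightarrow> a \<noteq> 16 * j + 1) \<Longrightarrow> m' a = m a"
    using EB.IH(2)[of "s\<lparr>mem := m\<rparr>" "Suc d"] EB.prems lt eq by auto
  let ?v = "apply_op f (eval a (absr s 0)) (eval b (absr s 0))"
  have v: "?v < W" using eval_le_ebd[of "EB f a b" U "absr s 0"] EB.prems by simp
  have x: "m' (16 * d + 1) = eval a (absr s 0)" using m'(3)[of "16 * d + 1"] m(2) by simp
  have "exec W \<omega> (Op f (16 * d + 1) (16 * d + 1) (16 * Suc d + 1)) (s\<lparr>mem := m'\<rparr>) 1 (s\<lparr>mem := m'(16 * d + 1 := ?v)\<rparr>)"
    using exec.Op[of ?v f "s\<lparr>mem := m'\<rparr>" "16 * d + 1" "16 * Suc d + 1" W \<omega> "16 * d + 1"] v x m'(2) by simp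
  then have "exec W \<omega> (ecomp d (EB f a b)) s (etime a + (etime b + 1)) (s\<lparr>mem := m'(16 * d + 1 := ?v)\<rparr>)"
    unfolding ecomp.simps by (intro exec.Seq[OF m(1)] exec.Seq[OF m'(1)])
  moreover have "(m'(16 * d + 1 := ?v)) a = mem s a" if "\<forall>j\<ge>d. a \<noteq> 16 * j + 1" for a
    using that m(3)[of a] m'(3)[of a] by auto
  ultimately show ?case by auto
qed

end

lemma absr_var:
  "absr (s\<lparr>mem := m(16 * v := x)\<rparr>) t =
     (absr (s\<lparr>mem := m\<rparr>) t)\<lparr>vr := (vr (absr (s\<lparr>mem := m\<rparr>) t))(v := x)\<rparr>"
proof -
  have "16 * y + k + 2 \<noteq> 16 * v" if "k < 14" for y k using that by presburger
  then show ?thesis by (auto simp: absr_def fun_eq_iff)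
qed

lemma absr_arr:
  assumes "k < 14"
  shows "absr (s\<lparr>mem := m(16 * y + k + 2 := x)\<rparr>) t =
     (absr (s\<lparr>mem := m\<rparr>) t)\<lparr>ar := (ar (absr (s\<lparr>mem := m\<rparr>) t))(k := (ar (absr (s\<lparr>mem := m\<rparr>) t) k)(y := x))\<rparr>"
proof -
  have "16 * y + k + 2 \<noteq> 16 * v" for v using assms by presburger
  moreover have "16 * v \<noteq> 16 * y + k + 2" for v using assms by presburger
  moreover have "16 * y' + k' + 2 = 16 * y + k + 2 \<longleftrightarrow> k' = k \<and> y' = y" if "k' < 14" for y' k'
    using that assms by (cases y' y rule: linorder_cases) auto
  ultimately show ?thesis using assms by (auto simp: absr_def fun_eq_iff simp del: add_2_eq_Suc')
qed

lemma tm_absr [simp]: "tm (absr s t) = t"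
  by (simp add: absr_def)

lemma absr_tm: "absr s t = \<sigma> \<Longrightarrow> absr s t' = \<sigma>\<lparr>tm := t'\<rparr>"
  by (auto simp: absr_def)

lemma absr_mem: "absr (s\<lparr>mem := mem s\<rparr>) t = absr s t"
  by (simp add: absr_def)

section \<open>Weakest preconditions with a clock\<close>

locale hl =
  fixes W U :: nat and \<omega> :: "nat \<Rightarrow> bool"
  assumes UW: "U < W" and U_pos: "1 \<le> U"
begin

definition cok :: "cmd \<Rightarrow> bool" where
  "cok c \<longleftrightarrow> cshape c \<and> cbd U c < W"

text \<open>All machine states with the given abstraction are covered, because nothing is known
  about the temporaries between two commands. The side condition \<open>cok\<close> sits inside, so
  the rules below need not carry it; \<open>wp_absr\<close> discharges it once for a whole
  program.\<close>

definition hx :: "cmd \<Rightarrow> hst \<Rightarrow> hst \<Rightarrow> bool" where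
  "hx c \<sigma> \<sigma>' \<longleftrightarrow> (cok c \<longrightarrow> tm \<sigma> \<le> tm \<sigma>' \<and> (\<forall>s. absr s (tm \<sigma>) = \<sigma> \<longrightarrow>
     (\<exists>t s'. exec W \<omega> (ccomp c) s t s' \<and> t \<le> tm \<sigma>' - tm \<sigma> \<and> absr s' (tm \<sigma>') = \<sigma>')))"

text \<open>\<open>valok\<close> is assumed and re-established by every command, so that word bounds
  have to be checked only where a value is stored.\<close>

definition wp :: "cmd \<Rightarrow> (hst \<Rightarrow> bool) \<Rightarrow> hst \<Rightarrow> bool" where
  "wp c Q \<sigma> \<longleftrightarrow> (valok U \<sigma> \<longrightarrow> (\<exists>\<sigma>'. hx c \<sigma> \<sigma>' \<and> valok U \<sigma>' \<and> Q \<sigma>'))"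

lemma wp_mono: "wp c P \<sigma> \<Longrightarrow> (\<And>\<sigma>'. valok U \<sigma>' \<Longrightarrow> P \<sigma>' \<Longrightarrow> Q \<sigma>') \<Longrightarrow> wp c Q \<sigma>"
  unfolding wp_def by blast

lemma wp_valok: "(valok U \<sigma> \<Longrightarrow> wp c P \<sigma>) \<Longrightarrow> wp c P \<sigma>"
  unfolding wp_def by blast

lemma wp_absr:
  assumes "wp c Q (absr s t0)" "cok c" "valok U (absr s t0)"
  shows "\<exists>t s'. exec W \<omega> (ccomp c) s t s' \<and> (\<exists>t'. t0 + t \<le> t' \<and> valok U (absr s' t') \<and> Q (absr s' t'))"
proof -
  obtain \<sigma>' where h: "hx c (absr s t0) \<sigma>'" "valok U \<sigma>'" "Q \<sigma>'" using assms unfolding wp_def by blast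
  obtain t s' where "exec W \<omega> (ccomp c) s t s'" "t \<le> tm \<sigma>' - t0" "absr s' (tm \<sigma>') = \<sigma>'" "t0 \<le> tm \<sigma>'"
    using h(1) assms(2) unfolding hx_def by auto
  with h show ?thesis by (intro exI[of _ t] exI[of _ s'] conjI exI[of _ "tm \<sigma>'"]) auto
qed

lemma ecomp_absr:
  assumes "eshape e" "ebd U e < W" "valok U \<sigma>" "absr s (tm \<sigma>) = \<sigma>"
  shows "\<exists>m. exec W \<omega> (ecomp d e) s (etime e) (s\<lparr>mem := m\<rparr>) \<and> m (16 * d + 1) = eval e \<sigma> \<and>
     (\<forall>a. (\<forall>j\<ge>d. a \<noteq> 16 * j + 1) \<longrightarrow> m a = mem s a) \<and> (\<forall>t. absr (s\<lparr>mem := m\<rparr>) t = absr s t)"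
proof -
  have t: "absr s t = (absr s (tm \<sigma>))\<lparr>tm := t\<rparr>" for t by (simp add: absr_def)
  have "valok U (absr s 0)" using assms(3) t[of 0] assms(4) by (simp add: valok_def)
  from exec_ecomp[OF assms(1,2) this UW, of \<omega> d] obtain m where
    m: "exec W \<omega> (ecomp d e) s (etime e) (s\<lparr>mem := m\<rparr>)" "m (16 * d + 1) = eval e (absr s 0)"
     "\<And>a. (\<And>j. j \<ge> d \<Longrightarrow> a \<noteq> 16 * j + 1) \<Longrightarrow> m a = mem s a" by blast
  have "absr (s\<lparr>mem := m\<rparr>) t = absr s t" for t
  proof (rule absr_temps)
    fix a :: nat assume "a mod 16 \<noteq> 1"
    then show "m a = mem s a" by (intro m(3)) auto
  qed
  moreover have "eval e (absr s 0) = eval e \<sigma>" using t[of 0] assms(4) by simp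
  ultimately show ?thesis using m by (intro exI[of _ m]) auto
qed

lemma wp_skip: "Q (\<sigma>\<lparr>tm := tm \<sigma> + 1\<rparr>) \<Longrightarrow> wp CSkip Q \<sigma>"
  unfolding wp_def
proof (intro impI exI conjI)
  show "hx CSkip \<sigma> (\<sigma>\<lparr>tm := tm \<sigma> + 1\<rparr>)"
    unfolding hx_def
  proof (intro impI conjI allI)
    fix s assume "absr s (tm \<sigma>) = \<sigma>"
    then have "absr s (tm \<sigma> + 1) = \<sigma>\<lparr>tm := tm \<sigma> + 1\<rparr>" by (rule absr_tm)
    then show "\<exists>t s'. exec W \<omega> (ccomp CSkip) s t s' \<and> t \<le> tm (\<sigma>\<lparr>tm := tm \<sigma> + 1\<rparr>) - tm \<sigma> \<and>
        absr s' (tm (\<sigma>\<lparr>tm := tm \<sigma> + 1\<rparr>)) = \<sigma>\<lparr>tm := tm \<sigma> + 1\<rparr>"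
      by (intro exI[of _ 1] exI[of _ s]) (auto intro: exec.Skip simp del: One_nat_def)
  qed simp
qed (auto simp: valok_def)

lemma wp_asg:
  assumes "valok U \<sigma> \<Longrightarrow> eval e \<sigma> \<le> U"
    and "Q (\<sigma>\<lparr>vr := (vr \<sigma>)(v := eval e \<sigma>), tm := tm \<sigma> + (etime e + 1)\<rparr>)"
  shows "wp (CAsg v e) Q \<sigma>"
  unfolding wp_def
proof (intro impI exI conjI)
  let ?s = "\<sigma>\<lparr>vr := (vr \<sigma>)(v := eval e \<sigma>), tm := tm \<sigma> + (etime e + 1)\<rparr>"
  assume v: "valok U \<sigma>"
  show "hx (CAsg v e) \<sigma> ?s"
    unfolding hx_def
  proof (intro impI conjI allI)
    fix s assume c: "cok (CAsg v e)" and s: "absr s (tm \<sigma>) = \<sigma>"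
    obtain m where m: "exec W \<omega> (ecomp 0 e) s (etime e) (s\<lparr>mem := m\<rparr>)" "m 1 = eval e \<sigma>"
      "\<And>t. absr (s\<lparr>mem := m\<rparr>) t = absr s t"
      using ecomp_absr[OF _ _ v s, of e 0] c by (auto simp: cok_def)
    have "exec W \<omega> (Op And (16 * v) 1 1) (s\<lparr>mem := m\<rparr>) 1 (s\<lparr>mem := m(16 * v := eval e \<sigma>)\<rparr>)"
      using exec.Op[of "eval e \<sigma>" And "s\<lparr>mem := m\<rparr>" 1 1 W \<omega> "16 * v"] m(2) assms(1)[OF v] UW by simp
    then have "exec W \<omega> (ccomp (CAsg v e)) s (etime e + 1) (s\<lparr>mem := m(16 * v := eval e \<sigma>)\<rparr>)"
      using m(1) by (auto intro: exec.Seq simp del: One_nat_def)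
    moreover have "absr (s\<lparr>mem := m(16 * v := eval e \<sigma>)\<rparr>) (tm ?s) = ?s"
      unfolding absr_var m(3) absr_tm[OF s] by simp
    ultimately show "\<exists>t s'. exec W \<omega> (ccomp (CAsg v e)) s t s' \<and> t \<le> tm ?s - tm \<sigma> \<and> absr s' (tm ?s) = ?s"
      by (intro exI conjI) auto
  qed simp
qed (use assms in \<open>auto simp: valok_def\<close>)

lemma wp_bop:
  assumes "apply_op f (vr \<sigma> y) (vr \<sigma> z) \<le> U"
    and "Q (\<sigma>\<lparr>vr := (vr \<sigma>)(x := apply_op f (vr \<sigma> y) (vr \<sigma> z)), tm := tm \<sigma> + 1\<rparr>)"
  shows "wp (CBop f x y z) Q \<sigma>"
  unfolding wp_def
proof (intro impI exI conjI)
  let ?v = "apply_op f (vr \<sigma> y) (vr \<sigma> z)"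
  let ?s = "\<sigma>\<lparr>vr := (vr \<sigma>)(x := ?v), tm := tm \<sigma> + 1\<rparr>"
  show "hx (CBop f x y z) \<sigma> ?s"
    unfolding hx_def
  proof (intro impI conjI allI)
    fix s assume s: "absr s (tm \<sigma>) = \<sigma>"
    have "vr \<sigma> i = mem s (16 * i)" for i by (subst s[symmetric]) (simp add: absr_def)
    then have "exec W \<omega> (ccomp (CBop f x y z)) s 1 (s\<lparr>mem := (mem s)(16 * x := ?v)\<rparr>)"
      using exec.Op[of ?v f s "16 * y" "16 * z" W \<omega> "16 * x"] assms(1) UW by simp
    moreover have "absr (s\<lparr>mem := (mem s)(16 * x := ?v)\<rparr>) (tm ?s) = ?s"
      unfolding absr_var absr_mem absr_tm[OF s] by simp
    ultimately show "\<exists>t s'. exec W \<omega> (ccomp (CBop f x y z)) s t s' \<and> t \<le> tm ?s - tm \<sigma> \<and> absr s' (tm ?s) = ?s"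
      by (intro exI conjI) auto
  qed simp
qed (use assms in \<open>auto simp: valok_def\<close>)

lemma wp_str:
  assumes "valok U \<sigma> \<Longrightarrow> eval e \<sigma> \<le> U"
    and "Q (\<sigma>\<lparr>ar := (ar \<sigma>)(k := (ar \<sigma> k)(eval a \<sigma> := eval e \<sigma>)), tm := tm \<sigma> + (etime a + etime e + 5)\<rparr>)"
  shows "wp (CStr k a e) Q \<sigma>"
  unfolding wp_def
proof (intro impI exI conjI)
  let ?s = "\<sigma>\<lparr>ar := (ar \<sigma>)(k := (ar \<sigma> k)(eval a \<sigma> := eval e \<sigma>)), tm := tm \<sigma> + (etime a + etime e + 5)\<rparr>"
  let ?v = "eval a \<sigma>"
  assume v: "valok U \<sigma>"
  show "hx (CStr k a e) \<sigma> ?s"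
    unfolding hx_def
  proof (intro impI conjI allI)
    fix s assume c: "cok (CStr k a e)" and s: "absr s (tm \<sigma>) = \<sigma>"
    have sh: "eshape a" "eshape e" "ebd U a < W" "ebd U e < W" "16 * ebd U a + k + 2 < W" "16 < W" "k + 2 < W" "k < 14"
      using c by (auto simp: cok_def)
    obtain m where m: "exec W \<omega> (ecomp 0 a) s (etime a) (s\<lparr>mem := m\<rparr>)" "m 1 = ?v"
      "\<And>t. absr (s\<lparr>mem := m\<rparr>) t = absr s t"
      using ecomp_absr[OF _ _ v s, of a 0] sh by auto
    have va: "?v \<le> ebd U a" using eval_le_ebd[OF sh(1) v] .
    define m1 where "m1 = m(17 := 16)"
    define m2 where "m2 = m1(1 := 16 * ?v)"
    define m3 where "m3 = m2(17 := k + 2)"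
    define m4 where "m4 = m3(1 := 16 * ?v + k + 2)"
    have e1: "exec W \<omega> (Const 17 16) (s\<lparr>mem := m\<rparr>) 1 (s\<lparr>mem := m1\<rparr>)"
      using exec.Const[OF sh(6), of \<omega> 17 "s\<lparr>mem := m\<rparr>"] by (simp add: m1_def)
    have e2: "exec W \<omega> (Op Mul 1 1 17) (s\<lparr>mem := m1\<rparr>) 1 (s\<lparr>mem := m2\<rparr>)"
      using exec.Op[of "16 * ?v" Mul "s\<lparr>mem := m1\<rparr>" 1 17 W \<omega> 1] m(2) va sh by (simp add: m1_def m2_def)
    have e3: "exec W \<omega> (Const 17 (k + 2)) (s\<lparr>mem := m2\<rparr>) 1 (s\<lparr>mem := m3\<rparr>)"
      using exec.Const[OF sh(7), of \<omega> 17 "s\<lparr>mem := m2\<rparr>"] by (simp add: m3_def)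
    have e4: "exec W \<omega> (Op Add 1 1 17) (s\<lparr>mem := m3\<rparr>) 1 (s\<lparr>mem := m4\<rparr>)"
      using exec.Op[of "16 * ?v + k + 2" Add "s\<lparr>mem := m3\<rparr>" 1 17 W \<omega> 1] va sh by (simp add: m2_def m3_def m4_def)
    have "absr (s\<lparr>mem := m4\<rparr>) t = absr (s\<lparr>mem := m\<rparr>) t" for t
    proof -
      have "m4 a = m a" if "a mod 16 \<noteq> 1" for a
        using that by (auto simp: m4_def m3_def m2_def m1_def)
      then show ?thesis using absr_temps[of m4 "s\<lparr>mem := m\<rparr>" t] by simp
    qed
    then have m4: "absr (s\<lparr>mem := m4\<rparr>) t = absr s t" for t using m(3) by simp
    obtain m5 where m5: "exec W \<omega> (ecomp 1 e) (s\<lparr>mem := m4\<rparr>) (etime e) (s\<lparr>mem := m5\<rparr>)" "m5 17 = eval e \<sigma>"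
      "\<And>t. absr (s\<lparr>mem := m5\<rparr>) t = absr s t" "m5 1 = m4 1"
      using ecomp_absr[OF _ _ v, of e "s\<lparr>mem := m4\<rparr>" 1] sh m4 s by auto
    let ?s2 = "s\<lparr>mem := m5(16 * ?v + k + 2 := eval e \<sigma>)\<rparr>"
    have e6: "exec W \<omega> (Store 1 17) (s\<lparr>mem := m5\<rparr>) 1 ?s2"
      using exec.Store[of W \<omega> 1 17 "s\<lparr>mem := m5\<rparr>"] m5(2,4) by (simp add: m4_def)
    have "exec W \<omega> (ccomp (CStr k a e)) s (etime a + (1 + (1 + (1 + (1 + (etime e + 1)))))) ?s2"
      unfolding ccomp.simps
      by (intro exec.Seq[OF m(1)] exec.Seq[OF e1] exec.Seq[OF e2] exec.Seq[OF e3] exec.Seq[OF e4] exec.Seq[OF m5(1)] e6)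
    moreover have "absr ?s2 (tm ?s) = ?s"
      unfolding absr_arr[OF sh(8)] m5(3) absr_tm[OF s] by simp
    ultimately show "\<exists>t s'. exec W \<omega> (ccomp (CStr k a e)) s t s' \<and> t \<le> tm ?s - tm \<sigma> \<and> absr s' (tm ?s) = ?s"
      by (intro exI conjI) auto
  qed simp
qed (use assms in \<open>auto simp: valok_def\<close>)

lemma wp_rd:
  assumes "hin \<sigma> = x # xs" "x \<le> U"
    and "Q (\<sigma>\<lparr>vr := (vr \<sigma>)(v := x), hin := xs, tm := tm \<sigma> + 1\<rparr>)"
  shows "wp (CRd v) Q \<sigma>"
  unfolding wp_def
proof (intro impI exI conjI)
  let ?s = "\<sigma>\<lparr>vr := (vr \<sigma>)(v := x), hin := xs, tm := tm \<sigma> + 1\<rparr>"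
  show "hx (CRd v) \<sigma> ?s"
    unfolding hx_def
  proof (intro impI conjI allI)
    fix s assume s: "absr s (tm \<sigma>) = \<sigma>"
    have "inp s = x # xs" using assms(1) by (subst (asm) s[symmetric]) (simp add: absr_def)
    then have "exec W \<omega> (ccomp (CRd v)) s 1 (s\<lparr>mem := (mem s)(16 * v := x), inp := xs\<rparr>)"
      using exec.Read[of s x xs W \<omega> "16 * v"] assms(2) UW by simp
    moreover have "absr (s\<lparr>mem := (mem s)(16 * v := x), inp := xs\<rparr>) (tm ?s) = ?s"
    proof -
      have "absr (s\<lparr>mem := (mem s)(16 * v := x), inp := xs\<rparr>) (tm ?s) =
        (absr (s\<lparr>mem := (mem s)(16 * v := x)\<rparr>) (tm ?s))\<lparr>hin := xs\<rparr>" by (simp add: absr_def cong: if_cong)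
      also have "\<dots> = ?s" unfolding absr_var absr_mem absr_tm[OF s] by simp
      finally show ?thesis .
    qed
    ultimately show "\<exists>t s'. exec W \<omega> (ccomp (CRd v)) s t s' \<and> t \<le> tm ?s - tm \<sigma> \<and> absr s' (tm ?s) = ?s"
      by (intro exI conjI) auto
  qed simp
qed (use assms in \<open>auto simp: valok_def\<close>)

lemma wp_wr:
  assumes "Q (\<sigma>\<lparr>hout := hout \<sigma> @ [vr \<sigma> v], tm := tm \<sigma> + 1\<rparr>)"
  shows "wp (CWr v) Q \<sigma>"
  unfolding wp_def
proof (intro impI exI conjI)
  let ?s = "\<sigma>\<lparr>hout := hout \<sigma> @ [vr \<sigma> v], tm := tm \<sigma> + 1\<rparr>"
  show "hx (CWr v) \<sigma> ?s"
    unfolding hx_def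
  proof (intro impI conjI allI)
    fix s assume s: "absr s (tm \<sigma>) = \<sigma>"
    have "exec W \<omega> (ccomp (CWr v)) s 1 (s\<lparr>outp := outp s @ [mem s (16 * v)]\<rparr>)"
      using exec.Write[of W \<omega> "16 * v" s] by simp
    moreover have "absr (s\<lparr>outp := outp s @ [mem s (16 * v)]\<rparr>) (tm ?s) = ?s"
    proof -
      have "absr (s\<lparr>outp := outp s @ [mem s (16 * v)]\<rparr>) (tm ?s) =
        (absr s (tm ?s))\<lparr>hout := hout (absr s (tm ?s)) @ [vr (absr s (tm ?s)) v]\<rparr>" by (simp add: absr_def cong: if_cong)
      also have "\<dots> = ?s" unfolding absr_tm[OF s] by simp
      finally show ?thesis .
    qed
    ultimately show "\<exists>t s'. exec W \<omega> (ccomp (CWr v)) s t s' \<and> t \<le> tm ?s - tm \<sigma> \<and> absr s' (tm ?s) = ?s"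
      by (intro exI conjI) auto
  qed simp
qed (use assms in \<open>auto simp: valok_def\<close>)

lemma wp_fl:
  assumes "Q (\<sigma>\<lparr>vr := (vr \<sigma>)(v := of_bool (\<omega> (hpos \<sigma>))), hpos := Suc (hpos \<sigma>), tm := tm \<sigma> + 1\<rparr>)"
  shows "wp (CFl v) Q \<sigma>"
  unfolding wp_def
proof (intro impI exI conjI)
  let ?x = "of_bool (\<omega> (hpos \<sigma>)) :: nat"
  let ?s = "\<sigma>\<lparr>vr := (vr \<sigma>)(v := ?x), hpos := Suc (hpos \<sigma>), tm := tm \<sigma> + 1\<rparr>"
  have b: "?x \<le> U" using U_pos by simp
  show "hx (CFl v) \<sigma> ?s"
    unfolding hx_def
  proof (intro impI conjI allI)
    fix s assume s: "absr s (tm \<sigma>) = \<sigma>"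
    have c: "coin_pos s = hpos \<sigma>" by (subst s[symmetric]) (simp add: absr_def)
    let ?s' = "s\<lparr>mem := (mem s)(16 * v := ?x), coin_pos := Suc (coin_pos s)\<rparr>"
    have "exec W \<omega> (ccomp (CFl v)) s 1 ?s'"
      using exec.Flip[of ?x \<omega> s W "16 * v"] b UW c by simp
    moreover have "absr ?s' (tm ?s) = ?s"
    proof -
      have "absr ?s' (tm ?s) =
        (absr (s\<lparr>mem := (mem s)(16 * v := ?x)\<rparr>) (tm ?s))\<lparr>hpos := Suc (coin_pos s)\<rparr>" by (simp add: absr_def cong: if_cong)
      also have "\<dots> = ?s" unfolding absr_var absr_mem absr_tm[OF s] using c by simp
      finally show ?thesis .
    qed
    ultimately show "\<exists>t s'. exec W \<omega> (ccomp (CFl v)) s t s' \<and> t \<le> tm ?s - tm \<sigma> \<and> absr s' (tm ?s) = ?s"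
      by (intro exI conjI) auto
  qed simp
  assume "valok U \<sigma>"
  then show "valok U ?s" using b by (auto simp: valok_def)
qed (use assms in \<open>auto simp: valok_def\<close>)

lemma wp_seq:
  assumes "wp c (wp d Q) \<sigma>"
  shows "wp (c ;; d) Q \<sigma>"
  unfolding wp_def
proof
  assume "valok U \<sigma>"
  then obtain \<sigma>1 where 1: "hx c \<sigma> \<sigma>1" "valok U \<sigma>1" "wp d Q \<sigma>1" using assms unfolding wp_def by blast
  then obtain \<sigma>2 where 2: "hx d \<sigma>1 \<sigma>2" "valok U \<sigma>2" "Q \<sigma>2" unfolding wp_def by blast
  have "hx (c ;; d) \<sigma> \<sigma>2"
    unfolding hx_def
  proof (intro impI conjI allI)
    assume "cok (c ;; d)"
    then have "cok c" "cok d" by (auto simp: cok_def)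
    note h = 1(1)[unfolded hx_def, rule_format, OF \<open>cok c\<close>] 2(1)[unfolded hx_def, rule_format, OF \<open>cok d\<close>]
    show "tm \<sigma> \<le> tm \<sigma>2" using h by linarith
    fix s assume s: "absr s (tm \<sigma>) = \<sigma>"
    then obtain t1 s1 where e1: "exec W \<omega> (ccomp c) s t1 s1" "t1 \<le> tm \<sigma>1 - tm \<sigma>" "absr s1 (tm \<sigma>1) = \<sigma>1"
      using h(1) by blast
    then obtain t2 s2 where e2: "exec W \<omega> (ccomp d) s1 t2 s2" "t2 \<le> tm \<sigma>2 - tm \<sigma>1" "absr s2 (tm \<sigma>2) = \<sigma>2"
      using h(2) by blast
    show "\<exists>t s'. exec W \<omega> (ccomp (c ;; d)) s t s' \<and> t \<le> tm \<sigma>2 - tm \<sigma> \<and> absr s' (tm \<sigma>2) = \<sigma>2"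
      using exec.Seq[OF e1(1) e2(1)] e1(2) e2(2,3) h
      by (intro exI[of _ "t1 + t2"] exI[of _ s2]) auto
  qed
  then show "\<exists>\<sigma>'. hx (c ;; d) \<sigma> \<sigma>' \<and> valok U \<sigma>' \<and> Q \<sigma>'" using 2 by blast
qed

lemma valok_tm [simp]: "valok U (\<sigma>\<lparr>tm := t\<rparr>) = valok U \<sigma>"
  by (simp add: valok_def)

lemma wp_if:
  assumes "eval e \<sigma> \<noteq> 0 \<Longrightarrow> wp c Q (\<sigma>\<lparr>tm := tm \<sigma> + (etime e + 1)\<rparr>)"
    and "eval e \<sigma> = 0 \<Longrightarrow> wp d Q (\<sigma>\<lparr>tm := tm \<sigma> + (etime e + 1)\<rparr>)"
  shows "wp (CIf e c d) Q \<sigma>"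
  unfolding wp_def
proof
  assume v: "valok U \<sigma>"
  define b where "b = (if eval e \<sigma> \<noteq> 0 then c else d)"
  let ?\<sigma> = "\<sigma>\<lparr>tm := tm \<sigma> + (etime e + 1)\<rparr>"
  have "wp b Q ?\<sigma>" using assms by (auto simp: b_def)
  then obtain \<sigma>2 where 2: "hx b ?\<sigma> \<sigma>2" "valok U \<sigma>2" "Q \<sigma>2" using v unfolding wp_def by auto
  have "hx (CIf e c d) \<sigma> \<sigma>2"
    unfolding hx_def
  proof (intro impI conjI allI)
    assume c: "cok (CIf e c d)"
    then have "cok b" and e: "eshape e" "ebd U e < W" by (auto simp: cok_def b_def)
    note h = 2(1)[unfolded hx_def, rule_format, OF \<open>cok b\<close>]
    show "tm \<sigma> \<le> tm \<sigma>2" using h by simp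
    fix s assume s: "absr s (tm \<sigma>) = \<sigma>"
    obtain m where m: "exec W \<omega> (ecomp 0 e) s (etime e) (s\<lparr>mem := m\<rparr>)" "m 1 = eval e \<sigma>"
      "\<And>t. absr (s\<lparr>mem := m\<rparr>) t = absr s t"
      using ecomp_absr[OF e v s, of 0] by auto
    have "absr (s\<lparr>mem := m\<rparr>) (tm ?\<sigma>) = ?\<sigma>" unfolding m(3) using absr_tm[OF s] by simp
    then obtain t2 s2 where e2: "exec W \<omega> (ccomp b) (s\<lparr>mem := m\<rparr>) t2 s2" "t2 \<le> tm \<sigma>2 - tm ?\<sigma>" "absr s2 (tm \<sigma>2) = \<sigma>2"
      using h by blast
    have "exec W \<omega> (IfNZ 1 (ccomp c) (ccomp d)) (s\<lparr>mem := m\<rparr>) (Suc t2) s2"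
      using e2(1) m(2) by (auto simp: b_def intro: exec.IfTrue exec.IfFalse split: if_splits)
    from exec.Seq[OF m(1) this] show "\<exists>t s'. exec W \<omega> (ccomp (CIf e c d)) s t s' \<and> t \<le> tm \<sigma>2 - tm \<sigma> \<and> absr s' (tm \<sigma>2) = \<sigma>2"
      using e2 h by (intro exI[of _ "etime e + Suc t2"] exI[of _ s2]) auto
  qed
  then show "\<exists>\<sigma>'. hx (CIf e c d) \<sigma> \<sigma>' \<and> valok U \<sigma>' \<and> Q \<sigma>'" using 2 by blast
qed

lemma wp_while_false:
  assumes "eval e \<sigma> = 0" "Q (\<sigma>\<lparr>tm := tm \<sigma> + (etime e + 1)\<rparr>)"
  shows "wp (CWh e c) Q \<sigma>"
  unfolding wp_def
proof
  assume v: "valok U \<sigma>"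
  let ?\<sigma> = "\<sigma>\<lparr>tm := tm \<sigma> + (etime e + 1)\<rparr>"
  have "hx (CWh e c) \<sigma> ?\<sigma>"
    unfolding hx_def
  proof (intro impI conjI allI)
    assume c: "cok (CWh e c)"
    then have e: "eshape e" "ebd U e < W" by (auto simp: cok_def)
    show "tm \<sigma> \<le> tm ?\<sigma>" by simp
    fix s assume s: "absr s (tm \<sigma>) = \<sigma>"
    obtain m where m: "exec W \<omega> (ecomp 0 e) s (etime e) (s\<lparr>mem := m\<rparr>)" "m 1 = eval e \<sigma>"
      "\<And>t. absr (s\<lparr>mem := m\<rparr>) t = absr s t"
      using ecomp_absr[OF e v s, of 0] by auto
    have a: "absr (s\<lparr>mem := m\<rparr>) (tm ?\<sigma>) = ?\<sigma>" unfolding m(3) using absr_tm[OF s] by simp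
    have "exec W \<omega> (WhileNZ 1 (Seq (ccomp c) (ecomp 0 e))) (s\<lparr>mem := m\<rparr>) 1 (s\<lparr>mem := m\<rparr>)"
      using m(2) assms(1) by (auto intro: exec.WhileFalse simp del: One_nat_def)
    from exec.Seq[OF m(1) this] show "\<exists>t s'. exec W \<omega> (ccomp (CWh e c)) s t s' \<and> t \<le> tm ?\<sigma> - tm \<sigma> \<and> absr s' (tm ?\<sigma>) = ?\<sigma>"
      using a by (intro exI[of _ "etime e + 1"] exI[of _ "s\<lparr>mem := m\<rparr>"]) auto
  qed
  then show "\<exists>\<sigma>'. hx (CWh e c) \<sigma> \<sigma>' \<and> valok U \<sigma>' \<and> Q \<sigma>'" using assms v by (intro exI[of _ ?\<sigma>]) auto
qed

lemma wp_while_true: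
  assumes "eval e \<sigma> \<noteq> 0" "wp c (wp (CWh e c) Q) (\<sigma>\<lparr>tm := tm \<sigma> + (etime e + 1)\<rparr>)"
  shows "wp (CWh e c) Q \<sigma>"
  unfolding wp_def
proof
  assume v: "valok U \<sigma>"
  let ?\<sigma> = "\<sigma>\<lparr>tm := tm \<sigma> + (etime e + 1)\<rparr>"
  obtain \<sigma>1 where 1: "hx c ?\<sigma> \<sigma>1" "valok U \<sigma>1" "wp (CWh e c) Q \<sigma>1"
    using assms(2) v unfolding wp_def by auto
  then obtain \<sigma>2 where 2: "hx (CWh e c) \<sigma>1 \<sigma>2" "valok U \<sigma>2" "Q \<sigma>2" unfolding wp_def by blast
  have "hx (CWh e c) \<sigma> \<sigma>2"
    unfolding hx_def
  proof (intro impI conjI allI)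
    assume c: "cok (CWh e c)"
    then have e: "eshape e" "ebd U e < W" and "cok c" by (auto simp: cok_def)
    note h = 1(1)[unfolded hx_def, rule_format, OF \<open>cok c\<close>] 2(1)[unfolded hx_def, rule_format, OF c]
    show "tm \<sigma> \<le> tm \<sigma>2" using h by simp
    fix s assume s: "absr s (tm \<sigma>) = \<sigma>"
    obtain m where m: "exec W \<omega> (ecomp 0 e) s (etime e) (s\<lparr>mem := m\<rparr>)" "m 1 = eval e \<sigma>"
      "\<And>t. absr (s\<lparr>mem := m\<rparr>) t = absr s t"
      using ecomp_absr[OF e v s, of 0] by auto
    have a: "absr (s\<lparr>mem := m\<rparr>) (tm ?\<sigma>) = ?\<sigma>" unfolding m(3) using absr_tm[OF s] by simp
    then obtain t1 s1 where e1: "exec W \<omega> (ccomp c) (s\<lparr>mem := m\<rparr>) t1 s1" "t1 \<le> tm \<sigma>1 - tm ?\<sigma>" "absr s1 (tm \<sigma>1) = \<sigma>1"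
      using h(1) by blast
    then obtain t2 s2 where e2: "exec W \<omega> (ccomp (CWh e c)) s1 t2 s2" "t2 \<le> tm \<sigma>2 - tm \<sigma>1" "absr s2 (tm \<sigma>2) = \<sigma>2"
      using h(2) by blast
    \<comment> \<open>The run of the remaining compiled loop starts with an evaluation of the guard.
      Split off, this evaluation becomes the end of the first round.\<close>
    from e2(1) obtain t3 s3 t4 where e3: "exec W \<omega> (ecomp 0 e) s1 t3 s3"
      "exec W \<omega> (WhileNZ 1 (Seq (ccomp c) (ecomp 0 e))) s3 t4 s2" "t2 = t3 + t4"
      by (auto elim: exec.cases)
    have "exec W \<omega> (WhileNZ 1 (Seq (ccomp c) (ecomp 0 e))) (s\<lparr>mem := m\<rparr>) (Suc (t1 + t3 + t4)) s2"
      using m(2) assms(1) exec.WhileTrue[of "s\<lparr>mem := m\<rparr>" 1 W \<omega>, OF _ exec.Seq[OF e1(1) e3(1)] e3(2)] by simp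
    from exec.Seq[OF m(1) this] show "\<exists>t s'. exec W \<omega> (ccomp (CWh e c)) s t s' \<and> t \<le> tm \<sigma>2 - tm \<sigma> \<and> absr s' (tm \<sigma>2) = \<sigma>2"
      using e1 e2 e3 h by (intro exI[of _ "etime e + Suc (t1 + t3 + t4)"] exI[of _ s2]) auto
  qed
  then show "\<exists>\<sigma>'. hx (CWh e c) \<sigma> \<sigma>' \<and> valok U \<sigma>' \<and> Q \<sigma>'" using 2 by blast
qed


end

section \<open>Counting loops\<close>

definition CFor :: "nat \<Rightarrow> expr \<Rightarrow> cmd \<Rightarrow> cmd" where
  "CFor v e c = CAsg v (EC 0) ;; CWh (EV v [<] e) (c ;; CAsg v (EV v [+] EC 1))"

context hl
begin

text \<open>The clock increments are exact: 2 for the initialisation, \<open>etime e + 3\<close> for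
  a test of the guard, 4 for the increment. The bound \<open>e\<close> is evaluated anew in each
  round, hence the premise that the invariant fixes its value.\<close>

lemma wp_for:
  assumes I0: "I 0 (\<sigma>\<lparr>vr := (vr \<sigma>)(v := 0), tm := tm \<sigma> + 2\<rparr>)"
    and step: "\<And>i \<sigma>. i < m \<Longrightarrow> valok U \<sigma> \<Longrightarrow> I i \<sigma> \<Longrightarrow> vr \<sigma> v = i \<Longrightarrow>
      wp c (\<lambda>\<sigma>'. vr \<sigma>' v = i \<and> I (Suc i) (\<sigma>'\<lparr>vr := (vr \<sigma>')(v := Suc i), tm := tm \<sigma>' + 4\<rparr>))
        (\<sigma>\<lparr>tm := tm \<sigma> + (etime e + 3)\<rparr>)"
    and bnd: "\<And>i \<sigma>. I i \<sigma> \<Longrightarrow> vr \<sigma> v = i \<Longrightarrow> i \<le> m \<Longrightarrow> eval e \<sigma> = m"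
    and m: "m \<le> U"
    and post: "\<And>\<sigma>. I m \<sigma> \<Longrightarrow> vr \<sigma> v = m \<Longrightarrow> Q (\<sigma>\<lparr>tm := tm \<sigma> + (etime e + 3)\<rparr>)"
  shows "wp (CFor v e c) Q \<sigma>"
proof -
  have "wp (CWh (EV v [<] e) (c ;; CAsg v (EV v [+] EC 1))) Q \<sigma>" if "i \<le> m" "vr \<sigma> v = i" "I i \<sigma>" for i \<sigma>
    using that
  proof (induction "m - i" arbitrary: i \<sigma>)
    case 0
    then have "i = m" by simp
    with 0 bnd[of i \<sigma>] have "eval (EV v [<] e) \<sigma> = 0" by simp
    then show ?case using post[of \<sigma>] 0 \<open>i = m\<close> by (intro wp_while_false) (auto simp: numeral_eq_Suc)
  next
    case (Suc d)
    then have "i < m" by simp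
    have b: "eval e \<sigma> = m" using Suc bnd by simp
    show ?case
    proof (rule wp_valok, rule wp_while_true)
      assume "valok U \<sigma>"
      show "eval (EV v [<] e) \<sigma> \<noteq> 0" using b Suc.prems \<open>i < m\<close> by simp
      have "wp c (\<lambda>\<sigma>'. vr \<sigma>' v = i \<and> I (Suc i) (\<sigma>'\<lparr>vr := (vr \<sigma>')(v := Suc i), tm := tm \<sigma>' + 4\<rparr>))
        (\<sigma>\<lparr>tm := tm \<sigma> + (etime e + 3)\<rparr>)" using step Suc \<open>i < m\<close> \<open>valok U \<sigma>\<close> by simp
      then have *: "wp c (wp (CAsg v (EV v [+] EC 1)) (wp (CWh (EV v [<] e) (c ;; CAsg v (EV v [+] EC 1))) Q))
        (\<sigma>\<lparr>tm := tm \<sigma> + (etime e + 3)\<rparr>)"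
      proof (rule wp_mono, intro wp_asg)
        fix \<sigma>' assume "valok U \<sigma>'" and a: "vr \<sigma>' v = i \<and> I (Suc i) (\<sigma>'\<lparr>vr := (vr \<sigma>')(v := Suc i), tm := tm \<sigma>' + 4\<rparr>)"
        then show "eval (EV v [+] EC 1) \<sigma>' \<le> U" using m \<open>i < m\<close> by simp
        show "wp (CWh (EV v [<] e) (c ;; CAsg v (EV v [+] EC 1))) Q
          (\<sigma>'\<lparr>vr := (vr \<sigma>')(v := eval (EV v [+] EC 1) \<sigma>'), tm := tm \<sigma>' + (etime (EV v [+] EC 1) + 1)\<rparr>)"
          using Suc.hyps(2) \<open>i < m\<close> a by (intro Suc.hyps(1)[of "Suc i"]) (auto simp: numeral_eq_Suc)
      qed
      show "wp (c ;; CAsg v (EV v [+] EC 1)) (wp (CWh (EV v [<] e) (c ;; CAsg v (EV v [+] EC 1))) Q)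
        (\<sigma>\<lparr>tm := tm \<sigma> + (etime (EV v [<] e) + 1)\<rparr>)"
        using wp_seq[OF *] by (simp add: numeral_eq_Suc)
    qed
  qed
  from this[of 0 "\<sigma>\<lparr>vr := (vr \<sigma>)(v := 0), tm := tm \<sigma> + 2\<rparr>"] I0
  show ?thesis unfolding CFor_def by (intro wp_seq wp_asg) auto
qed

end

section \<open>Executions and sessions\<close>

inductive_cases exec_elims:
  "exec W \<omega> Skip s t s'" "exec W \<omega> (Const i k) s t s'" "exec W \<omega> (Op f i j k) s t s'"
  "exec W \<omega> (Load i j) s t s'" "exec W \<omega> (Store i j) s t s'" "exec W \<omega> (Read i) s t s'"
  "exec W \<omega> (Write i) s t s'" "exec W \<omega> (Flip i) s t s'" "exec W \<omega> (Seq c d) s t s'"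
  "exec W \<omega> (IfNZ i c d) s t s'"

inductive_cases session_NilE: "session W \<omega> c s [] t yss"
inductive_cases session_ConsE: "session W \<omega> c s (x # xss) t yss"

inductive_cases exec_whileE: "exec W \<omega> (WhileNZ i c) s t s'"

lemma exec_det: "exec W \<omega> c s t s' \<Longrightarrow> exec W \<omega> c s t2 s2 \<Longrightarrow> t2 = t \<and> s2 = s'"
proof (induction arbitrary: t2 s2 rule: exec.induct)
  case (Seq c1 s t1 s1 c2 t2 s2)
  then show ?case by (blast elim: exec_elims)
next
  case (WhileTrue s i c t1 s1 t2a s2a)
  from WhileTrue.prems show ?case
  proof (rule exec_whileE)
    fix t1' s1' t2'
    assume "t2 = Suc (t1' + t2')" and e: "exec W \<omega> c s t1' s1'" "exec W \<omega> (WhileNZ i c) s1' t2' s2"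
    moreover from WhileTrue.IH(1)[OF e(1)] have "t1' = t1" "s1' = s1" by simp_all
    ultimately show ?thesis using WhileTrue.IH(2)[of t2' s2] by simp
  qed (use WhileTrue.hyps in simp)
next
  case (WhileFalse s i c)
  from WhileFalse.prems show ?case by (rule exec_whileE) (use WhileFalse in auto)
next
  case (IfTrue s i c1 t s1 c2)
  from IfTrue.prems show ?case by (rule exec_elims) (use IfTrue.hyps in \<open>auto dest: IfTrue.IH\<close>)
next
  case (IfFalse s i c2 t s1 c1)
  from IfFalse.prems show ?case by (rule exec_elims) (use IfFalse.hyps in \<open>auto dest: IfFalse.IH\<close>)
qed (erule exec_elims; simp)+

text \<open>A flip costs a step, so every time bound is also a bound on the coins consumed. This is
  what allows coins to be drawn in advance.\<close>

lemma exec_coin: "exec W \<omega> c s t s' \<Longrightarrow> coin_pos s \<le> coin_pos s' \<and> coin_pos s' \<le> coin_pos s + t"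
  by (induction rule: exec.induct) auto

lemma exec_mem: "exec W \<omega> c s t s' \<Longrightarrow> (\<And>a. mem s a < W) \<Longrightarrow> mem s' a < W"
  by (induction arbitrary: a rule: exec.induct) auto

text \<open>A run sees the tape only below its final coin position. It serves twice: to pass between
  truncated and full tapes, and to show that events about runs are measurable.\<close>

lemma exec_tape:
  "exec W \<omega> c s t s' \<Longrightarrow> (\<And>i. i < coin_pos s' \<Longrightarrow> \<omega>' i = \<omega> i) \<Longrightarrow> exec W \<omega>' c s t s'"
proof (induction rule: exec.induct)
  case (Seq c1 s t1 s1 c2 t2 s2)
  then show ?case using exec_coin[OF Seq.hyps(2)] by (intro exec.Seq) auto
next
  case (WhileTrue s i c t1 s1 t2 s2)
  then show ?case using exec_coin[OF WhileTrue.hyps(3)] by (intro exec.WhileTrue) auto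
qed (auto intro: exec.intros simp del: One_nat_def)

text \<open>Execution is deterministic, so the state after a list of requests can be named by a
  function and need not be carried as an existential witness.\<close>

definition step_fn :: "nat \<Rightarrow> (nat \<Rightarrow> bool) \<Rightarrow> com \<Rightarrow> ram \<Rightarrow> nat list \<Rightarrow> ram" where
  "step_fn W \<omega> c s x = (SOME s'. \<exists>t. exec W \<omega> c (s\<lparr>inp := x, outp := []\<rparr>) t s')"

lemma step_fn_eq: "exec W \<omega> c (s\<lparr>inp := x, outp := []\<rparr>) t s' \<Longrightarrow> step_fn W \<omega> c s x = s'"
  unfolding step_fn_def by (rule some_equality) (auto dest: exec_det)

definition fin :: "nat \<Rightarrow> (nat \<Rightarrow> bool) \<Rightarrow> com \<Rightarrow> ram \<Rightarrow> nat list list \<Rightarrow> ram" where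
  "fin W \<omega> c = foldl (step_fn W \<omega> c)"

lemma session_det: "session W \<omega> c s xss t yss \<Longrightarrow> session W \<omega> c s xss t2 yss2 \<Longrightarrow> t2 = t \<and> yss2 = yss"
proof (induction arbitrary: t2 yss2 rule: session.induct)
  case (Cons xs s t s1 xss t' yss)
  from Cons.prems show ?case
  proof (cases rule: session.cases)
    case (Cons t1 s1' t1' yss')
    with exec_det[OF \<open>exec W \<omega> c _ t s1\<close> Cons(3)] Cons.IH[of t1' yss'] show ?thesis by simp
  qed
next
  case (Nil s)
  then show ?case by (cases rule: session.cases) auto
qed

text \<open>Sessions grow at the front, whereas the reduction extends an insertion sequence at its
  end.\<close>

lemma session_snocD:
  "session W \<omega> c s (xss @ [x]) t yss \<Longrightarrow> \<exists>t1 y1 t2. session W \<omega> c s xss t1 y1 \<and>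
     exec W \<omega> c ((fin W \<omega> c s xss)\<lparr>inp := x, outp := []\<rparr>) t2 (fin W \<omega> c s (xss @ [x])) \<and>
     t = t1 + t2 \<and> yss = y1 @ [outp (fin W \<omega> c s (xss @ [x]))]"
proof (induction xss arbitrary: s t yss)
  case Nil
  then obtain t1 s1 where s: "exec W \<omega> c (s\<lparr>inp := x, outp := []\<rparr>) t1 s1" "t = t1" "yss = [outp s1]"
    by (auto elim!: session_ConsE session_NilE)
  with step_fn_eq[OF s(1)] show ?case
    by (intro exI[of _ 0] exI[of _ "[]"] exI[of _ t]) (auto simp: fin_def intro: session.Nil)
next
  case (Cons z xss)
  then obtain t1 s1 t' yss' where s: "exec W \<omega> c (s\<lparr>inp := z, outp := []\<rparr>) t1 s1"
    "session W \<omega> c s1 (xss @ [x]) t' yss'" "t = t1 + t'" "yss = outp s1 # yss'"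
    by (auto elim: session_ConsE)
  have f: "fin W \<omega> c s (z # l) = fin W \<omega> c s1 l" for l
    using step_fn_eq[OF s(1)] by (simp add: fin_def)
  from Cons.IH[OF s(2)] obtain t2 y1 t3 where
    "session W \<omega> c s1 xss t2 y1"
    "exec W \<omega> c ((fin W \<omega> c s1 xss)\<lparr>inp := x, outp := []\<rparr>) t3 (fin W \<omega> c s1 (xss @ [x]))"
    "t' = t2 + t3" "yss' = y1 @ [outp (fin W \<omega> c s1 (xss @ [x]))]" by blast
  with s show ?case
    by (intro exI[of _ "t1 + t2"] exI[of _ "outp s1 # y1"] exI[of _ t3])
      (auto simp: f intro: session.Cons)
qed

lemma session_coin:
  "session W \<omega> c s xss t yss \<Longrightarrow>
     coin_pos s \<le> coin_pos (fin W \<omega> c s xss) \<and> coin_pos (fin W \<omega> c s xss) \<le> coin_pos s + t"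
proof (induction rule: session.induct)
  case (Cons xs s t s1 xss t' yss)
  then show ?case using exec_coin[OF Cons.hyps(1)] step_fn_eq[OF Cons.hyps(1)] by (simp add: fin_def)
qed (simp add: fin_def)

lemma session_tape:
  "session W \<omega> c s xss t yss \<Longrightarrow> (\<And>i. i < coin_pos (fin W \<omega> c s xss) \<Longrightarrow> \<omega>' i = \<omega> i) \<Longrightarrow>
     session W \<omega>' c s xss t yss"
proof (induction rule: session.induct)
  case (Cons xs s t s1 xss t' yss)
  have f: "fin W \<omega> c s (xs # xss) = fin W \<omega> c s1 xss"
    using step_fn_eq[OF Cons.hyps(1)] by (simp add: fin_def)
  have "coin_pos s1 \<le> coin_pos (fin W \<omega> c s1 xss)" using session_coin[OF Cons.hyps(2)] by simp
  then show ?case using Cons f by (intro session.Cons exec_tape[OF Cons.hyps(1)]) auto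
qed (rule session.Nil)

section \<open>Simulating a program in versioned memory\<close>

text \<open>A cell of the simulated memory is looked up in the current area if it carries the current
  version, and in the snapshot area otherwise. Hence increasing the version undoes all writes.
  Variables: 4, 5 the number of prefetched coins and of copies, 8, 9 the bases of the current and
  of the snapshot area, 10 the version, 11 the number of the copy, 12 the input pointer, 15 the
  flag for exhausted coins; arrays: 3 coins, 4 memory contents, 5 versions, 8 input.
  The simulated cells 0, 1, 2 hold the coin position, the last output and the mark of a
  copy known to have erred; cell \<open>a\<close> of the program is cell \<open>a + 3\<close>.\<close>

definition vmem :: "(nat \<Rightarrow> nat \<Rightarrow> nat) \<Rightarrow> nat \<Rightarrow> nat \<Rightarrow> nat \<Rightarrow> nat \<Rightarrow> nat" where
  "vmem A B SB V a = (if A 5 (B + a) = V then A 4 (B + a) else A 4 (SB + a))"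

abbreviation vm :: "hst \<Rightarrow> nat \<Rightarrow> nat" where
  "vm \<sigma> \<equiv> vmem (ar \<sigma>) (vr \<sigma> 8) (vr \<sigma> 9) (vr \<sigma> 10)"

definition READ_CELL :: "expr \<Rightarrow> expr" where
  "READ_CELL e = ((EA 5 (EV 8 [+] e) [=] EV 10) [*] EA 4 (EV 8 [+] e)) [+]
     ((EC 1 [-] (EA 5 (EV 8 [+] e) [=] EV 10)) [*] EA 4 (EV 9 [+] e))"

definition WRITE_CELL :: "expr \<Rightarrow> expr \<Rightarrow> cmd" where
  "WRITE_CELL e f = CStr 4 (EV 8 [+] e) f ;; CStr 5 (EV 8 [+] e) (EV 10)"

lemma eval_READ_CELL [simp]: "eval (READ_CELL e) \<sigma> = vm \<sigma> (eval e \<sigma>)"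
  by (simp add: READ_CELL_def vmem_def)

lemma etime_READ_CELL [simp]: "etime (READ_CELL e) = 4 * etime e + 37"
  by (simp add: READ_CELL_def)

text \<open>Only the last word written is kept, since the expected answer to an update is a single
  word. The tapes of the copies are interleaved: coin \<open>p\<close> of copy \<open>r\<close> has
  index \<open>p * R + r\<close>. The stored coin position stops at \<open>L\<close>, so it always
  fits into a word.\<close>

fun tr :: "com \<Rightarrow> cmd" where
  "tr Skip = CSkip"
| "tr (Const i k) = WRITE_CELL (EC (i + 3)) (EC k)"
| "tr (Op f i j k) = CAsg 13 (READ_CELL (EC (j + 3))) ;; CAsg 14 (READ_CELL (EC (k + 3))) ;; CBop f 13 13 14 ;;
     WRITE_CELL (EC (i + 3)) (EV 13)"
| "tr (Load i j) = CAsg 13 (READ_CELL (READ_CELL (EC (j + 3)) [+] EC 3)) ;; WRITE_CELL (EC (i + 3)) (EV 13)"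
| "tr (Store i j) = CAsg 14 (READ_CELL (EC (j + 3))) ;; CAsg 13 (READ_CELL (EC (i + 3)) [+] EC 3) ;; WRITE_CELL (EV 13) (EV 14)"
| "tr (Read i) = WRITE_CELL (EC (i + 3)) (EA 8 (EV 12)) ;; CAsg 12 (EV 12 [+] EC 1)"
| "tr (Write i) = WRITE_CELL (EC 1) (READ_CELL (EC (i + 3)))"
| "tr (Flip i) = CAsg 13 (READ_CELL (EC 0)) ;; CIf (EV 13 [<] EV 4)
     (WRITE_CELL (EC (i + 3)) (EA 3 (EV 13 [*] EV 5 [+] EV 11)) ;; WRITE_CELL (EC 0) (EV 13 [+] EC 1))
     (CAsg 15 (EC 1) ;; WRITE_CELL (EC (i + 3)) (EC 0))"
| "tr (Seq c d) = tr c ;; tr d"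
| "tr (IfNZ i c d) = CIf (READ_CELL (EC (i + 3))) (tr c) (tr d)"
| "tr (WhileNZ i c) = CWh (READ_CELL (EC (i + 3))) (tr c)"

lemma eshape_READ_CELL [simp]: "eshape e \<Longrightarrow> eshape (READ_CELL e)"
  by (simp add: READ_CELL_def)

lemma cshape_tr: "cshape (tr c)"
  by (induction c) (auto simp: WRITE_CELL_def)

text \<open>Exceeds every address that the program names literally. Indirect addresses are words of
  the simulated machine, so an area of \<open>S0\<close> cells with \<open>WN \<le> S0\<close> and
  \<open>rbnd c \<le> S0\<close> contains everything that the program can touch.\<close>

fun rbnd :: "com \<Rightarrow> nat" where
  "rbnd Skip = 0"
| "rbnd (Const i k) = Suc i"
| "rbnd (Op f i j k) = Suc i + Suc j + Suc k"
| "rbnd (Load i j) = Suc i + Suc j"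
| "rbnd (Store i j) = Suc i + Suc j"
| "rbnd (Read i) = Suc i"
| "rbnd (Write i) = Suc i"
| "rbnd (Flip i) = Suc i"
| "rbnd (Seq c d) = rbnd c + rbnd d"
| "rbnd (IfNZ i c d) = Suc i + rbnd c + rbnd d"
| "rbnd (WhileNZ i c) = Suc i + rbnd c"

definition vupd :: "(nat \<Rightarrow> nat \<Rightarrow> nat) \<Rightarrow> nat \<Rightarrow> nat \<Rightarrow> nat \<Rightarrow> nat \<Rightarrow> nat \<Rightarrow> nat \<Rightarrow> nat" where
  "vupd A B V a x = A(4 := (A 4)(B + a := x), 5 := (A 5)(B + a := V))"

lemma vupd_other [simp]: "k \<noteq> 4 \<Longrightarrow> k \<noteq> 5 \<Longrightarrow> vupd A B V a x k = A k"
  by (simp add: vupd_def)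

text \<open>The case \<open>B = SB\<close> occurs in the preprocessing, which writes the snapshot
  area itself. Otherwise the disjointness of the two areas protects the snapshot.\<close>

lemma vmem_vupd:
  assumes "B = SB \<or> SB + S \<le> B" "a < S" "a' < S"
  shows "vmem (vupd A B V a x) B SB V a' = (if a' = a then x else vmem A B SB V a')"
  using assms by (auto simp: vmem_def vupd_def)

context hl
begin

lemma wp_WRITE_CELL:
  assumes "valok U \<sigma> \<Longrightarrow> eval f \<sigma> \<le> U"
    and "\<And>g. eval e (\<sigma>\<lparr>ar := g\<rparr>) = eval e \<sigma>"
    and "Q (\<sigma>\<lparr>ar := vupd (ar \<sigma>) (vr \<sigma> 8) (vr \<sigma> 10) (eval e \<sigma>) (eval f \<sigma>),
           tm := tm \<sigma> + (2 * etime e + etime f + 15)\<rparr>)"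
  shows "wp (WRITE_CELL e f) Q \<sigma>"
  unfolding WRITE_CELL_def
  by (intro wp_seq wp_str) (use assms in \<open>auto simp: valok_def vupd_def elim!: back_subst[of Q]\<close>)

end

section \<open>The simulation relation\<close>

locale sim = hl +
  fixes S0 WN L R :: nat
  assumes WN_S0: "WN \<le> S0" and S0_U: "S0 + 3 \<le> U" and L_U: "L \<le> U"
begin

text \<open>The coin counter is clipped at \<open>L\<close>; whether the simulated position went
  beyond is remembered by flag 15 only. Nothing is said about cell 1 while the output is empty, as
  it may still hold the answer to an earlier request.\<close>

definition simr :: "(nat \<Rightarrow> bool) \<Rightarrow> hst \<Rightarrow> ram \<Rightarrow> bool" where
  "simr tp \<sigma> s \<longleftrightarrow> vr \<sigma> 4 = L \<and> vr \<sigma> 5 = R \<and>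
     (vr \<sigma> 8 = vr \<sigma> 9 \<or> vr \<sigma> 9 + (S0 + 3) \<le> vr \<sigma> 8) \<and>
     (\<forall>p<L. ar \<sigma> 3 (p * R + vr \<sigma> 11) = of_bool (tp p)) \<and>
     (\<forall>a<S0. vm \<sigma> (a + 3) = mem s a) \<and> (\<forall>a. mem s a < WN) \<and>
     vm \<sigma> 0 = min (coin_pos s) L \<and> (L < coin_pos s \<longrightarrow> vr \<sigma> 15 \<noteq> 0) \<and>
     (\<forall>i<length (inp s). ar \<sigma> 8 (vr \<sigma> 12 + i) = inp s ! i) \<and> vr \<sigma> 12 + length (inp s) \<le> U \<and>
     (outp s \<noteq> [] \<longrightarrow> vm \<sigma> 1 = last (outp s))"

text \<open>Version entries change only to the current version, so they never exceed it and a larger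
  version makes all of them stale. Cell 2 survives because the cells of the simulated program start
  at 3.\<close>

definition sfr :: "hst \<Rightarrow> hst \<Rightarrow> ram \<Rightarrow> bool" where
  "sfr \<sigma> \<sigma>' s' \<longleftrightarrow> (\<forall>v. v \<notin> {12, 13, 14, 15} \<longrightarrow> vr \<sigma>' v = vr \<sigma> v) \<and>
     (\<forall>k. k \<notin> {4, 5} \<longrightarrow> ar \<sigma>' k = ar \<sigma> k) \<and>
     (\<forall>x. x < vr \<sigma> 8 \<or> vr \<sigma> 8 + (S0 + 3) \<le> x \<longrightarrow> ar \<sigma>' 4 x = ar \<sigma> 4 x \<and> ar \<sigma>' 5 x = ar \<sigma> 5 x) \<and>
     (\<forall>x. ar \<sigma>' 5 x = ar \<sigma> 5 x \<or> ar \<sigma>' 5 x = vr \<sigma> 10) \<and>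
     vm \<sigma>' 2 = vm \<sigma> 2 \<and> hin \<sigma>' = hin \<sigma> \<and> hout \<sigma>' = hout \<sigma> \<and> hpos \<sigma>' = hpos \<sigma> \<and>
     (vr \<sigma> 15 \<noteq> 0 \<longrightarrow> vr \<sigma>' 15 \<noteq> 0) \<and> (vr \<sigma>' 15 \<noteq> 0 \<longrightarrow> vr \<sigma> 15 \<noteq> 0 \<or> L < coin_pos s')"

lemma simr_tm [simp]: "simr tp (\<sigma>\<lparr>tm := t\<rparr>) s = simr tp \<sigma> s"
  by (simp add: simr_def)

lemma sfr_tm [simp]:
  "sfr (\<sigma>\<lparr>tm := t\<rparr>) \<sigma>' s' = sfr \<sigma> \<sigma>' s'" "sfr \<sigma> (\<sigma>'\<lparr>tm := t\<rparr>) s' = sfr \<sigma> \<sigma>' s'"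
  by (simp_all add: sfr_def)

lemma sfr_trans:
  assumes "sfr \<sigma> \<sigma>1 s1" "sfr \<sigma>1 \<sigma>2 s2" "coin_pos s1 \<le> coin_pos s2"
  shows "sfr \<sigma> \<sigma>2 s2"
  unfolding sfr_def
proof (intro conjI)
  have 8: "vr \<sigma>1 8 = vr \<sigma> 8" "vr \<sigma>1 10 = vr \<sigma> 10" using assms(1) by (auto simp: sfr_def)
  show "\<forall>x. ar \<sigma>2 5 x = ar \<sigma> 5 x \<or> ar \<sigma>2 5 x = vr \<sigma> 10"
    using assms(1,2) 8 unfolding sfr_def by metis
qed (use assms in \<open>auto simp: sfr_def\<close>)

lemma simr_vupd:
  assumes "simr tp \<sigma> s" "i < S0" "x < WN"
    and "\<And>v. v \<notin> {13, 14} \<Longrightarrow> vr \<sigma>1 v = vr \<sigma> v"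
    and "ar \<sigma>1 = vupd (ar \<sigma>) (vr \<sigma> 8) (vr \<sigma> 10) (i + 3) x"
    and "hin \<sigma>1 = hin \<sigma>" "hout \<sigma>1 = hout \<sigma>" "hpos \<sigma>1 = hpos \<sigma>"
  shows "simr tp \<sigma>1 (s\<lparr>mem := (mem s)(i := x)\<rparr>) \<and> sfr \<sigma> \<sigma>1 (s\<lparr>mem := (mem s)(i := x)\<rparr>)"
proof -
  have d: "vr \<sigma> 8 = vr \<sigma> 9 \<or> vr \<sigma> 9 + (S0 + 3) \<le> vr \<sigma> 8" using assms(1) by (simp add: simr_def)
  have vm: "vm \<sigma>1 a = (if a = i + 3 then x else vm \<sigma> a)" if "a < S0 + 3" for a
    using vmem_vupd[OF d _ that, of "i + 3" "ar \<sigma>" "vr \<sigma> 10" x] assms(2,4,5) by simp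
  show ?thesis
    unfolding simr_def sfr_def
  proof (intro conjI)
    show "\<forall>x. x < vr \<sigma> 8 \<or> vr \<sigma> 8 + (S0 + 3) \<le> x \<longrightarrow> ar \<sigma>1 4 x = ar \<sigma> 4 x \<and> ar \<sigma>1 5 x = ar \<sigma> 5 x"
      "\<forall>x. ar \<sigma>1 5 x = ar \<sigma> 5 x \<or> ar \<sigma>1 5 x = vr \<sigma> 10"
      using assms(2,5) by (auto simp: vupd_def)
  qed (use assms vm in \<open>auto simp: simr_def\<close>)
qed

text \<open>Coins from \<open>L\<close> on are tails on the simulated tape, so the simulation
  remains faithful when the prefetched coins are exhausted. The factor 600 generously covers the
  dearest instruction, the nested lookup of \<open>Load\<close>.\<close>

theorem wp_tr:
  assumes "exec WN tp c s t s'" "rbnd c \<le> S0" "simr tp \<sigma> s" "\<And>p. p \<ge> L \<Longrightarrow> \<not> tp p"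
  shows "wp (tr c) (\<lambda>\<sigma>'. simr tp \<sigma>' s' \<and> sfr \<sigma> \<sigma>' s' \<and> tm \<sigma>' \<le> tm \<sigma> + 600 * t) \<sigma>"
  using assms(1-3)
proof (induction arbitrary: \<sigma> rule: exec.induct)
  case (Skip s)
  then show ?case unfolding tr.simps by (intro wp_skip) (auto simp: simr_def sfr_def)
next
  case (Const k i s)
  have "k \<le> U" using Const WN_S0 S0_U by simp
  then show ?case unfolding tr.simps using Const
    by (intro wp_WRITE_CELL) (auto intro: simr_vupd[THEN conjunct1] simr_vupd[THEN conjunct2])
next
  case (Op x f s j k i)
  have m: "vm \<sigma> (j + 3) = mem s j" "vm \<sigma> (k + 3) = mem s k" "mem s j < WN" "mem s k < WN"
    using Op.prems by (auto simp: simr_def)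
  have "x \<le> U" "mem s j \<le> U" "mem s k \<le> U" using Op WN_S0 S0_U m(3,4) by (auto intro: less_imp_le order_less_le_trans)
  then show ?case unfolding tr.simps using Op m
    using simr_vupd[OF Op.prems(2), of i x "\<sigma>\<lparr>vr := (vr \<sigma>)(14 := mem s k, 13 := x),
      ar := vupd (ar \<sigma>) (vr \<sigma> 8) (vr \<sigma> 10) (i + 3) x, tm := 103 + tm \<sigma>\<rparr>"]
    by (intro wp_seq wp_asg wp_bop wp_WRITE_CELL) auto
next
  case (Load i j s)
  have 1: "vm \<sigma> (j + 3) = mem s j" "mem s j < WN" using Load.prems by (auto simp: simr_def)
  \<comment> \<open>An indirect address is a word below \<open>WN\<close>, hence inside the
    area.\<close>
  have 2: "vm \<sigma> (mem s j + 3) = mem s (mem s j)" "mem s (mem s j) < WN"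
    using Load.prems 1(2) order_less_le_trans[OF 1(2) WN_S0] unfolding simr_def by blast+
  have "mem s (mem s j) \<le> U" using WN_S0 S0_U 2 by auto
  then show ?case unfolding tr.simps using Load 1 2
    by (intro wp_seq wp_asg wp_WRITE_CELL) (auto intro: simr_vupd[THEN conjunct1] simr_vupd[THEN conjunct2])
next
  case (Store i j s)
  have m: "vm \<sigma> (j + 3) = mem s j" "vm \<sigma> (i + 3) = mem s i" "mem s j < WN" "mem s i < WN"
    using Store.prems by (auto simp: simr_def)
  have "mem s j \<le> U" "mem s i + 3 \<le> U" "mem s i < S0" using WN_S0 S0_U m by auto
  then show ?case unfolding tr.simps using Store m
    using simr_vupd[OF Store.prems(2), of "mem s i" "mem s j" "\<sigma>\<lparr>vr := (vr \<sigma>)(14 := mem s j, 13 := mem s i + 3),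
      ar := vupd (ar \<sigma>) (vr \<sigma> 8) (vr \<sigma> 10) (mem s i + 3) (mem s j), tm := 104 + tm \<sigma>\<rparr>"]
    by (intro wp_seq wp_asg wp_WRITE_CELL) auto
next
  case (Read s x xs i)
  let ?\<sigma> = "\<sigma>\<lparr>ar := vupd (ar \<sigma>) (vr \<sigma> 8) (vr \<sigma> 10) (i + 3) x\<rparr>"
  let ?s = "s\<lparr>mem := (mem s)(i := x)\<rparr>"
  have x: "x \<le> U" "ar \<sigma> 8 (vr \<sigma> 12) = x" "Suc (vr \<sigma> 12) + length xs \<le> U"
    using Read WN_S0 S0_U by (auto simp: simr_def)
  have i: "ar \<sigma> 8 (Suc (vr \<sigma> 12) + j) = xs ! j" if "j < length xs" for j
    using Read that unfolding simr_def by (metis add_Suc_shift length_Cons nth_Cons_Suc not_less_eq)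
  have *: "simr tp ?\<sigma> ?s \<and> sfr \<sigma> ?\<sigma> ?s" using Read by (intro simr_vupd) auto
  show ?case unfolding tr.simps
  proof (intro wp_seq wp_WRITE_CELL wp_asg conjI)
    let ?\<sigma>2 = "?\<sigma>\<lparr>vr := (vr \<sigma>)(12 := Suc (vr \<sigma> 12))\<rparr>"
    have "simr tp ?\<sigma>2 (?s\<lparr>inp := xs\<rparr>)" using * i x unfolding simr_def by simp
    then show "simr tp (\<sigma>\<lparr>ar := vupd (ar \<sigma>) (vr \<sigma> 8) (vr \<sigma> 10) (eval (EC (i + 3)) \<sigma>) (eval (EA 8 (EV 12)) \<sigma>),
      tm := tm \<sigma> + (2 * etime (EC (i + 3)) + etime (EA 8 (EV 12)) + 15),
      vr := (vr (\<sigma>\<lparr>ar := vupd (ar \<sigma>) (vr \<sigma> 8) (vr \<sigma> 10) (eval (EC (i + 3)) \<sigma>) (eval (EA 8 (EV 12)) \<sigma>),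
                  tm := tm \<sigma> + (2 * etime (EC (i + 3)) + etime (EA 8 (EV 12)) + 15)\<rparr>))
         (12 := eval (EV 12 [+] EC 1)
                   (\<sigma>\<lparr>ar := vupd (ar \<sigma>) (vr \<sigma> 8) (vr \<sigma> 10) (eval (EC (i + 3)) \<sigma>) (eval (EA 8 (EV 12)) \<sigma>),
                     tm := tm \<sigma> + (2 * etime (EC (i + 3)) + etime (EA 8 (EV 12)) + 15)\<rparr>)),
      tm := tm (\<sigma>\<lparr>ar := vupd (ar \<sigma>) (vr \<sigma> 8) (vr \<sigma> 10) (eval (EC (i + 3)) \<sigma>) (eval (EA 8 (EV 12)) \<sigma>),
                  tm := tm \<sigma> + (2 * etime (EC (i + 3)) + etime (EA 8 (EV 12)) + 15)\<rparr>) +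
            (etime (EV 12 [+] EC 1) + 1)\<rparr>) (s\<lparr>mem := (mem s)(i := x), inp := xs\<rparr>)"
      using x(2) by (simp add: simr_def)
  qed (use x * in \<open>auto simp: sfr_def\<close>)
next
  case (Write i s)
  have m: "vm \<sigma> (i + 3) = mem s i" "mem s i < WN" using Write.prems by (auto simp: simr_def)
  have d: "vr \<sigma> 8 = vr \<sigma> 9 \<or> vr \<sigma> 9 + (S0 + 3) \<le> vr \<sigma> 8" using Write.prems by (simp add: simr_def)
  have vm: "vmem (vupd (ar \<sigma>) (vr \<sigma> 8) (vr \<sigma> 10) 1 x) (vr \<sigma> 8) (vr \<sigma> 9) (vr \<sigma> 10) a = (if a = 1 then x else vm \<sigma> a)"
    if "a < S0 + 3" for a x
    using vmem_vupd[OF d _ that, of 1] by simp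
  have "mem s i \<le> U" using m WN_S0 S0_U by simp
  show ?case unfolding tr.simps
  proof (intro wp_WRITE_CELL conjI)
    let ?\<sigma> = "\<sigma>\<lparr>ar := vupd (ar \<sigma>) (vr \<sigma> 8) (vr \<sigma> 10) 1 (mem s i)\<rparr>"
    let ?s = "s\<lparr>outp := outp s @ [mem s i]\<rparr>"
    have 1: "simr tp ?\<sigma> ?s" using Write.prems vm unfolding simr_def by simp
    have "vm ?\<sigma> 2 = vm \<sigma> 2" using vm by simp
    then have 2: "sfr \<sigma> ?\<sigma> ?s" unfolding sfr_def by (auto simp: vupd_def)
    show "simr tp (\<sigma>\<lparr>ar := vupd (ar \<sigma>) (vr \<sigma> 8) (vr \<sigma> 10) (eval (EC 1) \<sigma>) (eval (READ_CELL (EC (i + 3))) \<sigma>),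
           tm := tm \<sigma> + (2 * etime (EC 1) + etime (READ_CELL (EC (i + 3))) + 15)\<rparr>) ?s"
      using 1 m by (simp add: simr_def)
    show "sfr \<sigma> (\<sigma>\<lparr>ar := vupd (ar \<sigma>) (vr \<sigma> 8) (vr \<sigma> 10) (eval (EC 1) \<sigma>) (eval (READ_CELL (EC (i + 3))) \<sigma>),
           tm := tm \<sigma> + (2 * etime (EC 1) + etime (READ_CELL (EC (i + 3))) + 15)\<rparr>) ?s"
      using 2 m by (simp add: sfr_def)
  qed (use m \<open>mem s i \<le> U\<close> in auto)
next
  case (Flip x s i)
  have d: "vr \<sigma> 8 = vr \<sigma> 9 \<or> vr \<sigma> 9 + (S0 + 3) \<le> vr \<sigma> 8" and c: "vm \<sigma> 0 = min (coin_pos s) L"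
    and p: "vr \<sigma> 4 = L" "vr \<sigma> 5 = R" "\<And>p. p < L \<Longrightarrow> ar \<sigma> 3 (p * R + vr \<sigma> 11) = of_bool (tp p)"
    using Flip.prems by (simp_all add: simr_def)
  have vm: "vmem (vupd A (vr \<sigma> 8) (vr \<sigma> 10) b x) (vr \<sigma> 8) (vr \<sigma> 9) (vr \<sigma> 10) a =
      (if a = b then x else vmem A (vr \<sigma> 8) (vr \<sigma> 9) (vr \<sigma> 10) a)"
    if "a < S0 + 3" "b < S0 + 3" for A a b x
    using vmem_vupd[OF d that(2,1)] by simp
  have i: "i < S0" using Flip.prems by simp
  show ?case unfolding tr.simps
  proof (rule wp_seq, rule wp_asg, use c L_U in simp, rule wp_if)
    let ?\<tau> = "\<sigma>\<lparr>vr := (vr \<sigma>)(13 := eval (READ_CELL (EC 0)) \<sigma>), tm := tm \<sigma> + (etime (READ_CELL (EC 0)) + 1)\<rparr>"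
    assume "eval (EV 13 [<] EV 4) ?\<tau> \<noteq> 0"
    then have cl: "coin_pos s < L" using c p by (auto simp: min_def split: if_splits)
    then have x: "ar \<sigma> 3 (coin_pos s * R + vr \<sigma> 11) = x" "x \<le> U" using p Flip U_pos by auto
    let ?A = "vupd (vupd (ar \<sigma>) (vr \<sigma> 8) (vr \<sigma> 10) (i + 3) x) (vr \<sigma> 8) (vr \<sigma> 10) 0 (Suc (coin_pos s))"
    let ?\<sigma> = "\<sigma>\<lparr>vr := (vr \<sigma>)(13 := coin_pos s), ar := ?A\<rparr>"
    let ?s = "s\<lparr>mem := (mem s)(i := x), coin_pos := Suc (coin_pos s)\<rparr>"
    have 1: "simr tp ?\<sigma> ?s" using Flip vm i cl unfolding simr_def by simp
    have "vm ?\<sigma> 2 = vm \<sigma> 2" using vm i by simp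
    then have 2: "sfr \<sigma> ?\<sigma> ?s" using i unfolding sfr_def by (auto simp: vupd_def)
    show "wp (WRITE_CELL (EC (i + 3)) (EA 3 (EV 13 [*] EV 5 [+] EV 11)) ;; WRITE_CELL (EC 0) (EV 13 [+] EC 1))
      (\<lambda>\<sigma>'. simr tp \<sigma>' ?s \<and> sfr \<sigma> \<sigma>' ?s \<and> tm \<sigma>' \<le> tm \<sigma> + 600 * 1)
      (?\<tau>\<lparr>tm := tm ?\<tau> + (etime (EV 13 [<] EV 4) + 1)\<rparr>)"
      using cl c p x L_U by (intro wp_seq wp_WRITE_CELL) (simp_all add: 1 2 min_def)
  next
    let ?\<tau> = "\<sigma>\<lparr>vr := (vr \<sigma>)(13 := eval (READ_CELL (EC 0)) \<sigma>), tm := tm \<sigma> + (etime (READ_CELL (EC 0)) + 1)\<rparr>"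
    assume "eval (EV 13 [<] EV 4) ?\<tau> = 0"
    then have cl: "coin_pos s \<ge> L" using c p by (auto simp: min_def split: if_splits)
    \<comment> \<open>The tape is constantly tails from \<open>L\<close> on, so writing 0 agrees
      with the simulated flip.\<close>
    then have x: "x = 0" "x \<le> U" using assms(4) Flip U_pos by auto
    let ?A = "vupd (ar \<sigma>) (vr \<sigma> 8) (vr \<sigma> 10) (i + 3) 0"
    let ?\<sigma> = "\<sigma>\<lparr>vr := (vr \<sigma>)(13 := L, 15 := 1), ar := ?A\<rparr>"
    let ?s = "s\<lparr>mem := (mem s)(i := x), coin_pos := Suc (coin_pos s)\<rparr>"
    have 1: "simr tp ?\<sigma> ?s" using Flip vm i cl x unfolding simr_def by (simp add: min_def)
    have "vm ?\<sigma> 2 = vm \<sigma> 2" using vm i by simp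
    then have 2: "sfr \<sigma> ?\<sigma> ?s" using i cl unfolding sfr_def by (auto simp: vupd_def)
    show "wp (CAsg 15 (EC 1) ;; WRITE_CELL (EC (i + 3)) (EC 0))
      (\<lambda>\<sigma>'. simr tp \<sigma>' ?s \<and> sfr \<sigma> \<sigma>' ?s \<and> tm \<sigma>' \<le> tm \<sigma> + 600 * 1)
      (?\<tau>\<lparr>tm := tm ?\<tau> + (etime (EV 13 [<] EV 4) + 1)\<rparr>)"
      using cl c p U_pos by (intro wp_seq wp_asg wp_WRITE_CELL) (simp_all add: 1[unfolded x(1) One_nat_def] 2[unfolded x(1) One_nat_def] min.absorb2 x(1))
  qed
next
  case (Seq c1 s t1 s1 c2 t2 s2)
  show ?case unfolding tr.simps
  proof (rule wp_seq, rule wp_mono[OF Seq.IH(1)])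
    fix \<sigma>1 assume 1: "simr tp \<sigma>1 s1 \<and> sfr \<sigma> \<sigma>1 s1 \<and> tm \<sigma>1 \<le> tm \<sigma> + 600 * t1"
    show "wp (tr c2) (\<lambda>\<sigma>'. simr tp \<sigma>' s2 \<and> sfr \<sigma> \<sigma>' s2 \<and> tm \<sigma>' \<le> tm \<sigma> + 600 * (t1 + t2)) \<sigma>1"
      by (rule wp_mono[OF Seq.IH(2)])
        (use Seq.prems 1 exec_coin[OF Seq.hyps(2)] sfr_trans in auto)
  qed (use Seq.prems in auto)
next
  case (IfTrue s i c1 t s1 c2)
  let ?\<sigma> = "\<sigma>\<lparr>tm := tm \<sigma> + (etime (READ_CELL (EC (i + 3))) + 1)\<rparr>"
  have m: "vm \<sigma> (i + 3) = mem s i" using IfTrue.prems by (auto simp: simr_def)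
  have "simr tp ?\<sigma> s" using IfTrue.prems by (simp add: simr_def)
  then have "wp (tr c1) (\<lambda>\<sigma>'. simr tp \<sigma>' s1 \<and> sfr ?\<sigma> \<sigma>' s1 \<and> tm \<sigma>' \<le> tm ?\<sigma> + 600 * t) ?\<sigma>"
    using IfTrue.IH[of ?\<sigma>] IfTrue.prems by (simp del: eval_READ_CELL etime_READ_CELL)
  then show ?case unfolding tr.simps using m IfTrue.hyps
    by (intro wp_if) (auto elim!: wp_mono)
next
  case (IfFalse s i c2 t s1 c1)
  let ?\<sigma> = "\<sigma>\<lparr>tm := tm \<sigma> + (etime (READ_CELL (EC (i + 3))) + 1)\<rparr>"
  have m: "vm \<sigma> (i + 3) = mem s i" using IfFalse.prems by (auto simp: simr_def)
  have "simr tp ?\<sigma> s" using IfFalse.prems by (simp add: simr_def)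
  then have "wp (tr c2) (\<lambda>\<sigma>'. simr tp \<sigma>' s1 \<and> sfr ?\<sigma> \<sigma>' s1 \<and> tm \<sigma>' \<le> tm ?\<sigma> + 600 * t) ?\<sigma>"
    using IfFalse.IH[of ?\<sigma>] IfFalse.prems by (simp del: eval_READ_CELL etime_READ_CELL)
  then show ?case unfolding tr.simps using m IfFalse.hyps
    by (intro wp_if) (auto elim!: wp_mono)
next
  case (WhileTrue s i c t1 s1 t2 s2)
  let ?\<sigma> = "\<sigma>\<lparr>tm := tm \<sigma> + (etime (READ_CELL (EC (i + 3))) + 1)\<rparr>"
  have m: "vm \<sigma> (i + 3) = mem s i" using WhileTrue.prems by (auto simp: simr_def)
  have s: "simr tp ?\<sigma> s" using WhileTrue.prems by (simp add: simr_def)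
  show ?case unfolding tr.simps
  proof (rule wp_while_true, use m WhileTrue.hyps in simp, rule wp_mono[OF WhileTrue.IH(1)[OF _ s]])
    fix \<sigma>1 assume 1: "simr tp \<sigma>1 s1 \<and> sfr ?\<sigma> \<sigma>1 s1 \<and> tm \<sigma>1 \<le> tm ?\<sigma> + 600 * t1"
    then have 2: "sfr \<sigma> \<sigma>1 s1" by simp
    show "wp (CWh (READ_CELL (EC (i + 3))) (tr c)) (\<lambda>\<sigma>'. simr tp \<sigma>' s2 \<and> sfr \<sigma> \<sigma>' s2 \<and>
        tm \<sigma>' \<le> tm \<sigma> + 600 * Suc (t1 + t2)) \<sigma>1"
      by (rule wp_mono[OF WhileTrue.IH(2)[unfolded tr.simps]])
        (use WhileTrue.prems 1 2 exec_coin[OF WhileTrue.hyps(3)] sfr_trans in auto)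
  qed (use WhileTrue.prems in auto)
next
  case (WhileFalse s i c)
  have m: "vm \<sigma> (i + 3) = mem s i" using WhileFalse.prems by (auto simp: simr_def)
  show ?case unfolding tr.simps
    by (intro wp_while_false) (use m WhileFalse in \<open>auto simp: simr_def sfr_def\<close>)
qed

end

section \<open>Inserting edges and brute force search\<close>

text \<open>Further variables: 0 \<open>n\<close>, 2 block side \<open>b\<close>, 3 stride of an area, 6 number of block rows,
  7 padded dimension, 16, 17 block row and column, 18 block, 19 query vertex, 20 flag for new rows,
  21, 22 loop counters. Further arrays: 0 matrix, 1 vector, 2 result, 6 versions of the blocks,
  7 next query vertices of the blocks.\<close>

definition SET_BASES :: cmd where
  "SET_BASES = CAsg 8 (((EV 18 [+] EC 1) [*] EV 5 [+] EV 11) [*] EV 3) ;; CAsg 9 (EV 11 [*] EV 3)"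

definition INSERT :: "com \<Rightarrow> expr \<Rightarrow> expr \<Rightarrow> cmd" where
  "INSERT upd ex ey = CStr 8 (EC 0) ex ;; CStr 8 (EC 1) ey ;;
     CFor 11 (EV 5) (SET_BASES ;; CAsg 12 (EC 0) ;; tr upd)"

definition INSERT_ALL :: "com \<Rightarrow> expr \<Rightarrow> expr \<Rightarrow> expr \<Rightarrow> expr \<Rightarrow> cmd" where
  "INSERT_ALL upd e cond ex ey = CFor 21 e (CIf cond (INSERT upd ex ey) CSkip)"

definition MATRIX_ENTRY :: "nat \<Rightarrow> expr" where
  "MATRIX_ENTRY v = EA 0 ((EV 16 [*] EV 2 [+] EV v [div] EV 2) [*] EV 7 [+] (EV 17 [*] EV 2 [+] EV v [mod] EV 2))"

definition BRUTE_FORCE :: cmd where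
  "BRUTE_FORCE = CFor 22 (EV 2 [*] EV 2)
     (CIf (MATRIX_ENTRY 22 [*] EA 1 (EV 17 [*] EV 2 [+] EV 22 [mod] EV 2) [*]
           (EC 1 [-] EA 2 (EV 16 [*] EV 2 [+] EV 22 [div] EV 2)))
        (CStr 2 (EV 16 [*] EV 2 [+] EV 22 [div] EV 2) (EC 1) ;; CAsg 20 (EC 1)) CSkip)"

section \<open>Insertion sequences\<close>

definition edge :: "nat \<times> nat \<Rightarrow> nat set" where
  "edge p = {fst p, snd p}"

lemma insertions_iff:
  "insertions n E es \<longleftrightarrow> (\<forall>p\<in>set es. fst p < n \<and> snd p < n \<and> fst p \<noteq> snd p) \<and>
     distinct (map edge es) \<and> edge ` set es \<inter> E = {}"
  by (induction n E es rule: insertions.induct) (auto simp: edge_def)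

text \<open>With the smaller endpoint written first, distinct pairs are distinct undirected
  edges.\<close>

lemma insertionsI:
  assumes "distinct es" "\<And>p. p \<in> set es \<Longrightarrow> fst p < snd p \<and> snd p < n"
  shows "insertions n {} es"
proof -
  have "inj_on edge (set es)"
  proof (rule inj_onI)
    fix p q assume "p \<in> set es" "q \<in> set es" "edge p = edge q"
    with assms(2)[of p] assms(2)[of q] show "p = q"
      by (auto simp: edge_def doubleton_eq_iff prod_eq_iff)
  qed
  moreover have "fst p < n \<and> snd p < n \<and> fst p \<noteq> snd p" if "p \<in> set es" for p
    using assms(2)[OF that] by simp
  ultimately show ?thesis using assms(1) by (simp add: insertions_iff distinct_map)
qed

lemma insertions_prefix: "insertions n E (xs @ ys) \<Longrightarrow> insertions n E xs"
  by (auto simp: insertions_iff)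

abbreviation reqs :: "(nat \<times> nat) list \<Rightarrow> nat list list" where
  "reqs es \<equiv> map (\<lambda>(u, v). [u, v]) es"

definition ini :: ram where
  "ini = \<lparr>mem = (\<lambda>_. 0), coin_pos = 0, inp = [], outp = []\<rparr>"

text \<open>The assumption \<open>alg\<close> is made for every tape, because each copy runs on a
  truncated tape of its own, and only for the empty initial graph, to which every rollback returns.
  \<open>bounds\<close> collects the quantities that must fit into a stored value.\<close>

locale red = sim W U \<omega> S0 WN L R for W U \<omega> S0 WN L R +
  fixes pre upd :: com and N b nb n TP TN :: nat and M :: "nat \<Rightarrow> nat \<Rightarrow> bool"
  assumes alg: "\<And>tp es. insertions N {} es \<Longrightarrow> \<exists>t u yss.
       online_run WN tp pre upd (mat_input N (\<lambda>_ _. False)) (reqs es) t u yss \<and> t \<le> TP \<and> u \<le> TN"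
    and rb: "rbnd pre \<le> S0" "rbnd upd \<le> S0"
    and b1: "1 \<le> b" and bN: "3 * b \<le> N" and R1: "1 \<le> R" and WN0: "0 < WN" and nP: "n \<le> nb * b"
    and bounds: "(nb * nb + 1) * R * (S0 + 3) \<le> U" "nb * nb \<le> U" "b * b \<le> U" "R \<le> U" "N + 2 \<le> U" "n \<le> U" "2 \<le> U"
begin

abbreviation "S \<equiv> S0 + 3"
abbreviation "P \<equiv> nb * b"

text \<open>Coins beyond the prefetched ones count as tails. Once one is requested, flag 15 is set for good
  and every block is searched by brute force; \<open>TP + TN \<le> L\<close> excludes this.\<close>

definition tape :: "nat \<Rightarrow> nat \<Rightarrow> bool" where
  "tape r p \<longleftrightarrow> p < L \<and> \<omega> (p * R + r)"

definition s0 :: "nat \<Rightarrow> ram" where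
  "s0 r = step_fn WN (tape r) pre ini (mat_input N (\<lambda>_ _. False))"

text \<open>There is no dependence on the block or the version: the coin position is rolled back as
  well, so all blocks and all restarts of copy \<open>r\<close> replay the same tape.\<close>

definition st :: "nat \<Rightarrow> (nat \<times> nat) list \<Rightarrow> ram" where
  "st r es = fin WN (tape r) upd (s0 r) (reqs es)"

text \<open>The update time of copy \<open>r\<close> on \<open>es\<close>, without the
  preprocessing; it is unique because sessions are deterministic.\<close>

definition tau :: "nat \<Rightarrow> (nat \<times> nat) list \<Rightarrow> nat" where
  "tau r es = (THE t. \<exists>yss. session WN (tape r) upd (s0 r) (reqs es) t yss)"

text \<open>Padding by zeros, as the block side need not divide \<open>n\<close>.\<close>

definition Mx :: "nat \<Rightarrow> nat \<Rightarrow> bool" where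
  "Mx i j \<longleftrightarrow> i < n \<and> j < n \<and> M i j"

lemma run_ex:
  assumes "insertions N {} es"
  shows "\<exists>t yss. exec WN (tape r) pre (ini\<lparr>inp := mat_input N (\<lambda>_ _. False), outp := []\<rparr>) t (s0 r) \<and> t \<le> TP \<and>
    session WN (tape r) upd (s0 r) (reqs es) (tau r es) yss \<and> tau r es \<le> TN"
proof -
  obtain t u yss s where e: "exec WN (tape r) pre (ini\<lparr>inp := mat_input N (\<lambda>_ _. False), outp := []\<rparr>) t s"
    "session WN (tape r) upd s (reqs es) u yss" "t \<le> TP" "u \<le> TN"
    using alg[OF assms, of "tape r"] by (auto simp: online_run_def ini_def)
  have "s = s0 r" using step_fn_eq[OF e(1)] by (simp add: s0_def)
  moreover have "tau r es = u" unfolding tau_def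
    by (rule the_equality) (use e(2) \<open>s = s0 r\<close> session_det in blast)+
  ultimately show ?thesis using e by blast
qed

lemma st_Nil [simp]: "st r [] = s0 r"
  by (simp add: st_def fin_def)

lemma tau_Nil [simp]: "tau r [] = 0"
  using run_ex[of "[]" r] by (auto elim: session_NilE)

lemma tau_le: "insertions N {} es \<Longrightarrow> tau r es \<le> TN"
  using run_ex[of es r] by blast

lemma st_snoc:
  assumes "insertions N {} (es @ [(x, y)])"
  shows "tau r es \<le> tau r (es @ [(x, y)])"
    "exec WN (tape r) upd ((st r es)\<lparr>inp := [x, y], outp := []\<rparr>) (tau r (es @ [(x, y)]) - tau r es) (st r (es @ [(x, y)]))"
proof -
  obtain yss where "session WN (tape r) upd (s0 r) (reqs (es @ [(x, y)])) (tau r (es @ [(x, y)])) yss"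
    using run_ex[OF assms] by blast
  then have "session WN (tape r) upd (s0 r) (reqs es @ [[x, y]]) (tau r (es @ [(x, y)])) yss" by simp
  from session_snocD[OF this] obtain t1 y1 t2 where 1: "session WN (tape r) upd (s0 r) (reqs es) t1 y1"
    "exec WN (tape r) upd ((st r es)\<lparr>inp := [x, y], outp := []\<rparr>) t2 (st r (es @ [(x, y)]))"
    "tau r (es @ [(x, y)]) = t1 + t2" by (auto simp: st_def)
  have "tau r es = t1"
    using run_ex[OF insertions_prefix[OF assms], of r] session_det[OF 1(1)] by blast
  with 1 show "tau r es \<le> tau r (es @ [(x, y)])"
    "exec WN (tape r) upd ((st r es)\<lparr>inp := [x, y], outp := []\<rparr>) (tau r (es @ [(x, y)]) - tau r es) (st r (es @ [(x, y)]))"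
    by simp_all
qed

lemma st_mem: "insertions N {} es \<Longrightarrow> mem (st r es) a < WN"
proof (induction es arbitrary: a rule: rev_induct)
  case Nil
  obtain t where "exec WN (tape r) pre (ini\<lparr>inp := mat_input N (\<lambda>_ _. False), outp := []\<rparr>) t (s0 r)"
    using run_ex[OF Nil, of r] by blast
  then show ?case by (auto elim!: exec_mem simp: ini_def WN0)
next
  case (snoc p es)
  obtain x y where p: "p = (x, y)" by fastforce
  have "mem ((st r es)\<lparr>inp := [x, y], outp := []\<rparr>) a < WN" for a
    using snoc.IH[OF insertions_prefix[OF snoc.prems]] by simp
  then show ?case using exec_mem[OF st_snoc(2)] snoc.prems unfolding p by blast
qed

lemma st_coin: "insertions N {} es \<Longrightarrow> coin_pos (st r es) \<le> TP + TN"
proof -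
  assume "insertions N {} es"
  from run_ex[OF this, of r] obtain t yss where
    1: "exec WN (tape r) pre (ini\<lparr>inp := mat_input N (\<lambda>_ _. False), outp := []\<rparr>) t (s0 r)" "t \<le> TP"
    "session WN (tape r) upd (s0 r) (reqs es) (tau r es) yss" "tau r es \<le> TN" by blast
  show ?thesis using exec_coin[OF 1(1)] session_coin[OF 1(3)] 1(2,4) by (simp add: st_def ini_def)
qed

text \<open>Evidence of an error: the sequences that a block retains are triangle-free in the
  evolution without misses, so a copy that is right about such a sequence answers NO on all its
  prefixes and is never killed.\<close>

definition killed :: "nat \<Rightarrow> (nat \<times> nat) list \<Rightarrow> bool" where
  "killed r es \<longleftrightarrow> (\<exists>p q. p \<noteq> [] \<and> es = p @ q \<and> outp (st r p) \<noteq> [0])"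

lemma killed_append: "killed r es \<Longrightarrow> killed r (es @ fs)"
  unfolding killed_def by (metis append_assoc)

section \<open>Memory areas of the copies\<close>

definition base :: "nat \<Rightarrow> nat \<Rightarrow> nat" where
  "base z r = ((z + 1) * R + r) * S"

abbreviation cell :: "(nat \<Rightarrow> nat \<Rightarrow> nat) \<Rightarrow> nat \<Rightarrow> nat \<Rightarrow> nat \<Rightarrow> nat \<Rightarrow> nat" where
  "cell A z r V \<equiv> vmem A (base z r) (r * S) V"

text \<open>Before the first insertion cell 1 must be 0, which counts as NO. The last clause makes
  the successor of \<open>V\<close> fresh, so that a rollback is possible at any time.\<close>

definition rep :: "(nat \<Rightarrow> nat \<Rightarrow> nat) \<Rightarrow> bool \<Rightarrow> nat \<Rightarrow> nat \<Rightarrow> nat \<Rightarrow> (nat \<times> nat) list \<Rightarrow> bool" where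
  "rep A bad z V r es \<longleftrightarrow> (\<forall>a<S0. cell A z r V (a + 3) = mem (st r es) a) \<and>
     cell A z r V 0 = min (coin_pos (st r es)) L \<and> (L < coin_pos (st r es) \<longrightarrow> bad) \<and>
     (es = [] \<longrightarrow> cell A z r V 1 = 0) \<and>
     (es \<noteq> [] \<and> outp (st r es) \<noteq> [] \<longrightarrow> cell A z r V 1 = last (outp (st r es))) \<and>
     (cell A z r V 2 \<noteq> 0 \<longrightarrow> bad \<or> killed r es) \<and> (\<forall>a<S. A 5 (base z r + a) \<le> V)"

definition snap :: "(nat \<Rightarrow> nat \<Rightarrow> nat) \<Rightarrow> bool \<Rightarrow> nat \<Rightarrow> bool" where
  "snap A bad r \<longleftrightarrow> (\<forall>a<S0. A 4 (r * S + (a + 3)) = mem (s0 r) a) \<and>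
     A 4 (r * S) = min (coin_pos (s0 r)) L \<and> (L < coin_pos (s0 r) \<longrightarrow> bad) \<and>
     A 4 (r * S + 1) = 0 \<and> A 4 (r * S + 2) = 0"

text \<open>This is the rollback: if all version entries of the area are smaller than
  \<open>V\<close>, every lookup falls through to the snapshot, although no cell of the area has
  been touched.\<close>

lemma rep_snap:
  assumes "snap A bad r" "\<And>a. a < S \<Longrightarrow> A 5 (base z r + a) < V"
  shows "rep A bad z V r []" and "cell A z r V 2 = 0"
proof -
  have c: "cell A z r V a = A 4 (r * S + a)" if "a < S" for a
    using assms(2)[OF that] by (simp add: vmem_def)
  then show "cell A z r V 2 = 0" using assms(1) by (simp add: snap_def)
  then show "rep A bad z V r []"
    unfolding rep_def using assms c by (auto simp: snap_def less_imp_le)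
qed

lemma rep_cong:
  assumes "\<And>a. a < S \<Longrightarrow> A' 4 (base z r + a) = A 4 (base z r + a)"
    "\<And>a. a < S \<Longrightarrow> A' 5 (base z r + a) = A 5 (base z r + a)"
    "\<And>a. a < S \<Longrightarrow> A' 4 (r * S + a) = A 4 (r * S + a)" "bad \<longrightarrow> bad'"
  shows "a < S \<Longrightarrow> cell A' z r V a = cell A z r V a" and "rep A bad z V r es \<Longrightarrow> rep A' bad' z V r es"
proof -
  show c: "cell A' z r V a = cell A z r V a" if "a < S" for a
    using assms that by (simp add: vmem_def)
  assume "rep A bad z V r es"
  then show "rep A' bad' z V r es"
    unfolding rep_def using c assms(2,4) by auto
qed

text \<open>Areas number \<open>k\<close> and \<open>k'\<close> are disjoint; numbers below \<open>R\<close> are the snapshots.\<close>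

lemma area_disjoint:
  assumes "k \<noteq> k'" "a < S"
  shows "k * S + a < k' * S \<or> k' * S + S \<le> k * S + (a::nat)"
proof (cases "k < k'")
  case True
  then have "Suc k * S \<le> k' * S" by (intro mult_le_mono1) simp
  then show ?thesis using assms by simp
next
  case False
  then have "Suc k' * S \<le> k * S" using assms by (intro mult_le_mono1) simp
  then show ?thesis by simp
qed

lemma base_inj: "r < R \<Longrightarrow> r' < R \<Longrightarrow> (z + 1) * R + r = (z' + 1) * R + r' \<longleftrightarrow> z = z' \<and> r = r'"
proof
  assume a: "r < R" "r' < R" and e: "(z + 1) * R + r = (z' + 1) * R + r'"
  have "((z + 1) * R + r) div R = ((z' + 1) * R + r') div R" "((z + 1) * R + r) mod R = ((z' + 1) * R + r') mod R"
    by (simp_all only: e)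
  moreover have "(w * R + u) div R = w" "(w * R + u) mod R = u" if "u < R" for w u using that by simp_all
  ultimately have "z + 1 = z' + 1" "r = r'" using a by metis+
  then show "z = z' \<and> r = r'" by simp
qed simp

text \<open>What the preprocessing establishes and no query destroys. Flag 15 may be raised later,
  but only if \<open>L\<close> is too small for the running time of a copy.\<close>

definition env :: "hst \<Rightarrow> bool" where
  "env \<sigma> \<longleftrightarrow> vr \<sigma> 0 = n \<and> vr \<sigma> 2 = b \<and> vr \<sigma> 3 = S \<and> vr \<sigma> 4 = L \<and> vr \<sigma> 5 = R \<and> vr \<sigma> 6 = nb \<and>
     vr \<sigma> 7 = P \<and> (\<forall>p<L. \<forall>r<R. ar \<sigma> 3 (p * R + r) = of_bool (\<omega> (p * R + r))) \<and>
     (\<forall>r<R. snap (ar \<sigma>) (vr \<sigma> 15 \<noteq> 0) r) \<and> (vr \<sigma> 15 \<noteq> 0 \<longrightarrow> L < TP + TN) \<and>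
     (\<forall>i<P. \<forall>j<P. ar \<sigma> 0 (i * P + j) = of_bool (Mx i j))"

text \<open>The effect of the commands on everything but the areas of the block \<open>z\<close>.\<close>

definition fr :: "nat set \<Rightarrow> nat set \<Rightarrow> nat \<Rightarrow> hst \<Rightarrow> hst \<Rightarrow> bool" where
  "fr X Y z \<sigma> \<sigma>' \<longleftrightarrow> (\<forall>v. v \<notin> X \<longrightarrow> v \<noteq> 15 \<longrightarrow> vr \<sigma>' v = vr \<sigma> v) \<and>
     (\<forall>k. k \<notin> Y \<longrightarrow> k \<notin> {4, 5} \<longrightarrow> ar \<sigma>' k = ar \<sigma> k) \<and>
     (\<forall>x. (\<forall>r<R. x < base z r \<or> base z r + S \<le> x) \<longrightarrow> ar \<sigma>' 4 x = ar \<sigma> 4 x \<and> ar \<sigma>' 5 x = ar \<sigma> 5 x) \<and>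
     hin \<sigma>' = hin \<sigma> \<and> hout \<sigma>' = hout \<sigma> \<and> hpos \<sigma>' = hpos \<sigma> \<and>
     (vr \<sigma> 15 \<noteq> 0 \<longrightarrow> vr \<sigma>' 15 \<noteq> 0) \<and> (vr \<sigma>' 15 \<noteq> 0 \<longrightarrow> vr \<sigma> 15 \<noteq> 0 \<or> L < TP + TN)"

lemma fr_refl [simp]: "fr X Y z \<sigma> \<sigma>"
  by (simp add: fr_def)

lemma fr_trans: "fr X Y z \<sigma> \<sigma>' \<Longrightarrow> fr X Y z \<sigma>' \<sigma>'' \<Longrightarrow> fr X Y z \<sigma> \<sigma>''"
  by (auto simp: fr_def)

lemma fr_mono: "fr X Y z \<sigma> \<sigma>' \<Longrightarrow> X \<subseteq> X' \<Longrightarrow> Y \<subseteq> Y' \<Longrightarrow> fr X' Y' z \<sigma> \<sigma>'"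
  unfolding fr_def by blast

lemma fr_tm [simp]: "fr X Y z (\<sigma>\<lparr>tm := t\<rparr>) \<sigma>' = fr X Y z \<sigma> \<sigma>'" "fr X Y z \<sigma> (\<sigma>'\<lparr>tm := t\<rparr>) = fr X Y z \<sigma> \<sigma>'"
  by (simp_all add: fr_def)

lemma fr_vr: "fr X Y z \<sigma> \<sigma>' \<Longrightarrow> v \<notin> X \<Longrightarrow> v \<noteq> 15 \<Longrightarrow> vr \<sigma>' v = vr \<sigma> v"
  by (simp add: fr_def)

lemma fr_ar: "fr X Y z \<sigma> \<sigma>' \<Longrightarrow> k \<notin> Y \<Longrightarrow> k \<noteq> 4 \<Longrightarrow> k \<noteq> 5 \<Longrightarrow> ar \<sigma>' k = ar \<sigma> k"
  by (simp add: fr_def)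

lemma fr_area:
  assumes "fr X Y z \<sigma> \<sigma>'" "k < R \<or> (\<exists>z' r. z' \<noteq> z \<and> r < R \<and> k = (z' + 1) * R + r)" "a < S"
  shows "ar \<sigma>' 4 (k * S + a) = ar \<sigma> 4 (k * S + a)" "ar \<sigma>' 5 (k * S + a) = ar \<sigma> 5 (k * S + a)"
proof -
  have "k \<noteq> (z + 1) * R + r" if "r < R" for r
  proof
    assume k: "k = (z + 1) * R + r"
    then have "\<not> k < R" by simp
    with assms(2) obtain z' r' where z': "z' \<noteq> z" "r' < R" "k = (z' + 1) * R + r'" by blast
    then have "(z' + 1) * R + r' = (z + 1) * R + r" using k by simp
    then show False using base_inj[OF z'(2) that] z'(1) by simp
  qed
  then have "\<forall>r<R. k * S + a < base z r \<or> base z r + S \<le> k * S + a"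
    unfolding base_def using area_disjoint assms(3) by blast
  then show "ar \<sigma>' 4 (k * S + a) = ar \<sigma> 4 (k * S + a)" "ar \<sigma>' 5 (k * S + a) = ar \<sigma> 5 (k * S + a)"
    using assms(1) unfolding fr_def by blast+
qed

lemma env_fr:
  assumes "env \<sigma>" "fr X Y z \<sigma> \<sigma>'" "X \<inter> {..7} = {}" "Y \<inter> {0, 3} = {}"
  shows "env \<sigma>'"
proof -
  have v: "vr \<sigma>' v = vr \<sigma> v" if "v \<le> 7" for v using that assms(2,3) by (intro fr_vr) auto
  have a: "ar \<sigma>' k = ar \<sigma> k" if "k \<in> {0, 3}" for k using that assms(2,4) by (intro fr_ar) auto
  have "snap (ar \<sigma>') (vr \<sigma>' 15 \<noteq> 0) r" if "r < R" for r
  proof -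
    have "ar \<sigma>' 4 (r * S + a) = ar \<sigma> 4 (r * S + a)" if "a < S" for a
      using fr_area[OF assms(2)] \<open>r < R\<close> that by blast
    from this[of 0] this[of 1] this[of 2] this show ?thesis using assms(1,2) that unfolding env_def snap_def fr_def
      by (simp del: add_2_eq_Suc')
  qed
  then show ?thesis using assms(1,2) v a unfolding env_def by (auto simp: fr_def)
qed

lemma other_block:
  assumes "fr X Y z \<sigma> \<sigma>'" "z' \<noteq> z" "r < R"
  shows "rep (ar \<sigma>) (vr \<sigma> 15 \<noteq> 0) z' V r es \<Longrightarrow> rep (ar \<sigma>') (vr \<sigma>' 15 \<noteq> 0) z' V r es"
    and "a < S \<Longrightarrow> cell (ar \<sigma>') z' r V a = cell (ar \<sigma>) z' r V a"
proof -
  have 1: "ar \<sigma>' 4 (base z' r + a) = ar \<sigma> 4 (base z' r + a)" "ar \<sigma>' 5 (base z' r + a) = ar \<sigma> 5 (base z' r + a)" if "a < S" for a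
    unfolding base_def using fr_area[OF assms(1), of "(z' + 1) * R + r" a] assms that by blast+
  have 2: "ar \<sigma>' 4 (r * S + a) = ar \<sigma> 4 (r * S + a)" if "a < S" for a
    using fr_area[OF assms(1), of r a] assms that by blast
  have 3: "vr \<sigma> 15 \<noteq> 0 \<longrightarrow> vr \<sigma>' 15 \<noteq> 0" using assms(1) by (simp add: fr_def)
  show "rep (ar \<sigma>) (vr \<sigma> 15 \<noteq> 0) z' V r es \<Longrightarrow> rep (ar \<sigma>') (vr \<sigma>' 15 \<noteq> 0) z' V r es"
    "a < S \<Longrightarrow> cell (ar \<sigma>') z' r V a = cell (ar \<sigma>) z' r V a"
    using rep_cong[of "ar \<sigma>'" z' r "ar \<sigma>", OF 1 2 3] by blast+
qed

section \<open>Inserting an edge into all copies\<close>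

lemma base_le: "z < nb * nb \<Longrightarrow> r < R \<Longrightarrow> base z r + S \<le> U"
proof -
  assume "z < nb * nb" "r < R"
  then have "(z + 1) * R + r + 1 \<le> (z + 1) * R + R" by simp
  also have "\<dots> = (z + 2) * R" by (simp add: algebra_simps)
  also have "\<dots> \<le> (nb * nb + 1) * R" using \<open>z < nb * nb\<close> by (intro mult_le_mono1) simp
  finally have "((z + 1) * R + r + 1) * S \<le> (nb * nb + 1) * R * S" by (rule mult_le_mono1)
  then show ?thesis unfolding base_def using bounds(1) by (simp add: algebra_simps)
qed

lemma base_ge: "r < R \<Longrightarrow> r * S + S \<le> base z r"
proof -
  assume "r < R"
  have "(r + 1) * S \<le> ((z + 1) * R + r) * S" using R1 by (intro mult_le_mono1) simp
  then show ?thesis unfolding base_def by (simp add: algebra_simps)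
qed

lemma wp_SET_BASES:
  assumes "vr \<sigma> 18 = z" "vr \<sigma> 11 = r" "vr \<sigma> 5 = R" "vr \<sigma> 3 = S" "z < nb * nb" "r < R"
    and "Q (\<sigma>\<lparr>vr := (vr \<sigma>)(8 := base z r, 9 := r * S), tm := tm \<sigma> + 14\<rparr>)"
  shows "wp SET_BASES Q \<sigma>"
proof -
  have "base z r \<le> U" "r * S \<le> U" using base_le[OF assms(5,6)] base_ge[OF assms(6), of z] by simp_all
  then show ?thesis unfolding SET_BASES_def using assms
    by (intro wp_seq wp_asg) (auto simp: base_def elim!: back_subst[of Q])
qed

definition copies_time :: "(nat \<times> nat) list \<Rightarrow> nat" where
  "copies_time es = (\<Sum>r<R. tau r es)"

abbreviation "XI \<equiv> {8, 9, 11, 12, 13, 14::nat}"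

text \<open>The time is stated through the growth of \<open>copies_time\<close>, so that the costs
  of successive insertions telescope to the update times of the copies. The endpoints are evaluated
  at different moments, hence \<open>ev\<close> ranges over all states that differ by scratch
  only.\<close>

lemma wp_INSERT:
  assumes env: "env \<sigma>" and z: "vr \<sigma> 18 = z" "z < nb * nb" and V: "vr \<sigma> 10 = V"
    and rep: "\<And>r. r < R \<Longrightarrow> rep (ar \<sigma>) (vr \<sigma> 15 \<noteq> 0) z V r es"
    and ins: "insertions N {} (es @ [(x, y)])"
    and ev: "\<And>\<sigma>'. fr XI {8} z \<sigma> \<sigma>' \<Longrightarrow> eval ex \<sigma>' = x \<and> eval ey \<sigma>' = y"
    and et: "etime ex \<le> 100" "etime ey \<le> 100"
  shows "wp (INSERT upd ex ey) (\<lambda>\<sigma>'. fr XI {8} z \<sigma> \<sigma>' \<and>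
      (\<forall>r<R. rep (ar \<sigma>') (vr \<sigma>' 15 \<noteq> 0) z V r (es @ [(x, y)])) \<and>
      (\<forall>r<R. cell (ar \<sigma>') z r V 2 = cell (ar \<sigma>) z r V 2) \<and>
      tm \<sigma>' + 600 * copies_time es \<le> tm \<sigma> + 600 * copies_time (es @ [(x, y)]) + 40 * R + 300) \<sigma>"
proof -
  let ?es = "es @ [(x, y)]"
  have xy: "x \<le> U" "y \<le> U" using ins bounds(5) by (auto simp: insertions_iff)
  let ?\<tau> = "\<sigma>\<lparr>ar := (ar \<sigma>)(8 := (ar \<sigma> 8)(0 := x))\<rparr>"
  have f1: "fr XI {8} z \<sigma> (?\<tau>\<lparr>tm := t\<rparr>)" for t by (simp add: fr_def)
  define I where "I i \<sigma>' \<longleftrightarrow> fr XI {8} z \<sigma> \<sigma>' \<and> ar \<sigma>' 8 0 = x \<and> ar \<sigma>' 8 1 = y \<and>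
     (\<forall>r<R. rep (ar \<sigma>') (vr \<sigma>' 15 \<noteq> 0) z V r (if r < i then ?es else es)) \<and>
     (\<forall>r<R. cell (ar \<sigma>') z r V 2 = cell (ar \<sigma>) z r V 2) \<and>
     tm \<sigma>' + 600 * (\<Sum>r<i. tau r es) \<le> tm \<sigma> + 600 * (\<Sum>r<i. tau r ?es) + 40 * i + 250" for i \<sigma>'
  show ?thesis
    unfolding INSERT_def
  proof (rule wp_seq, rule wp_str, use ev[OF fr_refl] xy in simp, rule wp_seq, rule wp_str)
    show "eval ey (\<sigma>\<lparr>ar := (ar \<sigma>)(8 := (ar \<sigma> 8)(eval (EC 0) \<sigma> := eval ex \<sigma>)), tm := tm \<sigma> + (etime (EC 0) + etime ex + 5)\<rparr>) \<le> U"
      using ev[OF f1] ev[OF fr_refl] xy by simp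
    let ?\<tau> = "\<sigma>\<lparr>ar := (ar \<sigma>)(8 := (ar \<sigma> 8)(eval (EC 0) \<sigma> := eval ex \<sigma>)), tm := tm \<sigma> + (etime (EC 0) + etime ex + 5)\<rparr>"
    show "wp (CFor 11 (EV 5) (SET_BASES ;; CAsg 12 (EC 0) ;; tr upd))
       (\<lambda>\<sigma>'. fr XI {8} z \<sigma> \<sigma>' \<and> (\<forall>r<R. rep (ar \<sigma>') (vr \<sigma>' 15 \<noteq> 0) z V r ?es) \<and>
          (\<forall>r<R. cell (ar \<sigma>') z r V 2 = cell (ar \<sigma>) z r V 2) \<and>
          tm \<sigma>' + 600 * copies_time es \<le> tm \<sigma> + 600 * copies_time ?es + 40 * R + 300)
       (?\<tau>\<lparr>ar := (ar ?\<tau>)(8 := (ar ?\<tau> 8)(eval (EC 1) ?\<tau> := eval ey ?\<tau>)), tm := tm ?\<tau> + (etime (EC 1) + etime ey + 5)\<rparr>)"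
    proof (rule wp_for[where I = I and m = R])
      have c: "cell ((ar \<sigma>)(8 := g)) z r V a = cell (ar \<sigma>) z r V a" for g r a by (simp add: vmem_def)
      have "rep ((ar \<sigma>)(8 := g)) (vr \<sigma> 15 \<noteq> 0) z V r es" if "r < R" for g r
        using rep[OF that] unfolding rep_def c by simp
      moreover have "eval ex \<sigma> = x" "eval ey ?\<tau> = y" using ev[OF f1] ev[OF fr_refl] by simp_all
      ultimately show "I 0 (?\<tau>\<lparr>ar := (ar ?\<tau>)(8 := (ar ?\<tau> 8)(eval (EC 1) ?\<tau> := eval ey ?\<tau>)), tm := tm ?\<tau> + (etime (EC 1) + etime ey + 5),
          vr := (vr (?\<tau>\<lparr>ar := (ar ?\<tau>)(8 := (ar ?\<tau> 8)(eval (EC 1) ?\<tau> := eval ey ?\<tau>)), tm := tm ?\<tau> + (etime (EC 1) + etime ey + 5)\<rparr>))(11 := 0),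
          tm := tm (?\<tau>\<lparr>ar := (ar ?\<tau>)(8 := (ar ?\<tau> 8)(eval (EC 1) ?\<tau> := eval ey ?\<tau>)), tm := tm ?\<tau> + (etime (EC 1) + etime ey + 5)\<rparr>) + 2\<rparr>)"
        unfolding I_def using et by (simp add: c) (simp add: fr_def)
    next
      fix i \<sigma>1 assume i: "i < R" and I: "I i \<sigma>1" and v: "vr \<sigma>1 11 = i"
      have fr1: "fr XI {8} z \<sigma> \<sigma>1" using I by (simp add: I_def)
      have env1: "env \<sigma>1" using env_fr[OF env fr1] by simp
      have z1: "vr \<sigma>1 18 = z" "vr \<sigma>1 10 = V" using fr_vr[OF fr1] z V by simp_all
      let ?s = "(st i es)\<lparr>inp := [x, y], outp := []\<rparr>"
      let ?\<rho> = "\<sigma>1\<lparr>vr := (vr \<sigma>1)(8 := base z i, 9 := i * S, 12 := 0), tm := tm \<sigma>1 + 20\<rparr>"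
      have ri: "rep (ar \<sigma>1) (vr \<sigma>1 15 \<noteq> 0) z V i es"
      proof -
        have "\<forall>r<R. rep (ar \<sigma>1) (vr \<sigma>1 15 \<noteq> 0) z V r (if r < i then ?es else es)"
          using I unfolding I_def by blast
        from this[rule_format, OF i] show ?thesis by simp
      qed
      have "simr (tape i) ?\<rho> ?s"
        unfolding simr_def
      proof (intro conjI)
        show "vr ?\<rho> 8 = vr ?\<rho> 9 \<or> vr ?\<rho> 9 + (S0 + 3) \<le> vr ?\<rho> 8" using base_ge[OF i, of z] by simp
        show "\<forall>a<S0. vm ?\<rho> (a + 3) = mem ?s a" "vm ?\<rho> 0 = min (coin_pos ?s) L" "L < coin_pos ?s \<longrightarrow> vr ?\<rho> 15 \<noteq> 0"
          using ri z1 unfolding rep_def by simp_all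
        show "\<forall>a. mem ?s a < WN" using st_mem[OF insertions_prefix[OF ins]] by simp
        show "\<forall>j<length (inp ?s). ar ?\<rho> 8 (vr ?\<rho> 12 + j) = inp ?s ! j"
          using I by (auto simp: I_def less_Suc_eq numeral_2_eq_2)
        show "\<forall>p<L. ar ?\<rho> 3 (p * R + vr ?\<rho> 11) = of_bool (tape i p)"
          using env1 v i by (simp add: env_def tape_def)
      qed (use env1 bounds(7) in \<open>auto simp: env_def\<close>)
      from wp_tr[OF st_snoc(2)[OF ins] rb(2) this]
      have w: "wp (tr upd) (\<lambda>\<sigma>'. simr (tape i) \<sigma>' (st i ?es) \<and> sfr ?\<rho> \<sigma>' (st i ?es) \<and>
         tm \<sigma>' \<le> tm ?\<rho> + 600 * (tau i ?es - tau i es)) ?\<rho>" by (simp add: tape_def)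
      have main: "vr \<sigma>2 11 = i \<and> I (Suc i) (\<sigma>2\<lparr>vr := (vr \<sigma>2)(11 := Suc i), tm := tm \<sigma>2 + 4\<rparr>)"
        if h: "simr (tape i) \<sigma>2 (st i ?es) \<and> sfr ?\<rho> \<sigma>2 (st i ?es) \<and>
         tm \<sigma>2 \<le> tm ?\<rho> + 600 * (tau i ?es - tau i es)" for \<sigma>2
      proof -
        have sf: "sfr ?\<rho> \<sigma>2 (st i ?es)" and sm: "simr (tape i) \<sigma>2 (st i ?es)" using h by simp_all
        have v2: "vr \<sigma>2 8 = base z i" "vr \<sigma>2 9 = i * S" "vr \<sigma>2 10 = V" "vr \<sigma>2 11 = i"
          using sf z1 v by (simp_all add: sfr_def)
        \<comment> \<open>Flag 15 is raised only beyond \<open>L\<close> coins, and by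
          \<open>st_coin\<close> no run uses more than \<open>TP + TN\<close>.\<close>
        have bad: "vr \<sigma>1 15 \<noteq> 0 \<longrightarrow> vr \<sigma>2 15 \<noteq> 0" "vr \<sigma>2 15 \<noteq> 0 \<longrightarrow> vr \<sigma>1 15 \<noteq> 0 \<or> L < TP + TN"
          using sf st_coin[OF ins, of i] by (auto simp: sfr_def)
        have out: "ar \<sigma>2 4 x = ar \<sigma>1 4 x \<and> ar \<sigma>2 5 x = ar \<sigma>1 5 x" if "x < base z i \<or> base z i + S \<le> x" for x
          using sf that by (auto simp: sfr_def)
        have o8: "ar \<sigma>2 k = ar \<sigma>1 k" if "k \<noteq> 4" "k \<noteq> 5" for k using sf that by (simp add: sfr_def)
        have "fr XI {8} z \<sigma>1 \<sigma>2" unfolding fr_def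
          using out i bad sf by (auto simp: sfr_def)
        with fr1 have fr2: "fr XI {8} z \<sigma> \<sigma>2" by (rule fr_trans)
        then have fr3: "fr XI {8} z \<sigma> (\<sigma>2\<lparr>vr := (vr \<sigma>2)(11 := Suc i), tm := tm \<sigma>2 + 4\<rparr>)" by (simp add: fr_def)
        have same: "r < R \<Longrightarrow> r \<noteq> i \<Longrightarrow> a < S \<Longrightarrow> cell (ar \<sigma>2) z r V a = cell (ar \<sigma>1) z r V a"
          "r < R \<Longrightarrow> r \<noteq> i \<Longrightarrow> rep (ar \<sigma>1) (vr \<sigma>1 15 \<noteq> 0) z V r fs \<Longrightarrow> rep (ar \<sigma>2) (vr \<sigma>2 15 \<noteq> 0) z V r fs" for r a fs
        proof -
          assume r: "r < R" "r \<noteq> i"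
          have 1: "base z r + a < base z i \<or> base z i + S \<le> base z r + a" if "a < S" for a
            unfolding base_def using r i that base_inj[of r i z z] by (intro area_disjoint) auto
          have 2: "r * S + a < base z i" if "a < S" for a
          proof -
            have "(r + 1) * S \<le> ((z + 1) * R + i) * S" using r(1) by (intro mult_le_mono1) simp
            then show ?thesis using that unfolding base_def by simp
          qed
          note c = rep_cong[of "ar \<sigma>2" z r "ar \<sigma>1" "vr \<sigma>1 15 \<noteq> 0" "vr \<sigma>2 15 \<noteq> 0", OF _ _ _ bad(1)]
          show "a < S \<Longrightarrow> cell (ar \<sigma>2) z r V a = cell (ar \<sigma>1) z r V a"
            using out 1 2 by (intro c(1)) blast+
          show "rep (ar \<sigma>1) (vr \<sigma>1 15 \<noteq> 0) z V r fs \<Longrightarrow> rep (ar \<sigma>2) (vr \<sigma>2 15 \<noteq> 0) z V r fs"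
            using out 1 2 by (intro c(2)) blast+
        qed
        have c2: "cell (ar \<sigma>2) z i V 2 = cell (ar \<sigma>1) z i V 2" using sf z1 v2 by (simp add: sfr_def)
        have ri2: "rep (ar \<sigma>2) (vr \<sigma>2 15 \<noteq> 0) z V i ?es"
          unfolding rep_def
        proof (intro conjI)
          show "\<forall>a<S. ar \<sigma>2 5 (base z i + a) \<le> V"
          proof (intro allI impI)
            fix a assume "a < S"
            then have "ar \<sigma>1 5 (base z i + a) \<le> V" using ri by (simp add: rep_def)
            moreover have "ar \<sigma>2 5 x = ar \<sigma>1 5 x \<or> ar \<sigma>2 5 x = V" for x using sf z1 by (simp add: sfr_def)
            ultimately show "ar \<sigma>2 5 (base z i + a) \<le> V" by (metis order_refl)
          qed
          show "cell (ar \<sigma>2) z i V 2 \<noteq> 0 \<longrightarrow> vr \<sigma>2 15 \<noteq> 0 \<or> killed i ?es"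
            using c2 ri bad killed_append unfolding rep_def by metis
        qed (use sm v2 in \<open>auto simp: simr_def\<close>)
        have t: "tau i es \<le> tau i ?es" using st_snoc(1)[OF ins] .
        show ?thesis unfolding I_def
        proof (intro conjI)
          show "\<forall>r<R. rep (ar (\<sigma>2\<lparr>vr := (vr \<sigma>2)(11 := Suc i), tm := tm \<sigma>2 + 4\<rparr>))
            (vr (\<sigma>2\<lparr>vr := (vr \<sigma>2)(11 := Suc i), tm := tm \<sigma>2 + 4\<rparr>) 15 \<noteq> 0) z V r (if r < Suc i then ?es else es)"
          proof (intro allI impI)
            fix r assume r: "r < R"
            show "rep (ar (\<sigma>2\<lparr>vr := (vr \<sigma>2)(11 := Suc i), tm := tm \<sigma>2 + 4\<rparr>))
              (vr (\<sigma>2\<lparr>vr := (vr \<sigma>2)(11 := Suc i), tm := tm \<sigma>2 + 4\<rparr>) 15 \<noteq> 0) z V r (if r < Suc i then ?es else es)"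
            proof (cases "r = i")
              case True
              then show ?thesis using ri2 by simp
            next
              case False
              then have "(if r < Suc i then ?es else es) = (if r < i then ?es else es)" by auto
              then show ?thesis using same(2)[OF r False] I r unfolding I_def by simp
            qed
          qed
          show "\<forall>r<R. cell (ar (\<sigma>2\<lparr>vr := (vr \<sigma>2)(11 := Suc i), tm := tm \<sigma>2 + 4\<rparr>)) z r V 2 = cell (ar \<sigma>) z r V 2"
          proof (intro allI impI)
            fix r assume r: "r < R"
            then show "cell (ar (\<sigma>2\<lparr>vr := (vr \<sigma>2)(11 := Suc i), tm := tm \<sigma>2 + 4\<rparr>)) z r V 2 = cell (ar \<sigma>) z r V 2"
              using same(1)[OF r, of 2] c2 I unfolding I_def by (cases "r = i") auto
          qed
          show "tm (\<sigma>2\<lparr>vr := (vr \<sigma>2)(11 := Suc i), tm := tm \<sigma>2 + 4\<rparr>) + 600 * (\<Sum>r<Suc i. tau r es)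
            \<le> tm \<sigma> + 600 * (\<Sum>r<Suc i. tau r ?es) + 40 * Suc i + 250"
          proof -
            have "tm \<sigma>1 + 600 * (\<Sum>r<i. tau r es) \<le> tm \<sigma> + 600 * (\<Sum>r<i. tau r ?es) + 40 * i + 250"
              using I unfolding I_def by blast
            moreover have "tm \<sigma>2 \<le> tm \<sigma>1 + 20 + 600 * (tau i ?es - tau i es)" using h by simp
            ultimately show ?thesis using t by simp
          qed
        qed (use v2 fr3 I o8 in \<open>auto simp: I_def\<close>)
      qed
      show "wp (SET_BASES ;; CAsg 12 (EC 0) ;; tr upd)
         (\<lambda>\<sigma>'. vr \<sigma>' 11 = i \<and> I (Suc i) (\<sigma>'\<lparr>vr := (vr \<sigma>')(11 := Suc i), tm := tm \<sigma>' + 4\<rparr>))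
         (\<sigma>1\<lparr>tm := tm \<sigma>1 + (etime (EV 5) + 3)\<rparr>)"
      proof (rule wp_seq, rule wp_SET_BASES[of _ z i])
        let ?\<rho>' = "\<sigma>1\<lparr>tm := tm \<sigma>1 + (etime (EV 5) + 3)\<rparr>"
        show "wp (CAsg 12 (EC 0) ;; tr upd)
         (\<lambda>\<sigma>'. vr \<sigma>' 11 = i \<and> I (Suc i) (\<sigma>'\<lparr>vr := (vr \<sigma>')(11 := Suc i), tm := tm \<sigma>' + 4\<rparr>))
         (?\<rho>'\<lparr>vr := (vr ?\<rho>')(8 := base z i, 9 := i * S), tm := tm ?\<rho>' + 14\<rparr>)"
        proof (intro wp_seq wp_asg)
          have "wp (tr upd) (\<lambda>\<sigma>'. vr \<sigma>' 11 = i \<and> I (Suc i) (\<sigma>'\<lparr>vr := (vr \<sigma>')(11 := Suc i), tm := tm \<sigma>' + 4\<rparr>)) ?\<rho>"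
            by (rule wp_mono[OF w]) (rule main)
          then show "wp (tr upd) (\<lambda>\<sigma>'. vr \<sigma>' 11 = i \<and> I (Suc i) (\<sigma>'\<lparr>vr := (vr \<sigma>')(11 := Suc i), tm := tm \<sigma>' + 4\<rparr>))
            (?\<rho>'\<lparr>vr := (vr ?\<rho>')(8 := base z i, 9 := i * S), tm := tm ?\<rho>' + 14,
               vr := (vr (?\<rho>'\<lparr>vr := (vr ?\<rho>')(8 := base z i, 9 := i * S), tm := tm ?\<rho>' + 14\<rparr>))
                 (12 := eval (EC 0) (?\<rho>'\<lparr>vr := (vr ?\<rho>')(8 := base z i, 9 := i * S), tm := tm ?\<rho>' + 14\<rparr>)),
               tm := tm (?\<rho>'\<lparr>vr := (vr ?\<rho>')(8 := base z i, 9 := i * S), tm := tm ?\<rho>' + 14\<rparr>) + (etime (EC 0) + 1)\<rparr>)"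
            by (simp add: numeral_eq_Suc)
        qed simp
      qed (use z1 v i z env1 in \<open>auto simp: env_def\<close>)
    next
      fix i \<sigma>1 assume "I i \<sigma>1"
      then have "env \<sigma>1" using env_fr[OF env, of XI "{8}" z \<sigma>1] by (simp add: I_def)
      then show "eval (EV 5) \<sigma>1 = R" by (simp add: env_def)
    next
      fix \<sigma>1 assume "I R \<sigma>1"
      then show "fr XI {8} z \<sigma> (\<sigma>1\<lparr>tm := tm \<sigma>1 + (etime (EV 5) + 3)\<rparr>) \<and>
        (\<forall>r<R. rep (ar (\<sigma>1\<lparr>tm := tm \<sigma>1 + (etime (EV 5) + 3)\<rparr>)) (vr (\<sigma>1\<lparr>tm := tm \<sigma>1 + (etime (EV 5) + 3)\<rparr>) 15 \<noteq> 0) z V r ?es) \<and>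
        (\<forall>r<R. cell (ar (\<sigma>1\<lparr>tm := tm \<sigma>1 + (etime (EV 5) + 3)\<rparr>)) z r V 2 = cell (ar \<sigma>) z r V 2) \<and>
        tm (\<sigma>1\<lparr>tm := tm \<sigma>1 + (etime (EV 5) + 3)\<rparr>) + 600 * copies_time es \<le> tm \<sigma> + 600 * copies_time ?es + 40 * R + 300"
        unfolding I_def copies_time_def by auto
    qed (rule bounds(4))
  qed
qed

end

text \<open>A copy that says YES although the block has no new row is marked in cell 2 and ignored until the
  next rollback, so that each copy can cause only one futile search between two rollbacks.\<close>

definition CHECK :: cmd where
  "CHECK = CFor 11 (EV 5) (SET_BASES ;; CIf (EV 15 [+] READ_CELL (EC 1) [*] (EC 1 [-] READ_CELL (EC 2)))
     (BRUTE_FORCE ;; CIf (EV 20) CSkip (WRITE_CELL (EC 2) (EC 1))) CSkip)"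

section \<open>Batches of insertions\<close>

context red
begin

definition edge_list :: "(nat \<Rightarrow> nat \<times> nat) \<Rightarrow> (nat \<Rightarrow> bool) \<Rightarrow> nat \<Rightarrow> (nat \<times> nat) list" where
  "edge_list f C m = map f (filter C [0..<m])"

lemma edge_list_Suc: "edge_list f C (Suc i) = edge_list f C i @ (if C i then [f i] else [])"
  by (simp add: edge_list_def)

lemma edge_list_prefix: "i \<le> m \<Longrightarrow> \<exists>zs. edge_list f C m = edge_list f C i @ zs"
  by (induction m) (auto simp: edge_list_Suc le_Suc_eq edge_list_def)

abbreviation "XJ \<equiv> {8, 9, 11, 12, 13, 14, 21::nat}"

text \<open>Stated for an arbitrary filtered enumeration, since a block receives three such batches:
  matrix entries, rows and columns. The frame leaves arrays 0, 1 and 2 alone, so conditions that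
  read them keep their values during the loop.\<close>

lemma wp_INSERT_ALL:
  assumes env: "env \<sigma>" and z: "vr \<sigma> 18 = z" "z < nb * nb" and V: "vr \<sigma> 10 = V"
    and rep: "\<And>r. r < R \<Longrightarrow> rep (ar \<sigma>) (vr \<sigma> 15 \<noteq> 0) z V r es"
    and ins: "insertions N {} (es @ edge_list f C m)" and m: "m \<le> U"
    and ev: "\<And>\<sigma>'. fr XJ {8} z \<sigma> \<sigma>' \<Longrightarrow> eval e \<sigma>' = m"
    and evc: "\<And>\<sigma>'. fr XJ {8} z \<sigma> \<sigma>' \<Longrightarrow> vr \<sigma>' 21 < m \<Longrightarrow> (eval cond \<sigma>' \<noteq> 0) = C (vr \<sigma>' 21)"
    and evx: "\<And>\<sigma>'. fr XJ {8} z \<sigma> \<sigma>' \<Longrightarrow> eval ex \<sigma>' = fst (f (vr \<sigma>' 21)) \<and> eval ey \<sigma>' = snd (f (vr \<sigma>' 21))"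
    and et: "etime ex \<le> 100" "etime ey \<le> 100" "etime cond \<le> 100" "etime e \<le> 100"
  shows "wp (INSERT_ALL upd e cond ex ey) (\<lambda>\<sigma>'. fr XJ {8} z \<sigma> \<sigma>' \<and>
      (\<forall>r<R. rep (ar \<sigma>') (vr \<sigma>' 15 \<noteq> 0) z V r (es @ edge_list f C m)) \<and>
      (\<forall>r<R. cell (ar \<sigma>') z r V 2 = cell (ar \<sigma>) z r V 2) \<and>
      tm \<sigma>' + 600 * copies_time es \<le> tm \<sigma> + 600 * copies_time (es @ edge_list f C m) + (40 * R + 600) * (m + 1)) \<sigma>"
proof -
  define I where "I i \<sigma>' \<longleftrightarrow> fr XJ {8} z \<sigma> \<sigma>' \<and>
      (\<forall>r<R. rep (ar \<sigma>') (vr \<sigma>' 15 \<noteq> 0) z V r (es @ edge_list f C i)) \<and>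
      (\<forall>r<R. cell (ar \<sigma>') z r V 2 = cell (ar \<sigma>) z r V 2) \<and>
      tm \<sigma>' + 600 * copies_time es \<le> tm \<sigma> + 600 * copies_time (es @ edge_list f C i) + (40 * R + 600) * i + 2" for i \<sigma>'
  show ?thesis
    unfolding INSERT_ALL_def
  proof (rule wp_for[where I = I and m = m])
    show "I 0 (\<sigma>\<lparr>vr := (vr \<sigma>)(21 := 0), tm := tm \<sigma> + 2\<rparr>)"
      unfolding I_def using rep by (auto simp: edge_list_def fr_def)
  next
    fix i \<sigma>1 assume i: "i < m" and I: "I i \<sigma>1" and v: "vr \<sigma>1 21 = i"
    let ?\<tau> = "\<sigma>1\<lparr>tm := tm \<sigma>1 + (etime e + 3)\<rparr>"
    let ?\<rho> = "?\<tau>\<lparr>tm := tm ?\<tau> + (etime cond + 1)\<rparr>"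
    have fr1: "fr XJ {8} z \<sigma> \<sigma>1" using I by (simp add: I_def)
    have rep1: "rep (ar \<sigma>1) (vr \<sigma>1 15 \<noteq> 0) z V r (es @ edge_list f C i)" if "r < R" for r
      using I that unfolding I_def by blast
    have c1: "cell (ar \<sigma>1) z r V 2 = cell (ar \<sigma>) z r V 2" if "r < R" for r
      using I that unfolding I_def by blast
    have t1: "tm \<sigma>1 + 600 * copies_time es \<le> tm \<sigma> + 600 * copies_time (es @ edge_list f C i) + (40 * R + 600) * i + 2"
      using I unfolding I_def by blast
    have cond: "(eval cond ?\<tau> \<noteq> 0) = C i" using evc[OF fr1] v i by simp
    show "wp (CIf cond (INSERT upd ex ey) CSkip)
       (\<lambda>\<sigma>'. vr \<sigma>' 21 = i \<and> I (Suc i) (\<sigma>'\<lparr>vr := (vr \<sigma>')(21 := Suc i), tm := tm \<sigma>' + 4\<rparr>)) ?\<tau>"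
    proof (rule wp_if)
      assume "eval cond ?\<tau> \<noteq> 0"
      then have C: "C i" using cond by simp
      obtain x y where f: "f i = (x, y)" by fastforce
      obtain zs where "edge_list f C m = edge_list f C (Suc i) @ zs" using edge_list_prefix[of "Suc i" m] i by auto
      then have ins1: "insertions N {} ((es @ edge_list f C i) @ [(x, y)])"
        using ins insertions_prefix[of N "{}" "es @ edge_list f C (Suc i)" zs] C f by (simp add: edge_list_Suc)
      have w: "wp (INSERT upd ex ey) (\<lambda>\<sigma>'. fr XI {8} z ?\<rho> \<sigma>' \<and>
        (\<forall>r<R. rep (ar \<sigma>') (vr \<sigma>' 15 \<noteq> 0) z V r ((es @ edge_list f C i) @ [(x, y)])) \<and>
        (\<forall>r<R. cell (ar \<sigma>') z r V 2 = cell (ar ?\<rho>) z r V 2) \<and>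
        tm \<sigma>' + 600 * copies_time (es @ edge_list f C i) \<le> tm ?\<rho> + 600 * copies_time ((es @ edge_list f C i) @ [(x, y)]) + 40 * R + 300) ?\<rho>"
      proof (rule wp_INSERT[OF _ _ z(2) _ _ ins1])
        show "env ?\<rho>" using env_fr[OF env fr1] by (simp add: env_def)
        show "vr ?\<rho> 18 = z" "vr ?\<rho> 10 = V" using fr_vr[OF fr1] z V by simp_all
        fix \<sigma>' assume a: "fr XI {8} z ?\<rho> \<sigma>'"
        then have "fr XJ {8} z \<sigma>1 \<sigma>'" by (auto intro: fr_mono)
        with fr1 have "fr XJ {8} z \<sigma> \<sigma>'" by (rule fr_trans)
        moreover have "vr \<sigma>' 21 = i" using fr_vr[OF a, of 21] v by simp
        ultimately show "eval ex \<sigma>' = x \<and> eval ey \<sigma>' = y" using evx f by simp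
      qed (use rep1 et in simp_all)
      show "wp (INSERT upd ex ey) (\<lambda>\<sigma>'. vr \<sigma>' 21 = i \<and> I (Suc i) (\<sigma>'\<lparr>vr := (vr \<sigma>')(21 := Suc i), tm := tm \<sigma>' + 4\<rparr>)) ?\<rho>"
      proof (rule wp_mono[OF w])
        fix \<sigma>' assume h: "fr XI {8} z ?\<rho> \<sigma>' \<and>
          (\<forall>r<R. rep (ar \<sigma>') (vr \<sigma>' 15 \<noteq> 0) z V r ((es @ edge_list f C i) @ [(x, y)])) \<and>
          (\<forall>r<R. cell (ar \<sigma>') z r V 2 = cell (ar ?\<rho>) z r V 2) \<and>
          tm \<sigma>' + 600 * copies_time (es @ edge_list f C i) \<le> tm ?\<rho> + 600 * copies_time ((es @ edge_list f C i) @ [(x, y)]) + 40 * R + 300"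
        then have "fr XI {8} z \<sigma>1 \<sigma>'" by simp
        then have "fr XJ {8} z \<sigma> \<sigma>'" and v': "vr \<sigma>' 21 = i"
          using fr_trans[OF fr1 fr_mono] v by (auto simp: fr_vr)
        then have f': "fr XJ {8} z \<sigma> (\<sigma>'\<lparr>vr := (vr \<sigma>')(21 := Suc i), tm := tm \<sigma>' + 4\<rparr>)" by (simp add: fr_def)
        have e: "es @ edge_list f C (Suc i) = (es @ edge_list f C i) @ [(x, y)]" using C f by (simp add: edge_list_Suc)
        have t: "tm \<sigma>' + 600 * copies_time (es @ edge_list f C i) \<le> tm \<sigma>1 + 204 + 600 * copies_time ((es @ edge_list f C i) @ [(x, y)]) + 40 * R + 300"
          using h et by simp
        show "vr \<sigma>' 21 = i \<and> I (Suc i) (\<sigma>'\<lparr>vr := (vr \<sigma>')(21 := Suc i), tm := tm \<sigma>' + 4\<rparr>)"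
          unfolding I_def e
        proof (intro conjI)
          show "tm (\<sigma>'\<lparr>vr := (vr \<sigma>')(21 := Suc i), tm := tm \<sigma>' + 4\<rparr>) + 600 * copies_time es
            \<le> tm \<sigma> + 600 * copies_time ((es @ edge_list f C i) @ [(x, y)]) + (40 * R + 600) * Suc i + 2"
            using t t1 by simp
        qed (use h c1 v' f' in simp_all)
      qed
    next
      assume "eval cond ?\<tau> = 0"
      then have C: "\<not> C i" using cond by simp
      then have e: "edge_list f C (Suc i) = edge_list f C i" by (simp add: edge_list_Suc)
      have "fr XJ {8} z \<sigma> (\<sigma>1\<lparr>vr := g, tm := t\<rparr>)" if "\<And>v. v \<noteq> 21 \<Longrightarrow> g v = vr \<sigma>1 v" for g t
        using fr1 that by (simp add: fr_def)
      then show "wp CSkip (\<lambda>\<sigma>'. vr \<sigma>' 21 = i \<and> I (Suc i) (\<sigma>'\<lparr>vr := (vr \<sigma>')(21 := Suc i), tm := tm \<sigma>' + 4\<rparr>)) ?\<rho>"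
        using rep1 c1 t1 v et by (intro wp_skip) (simp add: I_def e)
    qed
  next
    fix \<sigma>1 assume I: "I m \<sigma>1"
    then have "tm \<sigma>1 + 600 * copies_time es \<le> tm \<sigma> + 600 * copies_time (es @ edge_list f C m) + (40 * R + 600) * m + 2"
      unfolding I_def by blast
    then show "fr XJ {8} z \<sigma> (\<sigma>1\<lparr>tm := tm \<sigma>1 + (etime e + 3)\<rparr>) \<and>
      (\<forall>r<R. rep (ar (\<sigma>1\<lparr>tm := tm \<sigma>1 + (etime e + 3)\<rparr>)) (vr (\<sigma>1\<lparr>tm := tm \<sigma>1 + (etime e + 3)\<rparr>) 15 \<noteq> 0) z V r (es @ edge_list f C m)) \<and>
      (\<forall>r<R. cell (ar (\<sigma>1\<lparr>tm := tm \<sigma>1 + (etime e + 3)\<rparr>)) z r V 2 = cell (ar \<sigma>) z r V 2) \<and>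
      tm (\<sigma>1\<lparr>tm := tm \<sigma>1 + (etime e + 3)\<rparr>) + 600 * copies_time es \<le> tm \<sigma> + 600 * copies_time (es @ edge_list f C m) + (40 * R + 600) * (m + 1)"
      using I et(4) unfolding I_def by simp
  qed (use ev m in \<open>auto simp: I_def\<close>)
qed

section \<open>The rows contributed by one block, and the search for them\<close>

definition new :: "nat \<Rightarrow> (nat \<Rightarrow> bool) \<Rightarrow> nat set" where
  "new z v = {z div nb * b + i | i j. i < b \<and> j < b \<and> Mx (z div nb * b + i) (z mod nb * b + j) \<and> v (z mod nb * b + j)}"

definition io :: "hst \<Rightarrow> (nat \<Rightarrow> bool) \<Rightarrow> nat set \<Rightarrow> bool" where
  "io \<sigma> v Rs \<longleftrightarrow> (\<forall>x<P. ar \<sigma> 1 x = of_bool (v x)) \<and> (\<forall>x<P. ar \<sigma> 2 x = of_bool (x \<in> Rs))"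

lemma io_upd [simp]: "io (\<sigma>\<lparr>vr := g\<rparr>) v Rs = io \<sigma> v Rs" "io (\<sigma>\<lparr>tm := t\<rparr>) v Rs = io \<sigma> v Rs"
  by (simp_all add: io_def)

lemma io_vupd [simp]: "io (\<sigma>\<lparr>ar := vupd (ar \<sigma>) B V a x\<rparr>) v Rs = io \<sigma> v Rs"
  by (simp add: io_def)

lemma io_mark: "io \<sigma> v Rs \<Longrightarrow> io (\<sigma>\<lparr>ar := (ar \<sigma>)(2 := (ar \<sigma> 2)(x := Suc 0))\<rparr>) v (insert x Rs)"
  by (auto simp: io_def)

lemma idx_lt: "i < nb \<Longrightarrow> j < b \<Longrightarrow> i * b + j < P"
proof -
  assume "i < nb" "j < b"
  then have "i * b + j < (i + 1) * b" by simp
  also have "\<dots> \<le> nb * b" using \<open>i < nb\<close> by (intro mult_le_mono1) simp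
  finally show ?thesis .
qed

lemma div_lt: "t < x * y \<Longrightarrow> t div y < (x::nat)" "t < x * y \<Longrightarrow> t mod y < (y::nat)"
  by (auto simp: less_mult_imp_div_less intro!: mod_less_divisor gr0I)

lemma wp_BRUTE_FORCE:
  assumes env: "env \<sigma>" and z: "vr \<sigma> 16 = z div nb" "vr \<sigma> 17 = z mod nb" "z < nb * nb" and io: "io \<sigma> v Rs"
  shows "wp BRUTE_FORCE (\<lambda>\<sigma>'. (\<forall>k. k \<notin> {20, 22} \<longrightarrow> vr \<sigma>' k = vr \<sigma> k) \<and> (\<forall>k. k \<noteq> 2 \<longrightarrow> ar \<sigma>' k = ar \<sigma> k) \<and>
     hin \<sigma>' = hin \<sigma> \<and> hout \<sigma>' = hout \<sigma> \<and> hpos \<sigma>' = hpos \<sigma> \<and> io \<sigma>' v (Rs \<union> new z v) \<and>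
     vr \<sigma>' 20 = (if new z v \<subseteq> Rs then vr \<sigma> 20 else 1) \<and> tm \<sigma>' \<le> tm \<sigma> + 120 * (b * b + 1)) \<sigma>"
proof -
  let ?I = "z div nb" and ?J = "z mod nb"
  define c where "c u \<longleftrightarrow> Mx (?I * b + u div b) (?J * b + u mod b) \<and> v (?J * b + u mod b)" for u
  define H where "H t = {?I * b + u div b | u. u < t \<and> c u}" for t
  have H_Suc: "H (Suc t) = H t \<union> (if c t then {?I * b + t div b} else {})" for t
    unfolding H_def by (auto simp: less_Suc_eq)
  have H_all: "H (b * b) = new z v"
  proof (intro equalityI subsetI)
    fix x assume "x \<in> H (b * b)"
    then show "x \<in> new z v" unfolding H_def new_def c_def using div_lt[of _ b b] by blast
  next
    fix x assume "x \<in> new z v"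
    then obtain i j where ij: "x = ?I * b + i" "i < b" "j < b" "Mx (?I * b + i) (?J * b + j)" "v (?J * b + j)"
      unfolding new_def by blast
    have "i * b + j < b * b"
    proof -
      have "i * b + j < (i + 1) * b" using ij(3) by simp
      also have "\<dots> \<le> b * b" using ij(2) by (intro mult_le_mono1) simp
      finally show ?thesis .
    qed
    then show "x \<in> H (b * b)" unfolding H_def c_def using ij
      by (intro CollectI exI[of _ "i * b + j"]) auto
  qed
  have IJ: "?I < nb" "?J < nb" using z(3) div_lt by auto
  define I where "I t \<sigma>' \<longleftrightarrow> (\<forall>k. k \<notin> {20, 22} \<longrightarrow> vr \<sigma>' k = vr \<sigma> k) \<and> (\<forall>k. k \<noteq> 2 \<longrightarrow> ar \<sigma>' k = ar \<sigma> k) \<and>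
     hin \<sigma>' = hin \<sigma> \<and> hout \<sigma>' = hout \<sigma> \<and> hpos \<sigma>' = hpos \<sigma> \<and> io \<sigma>' v (Rs \<union> H t) \<and>
     vr \<sigma>' 20 = (if H t \<subseteq> Rs then vr \<sigma> 20 else 1) \<and> tm \<sigma>' \<le> tm \<sigma> + 120 * t + 2" for t \<sigma>'
  show ?thesis
    unfolding BRUTE_FORCE_def
  proof (rule wp_for[where I = I and m = "b * b"])
    show "I 0 (\<sigma>\<lparr>vr := (vr \<sigma>)(22 := 0), tm := tm \<sigma> + 2\<rparr>)"
      using io by (simp add: I_def H_def io_def)
  next
    fix t \<sigma>1 assume t: "t < b * b" and I: "I t \<sigma>1" and v1: "vr \<sigma>1 22 = t"
    have ij: "t div b < b" "t mod b < b" using t div_lt by auto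
    have lt: "?I * b + t div b < P" "?J * b + t mod b < P" using idx_lt IJ ij by auto
    have vs: "vr \<sigma>1 16 = ?I" "vr \<sigma>1 17 = ?J" "vr \<sigma>1 2 = b" "vr \<sigma>1 7 = P"
      using I z env by (simp_all add: I_def env_def)
    have a0: "ar \<sigma>1 0 ((?I * b + t div b) * P + (?J * b + t mod b)) = of_bool (Mx (?I * b + t div b) (?J * b + t mod b))"
      using I env lt by (simp add: I_def env_def)
    have a1: "ar \<sigma>1 1 (?J * b + t mod b) = of_bool (v (?J * b + t mod b))"
      "ar \<sigma>1 2 (?I * b + t div b) = of_bool (?I * b + t div b \<in> Rs \<union> H t)"
    proof -
      have "io \<sigma>1 v (Rs \<union> H t)" using I unfolding I_def by blast
      then show "ar \<sigma>1 1 (?J * b + t mod b) = of_bool (v (?J * b + t mod b))"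
        "ar \<sigma>1 2 (?I * b + t div b) = of_bool (?I * b + t div b \<in> Rs \<union> H t)"
        using lt unfolding io_def by blast+
    qed
    define e where "e = MATRIX_ENTRY 22 [*] EA 1 (EV 17 [*] EV 2 [+] EV 22 [mod] EV 2) [*]
           (EC 1 [-] EA 2 (EV 16 [*] EV 2 [+] EV 22 [div] EV 2))"
    have ev: "(eval e \<sigma>1 \<noteq> 0) = (c t \<and> ?I * b + t div b \<notin> Rs \<union> H t)"
      unfolding e_def MATRIX_ENTRY_def using vs v1 a0 a1 by (auto simp: c_def)
    have et: "etime e \<le> 90" by (simp add: e_def MATRIX_ENTRY_def)
    note e = et ev
    let ?\<tau> = "\<sigma>1\<lparr>tm := tm \<sigma>1 + (etime (EV 2 [*] EV 2) + 3)\<rparr>"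
    show "wp (CIf (MATRIX_ENTRY 22 [*] EA 1 (EV 17 [*] EV 2 [+] EV 22 [mod] EV 2) [*]
           (EC 1 [-] EA 2 (EV 16 [*] EV 2 [+] EV 22 [div] EV 2)))
        (CStr 2 (EV 16 [*] EV 2 [+] EV 22 [div] EV 2) (EC 1) ;; CAsg 20 (EC 1)) CSkip)
       (\<lambda>\<sigma>'. vr \<sigma>' 22 = t \<and> I (Suc t) (\<sigma>'\<lparr>vr := (vr \<sigma>')(22 := Suc t), tm := tm \<sigma>' + 4\<rparr>)) ?\<tau>"
      unfolding e_def[symmetric]
    proof (rule wp_if)
      assume "eval e ?\<tau> \<noteq> 0"
      then have c: "c t" "?I * b + t div b \<notin> Rs \<union> H t" using e by simp_all
      then have "H (Suc t) = insert (?I * b + t div b) (H t)" "\<not> H (Suc t) \<subseteq> Rs" by (auto simp: H_Suc)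
      with c I vs v1 U_pos e show "wp (CStr 2 (EV 16 [*] EV 2 [+] EV 22 [div] EV 2) (EC 1) ;; CAsg 20 (EC 1))
        (\<lambda>\<sigma>'. vr \<sigma>' 22 = t \<and> I (Suc t) (\<sigma>'\<lparr>vr := (vr \<sigma>')(22 := Suc t), tm := tm \<sigma>' + 4\<rparr>))
        (?\<tau>\<lparr>tm := tm ?\<tau> + (etime e + 1)\<rparr>)"
        using io_mark[of \<sigma>1 v "Rs \<union> H t" "?I * b + t div b"] unfolding I_def
        by (intro wp_seq wp_str wp_asg) auto
    next
      assume "eval e ?\<tau> = 0"
      then have "\<not> c t \<or> ?I * b + t div b \<in> Rs \<union> H t" using e by simp
      then have r: "Rs \<union> H (Suc t) = Rs \<union> H t" "H (Suc t) \<subseteq> Rs \<longleftrightarrow> H t \<subseteq> Rs" by (auto simp: H_Suc)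
      show "wp CSkip (\<lambda>\<sigma>'. vr \<sigma>' 22 = t \<and> I (Suc t) (\<sigma>'\<lparr>vr := (vr \<sigma>')(22 := Suc t), tm := tm \<sigma>' + 4\<rparr>))
        (?\<tau>\<lparr>tm := tm ?\<tau> + (etime e + 1)\<rparr>)"
        using I v1 e unfolding I_def by (intro wp_skip) (simp add: r)
    qed
  next
    fix t \<sigma>1 assume "I t \<sigma>1"
    then show "eval (EV 2 [*] EV 2) \<sigma>1 = b * b" using env by (simp add: I_def env_def)
  next
    fix \<sigma>1 assume "I (b * b) \<sigma>1"
    then show "(\<forall>k. k \<notin> {20, 22} \<longrightarrow> vr (\<sigma>1\<lparr>tm := tm \<sigma>1 + (etime (EV 2 [*] EV 2) + 3)\<rparr>) k = vr \<sigma> k) \<and>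
      (\<forall>k. k \<noteq> 2 \<longrightarrow> ar (\<sigma>1\<lparr>tm := tm \<sigma>1 + (etime (EV 2 [*] EV 2) + 3)\<rparr>) k = ar \<sigma> k) \<and>
      hin (\<sigma>1\<lparr>tm := tm \<sigma>1 + (etime (EV 2 [*] EV 2) + 3)\<rparr>) = hin \<sigma> \<and>
      hout (\<sigma>1\<lparr>tm := tm \<sigma>1 + (etime (EV 2 [*] EV 2) + 3)\<rparr>) = hout \<sigma> \<and>
      hpos (\<sigma>1\<lparr>tm := tm \<sigma>1 + (etime (EV 2 [*] EV 2) + 3)\<rparr>) = hpos \<sigma> \<and>
      io (\<sigma>1\<lparr>tm := tm \<sigma>1 + (etime (EV 2 [*] EV 2) + 3)\<rparr>) v (Rs \<union> new z v) \<and>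
      vr (\<sigma>1\<lparr>tm := tm \<sigma>1 + (etime (EV 2 [*] EV 2) + 3)\<rparr>) 20 = (if new z v \<subseteq> Rs then vr \<sigma> 20 else 1) \<and>
      tm (\<sigma>1\<lparr>tm := tm \<sigma>1 + (etime (EV 2 [*] EV 2) + 3)\<rparr>) \<le> tm \<sigma> + 120 * (b * b + 1)"
      unfolding I_def H_all by simp
  qed (rule bounds(3))
qed

definition dead :: "(nat \<Rightarrow> nat \<Rightarrow> nat) \<Rightarrow> nat \<Rightarrow> nat \<Rightarrow> nat set" where
  "dead A z V = {r. r < R \<and> cell A z r V 2 \<noteq> 0}"

lemma finite_dead [simp]: "finite (dead A z V)"
  by (simp add: dead_def)

lemma card_dead: "card (dead A z V) \<le> R"
proof -
  have "dead A z V \<subseteq> {..<R}" by (auto simp: dead_def)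
  then show ?thesis using card_mono[of "{..<R}"] by fastforce
qed

text \<open>The first summand bounds one search, and 40 allows for marking the copy
  afterwards.\<close>

definition brute_force_cost :: nat where "brute_force_cost = 120 * (b * b + 1) + 40"

text \<open>After a hit only the crude bound of one search per copy is kept. Without a hit, each
  search newly marks the copy that caused it, so the searches are paid by the growth of
  \<open>dead\<close>. This accounting needs flag 15 to be clear, because a set flag causes a search
  for marked copies too. If the search never took place although a row is new, then no unmarked copy
  has said YES.\<close>

lemma wp_CHECK:
  assumes env: "env \<sigma>" and z: "vr \<sigma> 16 = z div nb" "vr \<sigma> 17 = z mod nb" "z < nb * nb" "vr \<sigma> 18 = z"
    and V: "vr \<sigma> 10 = V" and rep: "\<And>r. r < R \<Longrightarrow> rep (ar \<sigma>) (vr \<sigma> 15 \<noteq> 0) z V r es"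
    and io: "io \<sigma> v Rs" and h0: "vr \<sigma> 20 = 0"
  shows "wp CHECK (\<lambda>\<sigma>'. fr {8, 9, 11, 20, 22} {2} z \<sigma> \<sigma>' \<and> vr \<sigma>' 15 = vr \<sigma> 15 \<and>
      (\<forall>r<R. \<forall>a<S. ar \<sigma>' 5 (base z r + a) \<le> V) \<and>
      tm \<sigma>' \<le> tm \<sigma> + 150 * (R + 1) + brute_force_cost * R \<and>
      (\<exists>h. vr \<sigma>' 20 = of_bool h \<and> io \<sigma>' v (if h then Rs \<union> new z v else Rs) \<and> (h \<longrightarrow> \<not> new z v \<subseteq> Rs) \<and>
        (\<not> h \<longrightarrow> (\<forall>r<R. rep (ar \<sigma>') (vr \<sigma>' 15 \<noteq> 0) z V r es) \<and> dead (ar \<sigma>) z V \<subseteq> dead (ar \<sigma>') z V \<and>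
          (new z v \<subseteq> Rs \<or> vr \<sigma> 15 = 0 \<and> (\<forall>r<R. cell (ar \<sigma>) z r V 1 = 0 \<or> cell (ar \<sigma>) z r V 2 \<noteq> 0)) \<and>
          (vr \<sigma> 15 = 0 \<longrightarrow> tm \<sigma>' + brute_force_cost * card (dead (ar \<sigma>) z V) \<le> tm \<sigma> + brute_force_cost * card (dead (ar \<sigma>') z V) + 150 * (R + 1))))) \<sigma>"
proof -
  define K where "K i \<sigma>' h \<longleftrightarrow> vr \<sigma>' 20 = of_bool h \<and> io \<sigma>' v (if h then Rs \<union> new z v else Rs) \<and> (h \<longrightarrow> \<not> new z v \<subseteq> Rs) \<and>
        (\<not> h \<longrightarrow> (\<forall>r<R. rep (ar \<sigma>') (vr \<sigma>' 15 \<noteq> 0) z V r es) \<and> dead (ar \<sigma>) z V \<subseteq> dead (ar \<sigma>') z V \<and>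
          (new z v \<subseteq> Rs \<or> (\<forall>r<i. vr \<sigma> 15 = 0 \<and> (cell (ar \<sigma>) z r V 1 = 0 \<or> cell (ar \<sigma>) z r V 2 \<noteq> 0))) \<and>
          (vr \<sigma> 15 = 0 \<longrightarrow> tm \<sigma>' + brute_force_cost * card (dead (ar \<sigma>) z V) \<le> tm \<sigma> + brute_force_cost * card (dead (ar \<sigma>') z V) + 150 * i + 2))" for i \<sigma>' h
  define I where "I i \<sigma>' \<longleftrightarrow> fr {8, 9, 11, 20, 22} {2} z \<sigma> \<sigma>' \<and> vr \<sigma>' 15 = vr \<sigma> 15 \<and>
      (\<forall>r<R. \<forall>a<S. ar \<sigma>' 5 (base z r + a) \<le> V) \<and>
      (\<forall>r a. i \<le> r \<longrightarrow> r < R \<longrightarrow> a < S \<longrightarrow> cell (ar \<sigma>') z r V a = cell (ar \<sigma>) z r V a) \<and>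
      tm \<sigma>' \<le> tm \<sigma> + 2 + 150 * i + brute_force_cost * i \<and> (\<exists>h. K i \<sigma>' h)" for i \<sigma>'
  have I_intro: "I i \<sigma>'"
    if "fr {8, 9, 11, 20, 22} {2} z \<sigma> \<sigma>'" "vr \<sigma>' 15 = vr \<sigma> 15" "\<forall>r<R. \<forall>a<S. ar \<sigma>' 5 (base z r + a) \<le> V"
      "\<And>r a. i \<le> r \<Longrightarrow> r < R \<Longrightarrow> a < S \<Longrightarrow> cell (ar \<sigma>') z r V a = cell (ar \<sigma>) z r V a"
      "tm \<sigma>' \<le> tm \<sigma> + 2 + 150 * i + brute_force_cost * i" "vr \<sigma>' 20 = of_bool h" "io \<sigma>' v (if h then Rs \<union> new z v else Rs)"
      "h \<Longrightarrow> \<not> new z v \<subseteq> Rs" "\<not> h \<Longrightarrow> \<forall>r<R. rep (ar \<sigma>') (vr \<sigma>' 15 \<noteq> 0) z V r es"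
      "\<not> h \<Longrightarrow> dead (ar \<sigma>) z V \<subseteq> dead (ar \<sigma>') z V"
      "\<not> h \<Longrightarrow> new z v \<subseteq> Rs \<or> (\<forall>r<i. vr \<sigma> 15 = 0 \<and> (cell (ar \<sigma>) z r V 1 = 0 \<or> cell (ar \<sigma>) z r V 2 \<noteq> 0))"
      "\<not> h \<Longrightarrow> vr \<sigma> 15 = 0 \<Longrightarrow> tm \<sigma>' + brute_force_cost * card (dead (ar \<sigma>) z V) \<le> tm \<sigma> + brute_force_cost * card (dead (ar \<sigma>') z V) + 150 * i + 2"
    for i \<sigma>' h
    unfolding I_def
  proof (intro conjI exI[of _ h])
    show "K i \<sigma>' h" unfolding K_def using that(6-12) by blast
  qed (use that in blast)+
  have ver: "ar \<sigma> 5 (base z r + a) \<le> V" if "r < R" "a < S" for r a using rep that by (simp add: rep_def)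
  show ?thesis
    unfolding CHECK_def
  proof (rule wp_for[where I = I and m = R])
    show "I 0 (\<sigma>\<lparr>vr := (vr \<sigma>)(11 := 0), tm := tm \<sigma> + 2\<rparr>)"
      by (rule I_intro[where h = False]) (use rep io h0 ver in \<open>auto simp: fr_def io_def\<close>)
  next
    fix i \<sigma>1 assume i: "i < R" and I: "I i \<sigma>1" and v1: "vr \<sigma>1 11 = i"
    have fr1: "fr {8, 9, 11, 20, 22} {2} z \<sigma> \<sigma>1" and bad1: "vr \<sigma>1 15 = vr \<sigma> 15"
      and ver1: "\<forall>r<R. \<forall>a<S. ar \<sigma>1 5 (base z r + a) \<le> V"
      and cell1: "\<And>r a. i \<le> r \<Longrightarrow> r < R \<Longrightarrow> a < S \<Longrightarrow> cell (ar \<sigma>1) z r V a = cell (ar \<sigma>) z r V a"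
      and t1: "tm \<sigma>1 \<le> tm \<sigma> + 2 + 150 * i + brute_force_cost * i"
      using I unfolding I_def by blast+
    obtain h where K: "K i \<sigma>1 h" using I unfolding I_def by blast
    have h: "vr \<sigma>1 20 = of_bool h" "io \<sigma>1 v (if h then Rs \<union> new z v else Rs)" "h \<Longrightarrow> \<not> new z v \<subseteq> Rs"
      and h': "\<not> h \<Longrightarrow> \<forall>r<R. rep (ar \<sigma>1) (vr \<sigma>1 15 \<noteq> 0) z V r es"
      "\<not> h \<Longrightarrow> dead (ar \<sigma>) z V \<subseteq> dead (ar \<sigma>1) z V"
      "\<not> h \<Longrightarrow> new z v \<subseteq> Rs \<or> (\<forall>r<i. vr \<sigma> 15 = 0 \<and> (cell (ar \<sigma>) z r V 1 = 0 \<or> cell (ar \<sigma>) z r V 2 \<noteq> 0))"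
      "\<not> h \<Longrightarrow> vr \<sigma> 15 = 0 \<Longrightarrow> tm \<sigma>1 + brute_force_cost * card (dead (ar \<sigma>) z V) \<le> tm \<sigma> + brute_force_cost * card (dead (ar \<sigma>1) z V) + 150 * i + 2"
      using K unfolding K_def by blast+
    have env1: "env \<sigma>1" using env_fr[OF env fr1] by simp
    have z1: "vr \<sigma>1 18 = z" "vr \<sigma>1 10 = V" "vr \<sigma>1 16 = z div nb" "vr \<sigma>1 17 = z mod nb" "vr \<sigma>1 5 = R" "vr \<sigma>1 3 = S"
      using fr_vr[OF fr1] z V env1 by (simp_all add: env_def)
    let ?e = "EV 15 [+] READ_CELL (EC 1) [*] (EC 1 [-] READ_CELL (EC 2))"
    let ?Q = "\<lambda>\<sigma>'. vr \<sigma>' 11 = i \<and> I (Suc i) (\<sigma>'\<lparr>vr := (vr \<sigma>')(11 := Suc i), tm := tm \<sigma>' + 4\<rparr>)"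
    define \<sigma>2 where "\<sigma>2 = \<sigma>1\<lparr>vr := (vr \<sigma>1)(8 := base z i, 9 := i * S), tm := tm \<sigma>1 + 18\<rparr>"
    have fr2: "fr {8, 9, 11, 20, 22} {2} z \<sigma> \<sigma>2" using fr1 by (simp add: fr_def \<sigma>2_def)
    have env2: "env \<sigma>2" using env1 by (simp add: env_def \<sigma>2_def)
    have vm2: "vm \<sigma>2 a = cell (ar \<sigma>1) z i V a" for a using z1 by (simp add: \<sigma>2_def)
    have et: "etime ?e = 87" by simp
    have "wp (CIf ?e (BRUTE_FORCE ;; CIf (EV 20) CSkip (WRITE_CELL (EC 2) (EC 1))) CSkip) ?Q \<sigma>2"
    proof (rule wp_if)
      assume c: "eval ?e \<sigma>2 \<noteq> 0"
      then have cc: "vr \<sigma> 15 \<noteq> 0 \<or> cell (ar \<sigma>1) z i V 1 \<noteq> 0 \<and> cell (ar \<sigma>1) z i V 2 = 0"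
        using vm2 bad1 by (auto simp: \<sigma>2_def)
      let ?\<rho> = "\<sigma>2\<lparr>tm := tm \<sigma>2 + (etime ?e + 1)\<rparr>"
      have w: "wp BRUTE_FORCE (\<lambda>\<sigma>'. (\<forall>k. k \<notin> {20, 22} \<longrightarrow> vr \<sigma>' k = vr ?\<rho> k) \<and> (\<forall>k. k \<noteq> 2 \<longrightarrow> ar \<sigma>' k = ar ?\<rho> k) \<and>
         hin \<sigma>' = hin ?\<rho> \<and> hout \<sigma>' = hout ?\<rho> \<and> hpos \<sigma>' = hpos ?\<rho> \<and>
         io \<sigma>' v ((if h then Rs \<union> new z v else Rs) \<union> new z v) \<and>
         vr \<sigma>' 20 = (if new z v \<subseteq> (if h then Rs \<union> new z v else Rs) then vr ?\<rho> 20 else 1) \<and>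
         tm \<sigma>' \<le> tm ?\<rho> + 120 * (b * b + 1)) ?\<rho>"
      proof (rule wp_BRUTE_FORCE)
        show "env ?\<rho>" using env2 by (simp add: env_def)
        show "io ?\<rho> v (if h then Rs \<union> new z v else Rs)" using h(2) by (simp add: \<sigma>2_def)
      qed (use z z1 in \<open>simp_all add: \<sigma>2_def\<close>)
      show "wp (BRUTE_FORCE ;; CIf (EV 20) CSkip (WRITE_CELL (EC 2) (EC 1))) ?Q ?\<rho>"
      proof (rule wp_seq, rule wp_mono[OF w])
        fix \<sigma>3 assume a: "(\<forall>k. k \<notin> {20, 22} \<longrightarrow> vr \<sigma>3 k = vr ?\<rho> k) \<and> (\<forall>k. k \<noteq> 2 \<longrightarrow> ar \<sigma>3 k = ar ?\<rho> k) \<and>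
         hin \<sigma>3 = hin ?\<rho> \<and> hout \<sigma>3 = hout ?\<rho> \<and> hpos \<sigma>3 = hpos ?\<rho> \<and>
         io \<sigma>3 v ((if h then Rs \<union> new z v else Rs) \<union> new z v) \<and>
         vr \<sigma>3 20 = (if new z v \<subseteq> (if h then Rs \<union> new z v else Rs) then vr ?\<rho> 20 else 1) \<and>
         tm \<sigma>3 \<le> tm ?\<rho> + 120 * (b * b + 1)"
        have io3: "io \<sigma>3 v ((if h then Rs \<union> new z v else Rs) \<union> new z v)" using a by blast
        have A: "ar \<sigma>3 4 = ar \<sigma>1 4" "ar \<sigma>3 5 = ar \<sigma>1 5" using a by (simp_all add: \<sigma>2_def)
        have t3: "tm \<sigma>3 \<le> tm \<sigma>1 + 106 + 120 * (b * b + 1)" using a by (simp add: \<sigma>2_def)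
        have v3: "vr \<sigma>3 11 = i" "vr \<sigma>3 8 = base z i" "vr \<sigma>3 9 = i * S" "vr \<sigma>3 10 = V" "vr \<sigma>3 15 = vr \<sigma> 15"
          using a v1 z1 bad1 by (simp_all add: \<sigma>2_def)
        have "fr {8, 9, 11, 20, 22} {2} z \<sigma>2 \<sigma>3" using a bad1 by (auto simp: fr_def)
        with fr2 have fr3: "fr {8, 9, 11, 20, 22} {2} z \<sigma> \<sigma>3" by (rule fr_trans)
        have c3: "vmem (ar \<sigma>3) = vmem (ar \<sigma>1)" using A by (simp add: vmem_def fun_eq_iff)
        show "wp (CIf (EV 20) CSkip (WRITE_CELL (EC 2) (EC 1))) ?Q \<sigma>3"
        proof (rule wp_if)
          assume "eval (EV 20) \<sigma>3 \<noteq> 0"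
          then have nn: "\<not> new z v \<subseteq> Rs" and v20: "vr \<sigma>3 20 = 1"
            using a h by (auto simp: \<sigma>2_def split: if_splits)
          let ?\<sigma> = "\<sigma>3\<lparr>tm := tm \<sigma>3 + (etime (EV 20) + 1), tm := tm (\<sigma>3\<lparr>tm := tm \<sigma>3 + (etime (EV 20) + 1)\<rparr>) + 1\<rparr>"
          have "I (Suc i) (?\<sigma>\<lparr>vr := (vr ?\<sigma>)(11 := Suc i), tm := tm ?\<sigma> + 4\<rparr>)"
          proof (rule I_intro[where h = True])
            show "fr {8, 9, 11, 20, 22} {2} z \<sigma> (?\<sigma>\<lparr>vr := (vr ?\<sigma>)(11 := Suc i), tm := tm ?\<sigma> + 4\<rparr>)"
              using fr3 by (simp add: fr_def)
            show "io (?\<sigma>\<lparr>vr := (vr ?\<sigma>)(11 := Suc i), tm := tm ?\<sigma> + 4\<rparr>) v (if True then Rs \<union> new z v else Rs)"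
              using io3 by (cases h) (simp_all add: Un_assoc)
            show "tm (?\<sigma>\<lparr>vr := (vr ?\<sigma>)(11 := Suc i), tm := tm ?\<sigma> + 4\<rparr>) \<le> tm \<sigma> + 2 + 150 * Suc i + brute_force_cost * Suc i"
              using t1 t3 by (simp add: brute_force_cost_def)
          qed (use v3 ver1 A c3 cell1 v20 nn in simp_all)
          then show "wp CSkip ?Q (\<sigma>3\<lparr>tm := tm \<sigma>3 + (etime (EV 20) + 1)\<rparr>)" using v3 by (intro wp_skip) simp
        next
          assume "eval (EV 20) \<sigma>3 = 0"
          then have hF: "\<not> h" and nn: "new z v \<subseteq> Rs"
            using a h by (auto simp: \<sigma>2_def split: if_splits)
          have v20: "vr \<sigma>3 20 = 0" using \<open>eval (EV 20) \<sigma>3 = 0\<close> by simp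
          let ?A = "vupd (ar \<sigma>3) (base z i) V 2 (Suc 0)"
          let ?\<sigma> = "\<sigma>3\<lparr>ar := ?A, tm := tm \<sigma>3 + 20\<rparr>"
          have vv: "vmem ?A (base z i) (i * S) V a = (if a = 2 then 1 else cell (ar \<sigma>1) z i V a)" if "a < S" for a
            using vmem_vupd[of "base z i" "i * S" S 2 a "ar \<sigma>3" V "Suc 0"] base_ge[OF i, of z] that c3 by simp
          have out: "?A 4 x = ar \<sigma>1 4 x \<and> ?A 5 x = ar \<sigma>1 5 x" if "x < base z i \<or> base z i + S \<le> x" for x
            using that A by (auto simp: vupd_def)
          have f5: "fr {8, 9, 11, 20, 22} {2} z \<sigma> (\<sigma>3\<lparr>ar := ?A, vr := g, tm := t\<rparr>)"
            if "\<And>v. v \<notin> {8, 9, 11, 20, 22} \<Longrightarrow> g v = vr \<sigma>3 v" for g t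
          proof -
            have "?A 4 x = ar \<sigma> 4 x \<and> ?A 5 x = ar \<sigma> 5 x" if "\<forall>r<R. x < base z r \<or> base z r + S \<le> x" for x
              using out[of x] that i fr1 unfolding fr_def by metis
            then show ?thesis using fr3 that by (simp add: fr_def)
          qed
          have rest: "cell ?A z r V a = cell (ar \<sigma>1) z r V a" "rep (ar \<sigma>1) bd z V r es \<Longrightarrow> rep ?A bd z V r es"
            if r: "r < R" "r \<noteq> i" and "a < S" for r a bd
          proof -
            have 1: "base z r + a < base z i \<or> base z i + S \<le> base z r + a" if "a < S" for a
              unfolding base_def using r i that base_inj[of r i z z] by (intro area_disjoint) auto
            have 2: "r * S + a < base z i" if "a < S" for a
            proof -
              have "(r + 1) * S \<le> ((z + 1) * R + i) * S" using r(1) by (intro mult_le_mono1) simp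
              then show ?thesis using that unfolding base_def by simp
            qed
            note c = rep_cong[of ?A z r "ar \<sigma>1" bd bd, OF _ _ _ impI]
            show "cell ?A z r V a = cell (ar \<sigma>1) z r V a"
              using out 1 2 \<open>a < S\<close> by (intro c(1)) blast+
            show "rep (ar \<sigma>1) bd z V r es \<Longrightarrow> rep ?A bd z V r es"
              using out 1 2 by (intro c(2)) blast+
          qed
          have ri: "rep (ar \<sigma>1) (vr \<sigma> 15 \<noteq> 0) z V i es" using h'(1)[OF hF] i bad1 by simp
          \<comment> \<open>A nonzero cell 1 excludes both the empty sequence and the answer NO, so
            \<open>es\<close> itself is the prefix that kills the copy.\<close>
          have k: "vr \<sigma> 15 \<noteq> 0 \<or> killed i es"
          proof (cases "vr \<sigma> 15 = 0")
            case True
            then have c1: "cell (ar \<sigma>1) z i V 1 \<noteq> 0" using cc by simp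
            then have ne: "es \<noteq> []" using ri by (auto simp: rep_def)
            have "outp (st i es) \<noteq> [0]" using ri c1 ne by (auto simp: rep_def)
            with ne show ?thesis unfolding killed_def by blast
          qed simp
          have ver5: "\<forall>r<R. \<forall>a<S. ?A 5 (base z r + a) \<le> V"
            using ver1 A by (auto simp: vupd_def)
          have ri': "rep ?A (vr \<sigma> 15 \<noteq> 0) z V i es"
            unfolding rep_def
          proof (intro conjI)
            show "\<forall>a<S0. cell ?A z i V (a + 3) = mem (st i es) a" using ri by (simp add: vv rep_def)
          qed (use ri k ver5 i in \<open>simp_all add: vv rep_def\<close>)
          have rep5: "\<forall>r<R. rep ?A (vr \<sigma> 15 \<noteq> 0) z V r es"
          proof (intro allI impI)
            fix r assume "r < R"
            then show "rep ?A (vr \<sigma> 15 \<noteq> 0) z V r es"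
              using ri' rest(2)[of r 0] h'(1)[OF hF] bad1 by (cases "r = i") auto
          qed
          have dead5: "dead ?A z V = insert i (dead (ar \<sigma>1) z V)"
          proof -
            have "cell ?A z r V 2 = (if r = i then Suc 0 else cell (ar \<sigma>1) z r V 2)" if "r < R" for r
              using rest(1)[OF that, of 2] vv[of 2] by simp
            then show ?thesis unfolding dead_def using i by auto
          qed
          \<comment> \<open>With flag 15 clear the search was triggered by an unmarked copy, so
            marking it enlarges the set.\<close>
          have card5: "vr \<sigma> 15 = 0 \<Longrightarrow> card (dead ?A z V) = Suc (card (dead (ar \<sigma>1) z V))"
            using cc unfolding dead5 by (subst card_insert_disjoint) (auto simp: dead_def)
          have "I (Suc i) (?\<sigma>\<lparr>vr := (vr ?\<sigma>)(11 := Suc i), tm := tm ?\<sigma> + 4\<rparr>)"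
          proof (rule I_intro[where h = False])
            show "fr {8, 9, 11, 20, 22} {2} z \<sigma> (?\<sigma>\<lparr>vr := (vr ?\<sigma>)(11 := Suc i), tm := tm ?\<sigma> + 4\<rparr>)"
              using f5[of "(vr \<sigma>3)(11 := Suc i)" "tm ?\<sigma> + 4"] by simp
            show "cell (ar (?\<sigma>\<lparr>vr := (vr ?\<sigma>)(11 := Suc i), tm := tm ?\<sigma> + 4\<rparr>)) z r V a = cell (ar \<sigma>) z r V a"
              if "Suc i \<le> r" "r < R" "a < S" for r a
              using rest(1)[of r a] cell1[of r a] that by simp
            show "io (?\<sigma>\<lparr>vr := (vr ?\<sigma>)(11 := Suc i), tm := tm ?\<sigma> + 4\<rparr>) v (if False then Rs \<union> new z v else Rs)"
              using io3 hF nn by (simp add: Un_absorb2)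
            show "tm (?\<sigma>\<lparr>vr := (vr ?\<sigma>)(11 := Suc i), tm := tm ?\<sigma> + 4\<rparr>) \<le> tm \<sigma> + 2 + 150 * Suc i + brute_force_cost * Suc i"
              using t1 t3 by (simp add: brute_force_cost_def)
            show "dead (ar \<sigma>) z V \<subseteq> dead (ar (?\<sigma>\<lparr>vr := (vr ?\<sigma>)(11 := Suc i), tm := tm ?\<sigma> + 4\<rparr>)) z V"
              using h'(2)[OF hF] dead5 by auto
            show "tm (?\<sigma>\<lparr>vr := (vr ?\<sigma>)(11 := Suc i), tm := tm ?\<sigma> + 4\<rparr>) + brute_force_cost * card (dead (ar \<sigma>) z V)
              \<le> tm \<sigma> + brute_force_cost * card (dead (ar (?\<sigma>\<lparr>vr := (vr ?\<sigma>)(11 := Suc i), tm := tm ?\<sigma> + 4\<rparr>)) z V) + 150 * Suc i + 2"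
              if "vr \<sigma> 15 = 0" using h'(4)[OF hF that] t3 card5[OF that] by (simp add: brute_force_cost_def)
          qed (use v3 ver5 v20 nn rep5 in simp_all)
          then show "wp (WRITE_CELL (EC 2) (EC 1)) ?Q (\<sigma>3\<lparr>tm := tm \<sigma>3 + (etime (EV 20) + 1)\<rparr>)"
            using v3 U_pos by (intro wp_WRITE_CELL) (simp_all add: add.commute)
        qed
      qed
    next
      assume "eval ?e \<sigma>2 = 0"
      then have cc: "vr \<sigma> 15 = 0" "cell (ar \<sigma>1) z i V 1 = 0 \<or> cell (ar \<sigma>1) z i V 2 \<noteq> 0"
        using vm2 bad1 by (auto simp: \<sigma>2_def)
      then have cc': "cell (ar \<sigma>) z i V 1 = 0 \<or> cell (ar \<sigma>) z i V 2 \<noteq> 0"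
        using cell1[of i 1] cell1[of i 2] i by simp
      let ?\<sigma> = "\<sigma>2\<lparr>tm := tm \<sigma>2 + (etime ?e + 1), tm := tm (\<sigma>2\<lparr>tm := tm \<sigma>2 + (etime ?e + 1)\<rparr>) + 1\<rparr>"
      have "I (Suc i) (?\<sigma>\<lparr>vr := (vr ?\<sigma>)(11 := Suc i), tm := tm ?\<sigma> + 4\<rparr>)"
      proof (rule I_intro[where h = h])
        show "fr {8, 9, 11, 20, 22} {2} z \<sigma> (?\<sigma>\<lparr>vr := (vr ?\<sigma>)(11 := Suc i), tm := tm ?\<sigma> + 4\<rparr>)"
          using fr2 by (simp add: fr_def)
        show "io (?\<sigma>\<lparr>vr := (vr ?\<sigma>)(11 := Suc i), tm := tm ?\<sigma> + 4\<rparr>) v (if h then Rs \<union> new z v else Rs)"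
          using h(2) by (simp add: \<sigma>2_def)
        show "new z v \<subseteq> Rs \<or> (\<forall>r<Suc i. vr \<sigma> 15 = 0 \<and> (cell (ar \<sigma>) z r V 1 = 0 \<or> cell (ar \<sigma>) z r V 2 \<noteq> 0))"
          if "\<not> h" using h'(3)[OF that] cc' cc(1) by (auto simp: less_Suc_eq)
        show "tm (?\<sigma>\<lparr>vr := (vr ?\<sigma>)(11 := Suc i), tm := tm ?\<sigma> + 4\<rparr>) + brute_force_cost * card (dead (ar \<sigma>) z V)
              \<le> tm \<sigma> + brute_force_cost * card (dead (ar (?\<sigma>\<lparr>vr := (vr ?\<sigma>)(11 := Suc i), tm := tm ?\<sigma> + 4\<rparr>)) z V) + 150 * Suc i + 2"
              if "\<not> h" "vr \<sigma> 15 = 0" using h'(4)[OF that] by (simp add: \<sigma>2_def)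
      qed (use bad1 ver1 cell1 t1 h(1,3) h'(1,2) in \<open>simp_all add: \<sigma>2_def\<close>)
      then show "wp CSkip ?Q (\<sigma>2\<lparr>tm := tm \<sigma>2 + (etime ?e + 1)\<rparr>)"
        using v1 by (intro wp_skip) (simp add: \<sigma>2_def)
    qed
    then show "wp (SET_BASES ;; CIf ?e (BRUTE_FORCE ;; CIf (EV 20) CSkip (WRITE_CELL (EC 2) (EC 1))) CSkip) ?Q (\<sigma>1\<lparr>tm := tm \<sigma>1 + (etime (EV 5) + 3)\<rparr>)"
      using z1 v1 z(3) i by (intro wp_seq wp_SET_BASES[of _ z i]) (simp_all add: \<sigma>2_def add.commute)
  next
    fix i \<sigma>1 assume "I i \<sigma>1"
    then have "env \<sigma>1" using env_fr[OF env, of "{8, 9, 11, 20, 22}" "{2}" z \<sigma>1] by (simp add: I_def)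
    then show "eval (EV 5) \<sigma>1 = R" by (simp add: env_def)
  next
    fix \<sigma>1 assume I: "I R \<sigma>1"
    let ?\<sigma> = "\<sigma>1\<lparr>tm := tm \<sigma>1 + (etime (EV 5) + 3)\<rparr>"
    obtain h where K: "K R \<sigma>1 h" using I unfolding I_def by blast
    have h: "vr \<sigma>1 20 = of_bool h" "io \<sigma>1 v (if h then Rs \<union> new z v else Rs)" "h \<Longrightarrow> \<not> new z v \<subseteq> Rs"
      "\<not> h \<Longrightarrow> \<forall>r<R. rep (ar \<sigma>1) (vr \<sigma>1 15 \<noteq> 0) z V r es"
      "\<not> h \<Longrightarrow> dead (ar \<sigma>) z V \<subseteq> dead (ar \<sigma>1) z V"
      "\<not> h \<Longrightarrow> new z v \<subseteq> Rs \<or> vr \<sigma> 15 = 0 \<and> (\<forall>r<R. cell (ar \<sigma>) z r V 1 = 0 \<or> cell (ar \<sigma>) z r V 2 \<noteq> 0)"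
      "\<not> h \<Longrightarrow> vr \<sigma> 15 = 0 \<Longrightarrow> tm \<sigma>1 + brute_force_cost * card (dead (ar \<sigma>) z V) \<le> tm \<sigma> + brute_force_cost * card (dead (ar \<sigma>1) z V) + 150 * R + 2"
      using K R1 Suc_le_eq[of 0 R] unfolding K_def One_nat_def by blast+
    have I': "fr {8, 9, 11, 20, 22} {2} z \<sigma> \<sigma>1" "vr \<sigma>1 15 = vr \<sigma> 15" "\<forall>r<R. \<forall>a<S. ar \<sigma>1 5 (base z r + a) \<le> V"
      "tm \<sigma>1 \<le> tm \<sigma> + 2 + 150 * R + brute_force_cost * R" using I unfolding I_def by blast+
    show "fr {8, 9, 11, 20, 22} {2} z \<sigma> ?\<sigma> \<and> vr ?\<sigma> 15 = vr \<sigma> 15 \<and>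
      (\<forall>r<R. \<forall>a<S. ar ?\<sigma> 5 (base z r + a) \<le> V) \<and> tm ?\<sigma> \<le> tm \<sigma> + 150 * (R + 1) + brute_force_cost * R \<and>
      (\<exists>h. vr ?\<sigma> 20 = of_bool h \<and> io ?\<sigma> v (if h then Rs \<union> new z v else Rs) \<and> (h \<longrightarrow> \<not> new z v \<subseteq> Rs) \<and>
        (\<not> h \<longrightarrow> (\<forall>r<R. rep (ar ?\<sigma>) (vr ?\<sigma> 15 \<noteq> 0) z V r es) \<and> dead (ar \<sigma>) z V \<subseteq> dead (ar ?\<sigma>) z V \<and>
          (new z v \<subseteq> Rs \<or> vr \<sigma> 15 = 0 \<and> (\<forall>r<R. cell (ar \<sigma>) z r V 1 = 0 \<or> cell (ar \<sigma>) z r V 2 \<noteq> 0)) \<and>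
          (vr \<sigma> 15 = 0 \<longrightarrow> tm ?\<sigma> + brute_force_cost * card (dead (ar \<sigma>) z V) \<le> tm \<sigma> + brute_force_cost * card (dead (ar ?\<sigma>) z V) + 150 * (R + 1))))"
    proof (intro conjI exI[of _ h] impI)
      show "io ?\<sigma> v (if h then Rs \<union> new z v else Rs)" using h(2) by simp
      show "tm ?\<sigma> + brute_force_cost * card (dead (ar \<sigma>) z V) \<le> tm \<sigma> + brute_force_cost * card (dead (ar ?\<sigma>) z V) + 150 * (R + 1)"
        if "\<not> h" "vr \<sigma> 15 = 0" using h(7)[OF that] by simp
    qed (use h I' in simp_all)
  qed (rule bounds(4))
qed

end

section \<open>One step of a block\<close>

text \<open>The matrix edges are inserted together with the first query vertex of a version, so a
  rollback itself costs constant time.\<close>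

definition BLOCK_BODY :: "com \<Rightarrow> cmd" where
  "BLOCK_BODY upd = CIf (EV 19 [=] EC 0)
       (INSERT_ALL upd (EV 2 [*] EV 2) (MATRIX_ENTRY 21) (EV 21 [div] EV 2) (EV 2 [+] EV 21 [mod] EV 2)) CSkip ;;
     INSERT_ALL upd (EV 2) (EC 1 [-] EA 2 (EV 16 [*] EV 2 [+] EV 21)) (EV 21) (EV 2 [+] EV 2 [+] EV 19) ;;
     INSERT_ALL upd (EV 2) (EA 1 (EV 17 [*] EV 2 [+] EV 21)) (EV 2 [+] EV 21) (EV 2 [+] EV 2 [+] EV 19) ;;
     CHECK ;; CIf (EV 20 [+] (EV 19 [+] EC 1 [=] EV 2)) (CStr 6 (EV 18) (EV 10) ;; CStr 7 (EV 18) (EC 0))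
       (CStr 7 (EV 18) (EV 19 [+] EC 1))"

text \<open>Array 6 holds the last retired version, and the live version is its successor. Cells
  never written carry version 0 and are therefore stale from the beginning, so the live areas need
  no initialisation.\<close>

definition BLOCK :: "com \<Rightarrow> cmd" where
  "BLOCK upd = CAsg 16 (EV 18 [div] EV 6) ;; CAsg 17 (EV 18 [mod] EV 6) ;; CAsg 19 (EA 7 (EV 18)) ;;
     CAsg 10 (EA 6 (EV 18) [+] EC 1) ;; CAsg 20 (EC 0) ;; BLOCK_BODY upd"

context red
begin

text \<open>Vertices below \<open>b\<close> are the rows of the block, the next \<open>b\<close> its
  columns and the last \<open>b\<close> the query vertices.\<close>

definition mlist :: "nat \<Rightarrow> (nat \<times> nat) list" where
  "mlist z = edge_list (\<lambda>t. (t div b, b + t mod b)) (\<lambda>t. Mx (z div nb * b + t div b) (z mod nb * b + t mod b)) (b * b)"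

definition ulist :: "nat \<Rightarrow> nat set \<Rightarrow> nat \<Rightarrow> (nat \<times> nat) list" where
  "ulist z Rs q = edge_list (\<lambda>i. (i, 2 * b + q)) (\<lambda>i. z div nb * b + i \<notin> Rs) b"

definition vlist :: "nat \<Rightarrow> (nat \<Rightarrow> bool) \<Rightarrow> nat \<Rightarrow> (nat \<times> nat) list" where
  "vlist z v q = edge_list (\<lambda>j. (b + j, 2 * b + q)) (\<lambda>j. v (z mod nb * b + j)) b"

text \<open>The sequence in the middle of a step: all edges of the query vertex are in, and it is
  not yet decided whether to roll back.\<close>

definition mid :: "nat \<Rightarrow> (nat \<Rightarrow> bool) \<Rightarrow> nat set \<Rightarrow> nat \<Rightarrow> (nat \<times> nat) list \<Rightarrow> (nat \<times> nat) list" where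
  "mid z v Rs q es = ((es @ (if q = 0 then mlist z else [])) @ ulist z Rs q) @ vlist z v q"

definition wf :: "nat \<Rightarrow> (nat \<times> nat) list \<Rightarrow> bool" where
  "wf q es \<longleftrightarrow> distinct es \<and> (\<forall>p\<in>set es. fst p < snd p \<and> fst p < 2 * b \<and> snd p < 2 * b + q)"

lemma wf_ins: "wf q es \<Longrightarrow> q \<le> b \<Longrightarrow> insertions N {} es"
  using bN by (intro insertionsI) (force simp: wf_def)+

text \<open>The edges for the query contain the vertex \<open>2 * b + q\<close>, which no older edge
  contains, and matrix edges are added to the empty sequence only.\<close>

lemma wf_mid:
  assumes "wf q es" "q = 0 \<longrightarrow> es = []"
  shows "wf (Suc q) (mid z v Rs q es)"
proof -
  have m: "distinct (mlist z)"
  proof -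
    have "inj (\<lambda>t. (t div b, b + t mod b))"
      by (rule injI) (metis add_left_cancel div_mult_mod_eq prod.inject)
    then show ?thesis unfolding mlist_def edge_list_def distinct_map by (auto intro: inj_on_subset)
  qed
  have ms: "fst p < b \<and> b \<le> snd p \<and> snd p < 2 * b" if "p \<in> set (mlist z)" for p
    using that b1 div_lt[of _ b b] by (auto simp: mlist_def edge_list_def)
  have us: "fst p < b \<and> snd p = 2 * b + q" if "p \<in> set (ulist z Rs q)" for p
    using that by (auto simp: ulist_def edge_list_def)
  have vs: "b \<le> fst p \<and> fst p < 2 * b \<and> snd p = 2 * b + q" if "p \<in> set (vlist z v q)" for p
    using that by (auto simp: vlist_def edge_list_def)
  have u: "distinct (ulist z Rs q)" "distinct (vlist z v q)"
    by (auto simp: ulist_def vlist_def edge_list_def distinct_map inj_on_def)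
  have e: "snd p < 2 * b + q" if "p \<in> set es" for p using assms that by (auto simp: wf_def)
  show ?thesis
    unfolding wf_def mid_def
  proof (intro conjI ballI)
    show "distinct (((es @ (if q = 0 then mlist z else [])) @ ulist z Rs q) @ vlist z v q)"
    proof -
      have A: "snd p < 2 * b + q" if "p \<in> set (es @ (if q = 0 then mlist z else []))" for p
        using that e[of p] ms[of p] by (auto split: if_splits)
      have "set (es @ (if q = 0 then mlist z else [])) \<inter> set (ulist z Rs q) = {}"
        using A us by (metis disjoint_iff less_irrefl)
      moreover have "set (es @ (if q = 0 then mlist z else [])) \<inter> set (vlist z v q) = {}"
        using A vs by (metis disjoint_iff less_irrefl)
      moreover have "set (ulist z Rs q) \<inter> set (vlist z v q) = {}"
        using us vs by (metis disjoint_iff not_le)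
      moreover have "distinct (es @ (if q = 0 then mlist z else []))"
        using assms m by (auto simp: wf_def)
      ultimately show ?thesis using u by (auto simp: Int_Un_distrib2)
    qed
    fix p assume "p \<in> set (((es @ (if q = 0 then mlist z else [])) @ ulist z Rs q) @ vlist z v q)"
    then have "p \<in> set es \<or> p \<in> set (mlist z) \<or> p \<in> set (ulist z Rs q) \<or> p \<in> set (vlist z v q)"
      by (auto split: if_splits)
    then show "fst p < snd p" "fst p < 2 * b" "snd p < 2 * b + Suc q"
      using ms[of p] us[of p] vs[of p] assms(1) b1 by (auto simp: wf_def)
  qed
qed

definition block_state :: "hst \<Rightarrow> nat \<Rightarrow> nat \<Rightarrow> (nat \<times> nat) list \<Rightarrow> bool" where
  "block_state \<sigma> z q es \<longleftrightarrow> ar \<sigma> 7 z = q \<and> q < b \<and> wf q es \<and> (q = 0 \<longrightarrow> es = []) \<and>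
     (\<forall>r<R. rep (ar \<sigma>) (vr \<sigma> 15 \<noteq> 0) z (ar \<sigma> 6 z + 1) r es)"

text \<open>\<open>setup_cost\<close> is the overhead of inserting the matrix edges, and
  \<open>max_potential\<close> bounds what all copies can consume between two rollbacks.
  \<open>step_cost\<close> spreads both over \<open>b\<close> steps. \<open>hit_cost\<close> pays
  for a rollback that comes early because of a new row, including a search for each copy.\<close>

definition setup_cost :: nat where "setup_cost = (40 * R + 600) * (b * b + 1)"
definition max_potential :: nat where "max_potential = 600 * (R * TN) + brute_force_cost * R"
definition step_cost :: nat where "step_cost = (max_potential + setup_cost) div b + 1"
definition hit_cost :: nat where "hit_cost = max_potential + setup_cost + brute_force_cost * R"
text \<open>Two batches of at most \<open>b\<close> edges, the loop over the copies and a constant.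
  The last summand is the price of exhausted coins, when every step searches once for each
  copy.\<close>

definition overhead :: nat where
  "overhead = 2 * ((40 * R + 600) * (b + 1)) + 150 * (R + 1) + 200 + (if L < TP + TN then brute_force_cost * R else 0)"

text \<open>The potential of a block, which pays for the time spent on it: most of the time is charged
  to the next time that its version is increased, which happens after \<open>b\<close> steps, each
  contributing \<open>step_cost\<close>, or if a new row is found.\<close>

definition G :: "hst \<Rightarrow> nat \<Rightarrow> nat \<Rightarrow> (nat \<times> nat) list \<Rightarrow> nat" where
  "G \<sigma> z q es = 600 * copies_time es + brute_force_cost * card (dead (ar \<sigma>) z (ar \<sigma> 6 z + 1)) + (if q \<noteq> 0 then setup_cost else 0) + (b - q) * step_cost"

text \<open>The added 1 in \<open>step_cost\<close> makes up for rounding down.\<close>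

lemma step_cost_ge: "max_potential + setup_cost \<le> b * step_cost"
proof -
  have "max_potential + setup_cost = b * ((max_potential + setup_cost) div b) + (max_potential + setup_cost) mod b" by simp
  also have "\<dots> \<le> b * ((max_potential + setup_cost) div b) + b" using b1 by (intro add_left_mono) (simp add: less_imp_le)
  finally show ?thesis by (simp add: step_cost_def algebra_simps)
qed

lemma copies_time_le: "insertions N {} es \<Longrightarrow> copies_time es \<le> R * TN"
  unfolding copies_time_def using sum_bounded_above[of "{..<R}" "\<lambda>r. tau r es" TN] tau_le by simp

abbreviation "XB \<equiv> {8, 9, 10, 11, 12, 13, 14, 16, 17, 19, 20, 21, 22::nat}"

text \<open>The clause for \<open>\<not> h\<close> is the only way in which errors of the copies
  enter: a new row can be overlooked only if no copy answered YES, except copies that were killed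
  before this step.\<close>

definition post :: "nat \<Rightarrow> (nat \<Rightarrow> bool) \<Rightarrow> nat set \<Rightarrow> nat \<Rightarrow> (nat \<times> nat) list \<Rightarrow> hst \<Rightarrow> hst \<Rightarrow> bool \<Rightarrow> nat \<Rightarrow> (nat \<times> nat) list \<Rightarrow> bool" where
  "post z v Rs q es \<sigma> \<sigma>' h q' es' \<longleftrightarrow>
     q' = (if h \<or> q + 1 = b then 0 else q + 1) \<and>
     es' = (if h \<or> q + 1 = b then [] else mid z v Rs q es) \<and>
     io \<sigma>' v (if h then Rs \<union> new z v else Rs) \<and> (h \<longrightarrow> \<not> new z v \<subseteq> Rs) \<and> block_state \<sigma>' z q' es' \<and>
     (\<not> h \<longrightarrow> new z v \<subseteq> Rs \<or> vr \<sigma>' 15 = 0 \<and> (\<forall>r<R. coin_pos (st r (mid z v Rs q es)) \<le> L \<and>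
        (mid z v Rs q es = [] \<or> outp (st r (mid z v Rs q es)) \<noteq> [1] \<or> killed r es))) \<and>
     tm \<sigma>' + G \<sigma> z q es \<le> tm \<sigma> + overhead + step_cost + (if h then hit_cost else 0) + G \<sigma>' z q' es'"

text \<open>\<open>G\<close> enters as a debt: a step may exceed its budget by the growth of
  \<open>G\<close>. A rollback resets \<open>G\<close> to \<open>b * step_cost\<close>; the debt
  lost in this way is absorbed by \<open>hit_cost\<close> after a hit, and by
  \<open>step_cost_ge\<close> when the query vertices are used up.\<close>

lemma wp_BLOCK:
  assumes env: "env \<sigma>" and z: "vr \<sigma> 18 = z" "z < nb * nb" and io: "io \<sigma> v Rs"
    and block_state: "block_state \<sigma> z q es" and U: "ar \<sigma> 6 z + 1 \<le> U"
  shows "wp (BLOCK upd) (\<lambda>\<sigma>'. fr XB {2, 6, 7, 8} z \<sigma> \<sigma>' \<and> (\<forall>x. x \<noteq> z \<longrightarrow> ar \<sigma>' 6 x = ar \<sigma> 6 x \<and> ar \<sigma>' 7 x = ar \<sigma> 7 x) \<and>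
      ar \<sigma>' 6 z \<le> ar \<sigma> 6 z + 1 \<and> (\<exists>h q' es'. post z v Rs q es \<sigma> \<sigma>' h q' es')) \<sigma>"
proof -
  let ?I = "z div nb" and ?J = "z mod nb" and ?V = "ar \<sigma> 6 z + 1"
  let ?m = "if q = 0 then mlist z else []"
  let ?u = "ulist z Rs q" and ?v = "vlist z v q"
  let ?mid = "mid z v Rs q es"
  have IJ: "?I < nb" "?J < nb" using z(2) div_lt by auto
  have q: "q < b" and q0: "q = 0 \<longrightarrow> es = []" and wfq: "wf q es" and rep0: "\<And>r. r < R \<Longrightarrow> rep (ar \<sigma>) (vr \<sigma> 15 \<noteq> 0) z ?V r es"
    and a7: "ar \<sigma> 7 z = q" using block_state by (auto simp: block_state_def)
  have ins_mid: "insertions N {} ?mid" using wf_ins[OF wf_mid[OF wfq q0]] q by simp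
  have ins3: "insertions N {} ((es @ ?m) @ ?u)" and ins2: "insertions N {} (es @ ?m)"
    using ins_mid insertions_prefix unfolding mid_def by blast+
  have nbU: "nb \<le> U" using bounds(2) by (metis le_trans le_square)
  have bU: "b \<le> U" "q \<le> U" "b * b \<le> U" using bN bounds(3,5) q by auto
  define \<sigma>1 where "\<sigma>1 = \<sigma>\<lparr>vr := (vr \<sigma>)(16 := ?I, 17 := ?J, 19 := q, 10 := ?V, 20 := 0), tm := tm \<sigma> + 26\<rparr>"
  have f1: "fr XB {2, 6, 7, 8} z \<sigma> \<sigma>1" by (simp add: fr_def \<sigma>1_def)
  have env1: "env \<sigma>1" using env by (simp add: env_def \<sigma>1_def)
  have v1: "vr \<sigma>1 16 = ?I" "vr \<sigma>1 17 = ?J" "vr \<sigma>1 19 = q" "vr \<sigma>1 10 = ?V" "vr \<sigma>1 20 = 0" "vr \<sigma>1 18 = z" "vr \<sigma>1 2 = b" "vr \<sigma>1 7 = P"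
    "ar \<sigma>1 = ar \<sigma>" "vr \<sigma>1 15 = vr \<sigma> 15" "tm \<sigma>1 = tm \<sigma> + 26"
    using z env by (simp_all add: \<sigma>1_def env_def)
  note v1' = fr_vr[where \<sigma> = \<sigma>1 and X = XJ and Y = "{8}" and z = z]
  have vs: "vr \<sigma>' 16 = ?I" "vr \<sigma>' 17 = ?J" "vr \<sigma>' 19 = q" "vr \<sigma>' 10 = ?V" "vr \<sigma>' 18 = z" "vr \<sigma>' 2 = b" "vr \<sigma>' 7 = P" "vr \<sigma>' 20 = 0"
    "ar \<sigma>' 0 = ar \<sigma> 0" "ar \<sigma>' 1 = ar \<sigma> 1" "ar \<sigma>' 2 = ar \<sigma> 2" if "fr XJ {8} z \<sigma>1 \<sigma>'" for \<sigma>'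
    using fr_vr[OF that] fr_ar[OF that] v1 by simp_all
  have M: "ar \<sigma> 0 ((?I * b + i) * P + (?J * b + j)) = of_bool (Mx (?I * b + i) (?J * b + j))" if "i < b" "j < b" for i j
    using env idx_lt[OF IJ(1) that(1)] idx_lt[OF IJ(2) that(2)] by (simp add: env_def)
  define P2 where "P2 \<sigma>' \<longleftrightarrow> fr XJ {8} z \<sigma>1 \<sigma>' \<and> (\<forall>r<R. rep (ar \<sigma>') (vr \<sigma>' 15 \<noteq> 0) z ?V r (es @ ?m)) \<and>
      (\<forall>r<R. cell (ar \<sigma>') z r ?V 2 = cell (ar \<sigma>1) z r ?V 2) \<and>
      tm \<sigma>' + 600 * copies_time es \<le> tm \<sigma>1 + 600 * copies_time (es @ ?m) + (if q = 0 then setup_cost else 0) + 10" for \<sigma>'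
  define P3 where "P3 \<sigma>' \<longleftrightarrow> fr XJ {8} z \<sigma>1 \<sigma>' \<and> (\<forall>r<R. rep (ar \<sigma>') (vr \<sigma>' 15 \<noteq> 0) z ?V r ((es @ ?m) @ ?u)) \<and>
      (\<forall>r<R. cell (ar \<sigma>') z r ?V 2 = cell (ar \<sigma>1) z r ?V 2) \<and>
      tm \<sigma>' + 600 * copies_time es \<le> tm \<sigma>1 + 600 * copies_time ((es @ ?m) @ ?u) + (if q = 0 then setup_cost else 0) + 10 + (40 * R + 600) * (b + 1)" for \<sigma>'
  define P4 where "P4 \<sigma>' \<longleftrightarrow> fr XJ {8} z \<sigma>1 \<sigma>' \<and> (\<forall>r<R. rep (ar \<sigma>') (vr \<sigma>' 15 \<noteq> 0) z ?V r ?mid) \<and>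
      (\<forall>r<R. cell (ar \<sigma>') z r ?V 2 = cell (ar \<sigma>1) z r ?V 2) \<and>
      tm \<sigma>' + 600 * copies_time es \<le> tm \<sigma>1 + 600 * copies_time ?mid + (if q = 0 then setup_cost else 0) + 10 + 2 * ((40 * R + 600) * (b + 1))" for \<sigma>'
  have w2: "wp (CIf (EV 19 [=] EC 0)
       (INSERT_ALL upd (EV 2 [*] EV 2) (MATRIX_ENTRY 21) (EV 21 [div] EV 2) (EV 2 [+] EV 21 [mod] EV 2)) CSkip) P2 \<sigma>1"
  proof (rule wp_if)
    assume "eval (EV 19 [=] EC 0) \<sigma>1 \<noteq> 0"
    then have q: "q = 0" using v1 by (simp split: if_splits)
    let ?\<tau> = "\<sigma>1\<lparr>tm := tm \<sigma>1 + (etime (EV 19 [=] EC 0) + 1)\<rparr>"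
    have "wp (INSERT_ALL upd (EV 2 [*] EV 2) (MATRIX_ENTRY 21) (EV 21 [div] EV 2) (EV 2 [+] EV 21 [mod] EV 2))
      (\<lambda>\<sigma>'. fr XJ {8} z ?\<tau> \<sigma>' \<and> (\<forall>r<R. rep (ar \<sigma>') (vr \<sigma>' 15 \<noteq> 0) z ?V r
          (es @ edge_list (\<lambda>t. (t div b, b + t mod b)) (\<lambda>t. Mx (?I * b + t div b) (?J * b + t mod b)) (b * b))) \<and>
      (\<forall>r<R. cell (ar \<sigma>') z r ?V 2 = cell (ar ?\<tau>) z r ?V 2) \<and>
      tm \<sigma>' + 600 * copies_time es \<le> tm ?\<tau> + 600 * copies_time (es @ edge_list (\<lambda>t. (t div b, b + t mod b)) (\<lambda>t. Mx (?I * b + t div b) (?J * b + t mod b)) (b * b)) +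
        (40 * R + 600) * (b * b + 1)) ?\<tau>"
    proof (rule wp_INSERT_ALL)
      show "env ?\<tau>" using env1 by (simp add: env_def)
      show "insertions N {} (es @ edge_list (\<lambda>t. (t div b, b + t mod b)) (\<lambda>t. Mx (?I * b + t div b) (?J * b + t mod b)) (b * b))"
        using ins2 q by (simp add: mlist_def)
      fix \<sigma>' assume f: "fr XJ {8} z ?\<tau> \<sigma>'"
      then have f: "fr XJ {8} z \<sigma>1 \<sigma>'" by simp
      note x = vs[OF f]
      show "eval (EV 2 [*] EV 2) \<sigma>' = b * b" using x by simp
      show "eval (EV 21 [div] EV 2) \<sigma>' = fst (vr \<sigma>' 21 div b, b + vr \<sigma>' 21 mod b) \<and>
        eval (EV 2 [+] EV 21 [mod] EV 2) \<sigma>' = snd (vr \<sigma>' 21 div b, b + vr \<sigma>' 21 mod b)" using x by simp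
      assume "vr \<sigma>' 21 < b * b"
      then show "(eval (MATRIX_ENTRY 21) \<sigma>' \<noteq> 0) = Mx (?I * b + vr \<sigma>' 21 div b) (?J * b + vr \<sigma>' 21 mod b)"
        using x M[of "vr \<sigma>' 21 div b" "vr \<sigma>' 21 mod b"] div_lt[of "vr \<sigma>' 21" b b] by (simp add: MATRIX_ENTRY_def)
    qed (use v1 z rep0 bU in \<open>simp_all add: MATRIX_ENTRY_def\<close>)
    then show "wp (INSERT_ALL upd (EV 2 [*] EV 2) (MATRIX_ENTRY 21) (EV 21 [div] EV 2) (EV 2 [+] EV 21 [mod] EV 2)) P2 ?\<tau>"
      by (rule wp_mono) (use q in \<open>simp add: P2_def mlist_def setup_cost_def\<close>)
  next
    assume "eval (EV 19 [=] EC 0) \<sigma>1 = 0"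
    then have "q \<noteq> 0" using v1 by (simp split: if_splits)
    then show "wp CSkip P2 (\<sigma>1\<lparr>tm := tm \<sigma>1 + (etime (EV 19 [=] EC 0) + 1)\<rparr>)"
      using rep0 v1 by (intro wp_skip) (simp add: P2_def)
  qed
  have w3: "wp (INSERT_ALL upd (EV 2) (EC 1 [-] EA 2 (EV 16 [*] EV 2 [+] EV 21)) (EV 21) (EV 2 [+] EV 2 [+] EV 19)) P3 \<sigma>2"
    if P2: "P2 \<sigma>2" for \<sigma>2
  proof -
    have f2: "fr XJ {8} z \<sigma>1 \<sigma>2" using P2 by (simp add: P2_def)
    have "wp (INSERT_ALL upd (EV 2) (EC 1 [-] EA 2 (EV 16 [*] EV 2 [+] EV 21)) (EV 21) (EV 2 [+] EV 2 [+] EV 19))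
      (\<lambda>\<sigma>'. fr XJ {8} z \<sigma>2 \<sigma>' \<and> (\<forall>r<R. rep (ar \<sigma>') (vr \<sigma>' 15 \<noteq> 0) z ?V r
          ((es @ ?m) @ edge_list (\<lambda>i. (i, 2 * b + q)) (\<lambda>i. ?I * b + i \<notin> Rs) b)) \<and>
      (\<forall>r<R. cell (ar \<sigma>') z r ?V 2 = cell (ar \<sigma>2) z r ?V 2) \<and>
      tm \<sigma>' + 600 * copies_time (es @ ?m) \<le> tm \<sigma>2 + 600 * copies_time ((es @ ?m) @ edge_list (\<lambda>i. (i, 2 * b + q)) (\<lambda>i. ?I * b + i \<notin> Rs) b) +
        (40 * R + 600) * (b + 1)) \<sigma>2"
    proof (rule wp_INSERT_ALL)
      show "env \<sigma>2" using env_fr[OF env1 f2] by simp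
      show "insertions N {} ((es @ ?m) @ edge_list (\<lambda>i. (i, 2 * b + q)) (\<lambda>i. ?I * b + i \<notin> Rs) b)"
        using ins3 by (simp only: ulist_def)
      show "rep (ar \<sigma>2) (vr \<sigma>2 15 \<noteq> 0) z ?V r (es @ ?m)" if "r < R" for r using P2 that unfolding P2_def by blast
      fix \<sigma>' assume "fr XJ {8} z \<sigma>2 \<sigma>'"
      with f2 have f: "fr XJ {8} z \<sigma>1 \<sigma>'" by (rule fr_trans)
      note x = vs[OF f]
      show "eval (EV 2) \<sigma>' = b" using x by simp
      show "eval (EV 21) \<sigma>' = fst (vr \<sigma>' 21, 2 * b + q) \<and> eval (EV 2 [+] EV 2 [+] EV 19) \<sigma>' = snd (vr \<sigma>' 21, 2 * b + q)"
        using x by simp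
      assume "vr \<sigma>' 21 < b"
      then have "?I * b + vr \<sigma>' 21 < P" using idx_lt IJ by simp
      then have "ar \<sigma> 2 (?I * b + vr \<sigma>' 21) = of_bool (?I * b + vr \<sigma>' 21 \<in> Rs)" using io unfolding io_def by blast
      then show "(eval (EC 1 [-] EA 2 (EV 16 [*] EV 2 [+] EV 21)) \<sigma>' \<noteq> 0) = (?I * b + vr \<sigma>' 21 \<notin> Rs)"
        using x by simp
    qed (use z vs[OF f2] bU in simp_all)
    then show ?thesis
    proof (rule wp_mono)
      fix \<sigma>' assume a: "fr XJ {8} z \<sigma>2 \<sigma>' \<and> (\<forall>r<R. rep (ar \<sigma>') (vr \<sigma>' 15 \<noteq> 0) z ?V r
          ((es @ ?m) @ edge_list (\<lambda>i. (i, 2 * b + q)) (\<lambda>i. ?I * b + i \<notin> Rs) b)) \<and>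
      (\<forall>r<R. cell (ar \<sigma>') z r ?V 2 = cell (ar \<sigma>2) z r ?V 2) \<and>
      tm \<sigma>' + 600 * copies_time (es @ ?m) \<le> tm \<sigma>2 + 600 * copies_time ((es @ ?m) @ edge_list (\<lambda>i. (i, 2 * b + q)) (\<lambda>i. ?I * b + i \<notin> Rs) b) +
        (40 * R + 600) * (b + 1)"
      show "P3 \<sigma>'" unfolding P3_def
      proof (intro conjI)
        show "fr XJ {8} z \<sigma>1 \<sigma>'" using a fr_trans[OF f2] by blast
        show "\<forall>r<R. rep (ar \<sigma>') (vr \<sigma>' 15 \<noteq> 0) z ?V r ((es @ ?m) @ ?u)" using a unfolding ulist_def by blast
        show "\<forall>r<R. cell (ar \<sigma>') z r ?V 2 = cell (ar \<sigma>1) z r ?V 2" using a P2 unfolding P2_def by metis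
        have "tm \<sigma>2 + 600 * copies_time es \<le> tm \<sigma>1 + 600 * copies_time (es @ ?m) + (if q = 0 then setup_cost else 0) + 10"
          using P2 unfolding P2_def by blast
        moreover have "tm \<sigma>' + 600 * copies_time (es @ ?m) \<le> tm \<sigma>2 + 600 * copies_time ((es @ ?m) @ ?u) + (40 * R + 600) * (b + 1)"
          using a unfolding ulist_def by blast
        ultimately show "tm \<sigma>' + 600 * copies_time es \<le> tm \<sigma>1 + 600 * copies_time ((es @ ?m) @ ?u) + (if q = 0 then setup_cost else 0) + 10 + (40 * R + 600) * (b + 1)"
          by linarith
      qed
    qed
  qed
  have w4: "wp (INSERT_ALL upd (EV 2) (EA 1 (EV 17 [*] EV 2 [+] EV 21)) (EV 2 [+] EV 21) (EV 2 [+] EV 2 [+] EV 19)) P4 \<sigma>2"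
    if P3: "P3 \<sigma>2" for \<sigma>2
  proof -
    have f2: "fr XJ {8} z \<sigma>1 \<sigma>2" using P3 by (simp add: P3_def)
    have "wp (INSERT_ALL upd (EV 2) (EA 1 (EV 17 [*] EV 2 [+] EV 21)) (EV 2 [+] EV 21) (EV 2 [+] EV 2 [+] EV 19))
      (\<lambda>\<sigma>'. fr XJ {8} z \<sigma>2 \<sigma>' \<and> (\<forall>r<R. rep (ar \<sigma>') (vr \<sigma>' 15 \<noteq> 0) z ?V r
          (((es @ ?m) @ ?u) @ edge_list (\<lambda>j. (b + j, 2 * b + q)) (\<lambda>j. v (?J * b + j)) b)) \<and>
      (\<forall>r<R. cell (ar \<sigma>') z r ?V 2 = cell (ar \<sigma>2) z r ?V 2) \<and>
      tm \<sigma>' + 600 * copies_time ((es @ ?m) @ ?u) \<le> tm \<sigma>2 + 600 * copies_time (((es @ ?m) @ ?u) @ edge_list (\<lambda>j. (b + j, 2 * b + q)) (\<lambda>j. v (?J * b + j)) b) +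
        (40 * R + 600) * (b + 1)) \<sigma>2"
    proof (rule wp_INSERT_ALL)
      show "env \<sigma>2" using env_fr[OF env1 f2] by simp
      show "insertions N {} (((es @ ?m) @ ?u) @ edge_list (\<lambda>j. (b + j, 2 * b + q)) (\<lambda>j. v (?J * b + j)) b)"
        using ins_mid by (simp only: mid_def vlist_def)
      show "rep (ar \<sigma>2) (vr \<sigma>2 15 \<noteq> 0) z ?V r ((es @ ?m) @ ?u)" if "r < R" for r using P3 that unfolding P3_def by blast
      fix \<sigma>' assume "fr XJ {8} z \<sigma>2 \<sigma>'"
      with f2 have f: "fr XJ {8} z \<sigma>1 \<sigma>'" by (rule fr_trans)
      note x = vs[OF f]
      show "eval (EV 2) \<sigma>' = b" using x by simp
      show "eval (EV 2 [+] EV 21) \<sigma>' = fst (b + vr \<sigma>' 21, 2 * b + q) \<and> eval (EV 2 [+] EV 2 [+] EV 19) \<sigma>' = snd (b + vr \<sigma>' 21, 2 * b + q)"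
        using x by simp
      assume "vr \<sigma>' 21 < b"
      then have "?J * b + vr \<sigma>' 21 < P" using idx_lt IJ by simp
      then have "ar \<sigma> 1 (?J * b + vr \<sigma>' 21) = of_bool (v (?J * b + vr \<sigma>' 21))" using io unfolding io_def by blast
      then show "(eval (EA 1 (EV 17 [*] EV 2 [+] EV 21)) \<sigma>' \<noteq> 0) = v (?J * b + vr \<sigma>' 21)"
        using x by simp
    qed (use z vs[OF f2] bU in simp_all)
    then show ?thesis
    proof (rule wp_mono)
      fix \<sigma>' assume a: "fr XJ {8} z \<sigma>2 \<sigma>' \<and> (\<forall>r<R. rep (ar \<sigma>') (vr \<sigma>' 15 \<noteq> 0) z ?V r
          (((es @ ?m) @ ?u) @ edge_list (\<lambda>j. (b + j, 2 * b + q)) (\<lambda>j. v (?J * b + j)) b)) \<and>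
      (\<forall>r<R. cell (ar \<sigma>') z r ?V 2 = cell (ar \<sigma>2) z r ?V 2) \<and>
      tm \<sigma>' + 600 * copies_time ((es @ ?m) @ ?u) \<le> tm \<sigma>2 + 600 * copies_time (((es @ ?m) @ ?u) @ edge_list (\<lambda>j. (b + j, 2 * b + q)) (\<lambda>j. v (?J * b + j)) b) +
        (40 * R + 600) * (b + 1)"
      show "P4 \<sigma>'" unfolding P4_def
      proof (intro conjI)
        show "fr XJ {8} z \<sigma>1 \<sigma>'" using a fr_trans[OF f2] by blast
        show "\<forall>r<R. rep (ar \<sigma>') (vr \<sigma>' 15 \<noteq> 0) z ?V r ?mid" using a unfolding mid_def vlist_def by blast
        show "\<forall>r<R. cell (ar \<sigma>') z r ?V 2 = cell (ar \<sigma>1) z r ?V 2" using a P3 unfolding P3_def by metis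
        have "tm \<sigma>2 + 600 * copies_time es \<le> tm \<sigma>1 + 600 * copies_time ((es @ ?m) @ ?u) + (if q = 0 then setup_cost else 0) + 10 + (40 * R + 600) * (b + 1)"
          using P3 unfolding P3_def by blast
        moreover have "tm \<sigma>' + 600 * copies_time ((es @ ?m) @ ?u) \<le> tm \<sigma>2 + 600 * copies_time ?mid + (40 * R + 600) * (b + 1)"
          using a unfolding mid_def vlist_def by blast
        ultimately show "tm \<sigma>' + 600 * copies_time es \<le> tm \<sigma>1 + 600 * copies_time ?mid + (if q = 0 then setup_cost else 0) + 10 + 2 * ((40 * R + 600) * (b + 1))"
          by linarith
      qed
    qed
  qed
  let ?Q = "\<lambda>\<sigma>'. fr XB {2, 6, 7, 8} z \<sigma> \<sigma>' \<and> (\<forall>x. x \<noteq> z \<longrightarrow> ar \<sigma>' 6 x = ar \<sigma> 6 x \<and> ar \<sigma>' 7 x = ar \<sigma> 7 x) \<and>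
      ar \<sigma>' 6 z \<le> ar \<sigma> 6 z + 1 \<and> (\<exists>h q' es'. post z v Rs q es \<sigma> \<sigma>' h q' es')"
  have w5: "wp (CHECK ;; CIf (EV 20 [+] (EV 19 [+] EC 1 [=] EV 2)) (CStr 6 (EV 18) (EV 10) ;; CStr 7 (EV 18) (EC 0))
       (CStr 7 (EV 18) (EV 19 [+] EC 1))) ?Q \<sigma>4" if P4: "P4 \<sigma>4" for \<sigma>4
  proof (rule wp_seq)
    have f4: "fr XJ {8} z \<sigma>1 \<sigma>4" using P4 by (simp add: P4_def)
    have f4': "fr XB {2, 6, 7, 8} z \<sigma> \<sigma>4" using fr_trans[OF f1 fr_mono[OF f4]] by simp
    note v4 = vs[OF f4]
    have a4: "ar \<sigma>4 6 = ar \<sigma> 6" "ar \<sigma>4 7 = ar \<sigma> 7" using fr_ar[OF f4] v1 by simp_all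
    have rep4: "\<And>r. r < R \<Longrightarrow> rep (ar \<sigma>4) (vr \<sigma>4 15 \<noteq> 0) z ?V r ?mid" using P4 unfolding P4_def by blast
    have cell4: "\<And>r. r < R \<Longrightarrow> cell (ar \<sigma>4) z r ?V 2 = cell (ar \<sigma>) z r ?V 2" using P4 v1 unfolding P4_def by simp
    have t4: "tm \<sigma>4 + 600 * copies_time es \<le> tm \<sigma> + 38 + 600 * copies_time ?mid + (if q = 0 then setup_cost else 0) + 2 * ((40 * R + 600) * (b + 1))"
      using P4 v1 unfolding P4_def by simp
    have io4: "io \<sigma>4 v Rs" using io v4 by (simp add: io_def)
    have dead4: "dead (ar \<sigma>4) z ?V = dead (ar \<sigma>) z ?V" unfolding dead_def using cell4 by auto
    have env4: "env \<sigma>4" using env_fr[OF env1 f4] by simp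
    have killed4: "cell (ar \<sigma>4) z r ?V 2 \<noteq> 0 \<longrightarrow> vr \<sigma>4 15 \<noteq> 0 \<or> killed r es" if "r < R" for r
      using rep0[OF that] cell4[OF that] f4' unfolding rep_def fr_def by auto
    show "wp CHECK (wp (CIf (EV 20 [+] (EV 19 [+] EC 1 [=] EV 2)) (CStr 6 (EV 18) (EV 10) ;; CStr 7 (EV 18) (EC 0))
       (CStr 7 (EV 18) (EV 19 [+] EC 1))) ?Q) \<sigma>4"
    proof (rule wp_mono, rule wp_CHECK[OF env4 _ _ z(2) _ _ rep4 io4])
      fix \<sigma>5
      let ?K = "\<lambda>h. vr \<sigma>5 20 = of_bool h \<and> io \<sigma>5 v (if h then Rs \<union> new z v else Rs) \<and> (h \<longrightarrow> \<not> new z v \<subseteq> Rs) \<and>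
        (\<not> h \<longrightarrow> (\<forall>r<R. rep (ar \<sigma>5) (vr \<sigma>5 15 \<noteq> 0) z ?V r ?mid) \<and> dead (ar \<sigma>4) z ?V \<subseteq> dead (ar \<sigma>5) z ?V \<and>
          (new z v \<subseteq> Rs \<or> vr \<sigma>4 15 = 0 \<and> (\<forall>r<R. cell (ar \<sigma>4) z r ?V 1 = 0 \<or> cell (ar \<sigma>4) z r ?V 2 \<noteq> 0)) \<and>
          (vr \<sigma>4 15 = 0 \<longrightarrow> tm \<sigma>5 + brute_force_cost * card (dead (ar \<sigma>4) z ?V) \<le> tm \<sigma>4 + brute_force_cost * card (dead (ar \<sigma>5) z ?V) + 150 * (R + 1)))"
      assume a: "fr {8, 9, 11, 20, 22} {2} z \<sigma>4 \<sigma>5 \<and> vr \<sigma>5 15 = vr \<sigma>4 15 \<and>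
        (\<forall>r<R. \<forall>a<S. ar \<sigma>5 5 (base z r + a) \<le> ?V) \<and>
        tm \<sigma>5 \<le> tm \<sigma>4 + 150 * (R + 1) + brute_force_cost * R \<and> (\<exists>h. ?K h)"
      then have f5: "fr {8, 9, 11, 20, 22} {2} z \<sigma>4 \<sigma>5" and bad5: "vr \<sigma>5 15 = vr \<sigma>4 15"
        and ver5: "\<And>r a. r < R \<Longrightarrow> a < S \<Longrightarrow> ar \<sigma>5 5 (base z r + a) \<le> ?V"
        and t5: "tm \<sigma>5 \<le> tm \<sigma>4 + 150 * (R + 1) + brute_force_cost * R" by blast+
      obtain h where K: "?K h"
        using a[THEN conjunct2, THEN conjunct2, THEN conjunct2, THEN conjunct2] by (elim exE)
      have f5': "fr XB {2, 6, 7, 8} z \<sigma> \<sigma>5" using fr_trans[OF f4' fr_mono[OF f5]] by simp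
      have env5: "env \<sigma>5" using env_fr[OF env f5'] by simp
      have v5: "vr \<sigma>5 20 = of_bool h" "vr \<sigma>5 19 = q" "vr \<sigma>5 18 = z" "vr \<sigma>5 10 = ?V" "vr \<sigma>5 2 = b"
        using K fr_vr[OF f5] v4 by simp_all
      have a5: "ar \<sigma>5 6 = ar \<sigma> 6" "ar \<sigma>5 7 = ar \<sigma> 7" using fr_ar[OF f5] a4 by simp_all
      have io5: "io \<sigma>5 v (if h then Rs \<union> new z v else Rs)" using K by blast
      have bad: "vr \<sigma>5 15 \<noteq> 0 \<longrightarrow> L < TP + TN" using env5 by (simp add: env_def)
      have compl: "new z v \<subseteq> Rs \<or> vr \<sigma>5 15 = 0 \<and> (\<forall>r<R. coin_pos (st r ?mid) \<le> L \<and>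
          (?mid = [] \<or> outp (st r ?mid) \<noteq> [1] \<or> killed r es))" if "\<not> h"
      proof (cases "new z v \<subseteq> Rs")
        case False
        then have c: "vr \<sigma>4 15 = 0" "\<And>r. r < R \<Longrightarrow> cell (ar \<sigma>4) z r ?V 1 = 0 \<or> cell (ar \<sigma>4) z r ?V 2 \<noteq> 0"
          using K that by blast+
        have "coin_pos (st r ?mid) \<le> L \<and> (?mid = [] \<or> outp (st r ?mid) \<noteq> [1] \<or> killed r es)" if r: "r < R" for r
          using rep4[OF r] c(1) c(2)[OF r] killed4[OF r] unfolding rep_def by auto
        then show ?thesis using c bad5 by simp
      qed simp
      \<comment> \<open>The matrix edges are either part of the old debt or inserted in this
        step.\<close>
      have qs: "(if q \<noteq> 0 then setup_cost else 0) + (if q = 0 then setup_cost else 0) = setup_cost" by simp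
      have Ls: "(if L < TP + TN then brute_force_cost * R else 0) = brute_force_cost * R" if "vr \<sigma>4 15 \<noteq> 0" using bad bad5 that by simp
      have Ttot: "600 * copies_time ?mid + brute_force_cost * card (dead (ar \<sigma>) z ?V) \<le> max_potential"
        unfolding max_potential_def using copies_time_le[OF ins_mid]
        by (intro add_le_mono mult_le_mono2 card_dead)
      have TTm: "copies_time es \<le> copies_time ?mid"
      proof -
        have "tau r es \<le> tau r (es @ zs)" if "insertions N {} (es @ zs)" for r zs
          using that
        proof (induction zs rule: rev_induct)
          case (snoc p zs)
          obtain x y where p: "p = (x, y)" by fastforce
          have "tau r es \<le> tau r (es @ zs)" using snoc insertions_prefix[of N "{}" "es @ zs" "[p]"] by simp
          also have "\<dots> \<le> tau r (es @ zs @ [p])" using st_snoc(1)[of "es @ zs" x y r] snoc.prems p by simp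
          finally show ?case .
        qed simp
        then have "tau r es \<le> tau r ?mid" for r using ins_mid by (simp add: mid_def)
        then show ?thesis unfolding copies_time_def by (intro sum_mono) simp
      qed
      show "wp (CIf (EV 20 [+] (EV 19 [+] EC 1 [=] EV 2)) (CStr 6 (EV 18) (EV 10) ;; CStr 7 (EV 18) (EC 0))
         (CStr 7 (EV 18) (EV 19 [+] EC 1))) ?Q \<sigma>5"
      proof (rule wp_if)
        assume "eval (EV 20 [+] (EV 19 [+] EC 1 [=] EV 2)) \<sigma>5 \<noteq> 0"
        then have hq: "h \<or> q + 1 = b" using v5 by (auto split: if_splits)
        define \<sigma>6 where "\<sigma>6 = \<sigma>5\<lparr>ar := (ar \<sigma>5)(6 := (ar \<sigma>5 6)(z := ?V), 7 := (ar \<sigma>5 7)(z := 0)), tm := tm \<sigma>5 + 22\<rparr>"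
        have f6: "fr XB {2, 6, 7, 8} z \<sigma> \<sigma>6" using f5' by (simp add: fr_def \<sigma>6_def)
        have env6: "env \<sigma>6" using env_fr[OF env f6] by simp
        have a6: "ar \<sigma>6 6 z = ?V" "ar \<sigma>6 7 z = 0" "\<And>k. k \<noteq> 6 \<Longrightarrow> k \<noteq> 7 \<Longrightarrow> ar \<sigma>6 k = ar \<sigma>5 k"
          by (simp_all add: \<sigma>6_def)
        have s6: "snap (ar \<sigma>6) (vr \<sigma>6 15 \<noteq> 0) r" if "r < R" for r using env6 that by (simp add: env_def)
        \<comment> \<open>Storing the current version as retired makes the live version larger than
          every entry, so \<open>rep_snap\<close> applies.\<close>
        have lt6: "ar \<sigma>6 5 (base z r + x) < ar \<sigma>6 6 z + 1" if "r < R" "x < S" for r x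
          using ver5[OF that] a6 by (simp add: le_imp_less_Suc)
        have rep6: "rep (ar \<sigma>6) (vr \<sigma>6 15 \<noteq> 0) z (ar \<sigma>6 6 z + 1) r []" "cell (ar \<sigma>6) z r (ar \<sigma>6 6 z + 1) 2 = 0" if "r < R" for r
          using rep_snap[OF s6[OF that] lt6[OF that]] by blast+
        have dead6: "dead (ar \<sigma>6) z (ar \<sigma>6 6 z + 1) = {}" using rep6(2) unfolding dead_def by simp
        have "wf 0 []" by (simp add: wf_def)
        moreover have "\<forall>r<R. rep (ar \<sigma>6) (vr \<sigma>6 15 \<noteq> 0) z (ar \<sigma>6 6 z + 1) r []" by (intro allI impI rep6(1))
        ultimately have bst6: "block_state \<sigma>6 z 0 []" unfolding block_state_def using a6(2) b1 by simp
        have G6: "G \<sigma>6 z 0 [] = b * step_cost" unfolding G_def dead6 by (simp add: copies_time_def)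
        have post6: "post z v Rs q es \<sigma> \<sigma>6 h 0 []"
          unfolding post_def
        proof (intro conjI)
          show "io \<sigma>6 v (if h then Rs \<union> new z v else Rs)" using io5 by (simp add: io_def \<sigma>6_def)
          show "\<not> h \<longrightarrow> new z v \<subseteq> Rs \<or> vr \<sigma>6 15 = 0 \<and> (\<forall>r<R. coin_pos (st r ?mid) \<le> L \<and>
            (?mid = [] \<or> outp (st r ?mid) \<noteq> [1] \<or> killed r es))" using compl by (simp add: \<sigma>6_def)
          \<comment> \<open>After a hit the whole old debt is charged to \<open>hit_cost\<close>,
            whatever \<open>q\<close> is. Otherwise this was the last query vertex, the payments of
            all \<open>b\<close> steps are available, and \<open>b - q\<close> is 1.\<close>
          show "tm \<sigma>6 + G \<sigma> z q es \<le> tm \<sigma> + overhead + step_cost + (if h then hit_cost else 0) + G \<sigma>6 z 0 []"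
          proof (cases h)
            case True
            have "(b - q) * step_cost \<le> b * step_cost" by (intro mult_le_mono1) simp
            moreover have "tm \<sigma>6 \<le> tm \<sigma>5 + 22" by (simp add: \<sigma>6_def)
            moreover have "tm \<sigma>5 + 600 * copies_time es + brute_force_cost * card (dead (ar \<sigma>) z ?V) + (if q \<noteq> 0 then setup_cost else 0)
              \<le> tm \<sigma> + 38 + max_potential + setup_cost + 2 * ((40 * R + 600) * (b + 1)) + 150 * (R + 1) + brute_force_cost * R"
              using t5 t4 Ttot qs by linarith
            ultimately show ?thesis unfolding G6 unfolding G_def overhead_def hit_cost_def if_P[OF True] by linarith
          next
            case False
            then have q1: "q + 1 = b" using hq by simp
            then have bq: "b - q = 1" by simp
            have "tm \<sigma>6 \<le> tm \<sigma>5 + 22" by (simp add: \<sigma>6_def)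
            moreover have "tm \<sigma>5 + 600 * copies_time es + brute_force_cost * card (dead (ar \<sigma>) z ?V) + (if q \<noteq> 0 then setup_cost else 0)
              \<le> tm \<sigma> + 38 + max_potential + setup_cost + 2 * ((40 * R + 600) * (b + 1)) + 150 * (R + 1) + (if L < TP + TN then brute_force_cost * R else 0)"
            proof (cases "vr \<sigma>4 15 = 0")
              case True
              then have "tm \<sigma>5 + brute_force_cost * card (dead (ar \<sigma>4) z ?V) \<le> tm \<sigma>4 + brute_force_cost * card (dead (ar \<sigma>5) z ?V) + 150 * (R + 1)"
                using K False by blast
              moreover have "brute_force_cost * card (dead (ar \<sigma>5) z ?V) \<le> brute_force_cost * R" by (intro mult_le_mono2 card_dead)
              ultimately have "tm \<sigma>5 + brute_force_cost * card (dead (ar \<sigma>) z ?V) \<le> tm \<sigma>4 + brute_force_cost * R + 150 * (R + 1)"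
                unfolding dead4 by linarith
              moreover have "600 * copies_time ?mid \<le> 600 * (R * TN)" using copies_time_le[OF ins_mid] by simp
              ultimately show ?thesis using t4 qs unfolding max_potential_def by linarith
            next
              case False
              then show ?thesis using t5 t4 Ttot qs Ls by linarith
            qed
            ultimately show ?thesis using step_cost_ge unfolding G6 unfolding G_def overhead_def if_not_P[OF False] bq by linarith
          qed
        qed (use K hq bst6 in auto)
        have "?Q \<sigma>6" using f6 post6 a5 by (auto simp: \<sigma>6_def)
        then show "wp (CStr 6 (EV 18) (EV 10) ;; CStr 7 (EV 18) (EC 0)) ?Q
          (\<sigma>5\<lparr>tm := tm \<sigma>5 + (etime (EV 20 [+] (EV 19 [+] EC 1 [=] EV 2)) + 1)\<rparr>)"
          using U v5 by (intro wp_seq wp_str) (simp_all add: \<sigma>6_def add.commute)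
      next
        assume "eval (EV 20 [+] (EV 19 [+] EC 1 [=] EV 2)) \<sigma>5 = 0"
        then have h: "\<not> h" and q1: "q + 1 \<noteq> b" using v5 by (auto split: if_splits)
        then have q2: "q + 1 < b" using q by simp
        define \<sigma>6 where "\<sigma>6 = \<sigma>5\<lparr>ar := (ar \<sigma>5)(7 := (ar \<sigma>5 7)(z := q + 1)), tm := tm \<sigma>5 + 17\<rparr>"
        have f6: "fr XB {2, 6, 7, 8} z \<sigma> \<sigma>6" using f5' by (simp add: fr_def \<sigma>6_def)
        have a6: "ar \<sigma>6 6 = ar \<sigma> 6" "ar \<sigma>6 4 = ar \<sigma>5 4" "ar \<sigma>6 5 = ar \<sigma>5 5" using a5 by (simp_all add: \<sigma>6_def)
        have vm6: "vmem (ar \<sigma>6) = vmem (ar \<sigma>5)" using a6 by (simp add: vmem_def fun_eq_iff)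
        have rep6: "rep (ar \<sigma>6) (vr \<sigma>6 15 \<noteq> 0) z ?V r ?mid" if "r < R" for r
        proof -
          have "rep (ar \<sigma>5) (vr \<sigma>5 15 \<noteq> 0) z ?V r ?mid" using K h that by blast
          then show ?thesis unfolding rep_def vm6 a6 by (simp add: \<sigma>6_def)
        qed
        have dead6: "dead (ar \<sigma>6) z ?V = dead (ar \<sigma>5) z ?V" unfolding dead_def vm6 ..
        have wf6: "wf (q + 1) ?mid" using wf_mid[OF wfq q0] by simp
        have bst6: "block_state \<sigma>6 z (q + 1) ?mid" unfolding block_state_def a6 using rep6 wf6 q2 by (simp add: \<sigma>6_def)
        have sub: "dead (ar \<sigma>) z ?V \<subseteq> dead (ar \<sigma>5) z ?V" using K h dead4 by simp
        have post6: "post z v Rs q es \<sigma> \<sigma>6 h (q + 1) ?mid"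
          unfolding post_def
        proof (intro conjI)
          show "io \<sigma>6 v (if h then Rs \<union> new z v else Rs)" using io5 by (simp add: io_def \<sigma>6_def)
          show "\<not> h \<longrightarrow> new z v \<subseteq> Rs \<or> vr \<sigma>6 15 = 0 \<and> (\<forall>r<R. coin_pos (st r ?mid) \<le> L \<and>
            (?mid = [] \<or> outp (st r ?mid) \<noteq> [1] \<or> killed r es))" using compl by (simp add: \<sigma>6_def)
          have "b - q = Suc (b - (q + 1))" using q2 by simp
          then have bq: "(b - q) * step_cost = step_cost + (b - (q + 1)) * step_cost" by simp
          \<comment> \<open>With flag 15 set, the searches need not enlarge \<open>dead\<close> and
            are paid by the last summand of \<open>overhead\<close>.\<close>
          have "tm \<sigma>5 + 600 * copies_time es + brute_force_cost * card (dead (ar \<sigma>) z ?V) + (if q \<noteq> 0 then setup_cost else 0)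
              \<le> tm \<sigma> + 38 + 600 * copies_time ?mid + brute_force_cost * card (dead (ar \<sigma>5) z ?V) + setup_cost + 2 * ((40 * R + 600) * (b + 1)) + 150 * (R + 1) +
                (if L < TP + TN then brute_force_cost * R else 0)"
          proof (cases "vr \<sigma>4 15 = 0")
            case True
            then have "tm \<sigma>5 + brute_force_cost * card (dead (ar \<sigma>4) z ?V) \<le> tm \<sigma>4 + brute_force_cost * card (dead (ar \<sigma>5) z ?V) + 150 * (R + 1)"
              using K h by blast
            then show ?thesis using t4 qs unfolding dead4 by linarith
          next
            case False
            have "brute_force_cost * card (dead (ar \<sigma>) z ?V) \<le> brute_force_cost * card (dead (ar \<sigma>5) z ?V)"
              using sub by (intro mult_le_mono2 card_mono) simp_all
            then show ?thesis using t5 t4 qs Ls[OF False] by linarith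
          qed
          moreover have "tm \<sigma>6 = tm \<sigma>5 + 17" by (simp add: \<sigma>6_def)
          ultimately show "tm \<sigma>6 + G \<sigma> z q es \<le> tm \<sigma> + overhead + step_cost + (if h then hit_cost else 0) + G \<sigma>6 z (q + 1) ?mid"
            unfolding G_def a6 dead6 bq overhead_def if_not_P[OF h] by simp
        qed (use h q1 bst6 in auto)
        have "?Q \<sigma>6" using f6 post6 a5 by (auto simp: \<sigma>6_def)
        then show "wp (CStr 7 (EV 18) (EV 19 [+] EC 1)) ?Q
          (\<sigma>5\<lparr>tm := tm \<sigma>5 + (etime (EV 20 [+] (EV 19 [+] EC 1 [=] EV 2)) + 1)\<rparr>)"
          using v5 q2 bU by (intro wp_str) (simp_all add: \<sigma>6_def add.commute)
      qed
    qed (use v4 in simp_all)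
  qed
  have "wp (BLOCK_BODY upd) ?Q \<sigma>1"
    unfolding BLOCK_BODY_def
    by (rule wp_seq, rule wp_mono[OF w2], rule wp_seq, erule wp_mono[OF w3], rule wp_seq, erule wp_mono[OF w4], erule w5)
  moreover have "?I \<le> U" "?J \<le> U" using IJ nbU by linarith+
  ultimately show ?thesis
    unfolding BLOCK_def
    using U bU z a7 env
    by (intro wp_seq wp_asg) (simp_all add: \<sigma>1_def env_def add.commute)
qed

end

section \<open>Answering a query\<close>

definition QUERY :: "com \<Rightarrow> cmd" where
  "QUERY upd = CFor 21 (EV 0) (CRd 22 ;; CStr 1 (EV 21) (EV 22)) ;; CFor 18 (EV 6 [*] EV 6) (BLOCK upd) ;;
     CFor 21 (EV 0) (CAsg 22 (EA 2 (EV 21)) ;; CWr 22 ;; CStr 2 (EV 21) (EC 0))"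

lemma triangle_answers_nth:
  "k < length es \<Longrightarrow> triangle_answers E es ! k = [of_bool (has_triangle (E \<union> edge ` set (take (Suc k) es)))]"
proof (induction E es arbitrary: k rule: triangle_answers.induct)
  case (2 E u v es)
  show ?case
  proof (cases k)
    case (Suc j)
    then show ?thesis using "2.IH"[of j] "2.prems" by (simp add: edge_def Un_commute)
  qed (simp add: edge_def)
qed simp

lemma has_triangle_mono: "has_triangle E \<Longrightarrow> E \<subseteq> F \<Longrightarrow> has_triangle F"
  unfolding has_triangle_def by blast

lemma image_ex: "y \<in> f ` A \<Longrightarrow> \<exists>x\<in>A. f x = y"
  by (elim imageE) (rule bexI, rule sym)

lemma session_nth:
  "session W \<omega> c s xss t yss \<Longrightarrow> length yss = length xss \<and>
     (\<forall>k<length xss. yss ! k = outp (fin W \<omega> c s (take (Suc k) xss)))"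
proof (induction xss arbitrary: t yss rule: rev_induct)
  case Nil
  then show ?case by (auto elim: session_NilE)
next
  case (snoc x xss)
  then obtain t1 y1 where y: "session W \<omega> c s xss t1 y1" "yss = y1 @ [outp (fin W \<omega> c s (xss @ [x]))]"
    using session_snocD by blast
  with snoc.IH[OF y(1)] show ?case by (auto simp: nth_append less_Suc_eq)
qed

section \<open>Correct copies and the evolution without errors\<close>

context red
begin

definition ctape :: "nat \<Rightarrow> nat \<Rightarrow> bool" where
  "ctape r p = \<omega> (p * R + r)"

text \<open>Formulated for the untruncated tape, since the error probability of the given algorithm
  is known for a full sequence of fair coins.\<close>

definition goodrun :: "nat \<Rightarrow> (nat \<times> nat) list \<Rightarrow> bool" where
  "goodrun r es \<longleftrightarrow> (\<exists>tp tu. online_run WN (ctape r) pre upd (mat_input N (\<lambda>_ _. False)) (reqs es) tp tu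
     (triangle_answers {} es))"

text \<open>The two tapes agree below \<open>L\<close>, and by assumption the run consumes no more
  coins, so it is the same run on both. Its answers are then right on every prefix, and the prefixes
  matter for \<open>killed\<close>.\<close>

lemma goodrun_out:
  assumes g: "goodrun r es" and ins: "insertions N {} es" and L: "coin_pos (st r es) \<le> L"
    and es: "es = p @ s" "p \<noteq> []"
  shows "outp (st r p) = [of_bool (has_triangle (edge ` set p))]"
proof -
  obtain t yss where 1: "exec WN (tape r) pre (ini\<lparr>inp := mat_input N (\<lambda>_ _. False), outp := []\<rparr>) t (s0 r)"
    "session WN (tape r) upd (s0 r) (reqs es) (tau r es) yss" using run_ex[OF ins, of r] by blast
  obtain tp tu s' where 2: "exec WN (ctape r) pre (ini\<lparr>inp := mat_input N (\<lambda>_ _. False), outp := []\<rparr>) tp s'"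
    "session WN (ctape r) upd s' (reqs es) tu (triangle_answers {} es)"
    using g by (auto simp: goodrun_def online_run_def ini_def)
  have c: "coin_pos (s0 r) \<le> coin_pos (st r es)" using session_coin[OF 1(2)] by (simp add: st_def)
  have "exec WN (ctape r) pre (ini\<lparr>inp := mat_input N (\<lambda>_ _. False), outp := []\<rparr>) t (s0 r)"
    by (rule exec_tape[OF 1(1)]) (use c L in \<open>simp add: tape_def ctape_def\<close>)
  then have s': "s' = s0 r" using exec_det[OF 2(1)] by blast
  have "session WN (ctape r) upd (s0 r) (reqs es) (tau r es) yss"
    by (rule session_tape[OF 1(2)]) (use L in \<open>simp add: tape_def ctape_def st_def\<close>)
  then have y: "yss = triangle_answers {} es" using session_det[OF 2(2)[unfolded s']] by blast
  have k: "length p - 1 < length es" "Suc (length p - 1) = length p" using es by (cases p; simp)+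
  have "yss ! (length p - 1) = outp (st r p)"
    using session_nth[OF 1(2)] k es by (simp add: st_def)
  moreover have "yss ! (length p - 1) = [of_bool (has_triangle (edge ` set p))]"
    unfolding y using triangle_answers_nth[OF k(1), of "{}"] k es by simp
  ultimately show ?thesis by simp
qed

definition known :: "nat \<Rightarrow> (nat \<Rightarrow> bool) \<Rightarrow> nat set" where
  "known z v = (\<Union>z'<z. new z' v)"

text \<open>The evolution of a block, as next query vertex and inserted edges, if every new row is
  noticed. No coins occur in it.\<close>

definition ideal_step :: "nat \<Rightarrow> (nat \<Rightarrow> bool) \<Rightarrow> nat \<times> (nat \<times> nat) list \<Rightarrow> nat \<times> (nat \<times> nat) list" where
  "ideal_step z v Y = (if \<not> new z v \<subseteq> known z v \<or> fst Y + 1 = b then (0, [])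
     else (fst Y + 1, mid z v (known z v) (fst Y) (snd Y)))"

text \<open>Triangle-freeness persists because a sequence is retained only if the block had no new
  row, in which case its latest query vertex lies in no triangle.\<close>

definition block_ok :: "nat \<Rightarrow> nat \<times> (nat \<times> nat) list \<Rightarrow> bool" where
  "block_ok z Y \<longleftrightarrow> fst Y < b \<and> wf (fst Y) (snd Y) \<and> (fst Y = 0 \<longrightarrow> snd Y = []) \<and> (fst Y \<noteq> 0 \<longrightarrow> set (mlist z) \<subseteq> set (snd Y)) \<and>
     (\<forall>p\<in>set (snd Y). p \<in> set (mlist z) \<or> 2 * b \<le> snd p) \<and> \<not> has_triangle (edge ` set (snd Y))"

lemma mlist_iff:
  "p \<in> set (mlist z) \<longleftrightarrow> (\<exists>i j. i < b \<and> j < b \<and> p = (i, b + j) \<and> Mx (z div nb * b + i) (z mod nb * b + j))"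
proof
  assume "p \<in> set (mlist z)"
  then show "\<exists>i j. i < b \<and> j < b \<and> p = (i, b + j) \<and> Mx (z div nb * b + i) (z mod nb * b + j)"
    using div_lt[of _ b b] by (auto simp: mlist_def edge_list_def)
next
  assume "\<exists>i j. i < b \<and> j < b \<and> p = (i, b + j) \<and> Mx (z div nb * b + i) (z mod nb * b + j)"
  then obtain i j where ij: "i < b" "j < b" "p = (i, b + j)" "Mx (z div nb * b + i) (z mod nb * b + j)" by blast
  have "i * b + j < b * b" using idx_lt ij(1,2)
  proof -
    have "i * b + j < (i + 1) * b" using ij(2) by simp
    also have "\<dots> \<le> b * b" using ij(1) by (intro mult_le_mono1) simp
    finally show ?thesis .
  qed
  then show "p \<in> set (mlist z)"
    using ij unfolding mlist_def edge_list_def by (auto intro!: image_eqI[of _ _ "i * b + j"])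
qed

text \<open>The new query vertex is adjacent exactly to the rows outside \<open>K\<close> and to the
  columns selected by \<open>v\<close>, so a triangle through it is a matrix entry that contributes
  a new row. A triangle avoiding it would lie in the older graph, which has none.\<close>

lemma mid_triangle:
  assumes "block_ok z (q, es)"
  shows "has_triangle (edge ` set (mid z v K q es)) \<longleftrightarrow> \<not> new z v \<subseteq> K"
proof
  let ?w = "2 * b + q"
  let ?old = "set es \<union> set (mlist z)"
  assume "\<not> new z v \<subseteq> K"
  then obtain i j where ij: "i < b" "j < b" "Mx (z div nb * b + i) (z mod nb * b + j)" "v (z mod nb * b + j)"
    "z div nb * b + i \<notin> K" unfolding new_def by blast
  have "(i, b + j) \<in> set (mlist z)" using ij mlist_iff by blast
  then have "(i, b + j) \<in> set (mid z v K q es)"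
    using assms unfolding block_ok_def mid_def by (cases "q = 0") auto
  moreover have "(i, ?w) \<in> set (mid z v K q es)" "(b + j, ?w) \<in> set (mid z v K q es)"
    using ij by (auto simp: mid_def ulist_def vlist_def edge_list_def)
  ultimately have "{i, b + j} \<in> edge ` set (mid z v K q es)" "{i, ?w} \<in> edge ` set (mid z v K q es)"
    "{b + j, ?w} \<in> edge ` set (mid z v K q es)" by (metis edge_def fst_conv snd_conv imageI)+
  moreover have "i \<noteq> b + j" "b + j \<noteq> ?w" "i \<noteq> ?w" using ij by simp_all
  ultimately show "has_triangle (edge ` set (mid z v K q es))"
    unfolding has_triangle_def by blast
next
  let ?w = "2 * b + q" and ?E = "edge ` set (mid z v K q es)"
  \<comment> \<open>The older edges: for \<open>q = 0\<close> nothing precedes the matrix edges, and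
    for larger \<open>q\<close> they are already contained in \<open>es\<close>.\<close>
  let ?o = "set (if q = 0 then mlist z else es)"
  have wfq: "wf q es" and q0: "q = 0 \<longrightarrow> es = []" and kind: "\<forall>p\<in>set es. p \<in> set (mlist z) \<or> 2 * b \<le> snd p"
    and nt: "\<not> has_triangle (edge ` set es)"
    using assms by (auto simp: block_ok_def)
  have midset: "set (mid z v K q es) = ?o \<union> set (ulist z K q) \<union> set (vlist z v q)"
    using q0 by (auto simp: mid_def)
  have ml: "fst p < b \<and> b \<le> snd p \<and> snd p < 2 * b" if "p \<in> set (mlist z)" for p using that by (auto simp: mlist_iff)
  have old: "fst p < snd p \<and> snd p < ?w \<and> (p \<in> set (mlist z) \<or> 2 * b \<le> snd p)" if "p \<in> ?o" for p
    using that ml[of p] wfq kind by (auto simp: wf_def split: if_splits)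
  have nto: "\<not> has_triangle (edge ` ?o)"
  proof (cases "q = 0")
    case True
    \<comment> \<open>Matrix edges join rows to columns; a bipartite graph contains no odd
      cycle.\<close>
    have *: "(x < b \<and> b \<le> y) \<or> (y < b \<and> b \<le> x)" if "{x, y} \<in> edge ` set (mlist z)" for x y
      using that ml by (fastforce simp: edge_def doubleton_eq_iff)
    show ?thesis
    proof
      assume "has_triangle (edge ` ?o)"
      then obtain x y u where "{x, y} \<in> edge ` set (mlist z)" "{y, u} \<in> edge ` set (mlist z)" "{x, u} \<in> edge ` set (mlist z)"
        unfolding has_triangle_def using True by auto
      from *[OF this(1)] *[OF this(2)] *[OF this(3)] show False by linarith
    qed
  qed (use nt in simp)
  have nbr: "x < 2 * b \<and> (x < b \<longrightarrow> z div nb * b + x \<notin> K) \<and> (b \<le> x \<longrightarrow> v (z mod nb * b + (x - b)))"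
    if e: "{x, ?w} \<in> ?E" for x
  proof -
    obtain p where p: "p \<in> set (mid z v K q es)" "edge p = {x, ?w}" using image_ex[OF e] by blast
    have "p \<notin> ?o" using old[of p] p(2) by (auto simp: edge_def doubleton_eq_iff)
    then have "p \<in> set (ulist z K q) \<or> p \<in> set (vlist z v q)" using p(1) midset by blast
    then show ?thesis using p(2) by (auto simp: ulist_def vlist_def edge_list_def edge_def doubleton_eq_iff)
  qed
  have inner: "\<exists>i j. i < b \<and> j < b \<and> Mx (z div nb * b + i) (z mod nb * b + j) \<and> {x, y} = {i, b + j}"
    if e: "{x, y} \<in> ?E" "x < 2 * b" "y < 2 * b" for x y
  proof -
    obtain p where p: "p \<in> set (mid z v K q es)" "edge p = {x, y}" using image_ex[OF e(1)] by blast
    have s: "snd p < 2 * b" using p(2) e by (auto simp: edge_def doubleton_eq_iff)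
    then have "p \<in> ?o" using p(1) unfolding midset by (auto simp: ulist_def vlist_def edge_list_def)
    then have "p \<in> set (mlist z)" using old s by fastforce
    then obtain i j where "i < b" "j < b" "p = (i, b + j)" "Mx (z div nb * b + i) (z mod nb * b + j)"
      using mlist_iff by blast
    then show ?thesis using p(2) by (intro exI[of _ i] exI[of _ j]) (simp add: edge_def)
  qed
  have key: "\<not> new z v \<subseteq> K" if k: "{x, ?w} \<in> ?E" "{y, ?w} \<in> ?E" "{x, y} \<in> ?E" for x y
  proof -
    obtain i j where ij: "i < b" "j < b" "Mx (z div nb * b + i) (z mod nb * b + j)" "{x, y} = {i, b + j}"
      using inner[OF k(3)] nbr[OF k(1)] nbr[OF k(2)] by blast
    then have "{i, ?w} \<in> ?E" "{b + j, ?w} \<in> ?E" using k(1,2) by (auto simp: doubleton_eq_iff)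
    then have "z div nb * b + i \<notin> K" "v (z mod nb * b + j)" using nbr[of i] nbr[of "b + j"] ij by auto
    then show ?thesis using ij unfolding new_def by blast
  qed
  assume "has_triangle ?E"
  then obtain x y u where t: "x \<noteq> y" "y \<noteq> u" "x \<noteq> u" "{x, y} \<in> ?E" "{y, u} \<in> ?E" "{x, u} \<in> ?E"
    unfolding has_triangle_def by blast
  show "\<not> new z v \<subseteq> K"
  proof (cases "x = ?w \<or> y = ?w \<or> u = ?w")
    case True
    then show ?thesis using t key[of y u] key[of x u] key[of x y] by (auto simp: insert_commute)
  next
    case False
    have o: "{c, d} \<in> edge ` ?o" if e: "{c, d} \<in> ?E" "c \<noteq> ?w" "d \<noteq> ?w" for c d
    proof -
      obtain p where p: "p \<in> set (mid z v K q es)" "edge p = {c, d}" using image_ex[OF e(1)] by blast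
      then have "snd p \<noteq> ?w" using e by (auto simp: edge_def doubleton_eq_iff)
      then have "p \<in> ?o" using p(1) unfolding midset by (auto simp: ulist_def vlist_def edge_list_def)
      then show ?thesis unfolding p(2)[symmetric] by (rule imageI)
    qed
    have n: "x \<noteq> ?w" "y \<noteq> ?w" "u \<noteq> ?w" using False by simp_all
    have "has_triangle (edge ` ?o)" unfolding has_triangle_def
      by (intro exI[of _ x] exI[of _ y] exI[of _ u] conjI t(1-3) o t(4-6) n)
    then show ?thesis using nto by blast
  qed
qed

lemma block_ok_ideal_step:
  assumes "block_ok z Y"
  shows "block_ok z (ideal_step z v Y)"
proof (cases "\<not> new z v \<subseteq> known z v \<or> fst Y + 1 = b")
  case True
  then show ?thesis using b1 by (auto simp: ideal_step_def block_ok_def wf_def has_triangle_def)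
next
  case False
  obtain q es where Y: "Y = (q, es)" by fastforce
  have w: "wf q es" "q = 0 \<longrightarrow> es = []" using assms by (auto simp: Y block_ok_def)
  have "wf (Suc q) (mid z v (known z v) q es)" using wf_mid[OF w] .
  moreover have "\<not> has_triangle (edge ` set (mid z v (known z v) q es))"
    using mid_triangle assms False Y by blast
  moreover have "set (mlist z) \<subseteq> set (mid z v (known z v) q es)"
    using assms by (cases "q = 0") (auto simp: Y block_ok_def mid_def)
  moreover have "\<forall>p\<in>set (mid z v (known z v) q es). p \<in> set (mlist z) \<or> 2 * b \<le> snd p"
    using assms by (auto simp: Y block_ok_def mid_def ulist_def vlist_def edge_list_def split: if_splits)
  ultimately show ?thesis using False assms by (auto simp: Y ideal_step_def block_ok_def)
qed

text \<open>If a triangle were overlooked, \<open>post\<close> would say of the correct copy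
  \<open>r\<close> that it did not answer YES now or was killed before. But it answers YES now, and
  NO on every nonempty prefix of the triangle-free sequence \<open>es\<close>.\<close>

lemma post_decides:
  assumes p: "post z v Rs q es \<sigma> \<sigma>' h q' es'" and t: "block_ok z (q, es)" and bad: "vr \<sigma>' 15 = 0"
    and g: "goodrun r (mid z v Rs q es)" "r < R"
  shows "h \<longleftrightarrow> \<not> new z v \<subseteq> Rs"
proof (rule iffI)
  show "h \<Longrightarrow> \<not> new z v \<subseteq> Rs" using p by (simp add: post_def)
  let ?mid = "mid z v Rs q es"
  assume n: "\<not> new z v \<subseteq> Rs"
  show h
  proof (rule ccontr)
    assume "\<not> h"
    then have c: "coin_pos (st r ?mid) \<le> L" "?mid = [] \<or> outp (st r ?mid) \<noteq> [1] \<or> killed r es"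
      using p n g(2) by (auto simp: post_def)
    have tr: "has_triangle (edge ` set ?mid)" using mid_triangle[OF t] n by blast
    then have ne: "?mid \<noteq> []" by (auto simp: has_triangle_def)
    have w: "wf q es" "q = 0 \<longrightarrow> es = []" "q < b" using t by (auto simp: block_ok_def)
    have ins: "insertions N {} ?mid" using wf_ins[OF wf_mid[OF w(1,2)]] w(3) by simp
    note out = goodrun_out[OF g(1) ins c(1)]
    have "outp (st r ?mid) = [1]" using out[of ?mid "[]"] ne tr by simp
    then have "killed r es" using c(2) ne by blast
    then obtain x y where xy: "x \<noteq> []" "es = x @ y" "outp (st r x) \<noteq> [0]" unfolding killed_def by blast
    have "?mid = x @ (y @ (if q = 0 then mlist z else []) @ ulist z Rs q @ vlist z v q)" using xy(2) by (simp add: mid_def)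
    from out[OF this xy(1)] have "has_triangle (edge ` set x)" using xy(3) by (auto split: if_splits)
    then have "has_triangle (edge ` set es)" by (rule has_triangle_mono) (use xy(2) in auto)
    then show False using t by (simp add: block_ok_def)
  qed
qed

section \<open>The loop over all blocks\<close>

definition inv :: "hst \<Rightarrow> (nat \<Rightarrow> nat \<times> (nat \<times> nat) list) \<Rightarrow> nat \<Rightarrow> bool" where
  "inv \<sigma> X k \<longleftrightarrow> env \<sigma> \<and> (\<forall>z<nb * nb. block_state \<sigma> z (fst (X z)) (snd (X z)) \<and> ar \<sigma> 6 z \<le> k) \<and>
     (\<forall>x<P. ar \<sigma> 2 x = 0) \<and> (\<forall>x. n \<le> x \<longrightarrow> x < P \<longrightarrow> ar \<sigma> 1 x = 0)"

definition sum_potential :: "hst \<Rightarrow> (nat \<Rightarrow> nat \<times> (nat \<times> nat) list) \<Rightarrow> nat" where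
  "sum_potential \<sigma> X = (\<Sum>z<nb * nb. G \<sigma> z (fst (X z)) (snd (X z)))"

lemma new_sub: "new z v \<subseteq> {..<n}"
  by (auto simp: new_def Mx_def)

lemma known_Suc: "known (Suc z) v = known z v \<union> new z v"
  by (auto simp: known_def less_Suc_eq)

lemma known_all:
  assumes "i < n"
  shows "i \<in> known (nb * nb) (\<lambda>x. x < n \<and> v x) \<longleftrightarrow> bool_mat_vec n M v i"
proof
  assume "i \<in> known (nb * nb) (\<lambda>x. x < n \<and> v x)"
  then show "bool_mat_vec n M v i" by (auto simp: known_def new_def Mx_def bool_mat_vec_def)
next
  assume "bool_mat_vec n M v i"
  then obtain j where j: "j < n" "M i j" "v j" by (auto simp: bool_mat_vec_def)
  have lt: "i < nb * b" "j < nb * b" using assms j(1) nP by auto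
  have d: "i div b < nb" "j div b < nb" "i mod b < b" "j mod b < b" using div_lt[OF lt(1)] div_lt[OF lt(2)] by auto
  let ?z = "i div b * nb + j div b"
  have z: "?z div nb = i div b" "?z mod nb = j div b" using d by auto
  have "?z < nb * nb"
  proof -
    have "?z < (i div b + 1) * nb" using d(2) by simp
    also have "\<dots> \<le> nb * nb" using d(1) by (intro mult_le_mono1) simp
    finally show ?thesis .
  qed
  moreover have "i \<in> new ?z (\<lambda>x. x < n \<and> v x)"
    unfolding new_def z using d assms j
    by (intro CollectI exI[of _ "i mod b"] exI[of _ "j mod b"]) (auto simp: Mx_def)
  ultimately show "i \<in> known (nb * nb) (\<lambda>x. x < n \<and> v x)" by (auto simp: known_def)
qed

lemma block_state_other:
  assumes "fr X Y z \<sigma> \<sigma>'" "z' \<noteq> z" "ar \<sigma>' 6 z' = ar \<sigma> 6 z'" "ar \<sigma>' 7 z' = ar \<sigma> 7 z'"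
  shows "block_state \<sigma> z' q es \<Longrightarrow> block_state \<sigma>' z' q es" and "G \<sigma>' z' q es = G \<sigma> z' q es"
proof -
  show "block_state \<sigma> z' q es \<Longrightarrow> block_state \<sigma>' z' q es"
    using other_block(1)[OF assms(1,2)] assms(3,4) by (auto simp: block_state_def)
  have "dead (ar \<sigma>') z' V = dead (ar \<sigma>) z' V" for V
    unfolding dead_def using other_block(2)[OF assms(1,2), of _ 2] by auto
  then show "G \<sigma>' z' q es = G \<sigma> z' q es" using assms(3) by (simp add: G_def)
qed

text \<open>\<open>H\<close> is an arbitrary proposition, later the event that each ideal instance
  has a correct copy. Carrying it as a premise of the correctness clauses lets one run deliver the
  unconditional time bound and the conditional answer together. \<open>X\<close> is the actual state
  of the blocks and \<open>Y\<close> the ideal one; they may differ only once flag 15 is set, and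
  then exhaustive search finds all rows anyway.\<close>

lemma wp_blocks:
  assumes env: "env \<sigma>" and block_state: "\<And>z. z < nb * nb \<Longrightarrow> block_state \<sigma> z (fst (X z)) (snd (X z)) \<and> ar \<sigma> 6 z + 1 \<le> U"
    and io: "io \<sigma> v {}"
    and H: "H \<Longrightarrow> \<forall>z<nb * nb. block_ok z (Y z) \<and> (\<exists>r<R. goodrun r (mid z v (known z v) (fst (Y z)) (snd (Y z))))"
    and HX: "H \<Longrightarrow> vr \<sigma> 15 \<noteq> 0 \<or> (\<forall>z<nb * nb. X z = Y z)"
  shows "wp (CFor 18 (EV 6 [*] EV 6) (BLOCK upd)) (\<lambda>\<sigma>'. env \<sigma>' \<and> (\<exists>X' Rs.
      (\<forall>z<nb * nb. block_state \<sigma>' z (fst (X' z)) (snd (X' z)) \<and> ar \<sigma>' 6 z \<le> ar \<sigma> 6 z + 1) \<and> io \<sigma>' v Rs \<and> Rs \<subseteq> {..<n} \<and>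
      (H \<longrightarrow> Rs = known (nb * nb) v \<and> (vr \<sigma>' 15 \<noteq> 0 \<or> (\<forall>z<nb * nb. X' z = ideal_step z v (Y z)))) \<and>
      tm \<sigma>' + sum_potential \<sigma> X \<le> tm \<sigma> + nb * nb * (overhead + step_cost + 20) + 20 + n * hit_cost + sum_potential \<sigma>' X') \<and>
      ar \<sigma>' 1 = ar \<sigma> 1 \<and> hin \<sigma>' = hin \<sigma> \<and> hout \<sigma>' = hout \<sigma>) \<sigma>"
proof -
  define K where "K i \<sigma>' X' Rs \<longleftrightarrow> (\<forall>z<nb * nb. block_state \<sigma>' z (fst (X' z)) (snd (X' z)) \<and>
      ar \<sigma>' 6 z \<le> ar \<sigma> 6 z + (if z < i then 1 else 0)) \<and> io \<sigma>' v Rs \<and> Rs \<subseteq> {..<n} \<and>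
      (H \<longrightarrow> Rs = known i v \<and> (vr \<sigma>' 15 \<noteq> 0 \<or> (\<forall>z<nb * nb. X' z = (if z < i then ideal_step z v (Y z) else Y z)))) \<and>
      tm \<sigma>' + sum_potential \<sigma> X \<le> tm \<sigma> + i * (overhead + step_cost + 20) + 2 + card Rs * hit_cost + sum_potential \<sigma>' X'" for i \<sigma>' X' Rs
  define I where "I i \<sigma>' \<longleftrightarrow> env \<sigma>' \<and> (\<exists>X' Rs. K i \<sigma>' X' Rs) \<and> ar \<sigma>' 1 = ar \<sigma> 1 \<and> hin \<sigma>' = hin \<sigma> \<and> hout \<sigma>' = hout \<sigma>" for i \<sigma>'
  have block_state_upd: "block_state (\<sigma>\<lparr>vr := g, tm := t\<rparr>) z q es = block_state \<sigma> z q es" if "g 15 = vr \<sigma> 15" for \<sigma> g t z q es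
    using that by (simp add: block_state_def)
  have G_upd: "G (\<sigma>\<lparr>vr := g, tm := t\<rparr>) z q es = G \<sigma> z q es" for \<sigma> g t z q es by (simp add: G_def)
  have sum_potential_upd: "sum_potential (\<sigma>\<lparr>vr := g, tm := t\<rparr>) X = sum_potential \<sigma> X" for \<sigma> g t X by (simp add: sum_potential_def G_upd)
  have env_upd: "env \<sigma> \<Longrightarrow> env (\<sigma>\<lparr>vr := (vr \<sigma>)(18 := x), tm := t\<rparr>)" for \<sigma> x t by (simp add: env_def)
  show ?thesis
  proof (rule wp_for[where I = I and m = "nb * nb"])
    have "K 0 (\<sigma>\<lparr>vr := (vr \<sigma>)(18 := 0), tm := tm \<sigma> + 2\<rparr>) X {}"
      unfolding K_def using block_state io HX by (auto simp: block_state_upd sum_potential_upd known_def)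
    then show "I 0 (\<sigma>\<lparr>vr := (vr \<sigma>)(18 := 0), tm := tm \<sigma> + 2\<rparr>)"
      unfolding I_def using env_upd[OF env] by auto
  next
    fix i \<sigma>1 assume i: "i < nb * nb" and I: "I i \<sigma>1" and v1: "vr \<sigma>1 18 = i"
    from I obtain X1 Rs where K: "K i \<sigma>1 X1 Rs" unfolding I_def by blast
    have env1: "env \<sigma>1" and same1: "ar \<sigma>1 1 = ar \<sigma> 1" "hin \<sigma>1 = hin \<sigma>" "hout \<sigma>1 = hout \<sigma>" using I by (auto simp: I_def)
    have b1: "\<And>z. z < nb * nb \<Longrightarrow> block_state \<sigma>1 z (fst (X1 z)) (snd (X1 z))"
      "\<And>z. z < nb * nb \<Longrightarrow> ar \<sigma>1 6 z \<le> ar \<sigma> 6 z + (if z < i then 1 else 0)"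
      and io1: "io \<sigma>1 v Rs" and Rs: "Rs \<subseteq> {..<n}"
      and H1: "H \<Longrightarrow> Rs = known i v \<and> (vr \<sigma>1 15 \<noteq> 0 \<or> (\<forall>z<nb * nb. X1 z = (if z < i then ideal_step z v (Y z) else Y z)))"
      and t1: "tm \<sigma>1 + sum_potential \<sigma> X \<le> tm \<sigma> + i * (overhead + step_cost + 20) + 2 + card Rs * hit_cost + sum_potential \<sigma>1 X1"
      using K unfolding K_def by blast+
    let ?\<tau> = "\<sigma>1\<lparr>tm := tm \<sigma>1 + (etime (EV 6 [*] EV 6) + 3)\<rparr>"
    have w: "wp (BLOCK upd) (\<lambda>\<sigma>'. fr XB {2, 6, 7, 8} i ?\<tau> \<sigma>' \<and> (\<forall>x. x \<noteq> i \<longrightarrow> ar \<sigma>' 6 x = ar ?\<tau> 6 x \<and> ar \<sigma>' 7 x = ar ?\<tau> 7 x) \<and>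
      ar \<sigma>' 6 i \<le> ar ?\<tau> 6 i + 1 \<and> (\<exists>h q' es'. post i v Rs (fst (X1 i)) (snd (X1 i)) ?\<tau> \<sigma>' h q' es')) ?\<tau>"
    proof (rule wp_BLOCK[OF _ _ i])
      show "env ?\<tau>" using env1 by (simp add: env_def)
      show "block_state ?\<tau> i (fst (X1 i)) (snd (X1 i))" using b1(1)[OF i] by (simp add: block_state_def)
      show "ar ?\<tau> 6 i + 1 \<le> U" using b1(2)[OF i] block_state[OF i] by simp
    qed (use v1 io1 in simp_all)
    show "wp (BLOCK upd) (\<lambda>\<sigma>'. vr \<sigma>' 18 = i \<and> I (Suc i) (\<sigma>'\<lparr>vr := (vr \<sigma>')(18 := Suc i), tm := tm \<sigma>' + 4\<rparr>)) ?\<tau>"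
    proof (rule wp_mono[OF w])
      fix \<sigma>2 assume a: "fr XB {2, 6, 7, 8} i ?\<tau> \<sigma>2 \<and> (\<forall>x. x \<noteq> i \<longrightarrow> ar \<sigma>2 6 x = ar ?\<tau> 6 x \<and> ar \<sigma>2 7 x = ar ?\<tau> 7 x) \<and>
        ar \<sigma>2 6 i \<le> ar ?\<tau> 6 i + 1 \<and> (\<exists>h q' es'. post i v Rs (fst (X1 i)) (snd (X1 i)) ?\<tau> \<sigma>2 h q' es')"
      then have f: "fr XB {2, 6, 7, 8} i \<sigma>1 \<sigma>2" and oth: "\<And>x. x \<noteq> i \<Longrightarrow> ar \<sigma>2 6 x = ar \<sigma>1 6 x \<and> ar \<sigma>2 7 x = ar \<sigma>1 7 x"
        and a6: "ar \<sigma>2 6 i \<le> ar \<sigma>1 6 i + 1" by simp_all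
      obtain h q' es' where p: "post i v Rs (fst (X1 i)) (snd (X1 i)) ?\<tau> \<sigma>2 h q' es'" using a by blast
      define X2 where "X2 = X1(i := (q', es'))"
      define Rs2 where "Rs2 = (if h then Rs \<union> new i v else Rs)"
      have env2: "env \<sigma>2" using env_fr[OF env1 f] by simp
      have "G ?\<tau> i q es = G \<sigma>1 i q es" for q es by (simp add: G_def)
      then have tp: "tm \<sigma>2 + G \<sigma>1 i (fst (X1 i)) (snd (X1 i)) \<le> tm \<sigma>1 + 6 + overhead + step_cost + (if h then hit_cost else 0) + G \<sigma>2 i q' es'"
      proof -
        have "tm \<sigma>2 + G ?\<tau> i (fst (X1 i)) (snd (X1 i)) \<le> tm ?\<tau> + overhead + step_cost + (if h then hit_cost else 0) + G \<sigma>2 i q' es'"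
          using p unfolding post_def by blast
        then show ?thesis using \<open>\<And>q es. G ?\<tau> i q es = G \<sigma>1 i q es\<close> by simp
      qed
      have K2: "K (Suc i) (\<sigma>2\<lparr>vr := (vr \<sigma>2)(18 := Suc i), tm := tm \<sigma>2 + 4\<rparr>) X2 Rs2"
        unfolding K_def
      proof (intro conjI allI impI)
        fix z assume z: "z < nb * nb"
        have "block_state \<sigma>2 z (fst (X2 z)) (snd (X2 z))"
        proof (cases "z = i")
          case True
          moreover have "block_state \<sigma>2 i q' es'" using p unfolding post_def by blast
          ultimately show ?thesis by (simp add: X2_def)
        next
          case False
          then show ?thesis using block_state_other(1)[OF f False] oth[OF False] b1(1)[OF z] by (simp add: X2_def)
        qed
        then show "block_state (\<sigma>2\<lparr>vr := (vr \<sigma>2)(18 := Suc i), tm := tm \<sigma>2 + 4\<rparr>) z (fst (X2 z)) (snd (X2 z))"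
          by (simp add: block_state_upd)
        show "ar (\<sigma>2\<lparr>vr := (vr \<sigma>2)(18 := Suc i), tm := tm \<sigma>2 + 4\<rparr>) 6 z \<le> ar \<sigma> 6 z + (if z < Suc i then 1 else 0)"
          using a6 oth[of z] b1(2)[OF z] by (cases "z = i") auto
      next
        show "io (\<sigma>2\<lparr>vr := (vr \<sigma>2)(18 := Suc i), tm := tm \<sigma>2 + 4\<rparr>) v Rs2"
          using p unfolding post_def Rs2_def by simp
        show "Rs2 \<subseteq> {..<n}" using Rs new_sub by (auto simp: Rs2_def)
      next
        assume H
        \<comment> \<open>With the flag clear, \<open>post_decides\<close> makes the actual step the
          ideal one. With the flag set, \<open>post\<close> itself guarantees that no row of the
          block is missed, although the states may deviate.\<close>
        have un: "Rs2 = Rs \<union> new i v \<and> (vr \<sigma>2 15 \<noteq> 0 \<or> (\<forall>z<nb * nb. X2 z = (if z < Suc i then ideal_step z v (Y z) else Y z)))"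
        proof (cases "vr \<sigma>2 15 = 0")
          case True
          then have "vr \<sigma>1 15 = 0" using f by (auto simp: fr_def)
          then have X1: "\<And>z. z < nb * nb \<Longrightarrow> X1 z = (if z < i then ideal_step z v (Y z) else Y z)" and Rk: "Rs = known i v"
            using H1[OF \<open>H\<close>] by auto
          obtain r where r: "r < R" "goodrun r (mid i v (known i v) (fst (Y i)) (snd (Y i)))" and ti: "block_ok i (Y i)"
            using H[OF \<open>H\<close>] i by blast
          have Xi: "X1 i = Y i" using X1[OF i] by simp
          have h: "h \<longleftrightarrow> \<not> new i v \<subseteq> Rs"
            using post_decides[OF p _ True _ r(1)] ti r(2) Xi Rk by simp
          have "(q', es') = ideal_step i v (Y i)" using p h Xi Rk by (auto simp: post_def ideal_step_def)
          then have "X2 z = (if z < Suc i then ideal_step z v (Y z) else Y z)" if "z < nb * nb" for z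
            using X1[OF that] by (auto simp: X2_def less_Suc_eq)
          moreover have "Rs2 = Rs \<union> new i v" using h by (auto simp: Rs2_def)
          ultimately show ?thesis by blast
        next
          case False
          then have "\<not> h \<Longrightarrow> new i v \<subseteq> Rs" using p by (auto simp: post_def)
          then show ?thesis using False by (auto simp: Rs2_def)
        qed
        then show "Rs2 = known (Suc i) v" using H1[OF \<open>H\<close>] by (simp add: known_Suc)
        show "vr (\<sigma>2\<lparr>vr := (vr \<sigma>2)(18 := Suc i), tm := tm \<sigma>2 + 4\<rparr>) 15 \<noteq> 0 \<or>
          (\<forall>z<nb * nb. X2 z = (if z < Suc i then ideal_step z v (Y z) else Y z))" using un by simp
      next
        \<comment> \<open>Every hit adds a row, so the number of hits of a query is at most the
          number of rows of its result.\<close>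
        have card: "card Rs * hit_cost + (if h then hit_cost else 0) \<le> card Rs2 * hit_cost"
        proof (cases h)
          case True
          then have "Rs \<subset> Rs2" using p by (auto simp: post_def Rs2_def)
          moreover have "finite Rs2" using Rs new_sub[of i v] finite_subset[of Rs2 "{..<n}"] by (auto simp: Rs2_def)
          ultimately have "Suc (card Rs) \<le> card Rs2" using psubset_card_mono by (metis Suc_leI)
          then have "Suc (card Rs) * hit_cost \<le> card Rs2 * hit_cost" by (rule mult_le_mono1)
          then show ?thesis using True by simp
        qed (simp add: Rs2_def)
        have s1: "sum_potential \<sigma>1 X1 = G \<sigma>1 i (fst (X1 i)) (snd (X1 i)) + (\<Sum>z\<in>{..<nb * nb} - {i}. G \<sigma>1 z (fst (X1 z)) (snd (X1 z)))"
          unfolding sum_potential_def using i by (subst sum.remove[of _ i]) auto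
        have "sum_potential \<sigma>2 X2 = G \<sigma>2 i (fst (X2 i)) (snd (X2 i)) + (\<Sum>z\<in>{..<nb * nb} - {i}. G \<sigma>2 z (fst (X2 z)) (snd (X2 z)))"
          unfolding sum_potential_def using i by (subst sum.remove[of _ i]) auto
        also have "(\<Sum>z\<in>{..<nb * nb} - {i}. G \<sigma>2 z (fst (X2 z)) (snd (X2 z))) = (\<Sum>z\<in>{..<nb * nb} - {i}. G \<sigma>1 z (fst (X1 z)) (snd (X1 z)))"
          using block_state_other(2)[OF f] oth by (intro sum.cong) (auto simp: X2_def)
        finally have s2: "sum_potential \<sigma>2 X2 = G \<sigma>2 i q' es' + (\<Sum>z\<in>{..<nb * nb} - {i}. G \<sigma>1 z (fst (X1 z)) (snd (X1 z)))"
          by (simp add: X2_def fun_upd_def)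
        show "tm (\<sigma>2\<lparr>vr := (vr \<sigma>2)(18 := Suc i), tm := tm \<sigma>2 + 4\<rparr>) + sum_potential \<sigma> X \<le> tm \<sigma> + Suc i * (overhead + step_cost + 20) + 2 +
          card Rs2 * hit_cost + sum_potential (\<sigma>2\<lparr>vr := (vr \<sigma>2)(18 := Suc i), tm := tm \<sigma>2 + 4\<rparr>) X2"
          using t1 tp card s1 s2 by (simp add: sum_potential_upd)
      qed
      have "I (Suc i) (\<sigma>2\<lparr>vr := (vr \<sigma>2)(18 := Suc i), tm := tm \<sigma>2 + 4\<rparr>)"
        unfolding I_def using K2 env_upd[OF env2] same1 f fr_ar[OF f, of 1] by (auto simp: fr_def)
      then show "vr \<sigma>2 18 = i \<and> I (Suc i) (\<sigma>2\<lparr>vr := (vr \<sigma>2)(18 := Suc i), tm := tm \<sigma>2 + 4\<rparr>)"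
        using fr_vr[OF f, of 18] v1 by simp
    qed
  next
    fix i \<sigma>1 assume "I i \<sigma>1"
    then show "eval (EV 6 [*] EV 6) \<sigma>1 = nb * nb" by (simp add: I_def env_def)
  next
    fix \<sigma>1 assume I: "I (nb * nb) \<sigma>1"
    let ?\<sigma> = "\<sigma>1\<lparr>tm := tm \<sigma>1 + (etime (EV 6 [*] EV 6) + 3)\<rparr>"
    from I obtain X1 Rs where K: "K (nb * nb) \<sigma>1 X1 Rs" unfolding I_def by blast
    have Rs: "Rs \<subseteq> {..<n}" using K unfolding K_def by blast
    then have "card Rs \<le> n" using card_mono[of "{..<n}" Rs] by simp
    then have "card Rs * hit_cost \<le> n * hit_cost" by (rule mult_le_mono1)
    moreover have "tm \<sigma>1 + sum_potential \<sigma> X \<le> tm \<sigma> + nb * nb * (overhead + step_cost + 20) + 2 + card Rs * hit_cost + sum_potential \<sigma>1 X1"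
      using K unfolding K_def by blast
    moreover have "sum_potential ?\<sigma> X1 = sum_potential \<sigma>1 X1" "tm ?\<sigma> = tm \<sigma>1 + 6" by (simp_all add: sum_potential_def G_def)
    ultimately have t: "tm ?\<sigma> + sum_potential \<sigma> X \<le> tm \<sigma> + nb * nb * (overhead + step_cost + 20) + 20 + n * hit_cost + sum_potential ?\<sigma> X1" by linarith
    have "env ?\<sigma>" using I by (simp add: I_def env_def)
    moreover have "\<forall>z<nb * nb. block_state ?\<sigma> z (fst (X1 z)) (snd (X1 z)) \<and> ar ?\<sigma> 6 z \<le> ar \<sigma> 6 z + 1"
      using K unfolding K_def by (simp add: block_state_def)
    moreover have "io ?\<sigma> v Rs" using K unfolding K_def by simp
    moreover have "H \<longrightarrow> Rs = known (nb * nb) v \<and> (vr ?\<sigma> 15 \<noteq> 0 \<or> (\<forall>z<nb * nb. X1 z = ideal_step z v (Y z)))"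
      using K unfolding K_def by simp
    moreover have "ar ?\<sigma> 1 = ar \<sigma> 1 \<and> hin ?\<sigma> = hin \<sigma> \<and> hout ?\<sigma> = hout \<sigma>" using I by (simp add: I_def)
    ultimately show "env ?\<sigma> \<and> (\<exists>X' Rs. (\<forall>z<nb * nb. block_state ?\<sigma> z (fst (X' z)) (snd (X' z)) \<and> ar ?\<sigma> 6 z \<le> ar \<sigma> 6 z + 1) \<and>
      io ?\<sigma> v Rs \<and> Rs \<subseteq> {..<n} \<and>
      (H \<longrightarrow> Rs = known (nb * nb) v \<and> (vr ?\<sigma> 15 \<noteq> 0 \<or> (\<forall>z<nb * nb. X' z = ideal_step z v (Y z)))) \<and>
      tm ?\<sigma> + sum_potential \<sigma> X \<le> tm \<sigma> + nb * nb * (overhead + step_cost + 20) + 20 + n * hit_cost + sum_potential ?\<sigma> X') \<and>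
      ar ?\<sigma> 1 = ar \<sigma> 1 \<and> hin ?\<sigma> = hin \<sigma> \<and> hout ?\<sigma> = hout \<sigma>"
      using Rs t by blast
  qed (rule bounds(2))
qed

end

section \<open>Preprocessing, a single query and the whole session\<close>

lemma map_div_mod:
  "concat (map (\<lambda>i. map (f i) [0..<n]) [0..<m]) = map (\<lambda>z. f (z div n) (z mod n)) [0..<m * n]"
proof (induction m)
  case (Suc m)
  have "[0..<Suc m * n] = [0..<m * n] @ map (\<lambda>j. j + m * n) [0..<n]"
    using upt_add_eq_append[of 0 "m * n" n] by (simp only: map_add_upt) (simp add: add.commute)
  moreover have "map (\<lambda>z. f (z div n) (z mod n)) (map (\<lambda>j. j + m * n) [0..<n]) = map (f m) [0..<n]"
    by simp
  ultimately show ?case using Suc by simp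
qed simp

lemma mult_add_inj: "y < p \<Longrightarrow> y' < p \<Longrightarrow> x * p + y = x' * p + y' \<longleftrightarrow> x = x' \<and> y = (y' :: nat)"
proof
  assume y: "y < p" "y' < p" and e: "x * p + y = x' * p + y'"
  have "(x * p + y) div p = (x' * p + y') div p" "(x * p + y) mod p = (x' * p + y') mod p"
    by (simp_all only: e)
  then show "x = x' \<and> y = y'" using y by simp
qed simp

lemma mat_input_eq: "mat_input n M = n # map (\<lambda>z. of_bool (M (z div n) (z mod n))) [0..<n * n]"
  unfolding mat_input_def vec_input_def map_div_mod by simp

text \<open>The input of \<open>pre\<close> is \<open>N\<close> followed by zeros, the empty graph,
  so only one word of array 8 has to be written. The bases 8 and 9 coincide, hence
  \<open>pre\<close> leaves its memory in the snapshot area; its last output is cleared because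
  \<open>snap\<close> wants cell 1 to be 0.\<close>

definition PRE2 :: "com \<Rightarrow> cmd" where
  "PRE2 pre = CFor 21 (EV 0 [*] EV 0) (CRd 22 ;; CStr 0 (EV 21 [div] EV 0 [*] EV 7 [+] EV 21 [mod] EV 0) (EV 22)) ;;
     CFor 21 (EV 5 [*] EV 4) (CFl 22 ;; CStr 3 (EV 21) (EV 22)) ;;
     CStr 8 (EC 0) (EV 1) ;; CAsg 10 (EC 1) ;;
     CFor 11 (EV 5) (CAsg 8 (EV 11 [*] EV 3) ;; CAsg 9 (EV 8) ;; CAsg 12 (EC 0) ;; tr pre ;; WRITE_CELL (EC 1) (EC 0))"

context red
begin

lemma same_cong:
  assumes "\<And>k. k \<in> {0, 3, 4, 5, 6, 7} \<Longrightarrow> ar \<sigma>' k = ar \<sigma> k" "\<And>v. v \<le> 7 \<or> v = 15 \<Longrightarrow> vr \<sigma>' v = vr \<sigma> v"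
  shows "env \<sigma>' = env \<sigma>" "block_state \<sigma>' z q es = block_state \<sigma> z q es" "G \<sigma>' z q es = G \<sigma> z q es" "sum_potential \<sigma>' X = sum_potential \<sigma> X"
proof -
  have vm: "vmem (ar \<sigma>') = vmem (ar \<sigma>)" using assms(1) by (simp add: vmem_def fun_eq_iff)
  show "env \<sigma>' = env \<sigma>" using assms by (simp add: env_def snap_def)
  show "block_state \<sigma>' z q es = block_state \<sigma> z q es" for z q es
    using assms unfolding block_state_def rep_def vm by simp
  show G: "G \<sigma>' z q es = G \<sigma> z q es" for z q es
    using assms unfolding G_def dead_def vm by simp
  show "sum_potential \<sigma>' X = sum_potential \<sigma> X" unfolding sum_potential_def G ..
qed

definition query_cost :: nat where "query_cost = nb * nb * (overhead + step_cost + 20) + n * hit_cost + 60 * n + 60"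

abbreviation "res v \<equiv> (\<lambda>x. x < n \<and> v x)"

text \<open>A query rolls back each block at most once, so \<open>k\<close> bounds the versions by
  the number of queries answered, and they fit into words.\<close>

lemma wp_QUERY:
  assumes inv: "inv \<sigma> X k" and io: "hin \<sigma> = vec_input n v" "hout \<sigma> = []" and k: "k + 1 \<le> U"
    and H: "H \<Longrightarrow> \<forall>z<nb * nb. block_ok z (Y z) \<and> (\<exists>r<R. goodrun r (mid z (res v) (known z (res v)) (fst (Y z)) (snd (Y z))))"
    and HX: "H \<Longrightarrow> vr \<sigma> 15 \<noteq> 0 \<or> (\<forall>z<nb * nb. X z = Y z)"
  shows "wp (QUERY upd) (\<lambda>\<sigma>'. \<exists>X'. inv \<sigma>' X' (k + 1) \<and> tm \<sigma>' + sum_potential \<sigma> X \<le> tm \<sigma> + query_cost + sum_potential \<sigma>' X' \<and>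
     (H \<longrightarrow> hout \<sigma>' = vec_input n (bool_mat_vec n M v) \<and>
        (vr \<sigma>' 15 \<noteq> 0 \<or> (\<forall>z<nb * nb. X' z = ideal_step z (res v) (Y z))))) \<sigma>"
    (is "wp _ ?Q \<sigma>")
proof -
  have env: "env \<sigma>" using inv by (simp add: inv_def)
  define I where "I i \<sigma>' \<longleftrightarrow> (\<forall>w. w \<noteq> 21 \<longrightarrow> w \<noteq> 22 \<longrightarrow> vr \<sigma>' w = vr \<sigma> w) \<and> (\<forall>j. j \<noteq> 1 \<longrightarrow> ar \<sigma>' j = ar \<sigma> j) \<and>
    (\<forall>x<i. ar \<sigma>' 1 x = of_bool (v x)) \<and> (\<forall>x. n \<le> x \<longrightarrow> x < P \<longrightarrow> ar \<sigma>' 1 x = 0) \<and>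
    hin \<sigma>' = map (\<lambda>j. of_bool (v j)) [i..<n] \<and> hout \<sigma>' = [] \<and> tm \<sigma>' \<le> tm \<sigma> + 30 * i + 2" for i and \<sigma>' :: hst
  have w1: "wp (CFor 21 (EV 0) (CRd 22 ;; CStr 1 (EV 21) (EV 22))) (\<lambda>\<sigma>'. I n (\<sigma>'\<lparr>tm := tm \<sigma>' - 4\<rparr>)) \<sigma>"
  proof (rule wp_for[where I = I and m = n])
    show "I 0 (\<sigma>\<lparr>vr := (vr \<sigma>)(21 := 0), tm := tm \<sigma> + 2\<rparr>)"
      using inv io by (simp add: I_def inv_def vec_input_def)
  next
    fix i \<sigma>1 assume i: "i < n" and I: "I i \<sigma>1" and v1: "vr \<sigma>1 21 = i"
    have h: "hin \<sigma>1 = of_bool (v i) # map (\<lambda>j. of_bool (v j)) [Suc i..<n]"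
      using I i by (simp add: I_def upt_conv_Cons)
    have "(of_bool (v i) :: nat) \<le> U" using U_pos by simp
    then show "wp (CRd 22 ;; CStr 1 (EV 21) (EV 22))
      (\<lambda>\<sigma>'. vr \<sigma>' 21 = i \<and> I (Suc i) (\<sigma>'\<lparr>vr := (vr \<sigma>')(21 := Suc i), tm := tm \<sigma>' + 4\<rparr>))
      (\<sigma>1\<lparr>tm := tm \<sigma>1 + (etime (EV 0) + 3)\<rparr>)"
      using I i v1 h
      by (intro wp_seq, intro wp_rd wp_str[where a = "EV 21"]) (auto simp: I_def less_Suc_eq)
  next
    fix i \<sigma>1 assume "I i \<sigma>1" then show "eval (EV 0) \<sigma>1 = n" using env by (simp add: I_def env_def)
  next
    fix \<sigma>1 assume "I n \<sigma>1"
    then show "I n (\<sigma>1\<lparr>tm := tm \<sigma>1 + (etime (EV 0) + 3), tm := tm (\<sigma>1\<lparr>tm := tm \<sigma>1 + (etime (EV 0) + 3)\<rparr>) - 4\<rparr>)"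
      by (simp add: I_def)
  qed (rule bounds(6))
  have main: "wp (CFor 18 (EV 6 [*] EV 6) (BLOCK upd) ;;
     CFor 21 (EV 0) (CAsg 22 (EA 2 (EV 21)) ;; CWr 22 ;; CStr 2 (EV 21) (EC 0))) ?Q \<sigma>1"
    if I: "I n (\<sigma>1\<lparr>tm := tm \<sigma>1 - 4\<rparr>)" for \<sigma>1
  proof (rule wp_seq)
    have "tm \<sigma>1 - 4 \<le> tm \<sigma> + 30 * n + 2" using I by (simp add: I_def)
    then have t1: "tm \<sigma>1 \<le> tm \<sigma> + 30 * n + 6" by linarith
    have a1: "\<And>j. j \<noteq> 1 \<Longrightarrow> ar \<sigma>1 j = ar \<sigma> j" "\<And>w. w \<noteq> 21 \<Longrightarrow> w \<noteq> 22 \<Longrightarrow> vr \<sigma>1 w = vr \<sigma> w"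
      "\<And>x. n \<le> x \<Longrightarrow> x < P \<Longrightarrow> ar \<sigma>1 1 x = 0" "\<And>x. x < n \<Longrightarrow> ar \<sigma>1 1 x = of_bool (v x)" "hout \<sigma>1 = []"
      using I by (simp_all add: I_def)
    have c1: "env \<sigma>1 = env \<sigma>" "\<And>z q es. block_state \<sigma>1 z q es = block_state \<sigma> z q es" "\<And>X. sum_potential \<sigma>1 X = sum_potential \<sigma> X"
      by (rule same_cong; use a1 in force)+
    have "wp (CFor 18 (EV 6 [*] EV 6) (BLOCK upd)) (\<lambda>\<sigma>'. env \<sigma>' \<and> (\<exists>X' Rs.
      (\<forall>z<nb * nb. block_state \<sigma>' z (fst (X' z)) (snd (X' z)) \<and> ar \<sigma>' 6 z \<le> ar \<sigma>1 6 z + 1) \<and> io \<sigma>' (res v) Rs \<and> Rs \<subseteq> {..<n} \<and>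
      (H \<longrightarrow> Rs = known (nb * nb) (res v) \<and> (vr \<sigma>' 15 \<noteq> 0 \<or> (\<forall>z<nb * nb. X' z = ideal_step z (res v) (Y z)))) \<and>
      tm \<sigma>' + sum_potential \<sigma>1 X \<le> tm \<sigma>1 + nb * nb * (overhead + step_cost + 20) + 20 + n * hit_cost + sum_potential \<sigma>' X') \<and>
      ar \<sigma>' 1 = ar \<sigma>1 1 \<and> hin \<sigma>' = hin \<sigma>1 \<and> hout \<sigma>' = hout \<sigma>1) \<sigma>1"
    proof (rule wp_blocks)
      show "env \<sigma>1" using c1 env by simp
      show "io \<sigma>1 (res v) {}" unfolding io_def
      proof (intro conjI allI impI)
        fix x assume "x < P"
        then show "ar \<sigma>1 1 x = of_bool (res v x)" "ar \<sigma>1 2 x = of_bool (x \<in> {})"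
          using a1(3,4)[of x] a1(1)[of 2] inv by (cases "x < n"; simp add: inv_def)+
      qed
      show "block_state \<sigma>1 z (fst (X z)) (snd (X z)) \<and> ar \<sigma>1 6 z + 1 \<le> U" if "z < nb * nb" for z
      proof -
        have "ar \<sigma> 6 z \<le> k" "block_state \<sigma> z (fst (X z)) (snd (X z))" using inv that by (auto simp: inv_def)
        then show ?thesis using a1(1)[of 6] k c1(2) by simp
      qed
    qed (use H HX a1(2)[of 15] in auto)
    then show "wp (CFor 18 (EV 6 [*] EV 6) (BLOCK upd))
      (wp (CFor 21 (EV 0) (CAsg 22 (EA 2 (EV 21)) ;; CWr 22 ;; CStr 2 (EV 21) (EC 0))) ?Q) \<sigma>1"
    proof (rule wp_mono)
      fix \<sigma>2 assume a: "env \<sigma>2 \<and> (\<exists>X' Rs.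
      (\<forall>z<nb * nb. block_state \<sigma>2 z (fst (X' z)) (snd (X' z)) \<and> ar \<sigma>2 6 z \<le> ar \<sigma>1 6 z + 1) \<and> io \<sigma>2 (res v) Rs \<and> Rs \<subseteq> {..<n} \<and>
      (H \<longrightarrow> Rs = known (nb * nb) (res v) \<and> (vr \<sigma>2 15 \<noteq> 0 \<or> (\<forall>z<nb * nb. X' z = ideal_step z (res v) (Y z)))) \<and>
      tm \<sigma>2 + sum_potential \<sigma>1 X \<le> tm \<sigma>1 + nb * nb * (overhead + step_cost + 20) + 20 + n * hit_cost + sum_potential \<sigma>2 X') \<and>
      ar \<sigma>2 1 = ar \<sigma>1 1 \<and> hin \<sigma>2 = hin \<sigma>1 \<and> hout \<sigma>2 = hout \<sigma>1"
      have env2: "env \<sigma>2" and out2: "hout \<sigma>2 = []" and a2: "ar \<sigma>2 1 = ar \<sigma>1 1" using a a1(5) by auto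
      from a obtain X' Rs where b2: "\<And>z. z < nb * nb \<Longrightarrow> block_state \<sigma>2 z (fst (X' z)) (snd (X' z)) \<and> ar \<sigma>2 6 z \<le> ar \<sigma>1 6 z + 1"
        and io2: "io \<sigma>2 (res v) Rs" and Rs: "Rs \<subseteq> {..<n}"
        and H2: "H \<Longrightarrow> Rs = known (nb * nb) (res v) \<and> (vr \<sigma>2 15 \<noteq> 0 \<or> (\<forall>z<nb * nb. X' z = ideal_step z (res v) (Y z)))"
        and t2: "tm \<sigma>2 + sum_potential \<sigma>1 X \<le> tm \<sigma>1 + nb * nb * (overhead + step_cost + 20) + 20 + n * hit_cost + sum_potential \<sigma>2 X'"
        by blast
      define J where "J i \<sigma>' \<longleftrightarrow> (\<forall>w. w \<noteq> 21 \<longrightarrow> w \<noteq> 22 \<longrightarrow> vr \<sigma>' w = vr \<sigma>2 w) \<and> (\<forall>j. j \<noteq> 2 \<longrightarrow> ar \<sigma>' j = ar \<sigma>2 j) \<and>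
        (\<forall>x<P. ar \<sigma>' 2 x = of_bool (i \<le> x \<and> x \<in> Rs)) \<and> hout \<sigma>' = map (\<lambda>j. of_bool (j \<in> Rs)) [0..<i] \<and>
        tm \<sigma>' \<le> tm \<sigma>2 + 30 * i + 2" for i and \<sigma>' :: hst
      show "wp (CFor 21 (EV 0) (CAsg 22 (EA 2 (EV 21)) ;; CWr 22 ;; CStr 2 (EV 21) (EC 0))) ?Q \<sigma>2"
      proof (rule wp_for[where I = J and m = n])
        show "J 0 (\<sigma>2\<lparr>vr := (vr \<sigma>2)(21 := 0), tm := tm \<sigma>2 + 2\<rparr>)"
          using io2 out2 by (simp add: J_def io_def)
      next
        fix i \<sigma>3 assume i: "i < n" and J: "J i \<sigma>3" and v3: "vr \<sigma>3 21 = i"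
        have iP: "i < P" using i nP by simp
        have x: "ar \<sigma>3 2 i = of_bool (i \<in> Rs)" using J iP unfolding J_def by simp
        have y: "\<And>x. x < P \<Longrightarrow> ar \<sigma>3 2 x = of_bool (i \<le> x \<and> x \<in> Rs)" using J unfolding J_def by blast
        have z: "(if x = i then 0 else ar \<sigma>3 2 x) = of_bool (Suc i \<le> x \<and> x \<in> Rs)" if "x < P" for x
          using y[OF that] by (cases "x = i") (auto simp: Suc_le_eq le_less)
        have J': "(\<forall>w. w \<noteq> 21 \<longrightarrow> w \<noteq> 22 \<longrightarrow> vr \<sigma>3 w = vr \<sigma>2 w)" "(\<forall>j. j \<noteq> 2 \<longrightarrow> ar \<sigma>3 j = ar \<sigma>2 j)"
          "hout \<sigma>3 = map (\<lambda>j. of_bool (j \<in> Rs)) [0..<i]" "tm \<sigma>3 \<le> tm \<sigma>2 + 30 * i + 2"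
          using J unfolding J_def by blast+
        have "(of_bool (i \<in> Rs) :: nat) \<le> U" using U_pos by simp
        then show "wp (CAsg 22 (EA 2 (EV 21)) ;; CWr 22 ;; CStr 2 (EV 21) (EC 0))
          (\<lambda>\<sigma>'. vr \<sigma>' 21 = i \<and> J (Suc i) (\<sigma>'\<lparr>vr := (vr \<sigma>')(21 := Suc i), tm := tm \<sigma>' + 4\<rparr>))
          (\<sigma>3\<lparr>tm := tm \<sigma>3 + (etime (EV 0) + 3)\<rparr>)"
          using J' v3 x z by (intro wp_seq wp_asg wp_wr wp_str) (simp_all add: J_def)
      next
        fix i \<sigma>3 assume "J i \<sigma>3" then show "eval (EV 0) \<sigma>3 = n" using env2 by (simp add: J_def env_def)
      next
        fix \<sigma>3 assume J: "J n \<sigma>3"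
        let ?\<sigma> = "\<sigma>3\<lparr>tm := tm \<sigma>3 + (etime (EV 0) + 3)\<rparr>"
        have J': "\<And>w. w \<noteq> 21 \<Longrightarrow> w \<noteq> 22 \<Longrightarrow> vr \<sigma>3 w = vr \<sigma>2 w" "\<And>j. j \<noteq> 2 \<Longrightarrow> ar \<sigma>3 j = ar \<sigma>2 j"
          "hout \<sigma>3 = map (\<lambda>j. of_bool (j \<in> Rs)) [0..<n]" "tm \<sigma>3 \<le> tm \<sigma>2 + 30 * n + 2"
          "\<And>x. x < P \<Longrightarrow> ar \<sigma>3 2 x = of_bool (n \<le> x \<and> x \<in> Rs)"
          using J unfolding J_def by blast+
        have c3: "env ?\<sigma> = env \<sigma>2" "\<And>z q es. block_state ?\<sigma> z q es = block_state \<sigma>2 z q es" "\<And>X. sum_potential ?\<sigma> X = sum_potential \<sigma>2 X"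
          by (rule same_cong; use J' in force)+
        have inv3: "inv ?\<sigma> X' (k + 1)"
          unfolding inv_def
        proof (intro conjI allI impI)
          fix z assume z: "z < nb * nb"
          show "block_state ?\<sigma> z (fst (X' z)) (snd (X' z))" using b2[OF z] c3 by simp
          have "ar \<sigma> 6 z \<le> k" using inv z by (auto simp: inv_def)
          then show "ar ?\<sigma> 6 z \<le> k + 1" using b2[OF z] J'(2)[of 6] a1(1)[of 6] by simp
        next
          fix x assume "x < P"
          then show "ar ?\<sigma> 2 x = 0" using J'(5)[of x] Rs by auto
        next
          fix x assume "n \<le> x" "x < P"
          then show "ar ?\<sigma> 1 x = 0" using J'(2)[of 1] a2 a1(3) by simp
        qed (use c3 env2 in simp)
        have "tm ?\<sigma> + sum_potential \<sigma> X \<le> tm \<sigma> + query_cost + sum_potential ?\<sigma> X'"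
          using J'(4) t1 t2 c1(3)[of X] c3(3)[of X'] by (simp add: query_cost_def)
        moreover have "hout ?\<sigma> = vec_input n (bool_mat_vec n M v) \<and> (vr ?\<sigma> 15 \<noteq> 0 \<or> (\<forall>z<nb * nb. X' z = ideal_step z (res v) (Y z)))" if H
          using H2[OF that] J'(1)[of 15] J'(3) known_all by (auto simp: vec_input_def)
        ultimately show "?Q ?\<sigma>" using inv3 by blast
      qed (rule bounds(6))
    qed
  qed
  show ?thesis unfolding QUERY_def by (rule wp_seq, rule wp_mono[OF w1], erule main)
qed

text \<open>The correct copy may vary from instance to instance. This keeps the event likely,
  although no single copy need be right throughout.\<close>

fun allgood :: "(nat \<Rightarrow> nat \<times> (nat \<times> nat) list) \<Rightarrow> (nat \<Rightarrow> bool) list \<Rightarrow> bool" where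
  "allgood Y [] = True"
| "allgood Y (v # vs) \<longleftrightarrow> (\<forall>z<nb * nb. \<exists>r<R. goodrun r (mid z (res v) (known z (res v)) (fst (Y z)) (snd (Y z)))) \<and>
     allgood (\<lambda>z. ideal_step z (res v) (Y z)) vs"

lemma sum_potential_le:
  assumes "inv \<sigma> X k"
  shows "sum_potential \<sigma> X \<le> nb * nb * (max_potential + setup_cost + b * step_cost)"
proof -
  have "G \<sigma> z (fst (X z)) (snd (X z)) \<le> max_potential + setup_cost + b * step_cost" if "z < nb * nb" for z
  proof -
    have "wf (fst (X z)) (snd (X z))" "fst (X z) < b" using assms that by (auto simp: inv_def block_state_def)
    then have "copies_time (snd (X z)) \<le> R * TN" using copies_time_le wf_ins by simp
    then have "600 * copies_time (snd (X z)) + brute_force_cost * card (dead (ar \<sigma>) z (ar \<sigma> 6 z + 1)) \<le> max_potential"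
      unfolding max_potential_def by (intro add_le_mono mult_le_mono2 card_dead)
    moreover have "(b - fst (X z)) * step_cost \<le> b * step_cost" by simp
    moreover have "(if fst (X z) \<noteq> 0 then setup_cost else 0) \<le> setup_cost" by simp
    ultimately show ?thesis unfolding G_def by linarith
  qed
  then have "sum_potential \<sigma> X \<le> of_nat (card {..<nb * nb}) * (max_potential + setup_cost + b * step_cost)"
    unfolding sum_potential_def by (intro sum_bounded_above) simp
  then show ?thesis by simp
qed

text \<open>The potentials telescope over the queries. Only the debt left at the end remains, and
  \<open>sum_potential_le\<close> bounds it.\<close>

lemma session_QUERY:
  assumes "cok (QUERY upd)"
  shows "inv (absr s 0) X k \<Longrightarrow> valok U (absr s 0) \<Longrightarrow> k + length vs \<le> U \<Longrightarrow>
    (H \<Longrightarrow> allgood Y vs \<and> (\<forall>z<nb * nb. block_ok z (Y z)) \<and> (vr (absr s 0) 15 \<noteq> 0 \<or> (\<forall>z<nb * nb. X z = Y z))) \<Longrightarrow>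
    \<exists>t yss. session W \<omega> (ccomp (QUERY upd)) s (map (vec_input n) vs) t yss \<and>
      t + sum_potential (absr s 0) X \<le> length vs * query_cost + nb * nb * (max_potential + setup_cost + b * step_cost) \<and>
      (H \<longrightarrow> yss = map (\<lambda>v. vec_input n (bool_mat_vec n M v)) vs)"
proof (induction vs arbitrary: s X k Y)
  case Nil
  then show ?case using sum_potential_le[OF Nil(1)] by (intro exI[of _ 0] exI[of _ "[]"]) (auto intro: session.Nil)
next
  case (Cons v vs)
  let ?s = "s\<lparr>inp := vec_input n v, outp := []\<rparr>"
  have eq: "vr (absr ?s 0) = vr (absr s 0)" "ar (absr ?s 0) = ar (absr s 0)" by (auto simp: absr_def cong: if_cong)
  have c: "env (absr ?s 0) = env (absr s 0)" "\<And>z q es. block_state (absr ?s 0) z q es = block_state (absr s 0) z q es"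
    "sum_potential (absr ?s 0) X = sum_potential (absr s 0) X" by (rule same_cong; use eq in simp)+
  have inv: "inv (absr ?s 0) X k" using Cons.prems(1) unfolding inv_def c eq by simp
  have val: "valok U (absr ?s 0)" using Cons.prems(2) by (simp add: valok_def eq)
  have w: "wp (QUERY upd) (\<lambda>\<sigma>'. \<exists>X'. inv \<sigma>' X' (k + 1) \<and> tm \<sigma>' + sum_potential (absr ?s 0) X \<le> tm (absr ?s 0) + query_cost + sum_potential \<sigma>' X' \<and>
     (H \<longrightarrow> hout \<sigma>' = vec_input n (bool_mat_vec n M v) \<and>
        (vr \<sigma>' 15 \<noteq> 0 \<or> (\<forall>z<nb * nb. X' z = ideal_step z (res v) (Y z))))) (absr ?s 0)"
  proof (rule wp_QUERY[OF inv])
    show "hin (absr ?s 0) = vec_input n v" "hout (absr ?s 0) = []" by (simp_all add: absr_def)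
    show "k + 1 \<le> U" using Cons.prems(3) by simp
    assume H
    then show "\<forall>z<nb * nb. block_ok z (Y z) \<and> (\<exists>r<R. goodrun r (mid z (res v) (known z (res v)) (fst (Y z)) (snd (Y z))))"
      "vr (absr ?s 0) 15 \<noteq> 0 \<or> (\<forall>z<nb * nb. X z = Y z)"
      using Cons.prems(4) eq by simp_all
  qed
  from wp_absr[OF w assms val] obtain t s1 t' X' where e: "exec W \<omega> (ccomp (QUERY upd)) ?s t s1" "t \<le> t'"
    "valok U (absr s1 t')" "inv (absr s1 t') X' (k + 1)" "t' + sum_potential (absr ?s 0) X \<le> query_cost + sum_potential (absr s1 t') X'"
    and h: "H \<Longrightarrow> hout (absr s1 t') = vec_input n (bool_mat_vec n M v) \<and>
        (vr (absr s1 t') 15 \<noteq> 0 \<or> (\<forall>z<nb * nb. X' z = ideal_step z (res v) (Y z)))"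
    by auto
  have eq1: "vr (absr s1 t') = vr (absr s1 0)" "ar (absr s1 t') = ar (absr s1 0)" by (auto simp: absr_def)
  have c1: "env (absr s1 t') = env (absr s1 0)" "\<And>z q es. block_state (absr s1 t') z q es = block_state (absr s1 0) z q es"
    "sum_potential (absr s1 t') X' = sum_potential (absr s1 0) X'" by (rule same_cong; use eq1 in simp)+
  have inv1: "inv (absr s1 0) X' (k + 1)" using e(4) unfolding inv_def c1 eq1 .
  have val1: "valok U (absr s1 0)" using e(3) by (simp add: valok_def eq1)
  have "\<exists>t yss. session W \<omega> (ccomp (QUERY upd)) s1 (map (vec_input n) vs) t yss \<and>
      t + sum_potential (absr s1 0) X' \<le> length vs * query_cost + nb * nb * (max_potential + setup_cost + b * step_cost) \<and>
      (H \<longrightarrow> yss = map (\<lambda>v. vec_input n (bool_mat_vec n M v)) vs)"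
  proof (rule Cons.IH[OF inv1 val1])
    show "k + 1 + length vs \<le> U" using Cons.prems(3) by simp
    assume H
    then show "allgood (\<lambda>z. ideal_step z (res v) (Y z)) vs \<and> (\<forall>z<nb * nb. block_ok z (ideal_step z (res v) (Y z))) \<and>
      (vr (absr s1 0) 15 \<noteq> 0 \<or> (\<forall>z<nb * nb. X' z = ideal_step z (res v) (Y z)))"
      using Cons.prems(4) h eq1 block_ok_ideal_step by simp
  qed
  then obtain t2 yss where 2: "session W \<omega> (ccomp (QUERY upd)) s1 (map (vec_input n) vs) t2 yss"
    "t2 + sum_potential (absr s1 0) X' \<le> length vs * query_cost + nb * nb * (max_potential + setup_cost + b * step_cost)"
    "H \<longrightarrow> yss = map (\<lambda>v. vec_input n (bool_mat_vec n M v)) vs" by blast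
  have "outp s1 = hout (absr s1 t')" by (simp add: absr_def)
  with h 2(3) have "H \<longrightarrow> outp s1 # yss = map (\<lambda>v. vec_input n (bool_mat_vec n M v)) (v # vs)" by simp
  moreover have "session W \<omega> (ccomp (QUERY upd)) s (map (vec_input n) (v # vs)) (t + t2) (outp s1 # yss)"
    using session.Cons[OF e(1) 2(1)] by simp
  moreover have "t + t2 + sum_potential (absr s 0) X \<le> length (v # vs) * query_cost + nb * nb * (max_potential + setup_cost + b * step_cost)"
    using e(2,5) 2(2) c(3) c1(3) by simp
  ultimately show ?case by (intro exI[of _ "t + t2"] exI[of _ "outp s1 # yss"] conjI)
qed

lemma wp_PRE2:
  assumes v: "vr \<sigma> 0 = n" "vr \<sigma> 1 = N" "vr \<sigma> 2 = b" "vr \<sigma> 3 = S" "vr \<sigma> 4 = L" "vr \<sigma> 5 = R" "vr \<sigma> 6 = nb" "vr \<sigma> 7 = P" "vr \<sigma> 15 = 0"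
    and A: "ar \<sigma> = (\<lambda>_ _. 0)" and h: "hin \<sigma> = map (\<lambda>z. of_bool (M (z div n) (z mod n))) [0..<n * n]" "hpos \<sigma> = 0"
    and bd: "n * n \<le> U" "R * L \<le> U" "N * N + 1 \<le> U"
  shows "wp (PRE2 pre) (\<lambda>\<sigma>'. inv \<sigma>' (\<lambda>_. (0, [])) 0 \<and>
     tm \<sigma>' \<le> tm \<sigma> + 50 * (n * n) + 30 * (R * L) + R * (600 * TP + 100) + 100) \<sigma>"
proof -
  define I1 where "I1 i \<sigma>' \<longleftrightarrow> (\<forall>w. w \<noteq> 21 \<longrightarrow> w \<noteq> 22 \<longrightarrow> vr \<sigma>' w = vr \<sigma> w) \<and> (\<forall>j. j \<noteq> 0 \<longrightarrow> ar \<sigma>' j = (\<lambda>_. 0)) \<and>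
     (\<forall>x<P. \<forall>y<P. ar \<sigma>' 0 (x * P + y) = of_bool (x * n + y < i \<and> Mx x y)) \<and>
     hin \<sigma>' = map (\<lambda>z. of_bool (M (z div n) (z mod n))) [i..<n * n] \<and> hpos \<sigma>' = 0 \<and> tm \<sigma>' \<le> tm \<sigma> + 50 * i + 2"
    for i and \<sigma>' :: hst
  have w1: "wp (CFor 21 (EV 0 [*] EV 0) (CRd 22 ;; CStr 0 (EV 21 [div] EV 0 [*] EV 7 [+] EV 21 [mod] EV 0) (EV 22)))
    (\<lambda>\<sigma>'. I1 (n * n) (\<sigma>'\<lparr>tm := tm \<sigma>' - 6\<rparr>)) \<sigma>"
  proof (rule wp_for[where I = I1 and m = "n * n"])
    show "I1 0 (\<sigma>\<lparr>vr := (vr \<sigma>)(21 := 0), tm := tm \<sigma> + 2\<rparr>)" using A h by (simp add: I1_def)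
  next
    fix i \<sigma>1 assume i: "i < n * n" and I: "I1 i \<sigma>1" and v1: "vr \<sigma>1 21 = i"
    have I': "\<And>w. w \<noteq> 21 \<Longrightarrow> w \<noteq> 22 \<Longrightarrow> vr \<sigma>1 w = vr \<sigma> w" "\<And>j. j \<noteq> 0 \<Longrightarrow> ar \<sigma>1 j = (\<lambda>_. 0)"
      "\<And>x y. x < P \<Longrightarrow> y < P \<Longrightarrow> ar \<sigma>1 0 (x * P + y) = of_bool (x * n + y < i \<and> Mx x y)"
      "hin \<sigma>1 = map (\<lambda>z. of_bool (M (z div n) (z mod n))) [i..<n * n]" "hpos \<sigma>1 = 0" "tm \<sigma>1 \<le> tm \<sigma> + 50 * i + 2"
      using I unfolding I1_def by blast+
    have hi: "hin \<sigma>1 = of_bool (M (i div n) (i mod n)) # map (\<lambda>z. of_bool (M (z div n) (z mod n))) [Suc i..<n * n]"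
      using I'(4) i by (simp add: upt_conv_Cons)
    have d: "i div n < n" "i mod n < n" using i div_lt by auto
    have key: "((ar \<sigma>1 0)(i div n * P + i mod n := of_bool (M (i div n) (i mod n)))) (x * P + y) = of_bool (x * n + y < Suc i \<and> Mx x y)"
      if "x < P" "y < P" for x y
    proof -
      have "x * P + y = i div n * P + i mod n \<longleftrightarrow> x = i div n \<and> y = i mod n"
      proof (rule mult_add_inj[OF that(2)])
        show "i mod n < P" using d(2) nP by (rule order_less_le_trans)
      qed
      moreover have "x * n + y = i \<longleftrightarrow> x = i div n \<and> y = i mod n" if "x < n" "y < n"
      proof
        assume "x * n + y = i"
        then show "x = i div n \<and> y = i mod n" using that by auto
      qed simp
      ultimately show ?thesis using I'(3)[OF that] d by (auto simp: Mx_def less_Suc_eq)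
    qed
    have fin: "I1 (Suc i) \<tau>"
      if "\<And>w. w \<noteq> 21 \<Longrightarrow> w \<noteq> 22 \<Longrightarrow> vr \<tau> w = vr \<sigma> w" "\<And>j. j \<noteq> 0 \<Longrightarrow> ar \<tau> j = (\<lambda>_. 0)"
        "ar \<tau> 0 = (ar \<sigma>1 0)(i div n * P + i mod n := of_bool (M (i div n) (i mod n)))"
        "hin \<tau> = map (\<lambda>z. of_bool (M (z div n) (z mod n))) [Suc i..<n * n]" "hpos \<tau> = 0" "tm \<tau> \<le> tm \<sigma> + 50 * Suc i + 2" for \<tau>
      unfolding I1_def that(3) using that(1,2,4-6) key by blast
    have u: "(of_bool (M (i div n) (i mod n)) :: nat) \<le> U" using U_pos by simp
    show "wp (CRd 22 ;; CStr 0 (EV 21 [div] EV 0 [*] EV 7 [+] EV 21 [mod] EV 0) (EV 22))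
      (\<lambda>\<sigma>'. vr \<sigma>' 21 = i \<and> I1 (Suc i) (\<sigma>'\<lparr>vr := (vr \<sigma>')(21 := Suc i), tm := tm \<sigma>' + 4\<rparr>))
      (\<sigma>1\<lparr>tm := tm \<sigma>1 + (etime (EV 0 [*] EV 0) + 3)\<rparr>)"
    proof (rule wp_seq, rule wp_rd[OF _ u], use hi in simp, rule wp_str, use u in simp, intro conjI fin)
    qed (use v v1 I'(1,2,5,6) in \<open>simp_all add: fun_upd_def\<close>)
  next
    fix i \<sigma>1 assume "I1 i \<sigma>1" then show "eval (EV 0 [*] EV 0) \<sigma>1 = n * n" using v by (simp add: I1_def)
  next
    fix \<sigma>1 assume "I1 (n * n) \<sigma>1"
    then show "I1 (n * n) (\<sigma>1\<lparr>tm := tm \<sigma>1 + (etime (EV 0 [*] EV 0) + 3),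
      tm := tm (\<sigma>1\<lparr>tm := tm \<sigma>1 + (etime (EV 0 [*] EV 0) + 3)\<rparr>) - 6\<rparr>)" by (simp add: I1_def)
  qed (rule bd)
  define J where "J \<sigma>' \<longleftrightarrow> (\<forall>w<20. vr \<sigma>' w = vr \<sigma> w) \<and>
     (\<forall>x<P. \<forall>y<P. ar \<sigma>' 0 (x * P + y) = of_bool (Mx x y))" for \<sigma>' :: hst
  define I2 where "I2 i \<sigma>' \<longleftrightarrow> J \<sigma>' \<and> (\<forall>j. j \<noteq> 0 \<longrightarrow> j \<noteq> 3 \<longrightarrow> ar \<sigma>' j = (\<lambda>_. 0)) \<and>
     (\<forall>x<i. ar \<sigma>' 3 x = of_bool (\<omega> x)) \<and> hpos \<sigma>' = i \<and> tm \<sigma>' \<le> tm \<sigma> + 50 * (n * n) + 30 * i + 12"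
    for i and \<sigma>' :: hst
  have J_upd: "J (\<sigma>'\<lparr>vr := (vr \<sigma>')(w := x), tm := t\<rparr>) = J \<sigma>'" "J (\<sigma>'\<lparr>vr := (vr \<sigma>')(w := x), hpos := p, tm := t\<rparr>) = J \<sigma>'"
    "J (\<sigma>'\<lparr>vr := (vr \<sigma>')(w := x, 21 := y), ar := (ar \<sigma>')(3 := g), hpos := p, tm := t\<rparr>) = J \<sigma>'" if "20 \<le> w" for \<sigma>' w x y p t g
    using that by (auto simp: J_def)
  have w2: "wp (CFor 21 (EV 5 [*] EV 4) (CFl 22 ;; CStr 3 (EV 21) (EV 22))) (\<lambda>\<sigma>'. I2 (R * L) (\<sigma>'\<lparr>tm := tm \<sigma>' - 6\<rparr>)) \<sigma>1"
    if I1: "I1 (n * n) (\<sigma>1\<lparr>tm := tm \<sigma>1 - 6\<rparr>)" for \<sigma>1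
  proof (rule wp_for[where I = I2 and m = "R * L"])
    have "x * n + y < n * n" if "Mx x y" for x y
    proof -
      have "x * n + y < (x + 1) * n" using that by (simp add: Mx_def)
      also have "\<dots> \<le> n * n" using that by (intro mult_le_mono1) (simp add: Mx_def)
      finally show ?thesis .
    qed
    then have "J \<sigma>1" using I1 unfolding I1_def J_def by auto
    moreover have "tm \<sigma>1 - 6 \<le> tm \<sigma> + 50 * (n * n) + 2" using I1 by (simp add: I1_def)
    ultimately show "I2 0 (\<sigma>1\<lparr>vr := (vr \<sigma>1)(21 := 0), tm := tm \<sigma>1 + 2\<rparr>)"
      using I1 unfolding I2_def I1_def by (simp add: J_upd)
  next
    fix i \<sigma>2 assume i: "i < R * L" and I: "I2 i \<sigma>2" and v2: "vr \<sigma>2 21 = i"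
    have "(of_bool (\<omega> i) :: nat) \<le> U" using U_pos by simp
    then show "wp (CFl 22 ;; CStr 3 (EV 21) (EV 22))
      (\<lambda>\<sigma>'. vr \<sigma>' 21 = i \<and> I2 (Suc i) (\<sigma>'\<lparr>vr := (vr \<sigma>')(21 := Suc i), tm := tm \<sigma>' + 4\<rparr>))
      (\<sigma>2\<lparr>tm := tm \<sigma>2 + (etime (EV 5 [*] EV 4) + 3)\<rparr>)"
      using I v2 by (intro wp_seq wp_fl wp_str) (auto simp: I2_def J_def less_Suc_eq)
  next
    fix i \<sigma>2 assume "I2 i \<sigma>2" then show "eval (EV 5 [*] EV 4) \<sigma>2 = R * L" using v by (simp add: I2_def J_def)
  next
    fix \<sigma>2 assume "I2 (R * L) \<sigma>2"
    then show "I2 (R * L) (\<sigma>2\<lparr>tm := tm \<sigma>2 + (etime (EV 5 [*] EV 4) + 3),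
      tm := tm (\<sigma>2\<lparr>tm := tm \<sigma>2 + (etime (EV 5 [*] EV 4) + 3)\<rparr>) - 6\<rparr>)" by (simp add: I2_def J_def)
  qed (rule bd)
  let ?c = "CAsg 8 (EV 11 [*] EV 3) ;; CAsg 9 (EV 8) ;; CAsg 12 (EC 0) ;; tr pre ;; WRITE_CELL (EC 1) (EC 0)"
  \<comment> \<open>The session without insertions contains the preprocessing run and its time
    bound.\<close>
  obtain tp where tp: "\<And>r. exec WN (tape r) pre (ini\<lparr>inp := mat_input N (\<lambda>_ _. False), outp := []\<rparr>) (tp r) (s0 r) \<and> tp r \<le> TP"
    using run_ex[of "[]"] by (metis insertions.simps(1))
  define I3 where "I3 i \<sigma>' \<longleftrightarrow> (\<forall>w<8. vr \<sigma>' w = vr \<sigma> w) \<and> vr \<sigma>' 10 = 1 \<and>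
     (\<forall>x<P. \<forall>y<P. ar \<sigma>' 0 (x * P + y) = of_bool (Mx x y)) \<and> (\<forall>x<R * L. ar \<sigma>' 3 x = of_bool (\<omega> x)) \<and>
     (\<forall>j. j \<in> {1, 2, 6, 7} \<longrightarrow> ar \<sigma>' j = (\<lambda>_. 0)) \<and> (ar \<sigma>' 8 0 = N \<and> (\<forall>x>0. ar \<sigma>' 8 x = 0)) \<and>
     (\<forall>x. i * S \<le> x \<longrightarrow> ar \<sigma>' 4 x = 0 \<and> ar \<sigma>' 5 x = 0) \<and> (\<forall>r<i. snap (ar \<sigma>') (vr \<sigma>' 15 \<noteq> 0) r) \<and>
     (vr \<sigma>' 15 \<noteq> 0 \<longrightarrow> L < TP + TN) \<and> tm \<sigma>' \<le> tm \<sigma> + 50 * (n * n) + 30 * (R * L) + 40 + i * (600 * TP + 80)"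
    for i and \<sigma>' :: hst
  have RS: "R * S \<le> U"
  proof -
    have "1 * (R * S) \<le> (nb * nb + 1) * (R * S)" by (intro mult_le_mono1) simp
    then show ?thesis using bounds(1) by (simp add: algebra_simps)
  qed
  have w3: "wp (CStr 8 (EC 0) (EV 1) ;; CAsg 10 (EC 1) ;; CFor 11 (EV 5) ?c)
     (\<lambda>\<sigma>'. inv \<sigma>' (\<lambda>_. (0, [])) 0 \<and>
     tm \<sigma>' \<le> tm \<sigma> + 50 * (n * n) + 30 * (R * L) + R * (600 * TP + 100) + 100) \<sigma>2"
    if I2: "I2 (R * L) (\<sigma>2\<lparr>tm := tm \<sigma>2 - 6\<rparr>)" for \<sigma>2
  proof -
    have "tm \<sigma>2 - 6 \<le> tm \<sigma> + 50 * (n * n) + 30 * (R * L) + 12" using I2 by (simp add: I2_def)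
    then have t2: "tm \<sigma>2 \<le> tm \<sigma> + 50 * (n * n) + 30 * (R * L) + 18" by linarith
    have x2: "\<And>w. w < 20 \<Longrightarrow> vr \<sigma>2 w = vr \<sigma> w" "\<forall>x<P. \<forall>y<P. ar \<sigma>2 0 (x * P + y) = of_bool (Mx x y)"
      "\<And>j. j \<noteq> 0 \<Longrightarrow> j \<noteq> 3 \<Longrightarrow> ar \<sigma>2 j = (\<lambda>_. 0)" "\<forall>x<R * L. ar \<sigma>2 3 x = of_bool (\<omega> x)"
      using I2 by (simp_all add: I2_def J_def)
    have NU: "N \<le> U" using bounds(5) by simp
    let ?\<tau> = "\<sigma>2\<lparr>ar := (ar \<sigma>2)(8 := (ar \<sigma>2 8)(0 := N)), vr := (vr \<sigma>2)(10 := 1), tm := tm \<sigma>2 + 9\<rparr>"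
    have "wp (CFor 11 (EV 5) ?c) (\<lambda>\<sigma>'. inv \<sigma>' (\<lambda>_. (0, [])) 0 \<and>
     tm \<sigma>' \<le> tm \<sigma> + 50 * (n * n) + 30 * (R * L) + R * (600 * TP + 100) + 100) ?\<tau>"
    proof (rule wp_for[where I = I3 and m = R])
      show "I3 0 (?\<tau>\<lparr>vr := (vr ?\<tau>)(11 := 0), tm := tm ?\<tau> + 2\<rparr>)"
        using x2 t2 v(9) by (simp add: I3_def)
    next
      fix i \<sigma>3 assume i: "i < R" and I: "I3 i \<sigma>3" and v3: "vr \<sigma>3 11 = i"
      have I': "\<And>w. w < 8 \<Longrightarrow> vr \<sigma>3 w = vr \<sigma> w" "vr \<sigma>3 10 = 1"
        "\<forall>x<P. \<forall>y<P. ar \<sigma>3 0 (x * P + y) = of_bool (Mx x y)" "\<And>x. x<R * L \<Longrightarrow> ar \<sigma>3 3 x = of_bool (\<omega> x)"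
        "\<And>j. j \<in> {1, 2, 6, 7} \<Longrightarrow> ar \<sigma>3 j = (\<lambda>_. 0)" "ar \<sigma>3 8 0 = N \<and> (\<forall>x>0. ar \<sigma>3 8 x = 0)"
        "\<And>x. i * S \<le> x \<Longrightarrow> ar \<sigma>3 4 x = 0 \<and> ar \<sigma>3 5 x = 0" "\<And>r. r < i \<Longrightarrow> snap (ar \<sigma>3) (vr \<sigma>3 15 \<noteq> 0) r"
        "vr \<sigma>3 15 \<noteq> 0 \<longrightarrow> L < TP + TN" "tm \<sigma>3 \<le> tm \<sigma> + 50 * (n * n) + 30 * (R * L) + 40 + i * (600 * TP + 80)"
        using I unfolding I3_def by ((elim conjE, (assumption | (rule conjI; assumption) | simp only: simp_thms))+)
      have iS: "i * S + S \<le> U"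
      proof -
        have "(i + 1) * S \<le> R * S" using i by (intro mult_le_mono1) simp
        then show ?thesis using RS by simp
      qed
      let ?\<rho> = "\<sigma>3\<lparr>vr := (vr \<sigma>3)(8 := i * S, 9 := i * S, 12 := 0), tm := tm \<sigma>3 + 12\<rparr>"
      let ?s = "ini\<lparr>inp := mat_input N (\<lambda>_ _. False), outp := []\<rparr>"
      have pR: "p * R + r < R * L" if "p < L" "r < R" for p r
      proof -
        have "p * R + r < (p + 1) * R" using that by simp
        also have "\<dots> \<le> L * R" using that by (intro mult_le_mono1) simp
        finally show ?thesis by (simp add: mult.commute)
      qed
      \<comment> \<open>The areas from number \<open>i\<close> on are untouched, so the simulated
        memory starts out as zero without being cleared.\<close>
      have vm0: "vm ?\<rho> a = 0" for a using I'(2) I'(7)[of "i * S + a"] by (simp add: vmem_def)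
      have len: "length (mat_input N (\<lambda>_ _. False)) = N * N + 1" by (simp add: mat_input_eq)
      have "simr (tape i) ?\<rho> ?s"
        unfolding simr_def
      proof (intro conjI)
        show "\<forall>a<S0. vm ?\<rho> (a + 3) = mem ?s a" "\<forall>a. mem ?s a < WN" "vm ?\<rho> 0 = min (coin_pos ?s) L"
          "L < coin_pos ?s \<longrightarrow> vr ?\<rho> 15 \<noteq> 0" unfolding vm0 by (simp_all add: ini_def WN0)
        show "\<forall>p<L. ar ?\<rho> 3 (p * R + vr ?\<rho> 11) = of_bool (tape i p)"
          using I'(4) v3 i pR by (simp add: tape_def)
        show "\<forall>j<length (inp ?s). ar ?\<rho> 8 (vr ?\<rho> 12 + j) = inp ?s ! j"
          using I'(6) by (auto simp: mat_input_eq nth_Cons split: nat.splits)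
        show "vr ?\<rho> 12 + length (inp ?s) \<le> U" using len bd(3) by simp
      qed (use I'(1)[of 4] I'(1)[of 5] v in simp_all)
      from wp_tr[OF conjunct1[OF tp[of i]] rb(1) this]
      have w: "wp (tr pre) (\<lambda>\<sigma>'. simr (tape i) \<sigma>' (s0 i) \<and> sfr ?\<rho> \<sigma>' (s0 i) \<and> tm \<sigma>' \<le> tm ?\<rho> + 600 * tp i) ?\<rho>"
        by (simp add: tape_def)
      have fin: "wp (WRITE_CELL (EC 1) (EC 0)) (\<lambda>\<sigma>'. vr \<sigma>' 11 = i \<and> I3 (Suc i) (\<sigma>'\<lparr>vr := (vr \<sigma>')(11 := Suc i), tm := tm \<sigma>' + 4\<rparr>)) \<sigma>4"
        if a: "simr (tape i) \<sigma>4 (s0 i) \<and> sfr ?\<rho> \<sigma>4 (s0 i) \<and> tm \<sigma>4 \<le> tm ?\<rho> + 600 * tp i" for \<sigma>4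
      proof (rule wp_WRITE_CELL)
        have sm: "simr (tape i) \<sigma>4 (s0 i)" and sf: "sfr ?\<rho> \<sigma>4 (s0 i)" and t4: "tm \<sigma>4 \<le> tm \<sigma>3 + 12 + 600 * tp i" using a by simp_all
        have v4: "vr \<sigma>4 8 = i * S" "vr \<sigma>4 9 = i * S" "vr \<sigma>4 10 = 1" "vr \<sigma>4 11 = i" "\<And>w. w < 8 \<Longrightarrow> vr \<sigma>4 w = vr \<sigma> w"
          using sf I'(1,2) v3 by (simp_all add: sfr_def)
        have A4: "\<And>k. k \<noteq> 4 \<Longrightarrow> k \<noteq> 5 \<Longrightarrow> ar \<sigma>4 k = ar \<sigma>3 k"
          "\<And>x. x < i * S \<or> i * S + S \<le> x \<Longrightarrow> ar \<sigma>4 4 x = ar \<sigma>3 4 x \<and> ar \<sigma>4 5 x = ar \<sigma>3 5 x"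
          using sf by (auto simp: sfr_def)
        have c: "coin_pos (s0 i) \<le> TP" using exec_coin[OF conjunct1[OF tp[of i]]] tp[of i] by (simp add: ini_def)
        have bad4: "vr \<sigma>3 15 \<noteq> 0 \<longrightarrow> vr \<sigma>4 15 \<noteq> 0" "vr \<sigma>4 15 \<noteq> 0 \<longrightarrow> L < TP + TN"
          using sf I'(9) c by (auto simp: sfr_def)
        have vm4: "vm \<sigma>4 a = ar \<sigma>4 4 (i * S + a)" for a using v4 by (simp add: vmem_def)
        let ?A = "vupd (ar \<sigma>4) (i * S) 1 1 0"
        have A5: "?A 4 = (ar \<sigma>4 4)(i * S + 1 := 0)" "?A 5 = (ar \<sigma>4 5)(i * S + 1 := 1)" by (simp_all add: vupd_def)
        have snap: "snap ?A (vr \<sigma>4 15 \<noteq> 0) i"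
          unfolding snap_def A5
        proof (intro conjI allI impI)
          show "((ar \<sigma>4 4)(i * S + 1 := 0)) (i * S + (x + 3)) = mem (s0 i) x" if "x < S0" for x
            using sm that vm4[of "x + 3"] unfolding simr_def by simp
          have "vm \<sigma>4 2 = vm ?\<rho> 2" using sf unfolding sfr_def by blast
          then show "((ar \<sigma>4 4)(i * S + 1 := 0)) (i * S + 2) = 0" using vm4[of 2] vm0[of 2] by simp
        qed (use sm vm4[of 0] in \<open>auto simp: simr_def\<close>)
        have snapo: "snap ?A (vr \<sigma>4 15 \<noteq> 0) r" if "r < i" for r
        proof -
          have lt: "r * S + a < i * S" if "a < S" for a
          proof -
            have "(r + 1) * S \<le> i * S" using \<open>r < i\<close> by (intro mult_le_mono1) simp
            then show ?thesis using that by simp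
          qed
          have e: "?A 4 (r * S + a) = ar \<sigma>3 4 (r * S + a)" if "a < S" for a
            using A4(2)[of "r * S + a"] lt[OF that] unfolding A5 by simp
          show ?thesis using I'(8)[OF that] bad4(1) e[of 0] e[of 1] e[of 2] e unfolding snap_def
            by (simp del: add_2_eq_Suc')
        qed
        have z: "?A 4 x = 0 \<and> ?A 5 x = 0" if "Suc i * S \<le> x" for x
          using that A4(2)[of x] I'(7)[of x] unfolding A5 by simp
        have I3: "I3 (Suc i) (\<sigma>4\<lparr>ar := ?A, vr := (vr \<sigma>4)(11 := Suc i), tm := tm \<sigma>4 + 22\<rparr>)"
          unfolding I3_def
        proof (intro conjI)
          show "\<forall>r<Suc i. snap (ar (\<sigma>4\<lparr>ar := ?A, vr := (vr \<sigma>4)(11 := Suc i), tm := tm \<sigma>4 + 22\<rparr>))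
            (vr (\<sigma>4\<lparr>ar := ?A, vr := (vr \<sigma>4)(11 := Suc i), tm := tm \<sigma>4 + 22\<rparr>) 15 \<noteq> 0) r"
            using snap snapo by (auto simp: less_Suc_eq)
          show "tm (\<sigma>4\<lparr>ar := ?A, vr := (vr \<sigma>4)(11 := Suc i), tm := tm \<sigma>4 + 22\<rparr>)
            \<le> tm \<sigma> + 50 * (n * n) + 30 * (R * L) + 40 + Suc i * (600 * TP + 80)"
            using t4 I'(10) tp[of i] by simp
        qed (use v4 A4(1) I'(3-6) z bad4 in simp_all)
        have "Suc 0 = 1" by simp
        show "vr (\<sigma>4\<lparr>ar := vupd (ar \<sigma>4) (vr \<sigma>4 8) (vr \<sigma>4 10) (eval (EC 1) \<sigma>4) (eval (EC 0) \<sigma>4),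
            tm := tm \<sigma>4 + (2 * etime (EC 1) + etime (EC 0) + 15)\<rparr>) 11 = i \<and>
          I3 (Suc i) (\<sigma>4\<lparr>ar := vupd (ar \<sigma>4) (vr \<sigma>4 8) (vr \<sigma>4 10) (eval (EC 1) \<sigma>4) (eval (EC 0) \<sigma>4),
            tm := tm \<sigma>4 + (2 * etime (EC 1) + etime (EC 0) + 15),
            vr := (vr (\<sigma>4\<lparr>ar := vupd (ar \<sigma>4) (vr \<sigma>4 8) (vr \<sigma>4 10) (eval (EC 1) \<sigma>4) (eval (EC 0) \<sigma>4),
              tm := tm \<sigma>4 + (2 * etime (EC 1) + etime (EC 0) + 15)\<rparr>))(11 := Suc i),
            tm := tm (\<sigma>4\<lparr>ar := vupd (ar \<sigma>4) (vr \<sigma>4 8) (vr \<sigma>4 10) (eval (EC 1) \<sigma>4) (eval (EC 0) \<sigma>4),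
              tm := tm \<sigma>4 + (2 * etime (EC 1) + etime (EC 0) + 15)\<rparr>) + 4\<rparr>)"
          using I3 v4 by (simp add: numeral_eq_Suc)
      qed simp_all
      have "wp (tr pre ;; WRITE_CELL (EC 1) (EC 0)) (\<lambda>\<sigma>'. vr \<sigma>' 11 = i \<and> I3 (Suc i) (\<sigma>'\<lparr>vr := (vr \<sigma>')(11 := Suc i), tm := tm \<sigma>' + 4\<rparr>)) ?\<rho>"
        by (rule wp_seq, rule wp_mono[OF w], rule fin)
      then show "wp ?c (\<lambda>\<sigma>'. vr \<sigma>' 11 = i \<and> I3 (Suc i) (\<sigma>'\<lparr>vr := (vr \<sigma>')(11 := Suc i), tm := tm \<sigma>' + 4\<rparr>))
        (\<sigma>3\<lparr>tm := tm \<sigma>3 + (etime (EV 5) + 3)\<rparr>)"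
        using iS v3 I'(1)[of 3] v
        by (intro wp_seq[of "CAsg 8 (EV 11 [*] EV 3)"] wp_seq[of "CAsg 9 (EV 8)"] wp_seq[of "CAsg 12 (EC 0)"] wp_asg)
          (simp_all add: add.commute)
    next
      fix i \<sigma>3 assume "I3 i \<sigma>3" then show "eval (EV 5) \<sigma>3 = R" using v by (simp add: I3_def)
    next
      fix \<sigma>3 assume I: "I3 R \<sigma>3"
      let ?\<sigma> = "\<sigma>3\<lparr>tm := tm \<sigma>3 + (etime (EV 5) + 3)\<rparr>"
      have I': "\<And>w. w < 8 \<Longrightarrow> vr \<sigma>3 w = vr \<sigma> w"
        "\<forall>x<P. \<forall>y<P. ar \<sigma>3 0 (x * P + y) = of_bool (Mx x y)" "\<And>x. x<R * L \<Longrightarrow> ar \<sigma>3 3 x = of_bool (\<omega> x)"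
        "\<And>j. j \<in> {1, 2, 6, 7} \<Longrightarrow> ar \<sigma>3 j = (\<lambda>_. 0)"
        "\<And>x. R * S \<le> x \<Longrightarrow> ar \<sigma>3 4 x = 0 \<and> ar \<sigma>3 5 x = 0" "\<And>r. r < R \<Longrightarrow> snap (ar \<sigma>3) (vr \<sigma>3 15 \<noteq> 0) r"
        "vr \<sigma>3 15 \<noteq> 0 \<longrightarrow> L < TP + TN" "tm \<sigma>3 \<le> tm \<sigma> + 50 * (n * n) + 30 * (R * L) + 40 + R * (600 * TP + 80)"
        using I unfolding I3_def by ((elim conjE, (assumption | (rule conjI; assumption) | simp only: simp_thms))+)
      have pR: "p * R + r < R * L" if "p < L" "r < R" for p r
      proof -
        have "p * R + r < (p + 1) * R" using that by simp
        also have "\<dots> \<le> L * R" using that by (intro mult_le_mono1) simp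
        finally show ?thesis by (simp add: mult.commute)
      qed
      have env: "env ?\<sigma>" unfolding env_def using I' v pR by simp
      have block_state: "block_state ?\<sigma> z 0 []" if "z < nb * nb" for z
      proof -
        have "ar \<sigma>3 5 (base z r + a) < 1" if "r < R" for r a
        proof -
          have "R * S \<le> base z r" unfolding base_def by (intro mult_le_mono1) simp
          then show ?thesis using I'(5)[of "base z r + a"] by simp
        qed
        then have "rep (ar \<sigma>3) (vr \<sigma>3 15 \<noteq> 0) z 1 r []" if "r < R" for r
          using rep_snap(1)[OF I'(6)[OF that]] that by blast
        then show ?thesis using I'(4)[of 6] I'(4)[of 7] b1 by (simp add: block_state_def wf_def)
      qed
      have "inv ?\<sigma> (\<lambda>_. (0, [])) 0" unfolding inv_def using env block_state I'(4)[of 6] I'(4)[of 2] I'(4)[of 1] by simp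
      moreover have "tm ?\<sigma> \<le> tm \<sigma> + 50 * (n * n) + 30 * (R * L) + R * (600 * TP + 100) + 100"
        using I'(8) by (simp add: algebra_simps)
      ultimately show "inv ?\<sigma> (\<lambda>_. (0, [])) 0 \<and> tm ?\<sigma> \<le> tm \<sigma> + 50 * (n * n) + 30 * (R * L) + R * (600 * TP + 100) + 100" ..
    qed (rule bounds(4))
    then show ?thesis using x2(1)[of 1] v NU U_pos by (intro wp_seq[of "CStr 8 (EC 0) (EV 1)"] wp_seq[of "CAsg 10 (EC 1)"] wp_str wp_asg) (simp_all add: add.commute)
  qed
  show ?thesis unfolding PRE2_def
    by (rule wp_seq, rule wp_mono[OF w1], rule wp_seq, erule wp_mono[OF w2], erule w3)
qed

end

section \<open>Choice of the parameters\<close>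

fun pw :: "expr \<Rightarrow> nat \<Rightarrow> expr" where
  "pw e 0 = EC 1"
| "pw e (Suc k) = pw e k [*] e"

lemma eval_pw [simp]: "eval (pw e k) \<sigma> = eval e \<sigma> ^ k"
  by (induction k) auto

lemma etime_pw [simp]: "etime (pw e k) = k * (etime e + 1) + 1"
  by (induction k) auto

lemma eshape_pw: "eshape e \<Longrightarrow> eshape (pw e k)"
  by (induction k) auto

definition mroot :: "nat \<Rightarrow> nat \<Rightarrow> nat" where
  "mroot d n = (THE m. m ^ d \<le> n \<and> n < (m + 1) ^ d)"

lemma mroot_eq:
  assumes "m ^ d \<le> n" "n < (m + 1) ^ d"
  shows "mroot d n = m"
  unfolding mroot_def
proof (rule the_equality)
  fix m' assume a: "m' ^ d \<le> n \<and> n < (m' + 1) ^ d"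
  have "m' ^ d < (m + 1) ^ d" "m ^ d < (m' + 1) ^ d" using a assms by auto
  then have "m' < m + 1" "m < m' + 1" by (auto dest!: power_less_imp_less_base)
  then show "m' = m" by simp
qed (use assms in simp)

text \<open>There are \<open>n * nb * nb \<le> (n + 1) ^ 3\<close> instances. The factor 3 leaves a
  total error of at most 1/3 when each of them fails with probability at most the inverse of a power
  of 3 not below \<open>cub n\<close>.\<close>

definition cub :: "nat \<Rightarrow> nat" where "cub n = 3 * (n + 1) ^ 3 + 1"

text \<open>The logarithm of \<open>cub n\<close> to base 3, rounded up, and expressed by powers as
  in the loop of \<open>PRE1\<close>.\<close>

definition num_copies :: "nat \<Rightarrow> nat" where
  "num_copies n = (THE R. cub n \<le> 3 ^ R \<and> 3 ^ (R - 1) < cub n)"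

lemma num_copies_eq:
  assumes "cub n \<le> 3 ^ R" "3 ^ (R - 1) < cub n"
  shows "num_copies n = R"
  unfolding num_copies_def
proof (rule the_equality)
  fix R' assume a: "cub n \<le> 3 ^ R' \<and> 3 ^ (R' - 1) < cub n"
  have "(3::nat) ^ (R' - 1) < 3 ^ R" "(3::nat) ^ (R - 1) < 3 ^ R'" using a assms by (meson order_less_le_trans)+
  then have "R' - 1 < R" "R - 1 < R'" by (auto simp: power_strict_increasing_iff)
  then show "R' = R" by simp
qed (use assms in simp)

text \<open>Root and logarithm are found by counting up; \<open>n\<close> rounds suffice for the
  root and, by \<open>cub_le\<close>, \<open>3 * n + 10\<close> for the logarithm. The exponents are
  constants of the program, so \<open>pw\<close> is an expression of fixed size.\<close>

definition PRE1 :: "nat \<Rightarrow> nat \<Rightarrow> nat \<Rightarrow> nat \<Rightarrow> cmd" where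
  "PRE1 d c l K = CRd 0 ;; CAsg 1 (EC 0) ;;
     CFor 21 (EV 0) (CIf (pw (EV 1 [+] EC 1) d [<] EV 0 [+] EC 1) (CAsg 1 (EV 1 [+] EC 1)) CSkip) ;;
     CAsg 1 (EV 1 [+] EC 3) ;; CAsg 2 (EV 1 [div] EC 3) ;; CAsg 3 (pw (EV 1 [+] EC 2) c [+] EC K [+] EC 3) ;;
     CAsg 4 (pw (EV 1 [+] EC 2) l) ;; CAsg 5 (EC 0) ;; CAsg 23 (EC 1) ;;
     CFor 21 (EC 3 [*] EV 0 [+] EC 10)
       (CIf (EV 23 [<] EC 3 [*] pw (EV 0 [+] EC 1) 3 [+] EC 1) (CAsg 23 (EV 23 [*] EC 3) ;; CAsg 5 (EV 5 [+] EC 1)) CSkip) ;;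
     CAsg 6 (EV 0 [div] EV 2 [+] EC 1) ;; CAsg 7 (EV 6 [*] EV 2)"

text \<open>The added 3 gives a block side of at least 1 for every \<open>n\<close>. The sizes
  \<open>n = (N - 3) ^ d\<close> are those where \<open>N\<close> is hit exactly.\<close>

definition par_N :: "nat \<Rightarrow> nat \<Rightarrow> nat" where "par_N d n = mroot d n + 3"
definition par_b :: "nat \<Rightarrow> nat \<Rightarrow> nat" where "par_b d n = par_N d n div 3"
definition par_nb :: "nat \<Rightarrow> nat \<Rightarrow> nat" where "par_nb d n = n div par_b d n + 1"

lemma mroot_ex:
  assumes "1 \<le> d"
  shows "mroot d n ^ d \<le> n" "n < (mroot d n + 1) ^ d"
proof -
  let ?P = "\<lambda>m. m ^ d \<le> n"
  have le: "m \<le> n" if "?P m" for m using that assms self_le_power[of m d] by (cases "m = 0") auto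
  have "?P 0" using assms by (simp add: power_0_left)
  then have 1: "?P (GREATEST m. ?P m)" using le by (intro GreatestI_nat[of ?P 0 n]) auto
  have "\<not> ?P ((GREATEST m. ?P m) + 1)" using Greatest_le_nat[of ?P _ n] le by fastforce
  then have "mroot d n = (GREATEST m. ?P m)" using 1 by (intro mroot_eq) auto
  then show "mroot d n ^ d \<le> n" "n < (mroot d n + 1) ^ d" using 1 \<open>\<not> ?P ((GREATEST m. ?P m) + 1)\<close> by auto
qed

lemma mroot_le: "1 \<le> d \<Longrightarrow> mroot d n \<le> n"
  using mroot_ex(1)[of d n] self_le_power[of "mroot d n" d] by (cases "mroot d n = 0") auto

lemma cub_le: "cub n \<le> 3 ^ (3 * n + 10)"
proof -
  have "(n + 1) ^ 3 \<le> (3 ^ n) ^ 3"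
  proof (rule power_mono)
    show "n + 1 \<le> 3 ^ n" by (induction n) auto
  qed simp
  also have "(3 ^ n) ^ 3 = (3::nat) ^ (3 * n)" by (simp add: power_mult[symmetric] mult.commute)
  finally have "cub n \<le> 3 * 3 ^ (3 * n) + 1" by (simp add: cub_def)
  also have "\<dots> \<le> 3 ^ 10 * 3 ^ (3 * n)"
  proof -
    have "(1::nat) \<le> 3 ^ (3 * n)" by simp
    then have "3 * 3 ^ (3 * n) + 1 \<le> 4 * (3::nat) ^ (3 * n)" by linarith
    also have "\<dots> \<le> 3 ^ 10 * 3 ^ (3 * n)" by (intro mult_le_mono1) simp
    finally show ?thesis .
  qed
  finally show ?thesis by (simp add: power_add)
qed

lemma num_copies_ex: "cub n \<le> 3 ^ num_copies n" "3 ^ (num_copies n - 1) < cub n" "1 \<le> num_copies n"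
proof -
  let ?R = "LEAST R. cub n \<le> 3 ^ R"
  have 1: "cub n \<le> 3 ^ ?R" using cub_le by (rule LeastI)
  have "1 < cub n" by (simp add: cub_def)
  then have pos: "?R \<noteq> 0" using 1 by (intro notI) simp
  then have "\<not> cub n \<le> 3 ^ (?R - 1)" by (intro not_less_Least) simp
  then have "num_copies n = ?R" using 1 by (intro num_copies_eq) auto
  with 1 pos \<open>\<not> cub n \<le> 3 ^ (?R - 1)\<close> show "cub n \<le> 3 ^ num_copies n" "3 ^ (num_copies n - 1) < cub n" "1 \<le> num_copies n" by auto
qed

context hl
begin

lemma wp_PRE1:
  assumes h: "hin \<sigma> = n # xs" "vr \<sigma> = (\<lambda>_. 0)" "ar \<sigma> = (\<lambda>_ _. 0)" "hpos \<sigma> = 0" and d: "1 \<le> d"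
    and bd: "n + 3 \<le> U" "(par_N d n + 2) ^ c + K + 3 \<le> U" "(par_N d n + 2) ^ l \<le> U" "3 * cub n \<le> U" "3 * n + 10 \<le> U"
      "par_nb d n \<le> U" "par_nb d n * par_b d n \<le> U"
  shows "wp (PRE1 d c l K) (\<lambda>\<sigma>'. vr \<sigma>' 0 = n \<and> vr \<sigma>' 1 = par_N d n \<and> vr \<sigma>' 2 = par_b d n \<and>
     vr \<sigma>' 3 = (par_N d n + 2) ^ c + K + 3 \<and> vr \<sigma>' 4 = (par_N d n + 2) ^ l \<and> vr \<sigma>' 5 = num_copies n \<and>
     vr \<sigma>' 6 = par_nb d n \<and> vr \<sigma>' 7 = par_nb d n * par_b d n \<and> vr \<sigma>' 15 = 0 \<and> ar \<sigma>' = (\<lambda>_ _. 0) \<and>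
     hin \<sigma>' = xs \<and> hpos \<sigma>' = 0 \<and> tm \<sigma>' \<le> tm \<sigma> + (4 * d + 4 * c + 4 * l + 1000) * (n + 1)) \<sigma>"
proof -
  define J where "J \<sigma>' \<longleftrightarrow> vr \<sigma>' 0 = n \<and> vr \<sigma>' 15 = 0 \<and> ar \<sigma>' = (\<lambda>_ _. 0) \<and> hin \<sigma>' = xs \<and> hpos \<sigma>' = 0" for \<sigma>' :: hst
  \<comment> \<open>The candidate moves in step with \<open>i\<close> until it is the root and stays
    there.\<close>
  define I1 where "I1 i \<sigma>' \<longleftrightarrow> J \<sigma>' \<and> vr \<sigma>' 1 \<le> i \<and> vr \<sigma>' 1 ^ d \<le> n \<and> (vr \<sigma>' 1 = i \<or> n < (vr \<sigma>' 1 + 1) ^ d) \<and>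
    tm \<sigma>' \<le> tm \<sigma> + (4 * d + 50) * i + 20" for i and \<sigma>' :: hst
  define \<sigma>1 where "\<sigma>1 = \<sigma>\<lparr>vr := (vr \<sigma>)(0 := n, 1 := 0), hin := xs, tm := tm \<sigma> + 3\<rparr>"
  have w1: "wp (CFor 21 (EV 0) (CIf (pw (EV 1 [+] EC 1) d [<] EV 0 [+] EC 1) (CAsg 1 (EV 1 [+] EC 1)) CSkip))
    (\<lambda>\<sigma>'. J \<sigma>' \<and> vr \<sigma>' 1 = mroot d n \<and> tm \<sigma>' \<le> tm \<sigma> + (4 * d + 50) * n + 40) \<sigma>1"
  proof (rule wp_for[where I = I1 and m = n])
    show "I1 0 (\<sigma>1\<lparr>vr := (vr \<sigma>1)(21 := 0), tm := tm \<sigma>1 + 2\<rparr>)"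
      using h d by (simp add: I1_def J_def \<sigma>1_def power_0_left)
  next
    fix i \<sigma>2 assume i: "i < n" and I: "I1 i \<sigma>2" and v: "vr \<sigma>2 21 = i"
    let ?e = "pw (EV 1 [+] EC 1) d [<] EV 0 [+] EC 1"
    have ev: "(eval ?e \<sigma>2 \<noteq> 0) = ((vr \<sigma>2 1 + 1) ^ d \<le> n)" using I by (auto simp: I1_def J_def less_Suc_eq_le)
    show "wp (CIf ?e (CAsg 1 (EV 1 [+] EC 1)) CSkip)
      (\<lambda>\<sigma>'. vr \<sigma>' 21 = i \<and> I1 (Suc i) (\<sigma>'\<lparr>vr := (vr \<sigma>')(21 := Suc i), tm := tm \<sigma>' + 4\<rparr>))
      (\<sigma>2\<lparr>tm := tm \<sigma>2 + (etime (EV 0) + 3)\<rparr>)"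
    proof (rule wp_if)
      assume "eval ?e (\<sigma>2\<lparr>tm := tm \<sigma>2 + (etime (EV 0) + 3)\<rparr>) \<noteq> 0"
      then have le: "(vr \<sigma>2 1 + 1) ^ d \<le> n" using ev by simp
      then have "vr \<sigma>2 1 = i" using I by (auto simp: I1_def)
      then show "wp (CAsg 1 (EV 1 [+] EC 1)) (\<lambda>\<sigma>'. vr \<sigma>' 21 = i \<and> I1 (Suc i) (\<sigma>'\<lparr>vr := (vr \<sigma>')(21 := Suc i), tm := tm \<sigma>' + 4\<rparr>))
        (\<sigma>2\<lparr>tm := tm \<sigma>2 + (etime (EV 0) + 3), tm := tm (\<sigma>2\<lparr>tm := tm \<sigma>2 + (etime (EV 0) + 3)\<rparr>) + (etime ?e + 1)\<rparr>)"
        using I v le i bd(1) by (intro wp_asg) (simp_all add: I1_def J_def)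
    next
      assume "eval ?e (\<sigma>2\<lparr>tm := tm \<sigma>2 + (etime (EV 0) + 3)\<rparr>) = 0"
      then have "n < (vr \<sigma>2 1 + 1) ^ d" using ev by simp
      then show "wp CSkip (\<lambda>\<sigma>'. vr \<sigma>' 21 = i \<and> I1 (Suc i) (\<sigma>'\<lparr>vr := (vr \<sigma>')(21 := Suc i), tm := tm \<sigma>' + 4\<rparr>))
        (\<sigma>2\<lparr>tm := tm \<sigma>2 + (etime (EV 0) + 3), tm := tm (\<sigma>2\<lparr>tm := tm \<sigma>2 + (etime (EV 0) + 3)\<rparr>) + (etime ?e + 1)\<rparr>)"
        using I v by (intro wp_skip) (simp add: I1_def J_def)
    qed
  next
    fix i \<sigma>2 assume "I1 i \<sigma>2" then show "eval (EV 0) \<sigma>2 = n" by (simp add: I1_def J_def)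
  next
    fix \<sigma>2 assume I: "I1 n \<sigma>2"
    have "n < (n + 1) ^ d" using d self_le_power[of "n + 1" d] by simp
    then have "mroot d n = vr \<sigma>2 1" using I by (intro mroot_eq) (auto simp: I1_def)
    then show "J (\<sigma>2\<lparr>tm := tm \<sigma>2 + (etime (EV 0) + 3)\<rparr>) \<and> vr (\<sigma>2\<lparr>tm := tm \<sigma>2 + (etime (EV 0) + 3)\<rparr>) 1 = mroot d n \<and>
      tm (\<sigma>2\<lparr>tm := tm \<sigma>2 + (etime (EV 0) + 3)\<rparr>) \<le> tm \<sigma> + (4 * d + 50) * n + 40"
      using I by (simp add: I1_def J_def)
  qed (use bd in simp)
  define C where "C = tm \<sigma> + (4 * d + 50) * n + 4 * c + 4 * l + 150"
  define J2 where "J2 \<sigma>' \<longleftrightarrow> J \<sigma>' \<and> vr \<sigma>' 1 = par_N d n \<and> vr \<sigma>' 2 = par_b d n \<and>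
     vr \<sigma>' 3 = (par_N d n + 2) ^ c + K + 3 \<and> vr \<sigma>' 4 = (par_N d n + 2) ^ l" for \<sigma>' :: hst
  define I2 where "I2 i \<sigma>' \<longleftrightarrow> J2 \<sigma>' \<and> vr \<sigma>' 5 \<le> i \<and> vr \<sigma>' 23 = 3 ^ vr \<sigma>' 5 \<and> (vr \<sigma>' 5 = i \<or> cub n \<le> 3 ^ vr \<sigma>' 5) \<and>
    3 ^ (vr \<sigma>' 5 - 1) < cub n \<and> tm \<sigma>' \<le> C + 70 * i" for i and \<sigma>' :: hst
  have w2: "wp (CFor 21 (EC 3 [*] EV 0 [+] EC 10)
       (CIf (EV 23 [<] EC 3 [*] pw (EV 0 [+] EC 1) 3 [+] EC 1) (CAsg 23 (EV 23 [*] EC 3) ;; CAsg 5 (EV 5 [+] EC 1)) CSkip))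
    (\<lambda>\<sigma>'. J2 \<sigma>' \<and> vr \<sigma>' 5 = num_copies n \<and> tm \<sigma>' \<le> C + 70 * (3 * n + 10) + 10) \<sigma>2"
    if s2: "J2 \<sigma>2" "vr \<sigma>2 5 = 0" "vr \<sigma>2 23 = 1" "tm \<sigma>2 + 2 \<le> C" for \<sigma>2
  proof (rule wp_for[where I = I2 and m = "3 * n + 10"])
    show "I2 0 (\<sigma>2\<lparr>vr := (vr \<sigma>2)(21 := 0), tm := tm \<sigma>2 + 2\<rparr>)"
      using s2 by (simp add: I2_def J2_def J_def cub_def)
  next
    fix i \<sigma>3 assume i: "i < 3 * n + 10" and I: "I2 i \<sigma>3" and v: "vr \<sigma>3 21 = i"
    let ?e = "EV 23 [<] EC 3 [*] pw (EV 0 [+] EC 1) 3 [+] EC 1"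
    have ev: "(eval ?e \<sigma>3 \<noteq> 0) = (3 ^ vr \<sigma>3 5 < cub n)" using I by (simp add: I2_def J2_def J_def cub_def)
    let ?\<tau> = "\<sigma>3\<lparr>tm := tm \<sigma>3 + (etime (EC 3 [*] EV 0 [+] EC 10) + 3)\<rparr>"
    show "wp (CIf ?e (CAsg 23 (EV 23 [*] EC 3) ;; CAsg 5 (EV 5 [+] EC 1)) CSkip)
      (\<lambda>\<sigma>'. vr \<sigma>' 21 = i \<and> I2 (Suc i) (\<sigma>'\<lparr>vr := (vr \<sigma>')(21 := Suc i), tm := tm \<sigma>' + 4\<rparr>)) ?\<tau>"
    proof (rule wp_if)
      assume "eval ?e ?\<tau> \<noteq> 0"
      then have lt: "3 ^ vr \<sigma>3 5 < cub n" using ev by simp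
      then have r: "vr \<sigma>3 5 = i" using I by (auto simp: I2_def)
      have "3 ^ i * 3 \<le> U" "i + 1 \<le> U" using lt r i bd(4,5) by auto
      then show "wp (CAsg 23 (EV 23 [*] EC 3) ;; CAsg 5 (EV 5 [+] EC 1))
        (\<lambda>\<sigma>'. vr \<sigma>' 21 = i \<and> I2 (Suc i) (\<sigma>'\<lparr>vr := (vr \<sigma>')(21 := Suc i), tm := tm \<sigma>' + 4\<rparr>)) (?\<tau>\<lparr>tm := tm ?\<tau> + (etime ?e + 1)\<rparr>)"
        using I v lt r by (intro wp_seq wp_asg) (simp_all add: I2_def J2_def J_def)
    next
      assume "eval ?e ?\<tau> = 0"
      then have "cub n \<le> 3 ^ vr \<sigma>3 5" using ev by simp
      then show "wp CSkip (\<lambda>\<sigma>'. vr \<sigma>' 21 = i \<and> I2 (Suc i) (\<sigma>'\<lparr>vr := (vr \<sigma>')(21 := Suc i), tm := tm \<sigma>' + 4\<rparr>)) (?\<tau>\<lparr>tm := tm ?\<tau> + (etime ?e + 1)\<rparr>)"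
        using I v by (intro wp_skip) (simp add: I2_def J2_def J_def)
    qed
  next
    fix i \<sigma>3 assume "I2 i \<sigma>3" then show "eval (EC 3 [*] EV 0 [+] EC 10) \<sigma>3 = 3 * n + 10" by (simp add: I2_def J2_def J_def)
  next
    fix \<sigma>3 assume I: "I2 (3 * n + 10) \<sigma>3"
    then have "num_copies n = vr \<sigma>3 5" using cub_le[of n] by (intro num_copies_eq) (auto simp: I2_def)
    then show "J2 (\<sigma>3\<lparr>tm := tm \<sigma>3 + (etime (EC 3 [*] EV 0 [+] EC 10) + 3)\<rparr>) \<and>
      vr (\<sigma>3\<lparr>tm := tm \<sigma>3 + (etime (EC 3 [*] EV 0 [+] EC 10) + 3)\<rparr>) 5 = num_copies n \<and>
      tm (\<sigma>3\<lparr>tm := tm \<sigma>3 + (etime (EC 3 [*] EV 0 [+] EC 10) + 3)\<rparr>) \<le> C + 70 * (3 * n + 10) + 10"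
      using I by (simp add: I2_def J2_def J_def)
  qed (use bd in simp)
  let ?Q = "\<lambda>\<sigma>'. vr \<sigma>' 0 = n \<and> vr \<sigma>' 1 = par_N d n \<and> vr \<sigma>' 2 = par_b d n \<and>
     vr \<sigma>' 3 = (par_N d n + 2) ^ c + K + 3 \<and> vr \<sigma>' 4 = (par_N d n + 2) ^ l \<and> vr \<sigma>' 5 = num_copies n \<and>
     vr \<sigma>' 6 = par_nb d n \<and> vr \<sigma>' 7 = par_nb d n * par_b d n \<and> vr \<sigma>' 15 = 0 \<and> ar \<sigma>' = (\<lambda>_ _. 0) \<and>
     hin \<sigma>' = xs \<and> hpos \<sigma>' = 0 \<and> tm \<sigma>' \<le> tm \<sigma> + (4 * d + 4 * c + 4 * l + 1000) * (n + 1)"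
  have w3: "wp (CAsg 6 (EV 0 [div] EV 2 [+] EC 1) ;; CAsg 7 (EV 6 [*] EV 2)) ?Q \<sigma>3"
    if "J2 \<sigma>3 \<and> vr \<sigma>3 5 = num_copies n \<and> tm \<sigma>3 \<le> C + 70 * (3 * n + 10) + 10" for \<sigma>3
    using that bd(6,7) by (intro wp_seq wp_asg) (auto simp: J2_def J_def par_nb_def C_def algebra_simps)
  have NU: "mroot d n + 3 \<le> U" using mroot_le[OF d, of n] bd(1) by simp
  have w4: "wp (CAsg 1 (EV 1 [+] EC 3) ;; CAsg 2 (EV 1 [div] EC 3) ;; CAsg 3 (pw (EV 1 [+] EC 2) c [+] EC K [+] EC 3) ;;
     CAsg 4 (pw (EV 1 [+] EC 2) l) ;; CAsg 5 (EC 0) ;; CAsg 23 (EC 1) ;;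
     CFor 21 (EC 3 [*] EV 0 [+] EC 10)
       (CIf (EV 23 [<] EC 3 [*] pw (EV 0 [+] EC 1) 3 [+] EC 1) (CAsg 23 (EV 23 [*] EC 3) ;; CAsg 5 (EV 5 [+] EC 1)) CSkip) ;;
     CAsg 6 (EV 0 [div] EV 2 [+] EC 1) ;; CAsg 7 (EV 6 [*] EV 2)) ?Q \<sigma>2"
    if s2: "J \<sigma>2 \<and> vr \<sigma>2 1 = mroot d n \<and> tm \<sigma>2 \<le> tm \<sigma> + (4 * d + 50) * n + 40" for \<sigma>2
  proof -
    have "(par_N d n + 2) ^ l \<le> U" "(par_N d n + 2) ^ c + K + 3 \<le> U" "par_b d n \<le> U" using bd NU by (auto simp: par_b_def par_N_def)
    note U = this NU U_pos
    show ?thesis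
    proof (rule wp_seq, rule wp_asg, use s2 U in simp, rule wp_seq, rule wp_asg, use s2 U in \<open>simp add: par_b_def par_N_def\<close>,
        rule wp_seq, rule wp_asg, use s2 U in \<open>simp add: par_N_def\<close>, rule wp_seq, rule wp_asg, use s2 U in \<open>simp add: par_N_def\<close>,
        rule wp_seq, rule wp_asg, simp, rule wp_seq, rule wp_asg, use U in simp, rule wp_seq, rule wp_mono[OF w2])
    qed (use s2 w3 in \<open>simp_all add: J2_def J_def par_b_def par_N_def C_def\<close>)
  qed
  have nU: "n \<le> U" using bd by simp
  show ?thesis
    unfolding PRE1_def
  proof (rule wp_seq, rule wp_rd[OF h(1)])
    let ?s = "\<sigma>\<lparr>vr := (vr \<sigma>)(0 := n), hin := xs, tm := tm \<sigma> + 1\<rparr>"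
    have e: "\<sigma>1 = ?s\<lparr>vr := (vr ?s)(1 := 0), tm := tm ?s + 2\<rparr>" by (simp add: \<sigma>1_def)
    show "n \<le> U" by (rule nU)
    show "wp (CAsg 1 (EC 0) ;; CFor 21 (EV 0) (CIf (pw (EV 1 [+] EC 1) d [<] EV 0 [+] EC 1) (CAsg 1 (EV 1 [+] EC 1)) CSkip) ;;
     CAsg 1 (EV 1 [+] EC 3) ;; CAsg 2 (EV 1 [div] EC 3) ;; CAsg 3 (pw (EV 1 [+] EC 2) c [+] EC K [+] EC 3) ;;
     CAsg 4 (pw (EV 1 [+] EC 2) l) ;; CAsg 5 (EC 0) ;; CAsg 23 (EC 1) ;;
     CFor 21 (EC 3 [*] EV 0 [+] EC 10)
       (CIf (EV 23 [<] EC 3 [*] pw (EV 0 [+] EC 1) 3 [+] EC 1) (CAsg 23 (EV 23 [*] EC 3) ;; CAsg 5 (EV 5 [+] EC 1)) CSkip) ;;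
     CAsg 6 (EV 0 [div] EV 2 [+] EC 1) ;; CAsg 7 (EV 6 [*] EV 2)) ?Q ?s"
    proof (rule wp_seq, rule wp_asg)
      show "eval (EC 0) ?s \<le> U" by simp
      have "?s\<lparr>vr := (vr ?s)(1 := eval (EC 0) ?s), tm := tm ?s + (etime (EC 0) + 1)\<rparr> = \<sigma>1" unfolding e by simp
      moreover have "wp (CFor 21 (EV 0) (CIf (pw (EV 1 [+] EC 1) d [<] EV 0 [+] EC 1) (CAsg 1 (EV 1 [+] EC 1)) CSkip) ;;
     CAsg 1 (EV 1 [+] EC 3) ;; CAsg 2 (EV 1 [div] EC 3) ;; CAsg 3 (pw (EV 1 [+] EC 2) c [+] EC K [+] EC 3) ;;
     CAsg 4 (pw (EV 1 [+] EC 2) l) ;; CAsg 5 (EC 0) ;; CAsg 23 (EC 1) ;;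
     CFor 21 (EC 3 [*] EV 0 [+] EC 10)
       (CIf (EV 23 [<] EC 3 [*] pw (EV 0 [+] EC 1) 3 [+] EC 1) (CAsg 23 (EV 23 [*] EC 3) ;; CAsg 5 (EV 5 [+] EC 1)) CSkip) ;;
     CAsg 6 (EV 0 [div] EV 2 [+] EC 1) ;; CAsg 7 (EV 6 [*] EV 2)) ?Q \<sigma>1"
        by (rule wp_seq, rule wp_mono[OF w1 w4]) assumption
      ultimately show "wp (CFor 21 (EV 0) (CIf (pw (EV 1 [+] EC 1) d [<] EV 0 [+] EC 1) (CAsg 1 (EV 1 [+] EC 1)) CSkip) ;;
     CAsg 1 (EV 1 [+] EC 3) ;; CAsg 2 (EV 1 [div] EC 3) ;; CAsg 3 (pw (EV 1 [+] EC 2) c [+] EC K [+] EC 3) ;;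
     CAsg 4 (pw (EV 1 [+] EC 2) l) ;; CAsg 5 (EC 0) ;; CAsg 23 (EC 1) ;;
     CFor 21 (EC 3 [*] EV 0 [+] EC 10)
       (CIf (EV 23 [<] EC 3 [*] pw (EV 0 [+] EC 1) 3 [+] EC 1) (CAsg 23 (EV 23 [*] EC 3) ;; CAsg 5 (EV 5 [+] EC 1)) CSkip) ;;
     CAsg 6 (EV 0 [div] EV 2 [+] EC 1) ;; CAsg 7 (EV 6 [*] EV 2)) ?Q
       (?s\<lparr>vr := (vr ?s)(1 := eval (EC 0) ?s), tm := tm ?s + (etime (EC 0) + 1)\<rparr>)" by (simp only:)
    qed
  qed
qed

end

section \<open>Amplification\<close>

lemma space_coin_tape [simp]: "space coin_tape = UNIV"
  by (simp add: coin_tape_def space_PiM)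

interpretation coins: prob_space coin_tape
  unfolding coin_tape_def by (intro prob_space_PiM prob_space_measure_pmf)

lemma coin_measurable: "(\<lambda>\<omega>. \<omega> i) \<in> measurable coin_tape (measure_pmf (bernoulli_pmf (1/2)))"
  unfolding coin_tape_def by (rule measurable_component_singleton) simp

text \<open>Such a set is open in the Cantor space, hence the union of the cylinders that it
  contains, and there are only countably many cylinders.\<close>

lemma finitely_determined_measurable:
  assumes "\<And>\<omega>. \<omega> \<in> S \<Longrightarrow> \<exists>q. \<forall>\<omega>'. (\<forall>i<q. \<omega>' i = \<omega> i) \<longrightarrow> \<omega>' \<in> S"
  shows "S \<in> sets coin_tape"
proof -
  define cyl where "cyl l = {\<omega>. \<forall>i<length l. \<omega> i = l ! i}" for l :: "bool list"
  have cyl: "cyl l \<in> sets coin_tape" for l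
  proof -
    have "{\<omega> \<in> space coin_tape. \<omega> i = c} \<in> sets coin_tape" for i c
      using measurable_sets[OF coin_measurable[of i], of "{c}"] by (simp add: vimage_def)
    then have "{\<omega> \<in> space coin_tape. \<forall>i\<in>{..<length l}. \<omega> i = l ! i} \<in> sets coin_tape"
      by (intro sets.sets_Collect_finite_All) auto
    then show ?thesis by (simp add: cyl_def Ball_def)
  qed
  have "S = (\<Union>l\<in>{l. cyl l \<subseteq> S}. cyl l)"
  proof (intro equalityI subsetI)
    fix \<omega> assume "\<omega> \<in> S"
    then obtain q where q: "\<And>\<omega>'. (\<forall>i<q. \<omega>' i = \<omega> i) \<Longrightarrow> \<omega>' \<in> S" using assms by blast
    let ?l = "map \<omega> [0..<q]"
    have "cyl ?l \<subseteq> S" using q by (auto simp: cyl_def)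
    moreover have "\<omega> \<in> cyl ?l" by (simp add: cyl_def)
    ultimately show "\<omega> \<in> (\<Union>l\<in>{l. cyl l \<subseteq> S}. cyl l)" by blast
  qed auto
  also have "\<dots> \<in> sets coin_tape" using cyl by (intro sets.countable_UN') auto
  finally show ?thesis .
qed

text \<open>A halting run depends on finitely many coins.\<close>

lemma online_run_measurable: "{\<omega>. \<exists>tp tq. online_run W \<omega> pre req x xss tp tq yss} \<in> sets coin_tape"
proof (rule finitely_determined_measurable)
  fix \<omega> assume "\<omega> \<in> {\<omega>. \<exists>tp tq. online_run W \<omega> pre req x xss tp tq yss}"
  then obtain tp tq s where 1: "exec W \<omega> pre \<lparr>mem = (\<lambda>_. 0), coin_pos = 0, inp = x, outp = []\<rparr> tp s"
    "session W \<omega> req s xss tq yss" by (auto simp: online_run_def)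
  have le: "coin_pos s \<le> coin_pos (fin W \<omega> req s xss)" using session_coin[OF 1(2)] by simp
  show "\<exists>q. \<forall>\<omega>'. (\<forall>i<q. \<omega>' i = \<omega> i) \<longrightarrow> \<omega>' \<in> {\<omega>. \<exists>tp tq. online_run W \<omega> pre req x xss tp tq yss}"
  proof (rule exI[of _ "coin_pos (fin W \<omega> req s xss)"], intro allI impI)
    fix \<omega>' assume a: "\<forall>i<coin_pos (fin W \<omega> req s xss). \<omega>' i = \<omega> i"
    have "exec W \<omega>' pre \<lparr>mem = (\<lambda>_. 0), coin_pos = 0, inp = x, outp = []\<rparr> tp s"
      by (rule exec_tape[OF 1(1)]) (use a le in simp)
    moreover have "session W \<omega>' req s xss tq yss"
      by (rule session_tape[OF 1(2)]) (use a in simp)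
    ultimately show "\<omega>' \<in> {\<omega>. \<exists>tp tq. online_run W \<omega> pre req x xss tp tq yss}" by (auto simp: online_run_def)
  qed
qed

lemma subtape_measurable: "(\<lambda>\<omega> p. \<omega> (p * R + r)) \<in> measurable coin_tape coin_tape"
proof -
  have "(\<lambda>\<omega>. \<lambda>p\<in>UNIV. \<omega> (p * R + r)) \<in> measurable coin_tape (\<Pi>\<^sub>M p\<in>UNIV. measure_pmf (bernoulli_pmf (1/2)))"
    by (intro measurable_restrict coin_measurable)
  then show ?thesis by (simp add: coin_tape_def restrict_UNIV)
qed

lemma subtape_distr:
  assumes "r < R"
  shows "distr coin_tape coin_tape (\<lambda>\<omega> p. \<omega> (p * R + r)) = coin_tape"
proof -
  have "inj (\<lambda>p. p * R + r)" using assms by (auto simp: inj_def)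
  then show ?thesis
    using distr_PiM_reindex[of UNIV "\<lambda>_::nat. measure_pmf (bernoulli_pmf (1/2))" "\<lambda>p. p * R + r" UNIV]
    by (simp add: coin_tape_def prob_space_measure_pmf restrict_UNIV)
qed

text \<open>The residue classes modulo \<open>R\<close> are disjoint sets of coins.\<close>

lemma subtapes_indep:
  "coins.indep_vars (\<lambda>_. coin_tape) (\<lambda>r \<omega> p. \<omega> (p * R + r)) {..<R}"
proof -
  let ?B = "measure_pmf (bernoulli_pmf (1/2))"
  let ?K = "\<lambda>r. {p * R + r | p. True}"
  have "distr coin_tape ?B (\<lambda>\<omega>. \<omega> i) = ?B" for i :: nat
    unfolding coin_tape_def by (rule distr_PiM_component) (auto intro: prob_space_measure_pmf)
  then have "coins.indep_vars (\<lambda>_. ?B) (\<lambda>i \<omega>. \<omega> i) (UNIV :: nat set)"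
    using coin_measurable
    by (subst coins.indep_vars_iff_distr_eq_PiM) (simp_all add: restrict_UNIV coin_tape_def[symmetric] distr_id2)
  then have 1: "coins.indep_vars (\<lambda>r. PiM (?K r) (\<lambda>_. ?B)) (\<lambda>r \<omega>. restrict (\<lambda>i. \<omega> i) (?K r)) {..<R}"
  proof (rule coins.indep_vars_restrict)
    show "disjoint_family_on ?K {..<R}"
      unfolding disjoint_family_on_def
    proof (intro ballI impI)
      fix r r' assume r: "r \<in> {..<R}" "r' \<in> {..<R}" "r \<noteq> r'"
      have "p * R + r \<noteq> p' * R + r'" for p p'
      proof
        assume "p * R + r = p' * R + r'"
        then have "(p * R + r) mod R = (p' * R + r') mod R" by simp
        then show False using r by simp
      qed
      then show "?K r \<inter> ?K r' = {}" by blast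
    qed
  qed auto
  have "(\<lambda>g. \<lambda>p\<in>UNIV. g (p * R + r)) \<in> measurable (PiM (?K r) (\<lambda>_. ?B)) (\<Pi>\<^sub>M p\<in>(UNIV :: nat set). ?B)" for r
    by (intro measurable_restrict measurable_component_singleton) auto
  then have "(\<lambda>g p. g (p * R + r)) \<in> measurable (PiM (?K r) (\<lambda>_. ?B)) coin_tape" for r
    by (simp add: coin_tape_def restrict_UNIV)
  from coins.indep_vars_compose2[OF 1, of "\<lambda>r g p. g (p * R + r)", OF this]
  have "coins.indep_vars (\<lambda>_. coin_tape) (\<lambda>r \<omega> p. restrict (\<lambda>i. \<omega> i) (?K r) (p * R + r)) {..<R}" .
  moreover have "restrict (\<lambda>i. \<omega> i) (?K r) (p * R + r) = \<omega> (p * R + r)" for \<omega> :: "nat \<Rightarrow> bool" and r p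
    by auto
  ultimately show ?thesis by simp
qed

lemma amplify_one:
  assumes A: "A \<in> sets coin_tape" "measure coin_tape A \<ge> 2/3" and R: "1 \<le> R"
  shows "{\<omega>. \<exists>r<R. (\<lambda>p. \<omega> (p * R + r)) \<in> A} \<in> sets coin_tape"
    and "measure coin_tape {\<omega>. \<not> (\<exists>r<R. (\<lambda>p. \<omega> (p * R + r)) \<in> A)} \<le> (1/3) ^ R"
proof -
  let ?X = "\<lambda>r \<omega> p. \<omega> (p * R + r) :: bool"
  have "?X r -` A \<inter> space coin_tape \<in> sets coin_tape" for r
    by (rule measurable_sets[OF subtape_measurable A(1)])
  then have "(\<Union>r\<in>{..<R}. ?X r -` A) \<in> sets coin_tape" by (intro sets.finite_UN) auto
  moreover have "(\<Union>r\<in>{..<R}. ?X r -` A) = {\<omega>. \<exists>r<R. (\<lambda>p. \<omega> (p * R + r)) \<in> A}" by auto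
  ultimately show "{\<omega>. \<exists>r<R. (\<lambda>p. \<omega> (p * R + r)) \<in> A} \<in> sets coin_tape" by simp
  have cA: "- A \<in> sets coin_tape" using sets.compl_sets[OF A(1)] by (simp add: Compl_eq_Diff_UNIV)
  have "measure coin_tape (?X r -` (- A) \<inter> space coin_tape) \<le> 1/3" if "r < R" for r
  proof -
    have "measure coin_tape (?X r -` (- A) \<inter> space coin_tape) = measure (distr coin_tape coin_tape (?X r)) (- A)"
      by (rule measure_distr[symmetric, OF subtape_measurable cA])
    also have "\<dots> = measure coin_tape (- A)" using subtape_distr[OF that] by simp
    also have "\<dots> = 1 - measure coin_tape A" using coins.prob_compl[OF A(1)] by (simp add: Compl_eq_Diff_UNIV)
    finally show ?thesis using A(2) by simp
  qed
  then have "(\<Prod>r\<in>{..<R}. measure coin_tape (?X r -` (- A) \<inter> space coin_tape)) \<le> (\<Prod>r\<in>{..<R}. 1/3)"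
    by (intro prod_mono) simp
  moreover have "measure coin_tape (\<Inter>r\<in>{..<R}. ?X r -` (- A) \<inter> space coin_tape) =
      (\<Prod>r\<in>{..<R}. measure coin_tape (?X r -` (- A) \<inter> space coin_tape))"
    using R by (intro coins.indep_varsD[OF subtapes_indep]) (auto simp: cA lessThan_empty_iff)
  moreover have "(\<Inter>r\<in>{..<R}. ?X r -` (- A) \<inter> space coin_tape) = {\<omega>. \<not> (\<exists>r<R. (\<lambda>p. \<omega> (p * R + r)) \<in> A)}"
    by auto
  ultimately show "measure coin_tape {\<omega>. \<not> (\<exists>r<R. (\<lambda>p. \<omega> (p * R + r)) \<in> A)} \<le> (1/3) ^ R" by simp
qed

text \<open>Independence is used only between the copies of one instance. Different instances may
  share their coins, since a union bound joins them.\<close>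

lemma amplify:
  assumes A: "\<And>m. m \<in> set ms \<Longrightarrow> A m \<in> sets coin_tape \<and> measure coin_tape (A m) \<ge> 2/3" and R: "1 \<le> R"
  shows "{\<omega>. \<forall>m\<in>set ms. \<exists>r<R. (\<lambda>p. \<omega> (p * R + r)) \<in> A m} \<in> sets coin_tape"
    and "measure coin_tape {\<omega>. \<forall>m\<in>set ms. \<exists>r<R. (\<lambda>p. \<omega> (p * R + r)) \<in> A m} \<ge> 1 - real (length ms) * (1/3) ^ R"
proof -
  let ?G = "\<lambda>m. {\<omega>. \<exists>r<R. (\<lambda>p. \<omega> (p * R + r)) \<in> A m}"
  let ?E = "{\<omega>. \<forall>m\<in>set ms. \<exists>r<R. (\<lambda>p. \<omega> (p * R + r)) \<in> A m}"
  have G: "?G m \<in> sets coin_tape" if "m \<in> set ms" for m using amplify_one(1) A[OF that] R by blast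
  have cG: "- ?G m \<in> sets coin_tape" if "m \<in> set ms" for m
    using sets.compl_sets[OF G[OF that]] by (simp add: Compl_eq_Diff_UNIV)
  have U: "(\<Union>m\<in>set ms. - ?G m) \<in> sets coin_tape" using cG by (intro sets.finite_UN) auto
  have E: "?E = - (\<Union>m\<in>set ms. - ?G m)" by auto
  show "?E \<in> sets coin_tape" unfolding E using sets.compl_sets[OF U] by (simp add: Compl_eq_Diff_UNIV)
  have "measure coin_tape (\<Union>m\<in>set ms. - ?G m) \<le> (\<Sum>m\<in>set ms. measure coin_tape (- ?G m))"
    using cG by (intro coins.finite_measure_subadditive_finite) auto
  also have "\<dots> \<le> (\<Sum>m\<in>set ms. (1/3) ^ R)"
  proof (rule sum_mono)
    fix m assume "m \<in> set ms"
    then show "measure coin_tape (- ?G m) \<le> (1/3) ^ R"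
      using amplify_one(2)[of "A m" R] A R by (simp add: Collect_neg_eq[symmetric])
  qed
  also have "\<dots> \<le> real (length ms) * (1/3) ^ R"
    using card_length[of ms] by (simp add: mult_right_mono)
  finally have "measure coin_tape (\<Union>m\<in>set ms. - ?G m) \<le> real (length ms) * (1/3) ^ R" .
  moreover have "measure coin_tape ?E = 1 - measure coin_tape (\<Union>m\<in>set ms. - ?G m)"
    unfolding E using coins.prob_compl[OF U] by (simp add: Compl_eq_Diff_UNIV)
  ultimately show "measure coin_tape ?E \<ge> 1 - real (length ms) * (1/3) ^ R" by simp
qed

section \<open>The instances and the running time\<close>

context red
begin

text \<open>The insertion sequences that occur if no triangle is missed do not depend on the coins, which
  makes the union bound over them possible.\<close>

fun instances :: "(nat \<Rightarrow> nat \<times> (nat \<times> nat) list) \<Rightarrow> (nat \<Rightarrow> bool) list \<Rightarrow> (nat \<times> nat) list list" where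
  "instances Y [] = []"
| "instances Y (v # vs) = map (\<lambda>z. mid z (res v) (known z (res v)) (fst (Y z)) (snd (Y z))) [0..<nb * nb] @
     instances (\<lambda>z. ideal_step z (res v) (Y z)) vs"

lemma allgood_iff: "allgood Y vs \<longleftrightarrow> (\<forall>m\<in>set (instances Y vs). \<exists>r<R. goodrun r m)"
  by (induction Y vs rule: instances.induct) auto

lemma length_instances: "length (instances Y vs) = length vs * (nb * nb)"
  by (induction Y vs rule: instances.induct) simp_all

lemma instances_insertions:
  "(\<And>z. z < nb * nb \<Longrightarrow> block_ok z (Y z)) \<Longrightarrow> m \<in> set (instances Y vs) \<Longrightarrow> insertions N {} m"
proof (induction Y vs rule: instances.induct)
  case (2 Y v vs)
  consider z where "z < nb * nb" "m = mid z (res v) (known z (res v)) (fst (Y z)) (snd (Y z))" |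
    "m \<in> set (instances (\<lambda>z. ideal_step z (res v) (Y z)) vs)" using "2.prems"(2) by auto
  then show ?case
  proof cases
    case 1
    then have "wf (Suc (fst (Y z))) m" "fst (Y z) < b"
      using "2.prems"(1)[of z] wf_mid by (auto simp: block_ok_def)
    then show ?thesis using wf_ins by simp
  next
    case 2
    show ?thesis by (rule "2.IH"[OF _ 2]) (use "2.prems"(1) block_ok_ideal_step in blast)
  qed
qed simp

lemma block_ok_init: "block_ok z (0, [])"
  using b1 by (simp add: block_ok_def wf_def has_triangle_def)

definition total_time :: "nat \<Rightarrow> nat" where
  "total_time a = a * (n + 1) + 50 * (n * n) + 30 * (R * L) + R * (600 * TP + 100) + 100 + n * query_cost + nb * nb * (max_potential + setup_cost + b * step_cost)"

text \<open>The time bound holds for every tape, as \<open>solves_OMv\<close> demands, and only the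
  answers depend on \<open>allgood\<close>.\<close>

lemma online_red:
  assumes eqs: "N = par_N d n" "b = par_b d n" "nb = par_nb d n" "S0 = (N + 2) ^ c + K" "L = (N + 2) ^ l" "R = num_copies n"
    and d: "1 \<le> d" and cok: "cok (PRE1 d c l K ;; PRE2 pre)" "cok (QUERY upd)" and vs: "length vs = n"
    and bd: "n + 3 \<le> U" "3 * cub n \<le> U" "3 * n + 10 \<le> U" "n * n \<le> U" "R * L \<le> U" "N * N + 1 \<le> U" "nb * b \<le> U"
  shows "\<exists>tp tq yss. online_run W \<omega> (ccomp (PRE1 d c l K ;; PRE2 pre)) (ccomp (QUERY upd)) (mat_input n M)
      (map (vec_input n) vs) tp tq yss \<and>
    tp + tq \<le> total_time (4 * d + 4 * c + 4 * l + 1000) \<and>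
    (allgood (\<lambda>_. (0, [])) vs \<longrightarrow> yss = map (\<lambda>v. vec_input n (bool_mat_vec n M v)) vs)"
proof -
  let ?ini = "\<lparr>mem = (\<lambda>_. 0), coin_pos = 0, inp = mat_input n M, outp = []\<rparr>"
  let ?T1 = "(4 * d + 4 * c + 4 * l + 1000) * (n + 1)"
  have "1 \<le> nb" using nP eqs by (simp add: par_nb_def)
  moreover have "nb \<le> nb * nb" by (cases nb) auto
  ultimately have nbU: "nb \<le> U" using bounds by linarith
  have w: "wp (PRE1 d c l K ;; PRE2 pre) (\<lambda>\<sigma>'. inv \<sigma>' (\<lambda>_. (0, [])) 0 \<and>
     tm \<sigma>' \<le> ?T1 + 50 * (n * n) + 30 * (R * L) + R * (600 * TP + 100) + 100) (absr ?ini 0)"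
  proof (rule wp_seq, rule wp_mono[OF wp_PRE1[where n = n and xs = "map (\<lambda>z. of_bool (M (z div n) (z mod n))) [0..<n * n]"]])
    show "hin (absr ?ini 0) = n # map (\<lambda>z. of_bool (M (z div n) (z mod n))) [0..<n * n]"
      by (simp add: absr_def mat_input_eq)
    show "vr (absr ?ini 0) = (\<lambda>_. 0)" "ar (absr ?ini 0) = (\<lambda>_ _. 0)" "hpos (absr ?ini 0) = 0" by (simp_all add: absr_def fun_eq_iff)
    show "(par_N d n + 2) ^ c + K + 3 \<le> U" "(par_N d n + 2) ^ l \<le> U" using S0_U L_U eqs by simp_all
    show "par_nb d n \<le> U" "par_nb d n * par_b d n \<le> U" using nbU bd(7) eqs by simp_all
    fix \<sigma>' :: hst
    assume a: "vr \<sigma>' 0 = n \<and> vr \<sigma>' 1 = par_N d n \<and> vr \<sigma>' 2 = par_b d n \<and>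
     vr \<sigma>' 3 = (par_N d n + 2) ^ c + K + 3 \<and> vr \<sigma>' 4 = (par_N d n + 2) ^ l \<and> vr \<sigma>' 5 = num_copies n \<and>
     vr \<sigma>' 6 = par_nb d n \<and> vr \<sigma>' 7 = par_nb d n * par_b d n \<and> vr \<sigma>' 15 = 0 \<and> ar \<sigma>' = (\<lambda>_ _. 0) \<and>
     hin \<sigma>' = map (\<lambda>z. of_bool (M (z div n) (z mod n))) [0..<n * n] \<and> hpos \<sigma>' = 0 \<and> tm \<sigma>' \<le> tm (absr ?ini 0) + ?T1"
    then have t: "tm \<sigma>' \<le> ?T1" by (simp add: absr_def)
    show "wp (PRE2 pre) (\<lambda>\<sigma>'. inv \<sigma>' (\<lambda>_. (0, [])) 0 \<and>
       tm \<sigma>' \<le> ?T1 + 50 * (n * n) + 30 * (R * L) + R * (600 * TP + 100) + 100) \<sigma>'"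
      by (rule wp_mono[OF wp_PRE2]) (use a eqs bd t in simp_all)
  qed (use d bd in simp_all)
  have tma: "tm (absr s t) = t" for s t by (simp add: absr_def)
  have val: "valok U (absr ?ini 0)" by (simp add: valok_def absr_def)
  from wp_absr[OF w cok(1) val] obtain t s' t' where e: "exec W \<omega> (ccomp (PRE1 d c l K ;; PRE2 pre)) ?ini t s'"
    "t \<le> t'" "valok U (absr s' t')" "inv (absr s' t') (\<lambda>_. (0, [])) 0"
    "t' \<le> ?T1 + 50 * (n * n) + 30 * (R * L) + R * (600 * TP + 100) + 100"
    by (auto simp: tma)
  have eq1: "vr (absr s' t') = vr (absr s' 0)" "ar (absr s' t') = ar (absr s' 0)" by (auto simp: absr_def)
  have c1: "env (absr s' t') = env (absr s' 0)" "\<And>z q es. block_state (absr s' t') z q es = block_state (absr s' 0) z q es"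
    by (rule same_cong; use eq1 in simp)+
  have inv1: "inv (absr s' 0) (\<lambda>_. (0, [])) 0" using e(4) unfolding inv_def c1 eq1 .
  have val1: "valok U (absr s' 0)" using e(3) by (simp add: valok_def eq1)
  have "\<exists>t yss. session W \<omega> (ccomp (QUERY upd)) s' (map (vec_input n) vs) t yss \<and>
      t + sum_potential (absr s' 0) (\<lambda>_. (0, [])) \<le> length vs * query_cost + nb * nb * (max_potential + setup_cost + b * step_cost) \<and>
      (allgood (\<lambda>_. (0, [])) vs \<longrightarrow> yss = map (\<lambda>v. vec_input n (bool_mat_vec n M v)) vs)"
    by (rule session_QUERY[where Y = "\<lambda>_. (0, [])", OF cok(2) inv1 val1]) (use vs bd block_ok_init in simp_all)
  then obtain t2 yss where 2: "session W \<omega> (ccomp (QUERY upd)) s' (map (vec_input n) vs) t2 yss"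
    "t2 \<le> n * query_cost + nb * nb * (max_potential + setup_cost + b * step_cost)"
    "allgood (\<lambda>_. (0, [])) vs \<longrightarrow> yss = map (\<lambda>v. vec_input n (bool_mat_vec n M v)) vs"
    using vs by (auto dest: add_leD1)
  show ?thesis
  proof (intro exI conjI)
    show "online_run W \<omega> (ccomp (PRE1 d c l K ;; PRE2 pre)) (ccomp (QUERY upd)) (mat_input n M) (map (vec_input n) vs) t t2 yss"
      unfolding online_run_def using e(1) 2(1) by blast
    show "t + t2 \<le> total_time (4 * d + 4 * c + 4 * l + 1000)"
      unfolding total_time_def using e(2,5) 2(2) by linarith
  qed (rule 2(3))
qed

text \<open>Let \<open>X\<close> be \<open>TN + N * N\<close>, where the square stands for matrix
  edges and exhaustive search. A step costs of order \<open>R * X / b\<close>, and there are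
  \<open>n * nb * nb\<close> steps with \<open>nb\<close> of order \<open>n / N\<close>; this gives
  the first term. At most \<open>n\<close> hits in each of \<open>n\<close> queries, each costing of
  order \<open>R * X\<close>, give the second. The last one covers coins and preprocessing.\<close>

lemma total_time_le:
  assumes L: "TP + TN \<le> L" and b: "b \<le> n" "N \<le> 9 * b" "nb * b \<le> n + b"
  shows "real (total_time a) \<le> (2 * a + 20000000) * real R * (real n ^ 3 * real (TN + N * N) / real N ^ 3 + real n ^ 2 * real (TN + N * N) + L)"
proof -
  define X where "X = TN + N * N"
  have N1: "1 \<le> N" "b \<le> N" using b1 bN by auto
  have bb: "b * b + 1 \<le> 2 * (N * N)" "b * b \<le> N * N"
  proof -
    show "b * b \<le> N * N" using N1 by (intro mult_le_mono) auto
    moreover have "1 \<le> N * N" using N1 by simp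
    ultimately show "b * b + 1 \<le> 2 * (N * N)" by linarith
  qed
  have b3: "9 * (b * b) \<le> N * N" using mult_le_mono[OF bN bN] by simp
  have NN: "9 \<le> N * N" using b3 b1 mult_le_mono[OF b1 b1] by linarith
  have c0: "b * b + 1 \<le> N * N" using b3 mult_le_mono[OF b1 b1] by linarith
  have cb: "brute_force_cost \<le> 160 * (N * N)" using c0 NN by (simp add: brute_force_cost_def)
  have st: "setup_cost \<le> 640 * (R * (N * N))"
  proof -
    have "(40 * R + 600) * (b * b + 1) \<le> (640 * R) * (N * N)" using R1 c0 by (intro mult_le_mono) auto
    then show ?thesis by (simp add: setup_cost_def mult.assoc)
  qed
  have cbR: "brute_force_cost * R \<le> 160 * (R * (N * N))" using mult_le_mono1[OF cb, of R] by (simp add: mult.assoc mult.commute)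
  have RX: "R * X = R * TN + R * (N * N)" by (simp add: X_def algebra_simps)
  have ps: "max_potential + setup_cost \<le> 800 * (R * X)" unfolding max_potential_def using st cbR RX by linarith
  have dh: "hit_cost \<le> 960 * (R * X)" unfolding hit_cost_def using ps cbR RX by linarith
  have X1: "N * N \<le> X" by (simp add: X_def)
  have RX1: "1 \<le> R * X" using R1 X1 NN by (metis One_nat_def Suc_le_eq nat_0_less_mult_iff order_less_le_trans zero_less_numeral)
  have db: "b * step_cost \<le> 801 * (R * X)"
  proof -
    have "b * step_cost = b * ((max_potential + setup_cost) div b) + b" by (simp add: step_cost_def)
    also have "\<dots> \<le> max_potential + setup_cost + b" by simp
    finally have le: "b * step_cost \<le> max_potential + setup_cost + b" .
    have "b \<le> R * X"
    proof -
      have "b \<le> N * N" using c0 b1 by (metis add_leD1 le_trans mult_le_mono1 nat_mult_1)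
      also have "\<dots> \<le> R * X" using X1 R1 by (metis le_trans mult_le_mono1 nat_mult_1)
      finally show ?thesis .
    qed
    then show ?thesis using le ps by linarith
  qed
  have ob: "b * overhead \<le> 3600 * (R * X)"
  proof -
    have "overhead \<le> 3060 * (R * b)"
    proof -
      \<comment> \<open>The assumption \<open>TP + TN \<le> L\<close> removes the penalty for
        exhausted coins.\<close>
      have "overhead = 80 * (R * b) + 1200 * b + 230 * R + 1550" using L by (simp add: overhead_def algebra_simps)
      moreover have "R \<le> R * b" "b \<le> R * b" using b1 R1 by simp_all
      moreover have "1 \<le> R * b" using b1 R1 by simp
      ultimately show ?thesis by linarith
    qed
    then have "b * overhead \<le> b * (3060 * (R * b))" by (rule mult_le_mono2)
    also have "\<dots> = 3060 * (R * (b * b))" by simp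
    also have "\<dots> \<le> 3060 * (R * X)" using bb(2) X1 by (intro mult_le_mono2) auto
    finally show ?thesis by simp
  qed
  have b20: "b * 20 \<le> 20 * (R * X)"
  proof -
    have "b \<le> b * b" using b1 by simp
    also have "\<dots> \<le> X" using bb(2) X1 by linarith
    also have "\<dots> \<le> R * X" using R1 by simp
    finally show ?thesis by simp
  qed
  have od: "b * (overhead + step_cost + 20) \<le> 4421 * (R * X)" using ob db b20 by (simp add: distrib_left)
  let ?n = "real n" and ?N = "real N" and ?R = "real R" and ?X = "real X" and ?b = "real b"
  have pos: "0 < ?N" "0 < ?b" "0 < ?n" "1 \<le> ?R" "1 \<le> ?n" using N1 b1 R1 b(1) by auto
  \<comment> \<open>The factor 18 comes from \<open>nb * b \<le> n + b \<le> 2 * n\<close> and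
    \<open>N \<le> 9 * b\<close>.\<close>
  have nbr: "real nb \<le> 18 * ?n / ?N"
  proof -
    have "nb * b \<le> 2 * n" using b by linarith
    then have "real nb * ?b \<le> 2 * ?n" by (metis of_nat_le_iff of_nat_mult of_nat_numeral)
    moreover have "?N \<le> 9 * ?b" using b(2) by linarith
    ultimately have "real nb * ?N \<le> 18 * ?n"
      using mult_left_mono[of ?N "9 * ?b" "real nb"] by simp
    then show ?thesis using pos by (simp add: pos_le_divide_eq)
  qed
  have nb2: "real nb * real nb \<le> 324 * ?n ^ 2 / ?N ^ 2"
    using mult_mono[OF nbr nbr] pos by (simp add: power2_eq_square)
  \<comment> \<open>Passing from \<open>b\<close> to \<open>N\<close> costs a factor 9, and 39789 is
    9 times 4421.\<close>
  have odr: "real (overhead + step_cost + 20) \<le> 39789 * ?R * ?X / ?N"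
  proof -
    have "real (overhead + step_cost + 20) * ?b \<le> 4421 * (?R * ?X)"
      using od by (metis mult.commute of_nat_le_iff of_nat_mult of_nat_numeral)
    moreover have "?N \<le> 9 * ?b" using b(2) by linarith
    ultimately have "real (overhead + step_cost + 20) * ?N \<le> 39789 * (?R * ?X)"
      using mult_left_mono[of ?N "9 * ?b" "real (overhead + step_cost + 20)"] by linarith
    then show ?thesis using pos by (simp add: pos_le_divide_eq)
  qed
  \<comment> \<open>The constant is 324 times 39789, where 324 is the square of 18; likewise 518724
    below is 324 times 1601.\<close>
  have t1: "real (nb * nb * (overhead + step_cost + 20)) \<le> 12891636 * ?R * (?n ^ 2 * ?X / ?N ^ 3)"
  proof -
    have "real nb * real nb * real (overhead + step_cost + 20) \<le> (324 * ?n ^ 2 / ?N ^ 2) * (39789 * ?R * ?X / ?N)"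
      using nb2 odr by (intro mult_mono) auto
    also have "\<dots> = 12891636 * ?R * (?n ^ 2 * ?X / ?N ^ 3)" by (simp add: power2_eq_square power3_eq_cube)
    finally show ?thesis by simp
  qed
  have t2: "real (nb * nb * (max_potential + setup_cost + b * step_cost)) \<le> 518724 * ?R * (?n ^ 2 * ?X)"
  proof -
    have h: "real (max_potential + setup_cost + b * step_cost) \<le> 1601 * (?R * ?X)"
    proof -
      have "max_potential + setup_cost + b * step_cost \<le> 1601 * (R * X)" using ps db by linarith
      then show ?thesis by (metis of_nat_le_iff of_nat_mult of_nat_numeral)
    qed
    have "324 * ?n ^ 2 / ?N ^ 2 \<le> 324 * ?n ^ 2"
    proof -
      have N2: "1 \<le> ?N ^ 2" using N1 by (intro one_le_power) simp
      have "324 * ?n ^ 2 * 1 \<le> 324 * ?n ^ 2 * ?N ^ 2" by (rule mult_left_mono[OF N2]) simp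
      then show ?thesis using pos by (simp add: pos_divide_le_eq)
    qed
    then have "real nb * real nb \<le> 324 * ?n ^ 2" using nb2 by linarith
    from mult_mono[OF this h] have "real nb * real nb * real (max_potential + setup_cost + b * step_cost) \<le> 324 * ?n ^ 2 * (1601 * (?R * ?X))"
      by simp
    then show ?thesis by (simp add: mult_ac)
  qed
  let ?A = "?n ^ 3 * ?X / ?N ^ 3" and ?B = "?n ^ 2 * ?X"
  have B: "?n ^ 2 \<le> ?B" "?n \<le> ?B" "1 \<le> ?B" "?R * ?B \<ge> ?B" "0 \<le> ?A"
  proof -
    have X: "1 \<le> ?X" using X1 NN by linarith
    have "1 \<le> ?n ^ 2" "?n \<le> ?n ^ 2" using pos(5) by (simp_all add: self_le_power)
    moreover have "?n ^ 2 \<le> ?B" using mult_left_mono[OF X, of "?n ^ 2"] by simp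
    ultimately show "?n ^ 2 \<le> ?B" "?n \<le> ?B" "1 \<le> ?B" by linarith+
    then show "?R * ?B \<ge> ?B" using mult_right_mono[OF pos(4), of ?B] by linarith
    show "0 \<le> ?A" by simp
  qed
  have dhr: "?n * ?n * real hit_cost \<le> 960 * (?R * ?B)"
  proof -
    have "real hit_cost \<le> 960 * (?R * ?X)" using dh by (metis of_nat_le_iff of_nat_mult of_nat_numeral)
    then have "?n * ?n * real hit_cost \<le> ?n * ?n * (960 * (?R * ?X))" by (rule mult_left_mono) simp
    then show ?thesis by (simp add: power2_eq_square mult_ac)
  qed
  have t3: "real (n * query_cost) \<le> 12891636 * (?R * ?A) + 1080 * (?R * ?B)"
  proof -
    have "real (n * query_cost) = ?n * real (nb * nb * (overhead + step_cost + 20)) + ?n * ?n * real hit_cost + 60 * ?n ^ 2 + 60 * ?n"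
      by (simp add: query_cost_def algebra_simps power2_eq_square)
    moreover have "?n * real (nb * nb * (overhead + step_cost + 20)) \<le> ?n * (12891636 * ?R * (?n ^ 2 * ?X / ?N ^ 3))"
      by (rule mult_left_mono[OF t1]) simp
    moreover have "?n * (12891636 * ?R * (?n ^ 2 * ?X / ?N ^ 3)) = 12891636 * (?R * ?A)"
      by (simp add: power2_eq_square power3_eq_cube)
    ultimately show ?thesis using dhr B by linarith
  qed
  have t4: "real a * (?n + 1) \<le> 2 * real a * (?R * ?B)"
    using mult_left_mono[of "?n + 1" "2 * (?R * ?B)" "real a"] B by simp
  have t5: "?R * real TP \<le> ?R * real L" using L by (intro mult_left_mono) auto
  have t6: "?R \<le> ?R * ?B" using mult_left_mono[OF B(3), of ?R] by simp
  have "real (total_time a) = real a * (?n + 1) + 50 * ?n ^ 2 + 30 * (?R * real L) + 600 * (?R * real TP) + 100 * ?R + 100 +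
      real (n * query_cost) + real (nb * nb * (max_potential + setup_cost + b * step_cost))"
    by (simp add: total_time_def algebra_simps power2_eq_square)
  also have "\<dots> \<le> 2 * real a * (?R * ?B) + (50 * (?R * ?B) + 630 * (?R * real L) + 200 * (?R * ?B) +
      12891636 * (?R * ?A) + 1080 * (?R * ?B) + 518724 * (?R * ?B))"
    using t2 t3 t4 t5 t6 B by linarith
  also have "\<dots> \<le> 2 * real a * (?R * ?B) + 20000000 * (?R * ?A + ?R * ?B + ?R * real L)"
  proof -
    have le: "w + (50 * y + 630 * z + 200 * y + 12891636 * x + 1080 * y + 518724 * y) \<le> w + 20000000 * (x + y + z)"
      if "0 \<le> x" "0 \<le> y" "0 \<le> z" for w x y z :: real using that unfolding distrib_left by linarith
    show ?thesis by (rule le) (use B in simp_all)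
  qed
  also have "\<dots> \<le> 2 * real a * (?R * ?A + ?R * ?B + ?R * real L) + 20000000 * (?R * ?A + ?R * ?B + ?R * real L)"
    using B by (intro add_right_mono mult_left_mono) auto
  also have "\<dots> = (2 * real a + 20000000) * ?R * (?A + ?B + real L)" by (simp add: algebra_simps)
  finally show ?thesis unfolding X_def .
qed

end

section \<open>The reduction for every size\<close>

lemma power_poly:
  assumes "\<exists>e. \<forall>n. f n \<le> (n + 2) ^ e"
  shows "\<exists>e. \<forall>n::nat. f n ^ k \<le> (n + 2 :: nat) ^ e"
proof -
  from assms obtain e where "f n \<le> (n + 2) ^ e" for n by blast
  then have "f n ^ k \<le> (n + 2) ^ (e * k)" for n by (simp add: power_mult power_mono)
  then show ?thesis by blast
qed

lemma add_poly:
  assumes "\<exists>e. \<forall>n. f n \<le> (n + 2) ^ e" "\<exists>e. \<forall>n. g n \<le> (n + 2) ^ e"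
  shows "\<exists>e. \<forall>n::nat. f n + g n \<le> (n + 2 :: nat) ^ e"
proof -
  from assms obtain e e' where e: "f n \<le> (n + 2) ^ e" "g n \<le> (n + 2) ^ e'" for n by blast
  have "f n + g n \<le> (n + 2) ^ (e + e' + 1)" for n
  proof -
    have "f n + g n \<le> (n + 2) ^ (e + e') + (n + 2) ^ (e + e')"
      using e[of n] by (intro add_mono) (auto intro: le_trans power_increasing)
    also have "\<dots> \<le> (n + 2) ^ (e + e' + 1)" by simp
    finally show ?thesis .
  qed
  then show ?thesis by blast
qed

lemma mult_poly:
  assumes "\<exists>e. \<forall>n. f n \<le> (n + 2) ^ e" "\<exists>e. \<forall>n. g n \<le> (n + 2) ^ e"
  shows "\<exists>e. \<forall>n::nat. f n * g n \<le> (n + 2 :: nat) ^ e"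
proof -
  from assms obtain e e' where e: "f n \<le> (n + 2) ^ e" "g n \<le> (n + 2) ^ e'" for n by blast
  have "f n * g n \<le> (n + 2) ^ (e + e')" for n
    unfolding power_add by (intro mult_le_mono e)
  then show ?thesis by blast
qed

lemma const_poly: "\<exists>e. \<forall>n::nat. k \<le> (n + 2 :: nat) ^ e"
proof (intro exI allI)
  fix n :: nat
  have "k \<le> 2 ^ k" by simp
  also have "\<dots> \<le> (n + 2) ^ k" by (intro power_mono) auto
  finally show "k \<le> (n + 2) ^ k" .
qed

lemma id_poly: "\<exists>e. \<forall>n::nat. n \<le> (n + 2 :: nat) ^ e"
  by (intro exI[of _ 1]) simp

lemma mono_poly: "\<exists>e. \<forall>n. g n \<le> (n + 2) ^ e \<Longrightarrow> (\<And>n. f n \<le> g n) \<Longrightarrow> \<exists>e. \<forall>n::nat. f n \<le> (n + 2 :: nat) ^ e"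
  by (meson le_trans)

lemma num_copies_le: "num_copies n \<le> 3 * n + 10"
proof -
  have "(3::nat) ^ (num_copies n - 1) < 3 ^ (3 * n + 10)" using num_copies_ex(2)[of n] cub_le[of n] by linarith
  then have "num_copies n - 1 < 3 * n + 10" by (simp add: power_strict_increasing_iff)
  then show ?thesis by simp
qed

lemma par_bounds:
  "1 \<le> par_b d n" "3 * par_b d n \<le> par_N d n" "par_N d n \<le> 9 * par_b d n" "n \<le> par_nb d n * par_b d n"
  "par_nb d n * par_b d n \<le> n + par_b d n" "par_nb d n \<le> n + 1"
proof -
  show b: "1 \<le> par_b d n" by (simp add: par_b_def par_N_def)
  show "3 * par_b d n \<le> par_N d n" by (simp add: par_b_def)
  show "par_N d n \<le> 9 * par_b d n" using b unfolding par_b_def by linarith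
  have e: "n div par_b d n * par_b d n + n mod par_b d n = n" by (rule div_mult_mod_eq)
  have "n mod par_b d n < par_b d n" using b by simp
  then show "n \<le> par_nb d n * par_b d n" "par_nb d n * par_b d n \<le> n + par_b d n"
    using e by (simp_all add: par_nb_def)
  show "par_nb d n \<le> n + 1" by (simp add: par_nb_def)
qed

lemma cshape_PRE: "cshape (PRE1 d c l K ;; PRE2 pre)"
  by (simp add: PRE1_def PRE2_def CFor_def WRITE_CELL_def eshape_pw cshape_tr)

lemma cshape_QUERY: "cshape (QUERY upd)"
  by (simp add: QUERY_def CFor_def WRITE_CELL_def cshape_tr BLOCK_def BLOCK_BODY_def CHECK_def BRUTE_FORCE_def INSERT_ALL_def INSERT_def SET_BASES_def MATRIX_ENTRY_def)

text \<open>The sum lists everything that has to stay below \<open>U\<close>, so a single exponent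
  serves for all of it.\<close>

lemma par_poly:
  assumes "1 \<le> d"
  defines "N \<equiv> par_N d" and "b \<equiv> par_b d" and "nb \<equiv> par_nb d"
  shows "\<exists>e. \<forall>n. (nb n * nb n + 1) * num_copies n * ((N n + 2) ^ c + K + 3) + nb n * nb n + b n * b n + num_copies n + (N n + 2) + n + 2 +
    n * n + num_copies n * (N n + 2) ^ l + (N n * N n + 1) + (N n + 2) ^ l + 3 * cub n + (3 * n + 10) + (n + 3) + nb n * b n +
    ((N n + 2) ^ c + K + 3) \<le> (n + 2) ^ e"
proof -
  have N: "\<exists>e. \<forall>n. N n \<le> (n + 2) ^ e"
    by (rule mono_poly[of "\<lambda>n. n + 3"], intro add_poly const_poly id_poly) (simp add: N_def par_N_def mroot_le[OF assms(1)])
  have b: "\<exists>e. \<forall>n. b n \<le> (n + 2) ^ e"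
    by (rule mono_poly[OF N]) (simp add: N_def b_def par_b_def)
  have nb: "\<exists>e. \<forall>n. nb n \<le> (n + 2) ^ e"
    by (rule mono_poly[of "\<lambda>n. n + 1"], intro add_poly const_poly id_poly) (unfold nb_def, rule par_bounds(6))
  have R: "\<exists>e. \<forall>n. num_copies n \<le> (n + 2) ^ e"
    by (rule mono_poly[of "\<lambda>n. 3 * n + 10"], intro add_poly mult_poly const_poly id_poly) (rule num_copies_le)
  have c: "\<exists>e. \<forall>n. cub n \<le> (n + 2) ^ e"
    unfolding cub_def by (intro add_poly mult_poly power_poly const_poly id_poly)
  show ?thesis by (intro add_poly mult_poly power_poly const_poly id_poly N b nb R c)
qed

text \<open>The instances do not depend on the tape, so they can be fixed before the coins are
  considered. All copies fail on a given one with probability at most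
  \<open>(1/3) ^ num_copies n\<close>, and \<open>cub\<close> was chosen so that these probabilities
  add up to at most 1/3.\<close>

lemma instance_measure:
  assumes red: "red W U S0 WN L (num_copies n) pre upd N b nb n TP TN" and nb: "nb \<le> n + 1" and vs: "length vs = n"
    and p: "\<And>es. insertions N {} es \<Longrightarrow> measure coin_tape {\<omega>. \<exists>tp tu.
      online_run WN \<omega> pre upd (mat_input N (\<lambda>_ _. False)) (reqs es) tp tu (triangle_answers {} es)} \<ge> 2/3"
    and run: "\<And>\<omega>. red.allgood \<omega> WN (num_copies n) pre upd N b nb n M (\<lambda>_. (0, [])) vs \<Longrightarrow>
      \<exists>tp tq. online_run W' \<omega> pre' qry x xss tp tq yss"
  shows "measure coin_tape {\<omega>. \<exists>tp tq. online_run W' \<omega> pre' qry x xss tp tq yss} \<ge> 2/3"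
proof -
  define ms where "ms = red.instances b nb n M (\<lambda>_. (0, [])) vs"
  define A where "A m = {\<omega>. \<exists>tp tu. online_run WN \<omega> pre upd (mat_input N (\<lambda>_ _. False)) (reqs m) tp tu (triangle_answers {} m)}" for m
  let ?E = "{\<omega>. \<forall>m\<in>set ms. \<exists>r<num_copies n. (\<lambda>p. \<omega> (p * num_copies n + r)) \<in> A m}"
  have A: "A m \<in> sets coin_tape \<and> measure coin_tape (A m) \<ge> 2/3" if "m \<in> set ms" for m
  proof -
    have "insertions N {} m"
      by (rule red.instances_insertions[OF red]) (use that red.block_ok_init[OF red] in \<open>auto simp: ms_def\<close>)
    then show ?thesis using p online_run_measurable by (simp add: A_def)
  qed
  have "red.ctape \<omega> (num_copies n) r = (\<lambda>p. \<omega> (p * num_copies n + r))" for \<omega> r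
    by (rule ext) (simp add: red.ctape_def[OF red])
  then have "?E \<subseteq> {\<omega>. \<exists>tp tq. online_run W' \<omega> pre' qry x xss tp tq yss}"
    by (intro subsetI CollectI run) (simp add: red.allgood_iff[OF red] red.goodrun_def[OF red] ms_def A_def)
  then have "measure coin_tape ?E \<le> measure coin_tape {\<omega>. \<exists>tp tq. online_run W' \<omega> pre' qry x xss tp tq yss}"
    by (intro coins.finite_measure_mono online_run_measurable)
  moreover have "1 - real (length ms) * (1/3) ^ num_copies n \<le> measure coin_tape ?E"
    by (rule amplify(2)[OF A num_copies_ex(3)])
  moreover have "real (length ms) * (1/3) ^ num_copies n \<le> 1/3"
  proof -
    have "3 * length ms \<le> 3 ^ num_copies n"
    proof -
      have "length ms = n * (nb * nb)" by (simp add: ms_def red.length_instances[OF red] vs)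
      also have "\<dots> \<le> (n + 1) * ((n + 1) * (n + 1))" using nb by (intro mult_le_mono) auto
      finally have "length ms \<le> (n + 1) ^ 3" by (simp only: power3_eq_cube mult.assoc)
      then show ?thesis using num_copies_ex(1)[of n] unfolding cub_def by linarith
    qed
    then have "3 * real (length ms) \<le> 3 ^ num_copies n" by (metis of_nat_le_iff of_nat_mult of_nat_numeral of_nat_power)
    then show ?thesis by (simp add: power_one_over field_simps)
  qed
  ultimately show ?thesis by linarith
qed

text \<open>The OMv algorithm is correct for every \<open>n\<close>, but its time is estimated only
  where \<open>N \<le> n\<close> and \<open>T N \<le> real N ^ 3\<close>. Elsewhere
  \<open>TB\<close> is merely some valid bound.\<close>

lemma reduction:
  assumes "solves_incremental_triangle pre upd T"
  obtains pre' qry TB l a where "solves_OMv pre' qry TB" "5 \<le> l" "\<And>n. 0 \<le> TB n"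
    "\<And>n N. N = par_N (2 * l) n \<Longrightarrow> N \<le> n \<Longrightarrow> T N \<le> real N ^ 3 \<Longrightarrow>
      0 \<le> T N \<and> TB n \<le> a * real (num_copies n) * (real n ^ 3 * (T N + real N ^ 2) / real N ^ 3 + real n ^ 2 * (T N + real N ^ 2) + (real N + 2) ^ l)"
proof -
  from assms obtain c k where ck: "\<And>n E es. graph_on n E \<and> insertions n E es \<longrightarrow>
    (\<forall>\<omega>. \<exists>tp tu yss.
      online_run (word_bound c n) \<omega> pre upd (mat_input n (\<lambda>u v. {u, v} \<in> E)) (reqs es) tp tu yss \<and>
      real tu \<le> T n \<and> real tp \<le> T n + (real n + 2) ^ k) \<and>
    measure coin_tape {\<omega>. \<exists>tp tu.
      online_run (word_bound c n) \<omega> pre upd (mat_input n (\<lambda>u v. {u, v} \<in> E)) (reqs es) tp tu (triangle_answers E es)} \<ge> 2/3"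
    unfolding solves_incremental_triangle_def by blast
  have run: "\<exists>tp tu yss. online_run ((N + 2) ^ c) \<omega> pre upd (mat_input N (\<lambda>_ _. False)) (reqs es) tp tu yss \<and>
      real tu \<le> T N \<and> real tp \<le> T N + (real N + 2) ^ k"
    and prob: "measure coin_tape {\<omega>. \<exists>tp tu.
      online_run ((N + 2) ^ c) \<omega> pre upd (mat_input N (\<lambda>_ _. False)) (reqs es) tp tu (triangle_answers {} es)} \<ge> 2/3"
    if "insertions N {} es" for N \<omega> es
    using ck[of N "{}" es] that by (simp_all add: graph_on_def word_bound_def)
  have T0: "0 \<le> T N" for N using run[of N "[]" "\<lambda>_. False"] by (auto intro: order_trans[rotated])
  \<comment> \<open>\<open>L\<close> must reach \<open>TP + TN\<close>. For \<open>T N\<close> at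
    most cubic this sum is at most \<open>2 * real N ^ 3 + (real N + 2) ^ k\<close>, hence at most 3
    times the power \<open>k + 3\<close>, and two more powers absorb the 3.\<close>
  define l where "l = k + 5"
  \<comment> \<open>Chosen so that \<open>N ^ l\<close> is at most \<open>n = (N - 3) ^ d\<close> as
    soon as \<open>N \<le> (N - 3) ^ 2\<close>.\<close>
  define d where "d = 2 * l"
  define K where "K = rbnd pre + rbnd upd"
  define TN where "TN N = nat \<lfloor>T N\<rfloor>" for N
  define TP where "TP N = nat \<lfloor>T N + (real N + 2) ^ k\<rfloor>" for N
  define a where "a = 4 * d + 4 * c + 4 * l + 1000"
  define L where "L n = (par_N d n + 2) ^ l" for n
  define S where "S n = (par_N d n + 2) ^ c + K" for n
  define TB where "TB n = red.total_time (L n) (num_copies n) (par_b d n) (par_nb d n) n (TP (par_N d n)) (TN (par_N d n)) a" for n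
  have d1: "1 \<le> d" by (simp add: d_def l_def)
  obtain c1 where c1: "\<And>n. (par_nb d n * par_nb d n + 1) * num_copies n * ((par_N d n + 2) ^ c + K + 3) + par_nb d n * par_nb d n +
    par_b d n * par_b d n + num_copies n + (par_N d n + 2) + n + 2 +
    n * n + num_copies n * (par_N d n + 2) ^ l + (par_N d n * par_N d n + 1) + (par_N d n + 2) ^ l + 3 * cub n + (3 * n + 10) + (n + 3) +
    par_nb d n * par_b d n + ((par_N d n + 2) ^ c + K + 3) \<le> (n + 2) ^ c1"
    using par_poly[OF d1, of c K l] by blast
  define U where "U n = (n + 2) ^ c1" for n :: nat
  have U: "(par_nb d n * par_nb d n + 1) * num_copies n * (S n + 3) \<le> U n" "par_nb d n * par_nb d n \<le> U n" "par_b d n * par_b d n \<le> U n"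
    "num_copies n \<le> U n" "par_N d n + 2 \<le> U n" "n \<le> U n" "2 \<le> U n" "n * n \<le> U n" "num_copies n * L n \<le> U n"
    "par_N d n * par_N d n + 1 \<le> U n" "L n \<le> U n" "3 * cub n \<le> U n" "3 * n + 10 \<le> U n" "n + 3 \<le> U n"
    "par_nb d n * par_b d n \<le> U n" "S n + 3 \<le> U n" for n
    using c1[of n] unfolding S_def L_def U_def by linarith+
  let ?pre = "PRE1 d c l K ;; PRE2 pre"
  obtain j1 j2 where j: "\<And>U. 2 \<le> U \<Longrightarrow> cbd U ?pre \<le> U ^ j1" "\<And>U. 2 \<le> U \<Longrightarrow> cbd U (QUERY upd) \<le> U ^ j2"
    using cbd_poly by meson
  \<comment> \<open>The additional 2 in the exponent makes both bounds on \<open>cbd\<close> and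
    also \<open>U\<close> itself strictly smaller than \<open>W\<close>.\<close>
  define W where "W n = word_bound (c1 * (j1 + j2 + 2)) n" for n
  have W: "W n = U n ^ (j1 + j2 + 2)" for n unfolding W_def word_bound_def U_def by (rule power_mult)
  have less: "U n ^ i < W n" if "i < j1 + j2 + 2" for n i
    unfolding W using U(7)[of n] that by (intro power_strict_increasing) auto
  have UW: "U n < W n" for n using less[of 1 n] by simp
  have red: "red (W n) (U n) (S n) ((par_N d n + 2) ^ c) (L n) (num_copies n) pre upd (par_N d n) (par_b d n) (par_nb d n) n
    (TP (par_N d n)) (TN (par_N d n))" for n
  proof unfold_locales
    show "U n < W n" by (rule UW)
    show "1 \<le> U n" using U(7)[of n] by simp
    show "(par_N d n + 2) ^ c \<le> S n" "rbnd pre \<le> S n" "rbnd upd \<le> S n" by (simp_all add: S_def K_def)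
    show "0 < (par_N d n + 2) ^ c" by simp
    fix tp :: "nat \<Rightarrow> bool" and es
    assume "insertions (par_N d n) {} es"
    from run[OF this, of tp] show "\<exists>t u yss. online_run ((par_N d n + 2) ^ c) tp pre upd (mat_input (par_N d n) (\<lambda>_ _. False)) (reqs es) t u yss \<and>
      t \<le> TP (par_N d n) \<and> u \<le> TN (par_N d n)"
      unfolding TP_def TN_def by (meson le_nat_floor)
  qed (use U[of n] par_bounds[where d = d and n = n] num_copies_ex(3)[of n] in \<open>auto\<close>)
  have "solves_OMv (ccomp ?pre) (ccomp (QUERY upd)) (\<lambda>n. real (TB n))"
    unfolding solves_OMv_def
  proof (intro exI[of _ "c1 * (j1 + j2 + 2)"] allI impI)
    fix n M and vs :: "(nat \<Rightarrow> bool) list"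
    assume vs: "length vs = n"
    have hl: "hl (W n) (U n)" using UW U(7)[of n] by (simp add: hl_def)
    have cok: "hl.cok (W n) (U n) ?pre" "hl.cok (W n) (U n) (QUERY upd)"
      using j[OF U(7)[of n]] less[of j1 n] less[of j2 n] cshape_PRE cshape_QUERY by (auto simp: hl.cok_def[OF hl] intro: le_less_trans)
    have on: "\<exists>tp tq yss. online_run (W n) \<omega> (ccomp ?pre) (ccomp (QUERY upd)) (mat_input n M) (map (vec_input n) vs) tp tq yss \<and>
        tp + tq \<le> TB n \<and>
        (red.allgood \<omega> ((par_N d n + 2) ^ c) (num_copies n) pre upd (par_N d n) (par_b d n) (par_nb d n) n M (\<lambda>_. (0, [])) vs \<longrightarrow>
         yss = map (\<lambda>v. vec_input n (bool_mat_vec n M v)) vs)" for \<omega>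
      unfolding TB_def a_def
      by (rule red.online_red[OF red refl refl refl S_def L_def refl d1 cok vs]) (rule U)+
    show "(\<forall>\<omega>. \<exists>tp tq yss.
      online_run (word_bound (c1 * (j1 + j2 + 2)) n) \<omega> (ccomp ?pre) (ccomp (QUERY upd)) (mat_input n M) (map (vec_input n) vs) tp tq yss \<and>
      real (tp + tq) \<le> real (TB n)) \<and>
    measure coin_tape {\<omega>. \<exists>tp tq.
      online_run (word_bound (c1 * (j1 + j2 + 2)) n) \<omega> (ccomp ?pre) (ccomp (QUERY upd)) (mat_input n M) (map (vec_input n) vs) tp tq
        (map (\<lambda>v. vec_input n (bool_mat_vec n M v)) vs)} \<ge> 2/3"
      unfolding W_def[symmetric] of_nat_le_iff
    proof (intro conjI allI)
      show "\<exists>tp tq yss. online_run (W n) \<omega> (ccomp ?pre) (ccomp (QUERY upd)) (mat_input n M) (map (vec_input n) vs) tp tq yss \<and>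
        tp + tq \<le> TB n" for \<omega> using on[of \<omega>] by meson
      show "measure coin_tape {\<omega>. \<exists>tp tq. online_run (W n) \<omega> (ccomp ?pre) (ccomp (QUERY upd)) (mat_input n M) (map (vec_input n) vs) tp tq
        (map (\<lambda>v. vec_input n (bool_mat_vec n M v)) vs)} \<ge> 2/3"
      proof (rule instance_measure[where M = M, OF red par_bounds(6) vs prob], assumption)
        fix \<omega>
        assume good: "red.allgood \<omega> ((par_N d n + 2) ^ c) (num_copies n) pre upd (par_N d n) (par_b d n) (par_nb d n) n M (\<lambda>_. (0, [])) vs"
        from on[of \<omega>] obtain tp tq yss where
          o: "online_run (W n) \<omega> (ccomp ?pre) (ccomp (QUERY upd)) (mat_input n M) (map (vec_input n) vs) tp tq yss"
          and y: "red.allgood \<omega> ((par_N d n + 2) ^ c) (num_copies n) pre upd (par_N d n) (par_b d n) (par_nb d n) n M (\<lambda>_. (0, [])) vs \<longrightarrow>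
            yss = map (\<lambda>v. vec_input n (bool_mat_vec n M v)) vs" by (elim exE conjE)
        show "\<exists>tp tq. online_run (W n) \<omega> (ccomp ?pre) (ccomp (QUERY upd)) (mat_input n M) (map (vec_input n) vs) tp tq
          (map (\<lambda>v. vec_input n (bool_mat_vec n M v)) vs)"
          using o unfolding mp[OF y good] by (intro exI)
      qed
    qed
  qed
  moreover have "5 \<le> l" by (simp add: l_def)
  moreover have "0 \<le> T N \<and> real (TB n) \<le> (2 * real a + 20000000) * real (num_copies n) *
      (real n ^ 3 * (T N + real N ^ 2) / real N ^ 3 + real n ^ 2 * (T N + real N ^ 2) + (real N + 2) ^ l)"
    if N: "N = par_N (2 * l) n" "N \<le> n" "T N \<le> real N ^ 3" for n N
  proof
    have N': "N = par_N d n" using N(1) by (simp add: d_def)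
    have Tr: "real (TN N) \<le> T N" using T0[of N] by (simp add: TN_def)
    have "real (TP N) \<le> T N + (real N + 2) ^ k" using T0[of N] by (simp add: TP_def)
    then have "real (TP N + TN N) \<le> 2 * real N ^ 3 + (real N + 2) ^ k" using Tr N(3) by simp
    also have "\<dots> \<le> 3 * (real N + 2) ^ (k + 3)"
    proof -
      have "real N ^ 3 \<le> (real N + 2) ^ 3" by (intro power_mono) auto
      also have "\<dots> \<le> (real N + 2) ^ (k + 3)" by (intro power_increasing) auto
      finally have 1: "real N ^ 3 \<le> (real N + 2) ^ (k + 3)" .
      have "(real N + 2) ^ k \<le> (real N + 2) ^ (k + 3)" by (intro power_increasing) auto
      with 1 show ?thesis by linarith
    qed
    also have "\<dots> \<le> (real N + 2) ^ 2 * (real N + 2) ^ (k + 3)"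
    proof (rule mult_right_mono)
      have "2 ^ 2 \<le> (real N + 2) ^ 2" by (intro power_mono) auto
      then show "3 \<le> (real N + 2) ^ 2" by simp
    qed simp
    also have "\<dots> = (real N + 2) ^ l" by (simp add: l_def power_add[symmetric])
    also have "\<dots> = real (L n)" by (simp add: L_def N' add.commute)
    finally have le: "TP N + TN N \<le> L n" by (simp only: of_nat_le_iff)
    have "par_b d n \<le> n" using N(2) N' par_bounds(2)[where d = d and n = n] by linarith
    from red.total_time_le[OF red[of n], folded N', OF le this par_bounds(3)[where d = d and n = n, folded N'] par_bounds(5), of a]
    have "real (TB n) \<le> (2 * real a + 20000000) * real (num_copies n) *
      (real n ^ 3 * real (TN N + N * N) / real N ^ 3 + real n ^ 2 * real (TN N + N * N) + real (L n))"
      by (simp add: TB_def N')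
    also have "real (L n) = (real N + 2) ^ l" by (simp add: L_def N' add.commute)
    also have "(2 * real a + 20000000) * real (num_copies n) *
      (real n ^ 3 * real (TN N + N * N) / real N ^ 3 + real n ^ 2 * real (TN N + N * N) + (real N + 2) ^ l)
      \<le> (2 * real a + 20000000) * real (num_copies n) *
      (real n ^ 3 * (T N + real N ^ 2) / real N ^ 3 + real n ^ 2 * (T N + real N ^ 2) + (real N + 2) ^ l)"
      using Tr by (intro mult_left_mono add_mono divide_right_mono) (auto simp: power2_eq_square)
    finally show "real (TB n) \<le> (2 * real a + 20000000) * real (num_copies n) *
      (real n ^ 3 * (T N + real N ^ 2) / real N ^ 3 + real n ^ 2 * (T N + real N ^ 2) + (real N + 2) ^ l)" .
  qed (rule T0)
  ultimately show ?thesis using that[of "ccomp ?pre" "ccomp (QUERY upd)" "\<lambda>n. real (TB n)" l "2 * real a + 20000000"] by simp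
qed

section \<open>Asymptotics\<close>

text \<open>The deficit of the exponent of \<open>T\<close> below 3 is eventually at most any given
  positive number, so it is itself a function tending to 0. A smaller \<open>\<epsilon>\<close>
  makes the assumption stronger, so the restriction to \<open>\<epsilon> \<le> 1\<close> loses
  nothing.\<close>

lemma almost_cubicI:
  assumes "\<And>\<epsilon>. 0 < \<epsilon> \<Longrightarrow> \<epsilon> \<le> 1 \<Longrightarrow> \<forall>\<^sub>F N in sequentially. real N powr (3 - \<epsilon>) \<le> T N"
  shows "almost_cubic T"
proof -
  \<comment> \<open>Cut off at 0, because \<open>T\<close> may also grow faster than cubically and
    \<open>\<delta>\<close> must still vanish.\<close>
  define \<delta> where "\<delta> N = max 0 (3 - ln (T N) / ln (real N))" for N
  have pos: "0 < T N" if "2 \<le> N" "real N powr (3 - \<epsilon>) \<le> T N" for N :: nat and \<epsilon>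
  proof -
    have "0 < real N powr (3 - \<epsilon>)" using that(1) by simp
    then show ?thesis using that(2) by linarith
  qed
  have le: "\<delta> N \<le> \<epsilon>" if N: "2 \<le> N" "real N powr (3 - \<epsilon>) \<le> T N" and "0 < \<epsilon>" for N \<epsilon>
  proof -
    have "ln (real N powr (3 - \<epsilon>)) \<le> ln (T N)" using N pos[OF N] by (intro ln_mono) auto
    then have "(3 - \<epsilon>) * ln (real N) \<le> ln (T N)" using N by (simp add: ln_powr)
    then have "3 - \<epsilon> \<le> ln (T N) / ln (real N)" using N by (simp add: pos_le_divide_eq)
    then show ?thesis using that(3) by (simp add: \<delta>_def)
  qed
  have "\<delta> \<longlonglongrightarrow> 0"
  proof (rule tendstoI)
    fix e :: real assume "0 < e"
    then have "\<forall>\<^sub>F N in sequentially. real N powr (3 - min 1 (e / 2)) \<le> T N" by (intro assms) auto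
    then show "\<forall>\<^sub>F N in sequentially. dist (\<delta> N) 0 < e"
      using eventually_ge_at_top[of 2]
    proof eventually_elim
      case (elim N)
      have "\<delta> N \<le> min 1 (e / 2)" by (rule le) (use elim \<open>0 < e\<close> in auto)
      moreover have "0 \<le> \<delta> N" by (simp add: \<delta>_def)
      ultimately show ?case using \<open>0 < e\<close> by (simp add: dist_real_def min_def split: if_splits)
    qed
  qed
  then have "\<delta> \<in> o(\<lambda>_. 1)" by (intro smalloI_tendsto) auto
  moreover have "T \<in> \<Omega>(\<lambda>n. real n powr (3 - \<delta> n))"
  proof (rule landau_omega.bigI[of 1])
    show "\<forall>\<^sub>F N in sequentially. 1 * norm (real N powr (3 - \<delta> N)) \<le> norm (T N)"
      using assms[OF zero_less_one order_refl] eventually_ge_at_top[of 2]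
    proof eventually_elim
      case (elim N)
      then have N: "2 \<le> N" "0 < T N" using pos[of N 1] by simp_all
      have "3 - \<delta> N \<le> ln (T N) / ln (real N)" by (simp add: \<delta>_def)
      then have "real N powr (3 - \<delta> N) \<le> real N powr (ln (T N) / ln (real N))" using N by (intro powr_mono) auto
      also have "\<dots> = T N" using N by (simp add: powr_def)
      finally show ?case using N by simp
    qed
  qed simp
  ultimately show ?thesis unfolding almost_cubic_def by blast
qed

text \<open>From \<open>exp 1 \<le> 3\<close> and \<open>cub n \<le> 25 * n ^ 3\<close>; the summand
  25 is 24 for the logarithm of 25 and 1 for rounding up.\<close>

lemma num_copies_ln:
  assumes "1 \<le> n"
  shows "real (num_copies n) \<le> 25 + 3 * ln (real n)"
proof -
  let ?r = "num_copies n - 1"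
  have "3 ^ ?r < cub n" by (rule num_copies_ex)
  also have "cub n \<le> 25 * n ^ 3"
  proof -
    have "(n + 1) ^ 3 \<le> (2 * n) ^ 3" using assms by (intro power_mono) auto
    moreover have "1 \<le> n ^ 3" using assms by simp
    ultimately show ?thesis by (simp add: cub_def power_mult_distrib)
  qed
  finally have "3 ^ ?r \<le> 25 * n ^ 3" by (rule less_imp_le)
  then have "real (3 ^ ?r) \<le> real (25 * n ^ 3)" by (simp only: of_nat_le_iff)
  then have "(3::real) ^ ?r \<le> 25 * real n ^ 3" by simp
  moreover have "exp (real ?r) \<le> 3 ^ ?r"
    using exp_of_nat_mult[of ?r "1::real"] power_mono[OF exp_le, of ?r] by simp
  ultimately have "exp (real ?r) \<le> 25 * real n ^ 3" by linarith
  then have "real ?r \<le> ln (25 * real n ^ 3)" using assms by (subst ln_ge_iff) auto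
  also have "\<dots> = ln 25 + 3 * ln (real n)" using assms by (simp add: ln_mult ln_realpow)
  also have "ln 25 \<le> (24::real)" using ln_le_minus_one[of "25::real"] by simp
  finally show ?thesis by simp
qed

theorem theorem1p4:
  fixes pre upd :: com and T :: "nat \<Rightarrow> real"
  assumes "OMv_hypothesis"
    and "solves_incremental_triangle pre upd T"
  shows "almost_cubic T"
proof (rule almost_cubicI, rule ccontr)
  fix \<epsilon> :: real
  assume \<epsilon>: "0 < \<epsilon>" "\<epsilon> \<le> 1" and "\<not> (\<forall>\<^sub>F N in sequentially. real N powr (3 - \<epsilon>) \<le> T N)"
  \<comment> \<open>The sizes \<open>N\<close> where \<open>T\<close> is small may be sparse. The
    lower bound for OMv holds for all large \<open>n\<close>, so it can be contradicted at sizes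
    \<open>n\<close> that match such \<open>N\<close>.\<close>
  then have freq: "\<exists>\<^sub>F N in sequentially. T N < real N powr (3 - \<epsilon>)"
    by (simp add: not_eventually not_le)
  obtain pre' qry TB l a where omv: "solves_OMv pre' qry TB" and l: "5 \<le> l" and TB0: "\<And>n. 0 \<le> TB n"
    and TB: "\<And>n N. N = par_N (2 * l) n \<Longrightarrow> N \<le> n \<Longrightarrow> T N \<le> real N ^ 3 \<Longrightarrow>
      0 \<le> T N \<and> TB n \<le> a * real (num_copies n) * (real n ^ 3 * (T N + real N ^ 2) / real N ^ 3 + real n ^ 2 * (T N + real N ^ 2) + (real N + 2) ^ l)"
    using reduction[OF assms(2)] by metis
  from assms(1) omv obtain \<delta> where \<delta>: "\<delta> \<in> o(\<lambda>_. 1)" and big: "TB \<in> \<Omega>(\<lambda>n. real n powr (3 - \<delta> n))"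
    unfolding OMv_hypothesis_def almost_cubic_def by blast
  from landau_omega.bigE[OF big] obtain c where c: "0 < c"
    "\<forall>\<^sub>F n in sequentially. c * norm (real n powr (3 - \<delta> n)) \<le> norm (TB n)" by blast
  define d where "d = 2 * l"
  \<comment> \<open>As \<open>n\<close> is at most \<open>N ^ d\<close>, the saving of
    \<open>N powr \<epsilon>\<close> is at least a saving of \<open>n powr \<eta>\<close>.\<close>
  define \<eta> where "\<eta> = \<epsilon> / real d"
  have \<eta>: "0 < \<eta>" using \<epsilon> l by (simp add: \<eta>_def d_def)
  \<comment> \<open>The three terms of the time bound contribute 2, 2 and \<open>2 ^ l\<close>; the
    added 1 makes the constant positive.\<close>
  define C where "C = \<bar>a\<bar> * (4 + 2 ^ l) + 1"
  have C: "0 < C" by (simp add: C_def add_nonneg_pos)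
  have "\<forall>\<^sub>F n in sequentially. \<bar>\<delta> n\<bar> \<le> \<eta> / 2"
    using landau_o.smallD[OF \<delta>, of "\<eta> / 2"] \<eta> by simp
  \<comment> \<open>The lower bound gives away only half of \<open>\<eta>\<close>; the other half
    beats the logarithmic number of copies.\<close>
  moreover have "\<forall>\<^sub>F n in sequentially. C * (25 + 3 * ln (real n)) * real n powr (3 - \<eta>) < c * real n powr (3 - \<eta> / 2)"
    using C c(1) \<eta> by real_asymp
  ultimately have ev: "\<forall>\<^sub>F n in sequentially. C * (25 + 3 * ln (real n)) * real n powr (3 - \<eta>) < TB n"
    using c(2) eventually_ge_at_top[of 1]
  proof eventually_elim
    case (elim n)
    have "real n powr (3 - \<eta> / 2) \<le> real n powr (3 - \<delta> n)" using elim by (intro powr_mono) auto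
    then have "c * real n powr (3 - \<eta> / 2) \<le> TB n" using elim c(1) TB0[of n] by (auto intro: order_trans[OF mult_left_mono])
    then show ?case using elim by linarith
  qed
  \<comment> \<open>Transports the statement about large \<open>n\<close> to the sizes
    \<open>(N - 3) ^ d\<close>, where it can be combined with the infinitely many small values of
    \<open>T\<close>.\<close>
  have "filterlim (\<lambda>N. (N - 3) ^ d) at_top sequentially"
  proof (rule filterlim_at_top_mono)
    show "filterlim (\<lambda>N. N - 3) at_top (sequentially :: nat filter)" by (rule filterlim_minus_const_nat_at_top)
    show "\<forall>\<^sub>F N in sequentially. N - 3 \<le> (N - 3) ^ d"
      using l by (intro eventually_mono[OF eventually_ge_at_top[of 4]] self_le_power) (auto simp: d_def)
  qed
  then have ev2: "\<forall>\<^sub>F N in sequentially. C * (25 + 3 * ln (real ((N - 3) ^ d))) * real ((N - 3) ^ d) powr (3 - \<eta>) < TB ((N - 3) ^ d)"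
    by (rule eventually_compose_filterlim[OF ev])
  obtain N where N: "T N < real N powr (3 - \<epsilon>)" "10 \<le> N"
    "C * (25 + 3 * ln (real ((N - 3) ^ d))) * real ((N - 3) ^ d) powr (3 - \<eta>) < TB ((N - 3) ^ d)"
    using frequently_ex[OF frequently_eventually_conj[OF freq eventually_conj[OF eventually_ge_at_top[of 10] ev2]]] by auto
  define n where "n = (N - 3) ^ d"
  define x where "x = real N powr - \<epsilon>"
  have N1: "1 \<le> real N" using N(2) by simp
  \<comment> \<open>For \<open>N\<close> at least 10, \<open>7 * (N - 3)\<close> is already at least
    \<open>N\<close>.\<close>
  have "N ^ l \<le> ((N - 3) ^ 2) ^ l"
  proof (rule power_mono)
    have "N = (N - 3) + 3" using N(2) by simp
    moreover have "7 * (N - 3) \<le> (N - 3) * (N - 3)" using N(2) by (intro mult_le_mono1) simp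
    ultimately show "N \<le> (N - 3) ^ 2" using N(2) unfolding power2_eq_square by linarith
  qed simp
  then have Nl: "N ^ l \<le> n" by (simp add: n_def d_def power_mult)
  have Np: "N ^ i \<le> n" if "i \<le> 5" for i
    using Nl power_increasing[of i l N] that l N(2) by linarith
  have Nn: "N \<le> n" using Np[of 1] by simp
  \<comment> \<open>By the shift in \<open>par_N\<close>, the program working on size
    \<open>n\<close> picks exactly the chosen \<open>N\<close>.\<close>
  have "mroot d n = N - 3"
    unfolding n_def using l N(2) by (intro mroot_eq power_strict_mono) (auto simp: d_def)
  then have pN: "N = par_N (2 * l) n" using N(2) by (simp add: par_N_def d_def)
  have T3: "real N powr (3 - \<epsilon>) = real N ^ 3 * x" using N1 by (simp add: x_def powr_diff powr_minus field_simps)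
  \<comment> \<open>The last claim uses \<open>\<epsilon> \<le> 1\<close>; it makes the term
    \<open>real N ^ 2\<close> at most \<open>real N ^ 3 * x\<close>.\<close>
  have x: "0 \<le> x" "x \<le> 1" "1 \<le> real N * x"
  proof -
    show "0 \<le> x" by (simp add: x_def)
    show "x \<le> 1" using powr_mono[of "- \<epsilon>" 0 "real N"] N1 \<epsilon> by (simp add: x_def)
    have "real N * x = real N powr (1 - \<epsilon>)" using N1 by (simp add: x_def powr_diff powr_minus field_simps)
    then show "1 \<le> real N * x" using N1 \<epsilon> by (simp add: ge_one_powr_ge_zero)
  qed
  have TN: "T N + real N ^ 2 \<le> 2 * (real N ^ 3 * x)" "T N \<le> real N ^ 3"
  proof -
    have "real N ^ 2 * 1 \<le> real N ^ 2 * (real N * x)" by (intro mult_left_mono x) simp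
    then show "T N + real N ^ 2 \<le> 2 * (real N ^ 3 * x)" using N(1) T3 by (simp add: power2_eq_square power3_eq_cube mult.assoc)
    have "real N ^ 3 * x \<le> real N ^ 3 * 1" by (intro mult_left_mono x) simp
    then show "T N \<le> real N ^ 3" using N(1) T3 by simp
  qed
  note TBn = TB[OF pN Nn TN(2)]
  let ?n = "real n" and ?N = "real N"
  have n1: "1 \<le> ?n" using Nn N1 by linarith
  have t1: "?n ^ 3 * (T N + ?N ^ 2) / ?N ^ 3 \<le> 2 * (?n ^ 3 * x)"
  proof -
    have "?n ^ 3 * (T N + ?N ^ 2) / ?N ^ 3 \<le> ?n ^ 3 * (2 * (?N ^ 3 * x)) / ?N ^ 3"
      by (intro divide_right_mono mult_left_mono TN) auto
    also have "\<dots> = 2 * (?n ^ 3 * x)" using N1 by simp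
    finally show ?thesis .
  qed
  \<comment> \<open>Hits are harmless because \<open>n\<close> is at least \<open>N ^ 3\<close>, so
    that one factor \<open>n\<close> outweighs the cubic part of \<open>T N\<close>.\<close>
  have t2: "?n ^ 2 * (T N + ?N ^ 2) \<le> 2 * (?n ^ 3 * x)"
  proof -
    have "?N ^ 3 \<le> ?n" using Np[of 3] by (simp flip: of_nat_power)
    then have "?N ^ 3 * x \<le> ?n * x" using x by (intro mult_right_mono) auto
    then have "?n ^ 2 * (T N + ?N ^ 2) \<le> ?n ^ 2 * (2 * (?n * x))" using TN by (intro mult_left_mono) auto
    also have "\<dots> = 2 * (?n ^ 3 * x)" by (simp add: power2_eq_square power3_eq_cube)
    finally show ?thesis .
  qed
  \<comment> \<open>Coins and preprocessing are harmless because \<open>N ^ l\<close> is at most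
    \<open>n\<close>.\<close>
  have t3: "(?N + 2) ^ l \<le> 2 ^ l * (?n ^ 3 * x)"
  proof -
    have nx: "1 \<le> ?n * x" using x Nn mult_right_mono[of ?N ?n x] by linarith
    have "(?N + 2) ^ l \<le> (2 * ?N) ^ l" using N(2) by (intro power_mono) auto
    also have "\<dots> \<le> 2 ^ l * ?n" using Nl unfolding power_mult_distrib by (intro mult_left_mono) (simp_all flip: of_nat_power)
    also have "?n \<le> ?n * (?n * (?n * x))"
    proof -
      have "1 * 1 \<le> ?n * (?n * x)" using n1 nx by (intro mult_mono) auto
      then show ?thesis using mult_left_mono[of 1 "?n * (?n * x)" ?n] by simp
    qed
    finally show ?thesis by (simp add: power3_eq_cube mult.assoc)
  qed
  have "TB n \<le> \<bar>a\<bar> * real (num_copies n) * ((4 + 2 ^ l) * (?n ^ 3 * x))"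
  proof -
    let ?S = "?n ^ 3 * (T N + ?N ^ 2) / ?N ^ 3 + ?n ^ 2 * (T N + ?N ^ 2) + (?N + 2) ^ l"
    have "TB n \<le> a * real (num_copies n) * ?S" using TBn by blast
    also have "\<dots> \<le> \<bar>a\<bar> * real (num_copies n) * ?S" using TBn by (intro mult_right_mono) auto
    also have "\<dots> \<le> \<bar>a\<bar> * real (num_copies n) * ((4 + 2 ^ l) * (?n ^ 3 * x))"
      using t1 t2 t3 by (intro mult_left_mono) (auto simp: algebra_simps)
    finally show ?thesis .
  qed
  also have "\<dots> = \<bar>a\<bar> * (4 + 2 ^ l) * real (num_copies n) * (?n ^ 3 * x)" by simp
  also have "\<dots> \<le> C * (25 + 3 * ln ?n) * (?n ^ 3 * ?n powr - \<eta>)"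
  proof (intro mult_mono)
    show "\<bar>a\<bar> * (4 + 2 ^ l) \<le> C" by (simp add: C_def)
    show "real (num_copies n) \<le> 25 + 3 * ln ?n" using n1 by (intro num_copies_ln) simp
    \<comment> \<open>Converts the saving \<open>x\<close> at \<open>N\<close> into a saving in
      terms of \<open>n\<close>, the power being antitone in its base.\<close>
    have "?n \<le> ?N powr real d"
    proof -
      have "n \<le> N ^ d" unfolding n_def by (intro power_mono) auto
      then have "?n \<le> ?N ^ d" by (simp flip: of_nat_power)
      then show ?thesis using N1 by (simp add: powr_realpow)
    qed
    then have "(?N powr real d) powr - \<eta> \<le> ?n powr - \<eta>" using n1 \<eta> by (intro powr_mono2') auto
    moreover have "(?N powr real d) powr - \<eta> = x" using l by (simp add: powr_powr x_def \<eta>_def d_def)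
    ultimately show "x \<le> ?n powr - \<eta>" by simp
    have "0 \<le> 25 + 3 * ln ?n" using n1 by simp
    then show "0 \<le> C * (25 + 3 * ln ?n)" using C by simp
  qed (use x C in auto)
  also have "?n ^ 3 * ?n powr - \<eta> = ?n powr (3 - \<eta>)" using n1 by (simp add: powr_diff powr_minus field_simps)
  finally show False using N(3) by (simp add: n_def)
qed

end
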